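(* Let $d\ge 2$, $T>0$, and consider the particle system on $\mathbb T^d$ with kernel $K$, exterior force $F$ and diffusion coefficients $\sigma_N$, with fluctuation measures $\eta^N=\sqrt N(\mu_N-\bar\rho)$, as described in the context. Assume: (1) $\eta^N_0$ converges in distribution in $\mathcal S'(\mathbb T^d)$ to a random element $\eta_0$; (2) $K:\mathbb T^d\to\mathbb R^d$ is either bounded, or satisfies $K(x)=-K(-x)$ for each $x$ and $|x|K(x)\in L^\infty$; (3) $\sup_{t\in[0,T]}\sup_N H(\rho_N(t)\,|\,\bar\rho_N(t))<\infty$; (4) $\sigma>0$, $|\sigma_N-\sigma|=\mathcal O(1/N)$, and $\bar\rho$ solves the mean-field equation in the weak sense. Assume in addition that, for some $\beta>d/2$, $\bar\rho\in C([0,T],C^{\beta+1}(\mathbb T^d))$ and $F\in C^{\beta+1}(\mathbb T^d)$, and that $\eta_0$ is characterized by $$\langle\eta_0,\varphi\rangle\sim\mathcal N\big(0,\langle\varphi^2,\bar\rho_0\rangle-\langle\varphi,\bar\rho_0\rangle^2\big),\qquad\varphi\in C^\infty(\mathbb T^d).$$ Let $\eta$ be the limit in distribution of $\eta^N$ in $L^2([0,T],H^{-\alpha})\cap C([0,T],H^{-\alpha-2})$, $\alpha>d/2$, i.e. the unique martingale solution to the limit SPDE given in the context. Then for each $\varphi\in C^\infty(\mathbb T^d)$ and $t\in[0,T]$, $$\langle\eta_t,\varphi\rangle\sim\mathcal N\Big(0,\ \langle|Q_{0,t}\varphi|^2,\bar\rho_0\rangle-\langle Q_{0,t}\varphi,\bar\rho_0\rangle^2+2\sigma\int_0^t\langle|\nabla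 Q_{s,t}\varphi|^2,\bar\rho_s\rangle\,ds\Big).$$
   Context: Notation. $\mathbb T^d$ is the torus with Fourier basis $e_k(x)=e^{\sqrt{-1}k\cdot x}$; $\langle k\rangle=\sqrt{1+|k|^2}$; $\langle\cdot,\cdot\rangle$ denotes integration/duality pairing; $\|f\|_{H^\alpha}^2=\sum_k\langle k\rangle^{2\alpha}|\langle f,e_k\rangle|^2$. $C^\alpha$ is the space of $\alpha$-times differentiable functions for $\alpha\in\mathbb N$ and $B^\alpha_{\infty,\infty}$ for non-integer $\alpha$. $\mathcal N(0,a)$ is the centered Gaussian law with variance $a$. Particle system. On a stochastic basis, for each $N$, $dX_i=\frac1N\sum_{j\neq i}K(X_i-X_j)dt+F(X_i)dt+\sqrt{2\sigma_N}dB^i_t$, $i=1,\dots,N$, with random initial data, $\sigma_N\ge0$, and $B^i$ independent Brownian motions on the torus independent of the initial data. $\rho_N(t)$ is the joint law of $(X_1(t),\dots,X_N(t))$, $\mu_N(t)=\frac1N\sum_i\delta_{X_i(t)}$. Mean-field equation. $\bar\rho_t$ (probability densities) solves $\partial_t\bar\rho=\sigma\Delta\bar\rho-\mathrm{div}([F+K*\bar\rho]\bar\rho)$, $\sigma=\lim_N\sigma_N$; $\bar\rho_N(t)=\bar\rho_t^{\otimes N}$; $\eta^N_t=\sqrt N(\mu_N(t)-\bar\rho_t)$. Relative entropy: $H(\mu|\nu)=\int\frac{d\mu}{d\nu}\log\frac{d\mu}{d\nu}d\nu$ if $\mu\ll\nu$, $+\infty$ otherwise. Limit SPDE: $\partial_t\eta=\sigma\Delta\eta-\nabla\cdot(\bar\rho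 K*\eta)-\nabla\cdot(\eta K*\bar\rho)-\nabla\cdot(F\eta)-\sqrt{2\sigma}\nabla\cdot(\sqrt{\bar\rho}\,\xi)$, $\eta(0)=\eta_0$, $\xi$ vector-valued space-time white noise. A martingale solution on a stochastic basis $(\Omega,\mathcal F,\mathcal F_t,\mathbb P)$ is a process $\eta$ such that: (i) $\eta$ is continuous, $(\mathcal F_t)$-adapted with values in $H^{-\alpha-2}$ and $\eta\in L^2([0,T],H^{-\alpha})$ for every $\alpha>d/2$, a.s.; (ii) for each $\varphi\in C^\infty$, $t\in[0,T]$, $\langle\eta_t,\varphi\rangle-\langle\eta_0,\varphi\rangle=\int_0^t\langle\sigma\Delta\varphi,\eta\rangle ds+\int_0^t\langle\nabla\varphi,\bar\rho K*\eta+\eta K*\bar\rho+F\eta\rangle ds+\mathcal M_t(\varphi)$, where $\mathcal M$ is a continuous $(\mathcal F_t)$-adapted centered Gaussian process with values in $H^{-\alpha-1}$ for every $\alpha>d/2$ and covariance $\mathbb E[\mathcal M_t(\varphi_1)\mathcal M_s(\varphi_2)]=2\sigma\int_0^{s\wedge t}\langle\nabla\varphi_1\cdot\nabla\varphi_2,\bar\rho_r\rangle dr$ (equivalently, each $\mathcal M(\varphi)$ is a continuous $(\mathcal F_t)$-martingale with quadratic variation $2\sigma\int_0^t\langle|\nabla\varphi|^2,\bar\rho_r\rangle dr$). Such a solution is unique in law given the law of $\eta_0$. Evolution operators. For $t\in[0,T]$ and $\varphi\in C^\infty$, $Q_{s,t}\varphi:=f(s)$, $s\in[0,t]$, where $f\in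 L^2([0,t],H^{\beta+2})\cap C([0,t],H^{\beta+1})$ with $\partial_sf\in L^2([0,t],H^\beta)$ is the unique solution of the backward equation $$f_s=\varphi+\sigma\int_s^t\Delta f_r\,dr+\int_s^t\big[K*\bar\rho_r\cdot\nabla f_r+K(-\cdot)*(\nabla f_r\,\bar\rho_r)+F\cdot\nabla f_r\big]dr,\quad s\in[0,t],$$ with $K(-\cdot)*g(x):=\int K(y-x)\cdot g(y)\,dy$. *)

theory Defs
  imports "HOL-Probability.Probability" "HOL-Library.Landau_Symbols"
begin

section \<open>Functions on the torus\<close>

text \<open>
  The torus is \<open>\<real>\<^sup>d / (2 \<pi> \<int>)\<^sup>d\<close>, the one on which the functions
  \<open>exp (\<i> k \<bullet> x)\<close>, \<open>k \<in> \<int>\<^sup>d\<close>, form the Fourier basis. A function on the torus is a periodic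
  function on \<open>\<real>\<^sup>d\<close>, integrals over the torus are Lebesgue integrals over the fundamental
  domain below, and a torus-valued process is given by a lift to \<open>\<real>\<^sup>d\<close>. All functions and
  distributions are real.
\<close>

definition torus :: "(real^'d) set" where
  "torus = {x. \<forall>i. - pi \<le> x $ i \<and> x $ i < pi}"

definition torus_proj :: "real^'d \<Rightarrow> real^'d" where
  "torus_proj x = (\<chi> i. x $ i - 2 * pi * of_int \<lfloor>(x $ i + pi) / (2 * pi)\<rfloor>)"

definition periodic :: "(real^'d \<Rightarrow> 'a) \<Rightarrow> bool" where
  "periodic f \<longleftrightarrow> (\<forall>x i. f (x + axis i (2 * pi)) = f x)"

definition pairing :: "(real^'d \<Rightarrow> real) \<Rightarrow> (real^'d \<Rightarrow> real) \<Rightarrow> real" where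
  "pairing f g = (LINT x:torus|lborel. f x * g x)"

definition partial_d :: "'d \<Rightarrow> (real^'d \<Rightarrow> real) \<Rightarrow> real^'d \<Rightarrow> real" where
  "partial_d i f x = frechet_derivative f (at x) (axis i 1)"

definition grad :: "(real^'d \<Rightarrow> real) \<Rightarrow> real^'d \<Rightarrow> real^'d" where
  "grad f x = (\<chi> i. partial_d i f x)"

definition laplacian :: "(real^'d \<Rightarrow> real) \<Rightarrow> real^'d \<Rightarrow> real" where
  "laplacian f x = (\<Sum>i\<in>UNIV. partial_d i (partial_d i f) x)"

fun C_diff :: "nat \<Rightarrow> (real^'d \<Rightarrow> real) \<Rightarrow> bool" where
  "C_diff 0 f \<longleftrightarrow> continuous_on UNIV f"
| "C_diff (Suc m) f \<longleftrightarrow> f differentiable_on UNIV \<and> (\<forall>i. C_diff m (partial_d i f))"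

definition smooth :: "(real^'d \<Rightarrow> real) \<Rightarrow> bool" where
  "smooth f \<longleftrightarrow> (\<forall>m. C_diff m f)"

definition test_function :: "(real^'d \<Rightarrow> real) \<Rightarrow> bool" where
  "test_function \<phi> \<longleftrightarrow> smooth \<phi> \<and> periodic \<phi>"

text \<open>A list of coordinates stands for the corresponding iterated partial derivative.\<close>

definition C_diff_norm :: "nat \<Rightarrow> (real^'d \<Rightarrow> real) \<Rightarrow> ennreal" where
  "C_diff_norm m f =
     (SUP js\<in>{js. length js \<le> m}. SUP x. ennreal \<bar>foldr partial_d js f x\<bar>)"


section \<open>Distributions and Sobolev spaces\<close>

text \<open>
  A distribution is a functional of which only the values on test functions matter; all the
  notions below look at these values only.
\<close>

type_synonym 'd functional = "(real^'d \<Rightarrow> real) \<Rightarrow> real"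

definition distribution :: "'d::finite functional \<Rightarrow> bool" where
  "distribution u \<longleftrightarrow>
     (\<forall>\<phi> \<psi> a b. test_function \<phi> \<longrightarrow> test_function \<psi> \<longrightarrow>
        u (\<lambda>x. a * \<phi> x + b * \<psi> x) = a * u \<phi> + b * u \<psi>) \<and>
     (\<exists>m C. \<forall>\<phi>. test_function \<phi> \<longrightarrow> ennreal \<bar>u \<phi>\<bar> \<le> ennreal C * C_diff_norm m \<phi>)"

definition freq :: "int^'d \<Rightarrow> real^'d" where
  "freq k = (\<chi> i. of_int (k $ i))"

text \<open>\<open>\<langle>u, e\<^sub>k\<rangle>\<close>, with the conjugate of \<open>e\<^sub>k\<close> in the duality pairing, split into real and
  imaginary part.\<close>

definition fourier_coeff :: "'d::finite functional \<Rightarrow> int^'d \<Rightarrow> complex" where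
  "fourier_coeff u k =
     Complex (u (\<lambda>x. cos (freq k \<bullet> x))) (- u (\<lambda>x. sin (freq k \<bullet> x)))"

definition sobolev_norm2 :: "real \<Rightarrow> 'd::finite functional \<Rightarrow> ennreal" where
  "sobolev_norm2 \<alpha> u =
     (\<integral>\<^sup>+k. ennreal (sqrt (1 + (norm (freq k))\<^sup>2) powr (2 * \<alpha>) * (cmod (fourier_coeff u k))\<^sup>2)
        \<partial>count_space UNIV)"

definition sobolev :: "real \<Rightarrow> 'd::finite functional \<Rightarrow> bool" where
  "sobolev \<alpha> u \<longleftrightarrow> distribution u \<and> sobolev_norm2 \<alpha> u < \<infinity>"

text \<open>
  The duality pairing between \<open>H\<^sup>-\<^sup>\<alpha>\<close> and \<open>H\<^sup>\<alpha>\<close>, needed because the coefficients of the limit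
  equation have finite regularity: \<open>F \<bullet> \<nabla>\<phi>\<close> need not be a test function. By Parseval it is
  \<open>u g\<close> if \<open>g\<close> is a test function.
\<close>

definition sobolev_pairing :: "'d::finite functional \<Rightarrow> (real^'d \<Rightarrow> real) \<Rightarrow> real" where
  "sobolev_pairing u g =
     (\<Sum>\<^sub>\<infinity>k. Re (fourier_coeff u k * cnj (fourier_coeff (pairing g) k))) / (2 * pi) ^ CARD('d)"

definition C_sobolev :: "real \<Rightarrow> real \<Rightarrow> (real \<Rightarrow> 'd::finite functional) \<Rightarrow> bool" where
  "C_sobolev T \<alpha> u \<longleftrightarrow>
     (\<forall>t\<in>{0..T}. sobolev \<alpha> (u t) \<and>
        ((\<lambda>s. sobolev_norm2 \<alpha> (\<lambda>\<phi>. u s \<phi> - u t \<phi>)) \<longlongrightarrow> 0) (at t within {0..T}))"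

text \<open>\<open>L\<^sup>2([0,T], H\<^sup>\<alpha>)\<close>: since \<open>H\<^sup>\<alpha>\<close> is separable, weak measurability is enough.\<close>

definition L2_sobolev :: "real \<Rightarrow> real \<Rightarrow> (real \<Rightarrow> 'd::finite functional) \<Rightarrow> bool" where
  "L2_sobolev T \<alpha> u \<longleftrightarrow>
     (AE t in lebesgue_on {0..T}. sobolev \<alpha> (u t)) \<and>
     (\<forall>\<phi>. test_function \<phi> \<longrightarrow> (\<lambda>t. u t \<phi>) \<in> borel_measurable (lebesgue_on {0..T})) \<and>
     (\<integral>\<^sup>+t. sobolev_norm2 \<alpha> (u t) \<partial>lebesgue_on {0..T}) < \<infinity>"


section \<open>The spaces \<open>C\<^sup>\<alpha>\<close>\<close>

definition dyadic_partition :: "(real^'d \<Rightarrow> real) \<Rightarrow> (real^'d \<Rightarrow> real) \<Rightarrow> bool" where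
  "dyadic_partition \<zeta> \<theta> \<longleftrightarrow>
     smooth \<zeta> \<and> smooth \<theta> \<and> (\<forall>x. 0 \<le> \<zeta> x) \<and> (\<forall>x. 0 \<le> \<theta> x) \<and>
     (\<forall>x y. norm x = norm y \<longrightarrow> \<zeta> x = \<zeta> y \<and> \<theta> x = \<theta> y) \<and>
     (\<exists>R. \<forall>x. R < norm x \<longrightarrow> \<zeta> x = 0) \<and>
     (\<exists>r>0. \<exists>R. \<forall>x. norm x < r \<or> R < norm x \<longrightarrow> \<theta> x = 0) \<and>
     (\<forall>x. (\<lambda>j. \<theta> (x /\<^sub>R 2 ^ j)) sums (1 - \<zeta> x)) \<and>
     (\<forall>x. \<forall>j\<ge>1. \<zeta> x * \<theta> (x /\<^sub>R 2 ^ j) = 0) \<and>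
     (\<forall>x i j. i + 1 < j \<longrightarrow> \<theta> (x /\<^sub>R 2 ^ i) * \<theta> (x /\<^sub>R 2 ^ j) = 0)"

text \<open>The Littlewood-Paley blocks \<open>\<Delta>\<^sub>j\<close>, \<open>j \<ge> -1\<close>, are numbered by \<open>n = j + 1\<close>.\<close>

definition lp_block ::
  "(real^'d \<Rightarrow> real) \<Rightarrow> (real^'d \<Rightarrow> real) \<Rightarrow> nat \<Rightarrow> (real^'d \<Rightarrow> real) \<Rightarrow> real^'d \<Rightarrow> complex" where
  "lp_block \<zeta> \<theta> n f x =
     (\<Sum>\<^sub>\<infinity>k. of_real (case n of 0 \<Rightarrow> \<zeta> (freq k) | Suc j \<Rightarrow> \<theta> (freq k /\<^sub>R 2 ^ j))
        * fourier_coeff (pairing f) k * cis (freq k \<bullet> x)) / of_real ((2 * pi) ^ CARD('d))"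

definition besov_norm ::
  "(real^'d \<Rightarrow> real) \<Rightarrow> (real^'d \<Rightarrow> real) \<Rightarrow> real \<Rightarrow> (real^'d \<Rightarrow> real) \<Rightarrow> ennreal" where
  "besov_norm \<zeta> \<theta> \<alpha> f =
     (SUP n. SUP x. ennreal (2 powr ((real n - 1) * \<alpha>) * cmod (lp_block \<zeta> \<theta> n f x)))"

definition C_norm ::
  "(real^'d \<Rightarrow> real) \<Rightarrow> (real^'d \<Rightarrow> real) \<Rightarrow> real \<Rightarrow> (real^'d \<Rightarrow> real) \<Rightarrow> ennreal" where
  "C_norm \<zeta> \<theta> \<alpha> f = (if \<alpha> \<in> \<nat> then C_diff_norm (nat \<lfloor>\<alpha>\<rfloor>) f else besov_norm \<zeta> \<theta> \<alpha> f)"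

text \<open>For \<open>\<alpha> > 0\<close>, the elements of \<open>B\<^sup>\<alpha>\<^sub>\<infinity>\<^sub>,\<^sub>\<infinity>\<close> are continuous functions.\<close>

definition C_space ::
  "(real^'d \<Rightarrow> real) \<Rightarrow> (real^'d \<Rightarrow> real) \<Rightarrow> real \<Rightarrow> (real^'d \<Rightarrow> real) \<Rightarrow> bool" where
  "C_space \<zeta> \<theta> \<alpha> f \<longleftrightarrow>
     periodic f \<and> continuous_on UNIV f \<and> (\<alpha> \<in> \<nat> \<longrightarrow> C_diff (nat \<lfloor>\<alpha>\<rfloor>) f) \<and> C_norm \<zeta> \<theta> \<alpha> f < \<infinity>"

definition C_path ::
  "(real^'d \<Rightarrow> real) \<Rightarrow> (real^'d \<Rightarrow> real) \<Rightarrow> real \<Rightarrow> real \<Rightarrow> (real \<Rightarrow> real^'d \<Rightarrow> real) \<Rightarrow> bool" where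
  "C_path \<zeta> \<theta> T \<alpha> f \<longleftrightarrow>
     (\<forall>t\<in>{0..T}. C_space \<zeta> \<theta> \<alpha> (f t) \<and>
        ((\<lambda>s. C_norm \<zeta> \<theta> \<alpha> (\<lambda>x. f s x - f t x)) \<longlongrightarrow> 0) (at t within {0..T}))"


section \<open>Probabilistic notions\<close>

text \<open>\<open>X \<sim> \<N>(0, v)\<close>; for \<open>v = 0\<close> this is the Dirac measure at 0.\<close>

definition centered_normal :: "'w measure \<Rightarrow> ('w \<Rightarrow> real) \<Rightarrow> real \<Rightarrow> bool" where
  "centered_normal P X v \<longleftrightarrow>
     X \<in> borel_measurable P \<and> 0 \<le> v \<and>
     distr P borel X =
       (if v = 0 then return borel 0
        else density lborel (\<lambda>x. ennreal (normal_density 0 (sqrt v) x)))"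

text \<open>Random elements are allowed to leave the space on a null set, hence the completion.\<close>

definition random_element :: "'s topology \<Rightarrow> 'w measure \<Rightarrow> ('w \<Rightarrow> 's) \<Rightarrow> bool" where
  "random_element \<tau> P X \<longleftrightarrow>
     (AE \<omega> in P. X \<omega> \<in> topspace \<tau>) \<and>
     (\<forall>U. openin \<tau> U \<longrightarrow> {\<omega> \<in> space P. X \<omega> \<in> U} \<in> sets (completion P))"

definition converges_in_law ::
  "'s topology \<Rightarrow> (nat \<Rightarrow> 'v measure) \<Rightarrow> (nat \<Rightarrow> 'v \<Rightarrow> 's) \<Rightarrow> 'w measure \<Rightarrow> ('w \<Rightarrow> 's) \<Rightarrow> bool" where
  "converges_in_law \<tau> Ps Xs P X \<longleftrightarrow>
     (\<forall>N\<ge>1. random_element \<tau> (Ps N) (Xs N)) \<and> random_element \<tau> P X \<and>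
     (\<forall>g. continuous_map \<tau> euclideanreal g \<longrightarrow> bounded (g ` topspace \<tau>) \<longrightarrow>
        (\<lambda>N. \<integral>\<omega>. g (Xs N \<omega>) \<partial>completion (Ps N)) \<longlonglongrightarrow> (\<integral>\<omega>. g (X \<omega>) \<partial>completion P))"

text \<open>The space of distributions \<open>S'\<close> with the weak-* topology.\<close>

definition distribution_topology :: "'d::finite functional topology" where
  "distribution_topology =
     topology_generated_by
       {{u. distribution u \<and> u \<phi> \<in> U} | \<phi> U. test_function \<phi> \<and> open U}"

text \<open>The space \<open>L\<^sup>2([0,T], H\<^sup>-\<^sup>\<alpha>) \<inter> C([0,T], H\<^sup>-\<^sup>\<alpha>\<^sup>-\<^sup>2)\<close> and its topology, generated by the balls
  for the maximum of the two norms.\<close>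

definition path_space :: "real \<Rightarrow> real \<Rightarrow> (real \<Rightarrow> 'd::finite functional) set" where
  "path_space T \<alpha> = {u. L2_sobolev T (- \<alpha>) u \<and> C_sobolev T (- \<alpha> - 2) u}"

definition path_ball ::
  "real \<Rightarrow> real \<Rightarrow> (real \<Rightarrow> 'd::finite functional) \<Rightarrow> real \<Rightarrow> (real \<Rightarrow> 'd::finite functional) set" where
  "path_ball T \<alpha> u r =
     {v \<in> path_space T \<alpha>.
        (\<integral>\<^sup>+t. sobolev_norm2 (- \<alpha>) (\<lambda>\<phi>. v t \<phi> - u t \<phi>) \<partial>lebesgue_on {0..T}) < ennreal (r\<^sup>2) \<and>
        (SUP t\<in>{0..T}. sobolev_norm2 (- \<alpha> - 2) (\<lambda>\<phi>. v t \<phi> - u t \<phi>)) < ennreal (r\<^sup>2)}"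

definition path_topology :: "real \<Rightarrow> real \<Rightarrow> (real \<Rightarrow> 'd::finite functional) topology" where
  "path_topology T \<alpha> =
     topology_generated_by {path_ball T \<alpha> u r | u r. u \<in> path_space T \<alpha> \<and> 0 < r}"

definition stochastic_basis :: "'w measure \<Rightarrow> (real \<Rightarrow> 'w measure) \<Rightarrow> bool" where
  "stochastic_basis P \<F> \<longleftrightarrow>
     prob_space P \<and> filtration (space P) \<F> \<and> (\<forall>t. subalgebra P (\<F> t))"

definition martingale ::
  "'w measure \<Rightarrow> (real \<Rightarrow> 'w measure) \<Rightarrow> real \<Rightarrow> (real \<Rightarrow> 'w \<Rightarrow> real) \<Rightarrow> bool" where
  "martingale P \<F> T X \<longleftrightarrow>
     (\<forall>t\<in>{0..T}. X t \<in> borel_measurable (\<F> t) \<and> integrable P (X t)) \<and>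
     (\<forall>t\<in>{0..T}. \<forall>s\<in>{0..t}. AE \<omega> in P. real_cond_exp P (\<F> s) (X t) \<omega> = X s \<omega>)"

definition brownian_motion ::
  "'w measure \<Rightarrow> (real \<Rightarrow> 'w measure) \<Rightarrow> real \<Rightarrow> (real \<Rightarrow> 'w \<Rightarrow> real^'d) \<Rightarrow> bool" where
  "brownian_motion P \<F> T B \<longleftrightarrow>
     (\<forall>t\<in>{0..T}. B t \<in> borel_measurable (\<F> t)) \<and>
     (AE \<omega> in P. B 0 \<omega> = 0 \<and> continuous_on {0..T} (\<lambda>t. B t \<omega>)) \<and>
     (\<forall>t\<in>{0..T}. \<forall>s\<in>{0..<t}.
        (\<forall>l. centered_normal P (\<lambda>\<omega>. (B t \<omega> - B s \<omega>) $ l) (t - s)) \<and>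
        prob_space.indep_vars P (\<lambda>_. borel) (\<lambda>l \<omega>. (B t \<omega> - B s \<omega>) $ l) UNIV \<and>
        prob_space.indep_set P (sets (\<F> s))
          {(\<lambda>\<omega>. B t \<omega> - B s \<omega>) -` A \<inter> space P | A. A \<in> sets borel})"

definition generated_events ::
  "'w measure \<Rightarrow> 'i set \<Rightarrow> ('i \<Rightarrow> 'w \<Rightarrow> real^'d) \<Rightarrow> 'w set set" where
  "generated_events P I Y =
     sigma_sets (space P) {Y i -` A \<inter> space P | i A. i \<in> I \<and> A \<in> sets borel}"

text \<open>\<open>H(\<mu>|\<nu>)\<close>. As \<open>h ln h\<close> is bounded below and \<open>\<nu>\<close> is finite in all uses, the integral is
  \<open>\<infinity>\<close> when \<open>h ln h\<close> is not integrable.\<close>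

definition relative_entropy :: "'a measure \<Rightarrow> 'a measure \<Rightarrow> ereal" where
  "relative_entropy \<mu> \<nu> =
     (let h = (\<lambda>x. enn2real (RN_deriv \<nu> \<mu> x)) in
      if absolutely_continuous \<nu> \<mu> \<and> integrable \<nu> (\<lambda>x. h x * ln (h x))
      then ereal (\<integral>x. h x * ln (h x) \<partial>\<nu>) else \<infinity>)"


section \<open>Particle system and mean-field equation\<close>

text \<open>
  The noise is additive, so the stochastic differential equation is the integral equation below.
  \<open>X i\<close> and \<open>B i\<close> are the lifts to \<open>\<real>\<^sup>d\<close> of the torus-valued processes; the particles are
  numbered by \<open>i < N\<close>.
\<close>

definition particle_drift ::
  "nat \<Rightarrow> (real^'d \<Rightarrow> real^'d) \<Rightarrow> (real^'d \<Rightarrow> real^'d) \<Rightarrow> (nat \<Rightarrow> real^'d) \<Rightarrow> nat \<Rightarrow> real^'d" where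
  "particle_drift N K F x i = (\<Sum>j\<in>{..<N} - {i}. K (x i - x j)) /\<^sub>R real N + F (x i)"

definition particle_system ::
  "'v measure \<Rightarrow> (real \<Rightarrow> 'v measure) \<Rightarrow> real \<Rightarrow> nat \<Rightarrow> real \<Rightarrow>
   (real^'d \<Rightarrow> real^'d) \<Rightarrow> (real^'d \<Rightarrow> real^'d) \<Rightarrow>
   (nat \<Rightarrow> real \<Rightarrow> 'v \<Rightarrow> real^'d) \<Rightarrow> (nat \<Rightarrow> real \<Rightarrow> 'v \<Rightarrow> real^'d) \<Rightarrow> bool" where
  "particle_system P \<F> T N \<sigma> K F B X \<longleftrightarrow>
     stochastic_basis P \<F> \<and>
     (\<forall>i<N. brownian_motion P \<F> T (B i)) \<and>
     prob_space.indep_sets P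
       (\<lambda>j. case j of None \<Rightarrow> generated_events P {..<N} (\<lambda>i. X i 0)
                    | Some i \<Rightarrow> generated_events P {0..T} (B i))
       (insert None (Some ` {..<N})) \<and>
     (\<forall>i<N. \<forall>t\<in>{0..T}. X i t \<in> borel_measurable (\<F> t)) \<and>
     (AE \<omega> in P. \<forall>i<N.
        continuous_on {0..T} (\<lambda>t. X i t \<omega>) \<and>
        set_integrable lebesgue {0..T} (\<lambda>s. particle_drift N K F (\<lambda>j. X j s \<omega>) i) \<and>
        (\<forall>t\<in>{0..T}.
           X i t \<omega> = X i 0 \<omega>
             + (LINT s:{0..t}|lebesgue. particle_drift N K F (\<lambda>j. X j s \<omega>) i)
             + sqrt (2 * \<sigma>) *\<^sub>R B i t \<omega>))"

definition joint_law ::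
  "'v measure \<Rightarrow> nat \<Rightarrow> (nat \<Rightarrow> 'v \<Rightarrow> real^'d) \<Rightarrow> (nat \<Rightarrow> real^'d) measure" where
  "joint_law P N Y =
     distr P (\<Pi>\<^sub>M i\<in>{..<N}. borel) (\<lambda>\<omega>. \<lambda>i\<in>{..<N}. torus_proj (Y i \<omega>))"

definition density_law :: "(real^'d \<Rightarrow> real) \<Rightarrow> (real^'d) measure" where
  "density_law \<rho> = density lborel (\<lambda>x. ennreal (indicator torus x * \<rho> x))"

definition tensor_law :: "nat \<Rightarrow> (real^'d \<Rightarrow> real) \<Rightarrow> (nat \<Rightarrow> real^'d) measure" where
  "tensor_law N \<rho> = (\<Pi>\<^sub>M i\<in>{..<N}. density_law \<rho>)"

text \<open>\<open>\<surd>N (\<mu>\<^sub>N - \<rho>)\<close> for the empirical measure \<open>\<mu>\<^sub>N\<close> of \<open>x 0, \<dots>, x (N - 1)\<close>.\<close>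

definition fluctuation :: "nat \<Rightarrow> (nat \<Rightarrow> real^'d) \<Rightarrow> (real^'d \<Rightarrow> real) \<Rightarrow> 'd::finite functional" where
  "fluctuation N x \<rho> \<phi> = sqrt (real N) * ((\<Sum>i<N. \<phi> (x i)) / real N - pairing \<phi> \<rho>)"

definition convolution :: "(real^'d \<Rightarrow> real^'d) \<Rightarrow> (real^'d \<Rightarrow> real) \<Rightarrow> real^'d \<Rightarrow> real^'d" where
  "convolution K g x = (LINT y:torus|lborel. g y *\<^sub>R K (x - y))"

text \<open>\<open>K(-\<sqdot>) * g\<close>\<close>

definition reflected_convolution ::
  "(real^'d \<Rightarrow> real^'d) \<Rightarrow> (real^'d \<Rightarrow> real^'d) \<Rightarrow> real^'d \<Rightarrow> real" where
  "reflected_convolution K g x = (LINT y:torus|lborel. K (y - x) \<bullet> g y)"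

definition probability_density :: "(real^'d \<Rightarrow> real) \<Rightarrow> bool" where
  "probability_density \<rho> \<longleftrightarrow>
     periodic \<rho> \<and> \<rho> \<in> borel_measurable borel \<and> (\<forall>x. 0 \<le> \<rho> x) \<and>
     set_integrable lborel torus \<rho> \<and> (LINT x:torus|lborel. \<rho> x) = 1"

definition mean_field_weak_solution ::
  "real \<Rightarrow> real \<Rightarrow> (real^'d \<Rightarrow> real^'d) \<Rightarrow> (real^'d \<Rightarrow> real^'d) \<Rightarrow>
   (real \<Rightarrow> real^'d \<Rightarrow> real) \<Rightarrow> bool" where
  "mean_field_weak_solution T \<sigma> K F \<rho> \<longleftrightarrow>
     (\<forall>t\<in>{0..T}. probability_density (\<rho> t)) \<and>
     (\<forall>\<phi>. test_function \<phi> \<longrightarrow> (\<forall>t\<in>{0..T}.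
        pairing \<phi> (\<rho> t) = pairing \<phi> (\<rho> 0)
          + (LINT s:{0..t}|lebesgue. \<sigma> * pairing (laplacian \<phi>) (\<rho> s)
               + pairing (\<lambda>x. grad \<phi> x \<bullet> (F x + convolution K (\<rho> s) x)) (\<rho> s))))"


section \<open>The limit equation\<close>

text \<open>
  The transport terms of the limit equation are moved to the test function, where they are
  \<open>\<langle>\<nabla>\<phi>, \<rho> K * \<eta> + \<eta> K * \<rho> + F \<eta>\<rangle> = \<langle>\<eta>, K(-\<sqdot>) * (\<rho> \<nabla>\<phi>) + (K * \<rho>) \<bullet> \<nabla>\<phi> + F \<bullet> \<nabla>\<phi>\<rangle>\<close>: this is the
  definition of the convolution of \<open>K\<close> with a distribution and of the product of a distribution
  and a function. The same operator appears in the backward equation.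
\<close>

definition dual_transport ::
  "(real^'d \<Rightarrow> real^'d) \<Rightarrow> (real^'d \<Rightarrow> real^'d) \<Rightarrow> (real^'d \<Rightarrow> real) \<Rightarrow>
   (real^'d \<Rightarrow> real) \<Rightarrow> real^'d \<Rightarrow> real" where
  "dual_transport K F \<rho> \<phi> x =
     convolution K \<rho> x \<bullet> grad \<phi> x
     + reflected_convolution K (\<lambda>y. \<rho> y *\<^sub>R grad \<phi> y) x
     + F x \<bullet> grad \<phi> x"

text \<open>
  The martingale part: a centered Gaussian process with the prescribed covariance which is a
  martingale with respect to the given filtration, with the corresponding quadratic variation.
  The martingale property makes the increments independent of the past; mere adaptedness of the
  Gaussian process would not, as it says nothing for a large filtration.
\<close>

definition noise_process ::
  "'w measure \<Rightarrow> (real \<Rightarrow> 'w measure) \<Rightarrow> real \<Rightarrow> real \<Rightarrow> (real \<Rightarrow> real^'d \<Rightarrow> real) \<Rightarrow>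
   (real \<Rightarrow> 'w \<Rightarrow> 'd::finite functional) \<Rightarrow> bool" where
  "noise_process P \<F> T \<sigma> \<rho> \<M> \<longleftrightarrow>
     (AE \<omega> in P. \<forall>\<alpha>>real CARD('d) / 2. C_sobolev T (- \<alpha> - 1) (\<lambda>t. \<M> t \<omega>)) \<and>
     (\<forall>t\<in>{0..T}. \<forall>\<phi>. test_function \<phi> \<longrightarrow> (\<lambda>\<omega>. \<M> t \<omega> \<phi>) \<in> borel_measurable (\<F> t)) \<and>
     (\<forall>(n::nat) c t \<phi>. (\<forall>i<n. t i \<in> {0..T} \<and> test_function (\<phi> i)) \<longrightarrow>
        (\<exists>v. centered_normal P (\<lambda>\<omega>. \<Sum>i<n. c i * \<M> (t i) \<omega> (\<phi> i)) v)) \<and>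
     (\<forall>t\<in>{0..T}. \<forall>s\<in>{0..T}. \<forall>\<phi> \<psi>. test_function \<phi> \<longrightarrow> test_function \<psi> \<longrightarrow>
        (\<integral>\<omega>. \<M> t \<omega> \<phi> * \<M> s \<omega> \<psi> \<partial>P) =
          2 * \<sigma> * (LINT r:{0..min s t}|lebesgue. pairing (\<lambda>x. grad \<phi> x \<bullet> grad \<psi> x) (\<rho> r))) \<and>
     (\<forall>\<phi>. test_function \<phi> \<longrightarrow>
        martingale P \<F> T (\<lambda>t \<omega>. \<M> t \<omega> \<phi>) \<and>
        martingale P \<F> T (\<lambda>t \<omega>. (\<M> t \<omega> \<phi>)\<^sup>2
          - 2 * \<sigma> * (LINT r:{0..t}|lebesgue. pairing (\<lambda>x. (norm (grad \<phi> x))\<^sup>2) (\<rho> r))))"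

definition martingale_solution ::
  "'w measure \<Rightarrow> (real \<Rightarrow> 'w measure) \<Rightarrow> real \<Rightarrow> real \<Rightarrow>
   (real^'d \<Rightarrow> real^'d) \<Rightarrow> (real^'d \<Rightarrow> real^'d) \<Rightarrow> (real \<Rightarrow> real^'d \<Rightarrow> real) \<Rightarrow>
   ('w \<Rightarrow> 'd::finite functional) \<Rightarrow> (real \<Rightarrow> 'w \<Rightarrow> 'd::finite functional) \<Rightarrow> bool" where
  "martingale_solution P \<F> T \<sigma> K F \<rho> \<eta>\<^sub>0 \<eta> \<longleftrightarrow>
     stochastic_basis P \<F> \<and>
     (AE \<omega> in P. \<forall>\<phi>. test_function \<phi> \<longrightarrow> \<eta> 0 \<omega> \<phi> = \<eta>\<^sub>0 \<omega> \<phi>) \<and>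
     (\<forall>t\<in>{0..T}. \<forall>\<phi>. test_function \<phi> \<longrightarrow> (\<lambda>\<omega>. \<eta> t \<omega> \<phi>) \<in> borel_measurable (\<F> t)) \<and>
     (AE \<omega> in P. \<forall>\<alpha>>real CARD('d) / 2.
        C_sobolev T (- \<alpha> - 2) (\<lambda>t. \<eta> t \<omega>) \<and> L2_sobolev T (- \<alpha>) (\<lambda>t. \<eta> t \<omega>)) \<and>
     (\<exists>\<M>. noise_process P \<F> T \<sigma> \<rho> \<M> \<and>
        (\<forall>\<phi>. test_function \<phi> \<longrightarrow> (\<forall>t\<in>{0..T}. AE \<omega> in P.
           \<eta> t \<omega> \<phi> - \<eta>\<^sub>0 \<omega> \<phi> =
             (LINT s:{0..t}|lebesgue. \<sigma> * \<eta> s \<omega> (laplacian \<phi>))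
             + (LINT s:{0..t}|lebesgue. sobolev_pairing (\<eta> s \<omega>) (dual_transport K F (\<rho> s) \<phi>))
             + \<M> t \<omega> \<phi>)))"

text \<open>
  Solutions of the backward equation on \<open>[0,t]\<close> with terminal value \<open>\<phi>\<close>. As \<open>\<beta> > d/2\<close>, Sobolev
  embedding gives \<open>H\<^sup>\<beta>\<^sup>+\<^sup>1 \<subseteq> C\<^sup>1\<close> and \<open>H\<^sup>\<beta>\<^sup>+\<^sup>2 \<subseteq> C\<^sup>2\<close>: for the continuous representative, \<open>\<nabla>f\<^sub>r\<close> is a
  classical derivative, so is \<open>\<Delta>f\<^sub>r\<close> for almost every \<open>r\<close>, and the equation in \<open>H\<^sup>\<beta>\<close> is an
  equation between continuous functions. The functional \<open>g r\<close> is \<open>\<partial>\<^sub>rf\<^sub>r\<close>.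
\<close>

definition backward_solution ::
  "real \<Rightarrow> real \<Rightarrow> (real^'d \<Rightarrow> real^'d) \<Rightarrow> (real^'d \<Rightarrow> real^'d) \<Rightarrow> (real \<Rightarrow> real^'d \<Rightarrow> real) \<Rightarrow>
   real \<Rightarrow> (real^'d \<Rightarrow> real) \<Rightarrow> (real \<Rightarrow> real^'d \<Rightarrow> real) \<Rightarrow> bool" where
  "backward_solution \<beta> \<sigma> K F \<rho> t \<phi> f \<longleftrightarrow>
     (\<forall>s\<in>{0..t}. periodic (f s) \<and> continuous_on UNIV (f s)) \<and>
     L2_sobolev t (\<beta> + 2) (\<lambda>s. pairing (f s)) \<and>
     C_sobolev t (\<beta> + 1) (\<lambda>s. pairing (f s)) \<and>
     (\<exists>g. L2_sobolev t \<beta> g \<and>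
        (\<forall>\<psi>. test_function \<psi> \<longrightarrow> (\<forall>s\<in>{0..t}.
           pairing (f s) \<psi> = pairing (f 0) \<psi> + (LINT r:{0..s}|lebesgue. g r \<psi>)))) \<and>
     (\<forall>s\<in>{0..t}. \<forall>x.
        f s x = \<phi> x + \<sigma> * (LINT r:{s..t}|lebesgue. laplacian (f r) x)
          + (LINT r:{s..t}|lebesgue. dual_transport K F (\<rho> r) (f r) x))"

definition evolution_operators ::
  "real \<Rightarrow> real \<Rightarrow> real \<Rightarrow> (real^'d \<Rightarrow> real^'d) \<Rightarrow> (real^'d \<Rightarrow> real^'d) \<Rightarrow>
   (real \<Rightarrow> real^'d \<Rightarrow> real) \<Rightarrow>
   (real \<Rightarrow> real \<Rightarrow> (real^'d \<Rightarrow> real) \<Rightarrow> real^'d \<Rightarrow> real) \<Rightarrow> bool" where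
  "evolution_operators \<beta> T \<sigma> K F \<rho> Q \<longleftrightarrow>
     (\<forall>t\<in>{0..T}. \<forall>\<phi>. test_function \<phi> \<longrightarrow>
        backward_solution \<beta> \<sigma> K F \<rho> t \<phi> (\<lambda>s. Q s t \<phi>))"

end

theory Submission
  imports Defs
begin

text \<open>
  Formally, \<open>s \<mapsto> \<langle>\<eta>\<^sub>s, Q\<^sub>s\<^sub>,\<^sub>t\<phi>\<rangle>\<close> has no drift, so that \<open>\<langle>\<eta>\<^sub>t, \<phi>\<rangle>\<close> is \<open>\<langle>\<eta>\<^sub>0, Q\<^sub>0\<^sub>,\<^sub>t\<phi>\<rangle>\<close> plus the stochastic
  integral of \<open>\<nabla>Q\<^sub>s\<^sub>,\<^sub>t\<phi>\<close>. As \<open>Q\<^sub>s\<^sub>,\<^sub>t\<phi>\<close> is neither smooth nor constant in time, it is replaced by its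
  Fourier truncation at level \<open>n\<close>, frozen on the intervals of a partition of \<open>[0,t]\<close> with mesh \<open>t/m\<close>.
  The drift errors vanish for almost every path as first \<open>m\<close> and then \<open>n\<close> tends to infinity: in Fourier
  coefficients all terms are controlled by the duality of \<open>H\<^sup>-\<^sup>\<beta>\<close> and \<open>H\<^sup>\<beta>\<close>, because the transport
  operator maps \<open>H\<^sup>\<beta>\<^sup>+\<^sup>1\<close> to \<open>H\<^sup>\<beta>\<close> and \<open>C\<^sup>\<beta>\<^sup>+\<^sup>1 \<subseteq> H\<^sup>\<beta>\<close>. What remains is \<open>\<eta>\<^sub>0\<close> plus a finite sum of noise
  increments. Each of these is Gaussian conditionally on the past, by a third order expansion of its
  characteristic function, so the sum is Gaussian with an explicit variance; Gaussian laws and their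
  variances pass to the almost sure limit.
\<close>

section \<open>Integration over the torus\<close>

text \<open>Functions are handled through absolutely convergent Fourier series, and sums over
  frequencies are Bochner integrals for the counting measure \<open>cs\<close>, so Fubini and
  dominated convergence serve sums and integrals alike. As \<beta> > d/2, the classical derivatives
  and convolutions in the hypotheses agree with formulas for coefficients.

  The two limits are taken one after the other on purpose. At a fixed cut-off only finitely many
  modes occur, each continuous in time, so refining the partition needs no rate. In that limit the
  Laplacian terms of the two equations cancel mode by mode, which spares any estimate of \<eta>
  against the Laplacian. What is left is the commutator of the cut-off with the transport operator.

  The equation holds almost surely for each test function and time separately. Only countably many
  grid times and polynomials enter, so one null set suffices and the limit is deterministic, path by
  path. As for the law, normality of an increment says nothing about its relation to the past of a
  large filtration; that information comes from the two martingale identities.\<close>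

abbreviation cs :: "'k measure" where "cs \<equiv> count_space UNIV"

lemma sigma_finite_cs: "sigma_finite_measure (cs :: 'k::countable measure)"
  by (rule sigma_finite_measure_count_space_countable) auto

lemma measurable_cs_pair:
  fixes f :: "'k::countable \<Rightarrow> 'a \<Rightarrow> 'b"
  assumes "\<And>k. f k \<in> measurable M N"
  shows "(\<lambda>(k, x). f k x) \<in> measurable (cs \<Otimes>\<^sub>M M) N"
  by (rule measurable_pair_measure_countable1) (use assms in auto)

lemma measurable_pair_cs:
  fixes f :: "'k::countable \<Rightarrow> 'a \<Rightarrow> 'b"
  assumes "\<And>k. f k \<in> measurable M N"
  shows "(\<lambda>(x, k). f k x) \<in> measurable (M \<Otimes>\<^sub>M cs) N"
  using measurable_compose[OF measurable_pair_swap' measurable_cs_pair[OF assms]]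
  by (simp add: case_prod_unfold)

lemma nn_integral_sum_swap:
  fixes f :: "'k::countable \<Rightarrow> 'a \<Rightarrow> ennreal"
  assumes "sigma_finite_measure M" and "\<And>k. f k \<in> borel_measurable M"
  shows "(\<integral>\<^sup>+x. (\<integral>\<^sup>+k. f k x \<partial>cs) \<partial>M) = (\<integral>\<^sup>+k. (\<integral>\<^sup>+x. f k x \<partial>M) \<partial>cs)"
proof -
  interpret pair_sigma_finite "cs :: 'k measure" M
    using assms(1) sigma_finite_cs by (simp add: pair_sigma_finite_def)
  show ?thesis using Fubini'[OF measurable_cs_pair[OF assms(2)]] by simp
qed

lemma borel_measurable_sum_cs:
  fixes f :: "'k::countable \<Rightarrow> 'a \<Rightarrow> 'b::{banach,second_countable_topology}"
  assumes "\<And>k. f k \<in> borel_measurable M"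
  shows "(\<lambda>x. \<integral>k. f k x \<partial>cs) \<in> borel_measurable M"
  using sigma_finite_measure.borel_measurable_lebesgue_integral[OF sigma_finite_cs
      measurable_pair_cs[OF assms]] .

lemma
  fixes f :: "'k::countable \<Rightarrow> 'a \<Rightarrow> 'b::{banach,second_countable_topology}"
  assumes M: "sigma_finite_measure M" and f: "\<And>k. f k \<in> borel_measurable M"
    and fin: "(\<integral>\<^sup>+k. (\<integral>\<^sup>+x. norm (f k x) \<partial>M) \<partial>cs) < \<infinity>"
  shows integral_sum_swap: "(\<integral>x. (\<integral>k. f k x \<partial>cs) \<partial>M) = (\<integral>k. (\<integral>x. f k x \<partial>M) \<partial>cs)"
    and integrable_sum_swap1: "integrable M (\<lambda>x. \<integral>k. f k x \<partial>cs)"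
    and integrable_sum_swap2: "integrable cs (\<lambda>k. \<integral>x. f k x \<partial>M)"
proof -
  interpret pair_sigma_finite "cs :: 'k measure" M
    using M sigma_finite_cs by (simp add: pair_sigma_finite_def)
  have i: "integrable (cs \<Otimes>\<^sub>M M) (\<lambda>(k, x). f k x)"
  proof (rule integrableI_bounded)
    show "(\<lambda>(k, x). f k x) \<in> borel_measurable (cs \<Otimes>\<^sub>M M)"
      by (rule measurable_cs_pair[OF f])
    have "(\<integral>\<^sup>+z. ennreal (norm (case z of (k, x) \<Rightarrow> f k x)) \<partial>(cs \<Otimes>\<^sub>M M)) =
       (\<integral>\<^sup>+k. (\<integral>\<^sup>+x. norm (f k x) \<partial>M) \<partial>cs)"
      by (subst M2.nn_integral_fst[symmetric])
         (use measurable_compose[OF measurable_cs_pair[OF f] borel_measurable_norm] in auto)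
    then show "(\<integral>\<^sup>+z. ennreal (norm (case z of (k, x) \<Rightarrow> f k x)) \<partial>(cs \<Otimes>\<^sub>M M)) < \<infinity>"
      using fin by simp
  qed
  show "(\<integral>x. (\<integral>k. f k x \<partial>cs) \<partial>M) = (\<integral>k. (\<integral>x. f k x \<partial>M) \<partial>cs)"
    using Fubini_integral[OF i] .
  show "integrable M (\<lambda>x. \<integral>k. f k x \<partial>cs)" using integrable_snd[OF i] .
  show "integrable cs (\<lambda>k. \<integral>x. f k x \<partial>M)" using integrable_fst[OF i] by simp
qed

section \<open>The period lattice and its fundamental domains\<close>

definition lat :: "int^'d \<Rightarrow> real^'d" where "lat k = (\<chi> i. 2 * pi * of_int (k $ i))"

text \<open>\<open>periodic\<close> only speaks of one positive period along one axis; natural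
  multiples, integer multiples and finally sums over the coordinates are reached one after the
  other.\<close>

lemma periodic_lat:
  fixes f :: "real^'d::finite \<Rightarrow> 'a"
  assumes "periodic f"
  shows "f (x + lat k) = f x"
proof -
  have 1: "f (x + axis i (2 * pi)) = f x" for x i using assms by (simp add: periodic_def)
  have nat: "f (x + axis i (2 * pi * real n)) = f x" for x i and n :: nat
  proof (induction n)
    case (Suc n)
    have "axis i (2 * pi * real (Suc n)) = axis i (2 * pi * real n) + axis i (2 * pi)"
      by (simp add: vec_eq_iff axis_def algebra_simps)
    then show ?case using 1[of "x + axis i (2 * pi * real n)" i] Suc by (simp add: add.assoc)
  next
    case 0 show ?case by (simp add: axis_def zero_vec_def[symmetric])
  qed
  have int: "f (x + axis i (2 * pi * of_int m)) = f x" for x i and m :: int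
  proof (cases "m \<ge> 0")
    case True then show ?thesis using nat[of x i "nat m"] by simp
  next
    case False
    have "axis i (2 * pi * of_int m) + axis i (2 * pi * real (nat (-m))) = 0"
      using False by (simp add: vec_eq_iff axis_def algebra_simps)
    then show ?thesis using nat[of "x + axis i (2 * pi * of_int m)" i "nat (-m)"]
      by (simp add: add.assoc)
  qed
  have "f (x + (\<Sum>i\<in>A. axis i (2 * pi * of_int (k $ i)))) = f x" if "finite A" for A
    using that
  proof (induction A)
    case (insert a A)
    then show ?case
      using int[of "x + (\<Sum>i\<in>A. axis i (2 * pi * of_int (k $ i)))" a "k $ a"]
      by (simp add: ac_simps)
  qed simp
  from this[of UNIV] have "f (x + (\<Sum>i\<in>UNIV. axis i (2 * pi * of_int (k $ i)))) = f x" by simp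
  also have "(\<Sum>i\<in>UNIV. axis i (2 * pi * of_int (k $ i))) = lat k"
    by (simp add: lat_def vec_eq_iff axis_def)
  finally show ?thesis .
qed

lemma lat_diff: "lat (k - l) = lat k - lat l"
  and lat_minus: "lat (- k) = - lat k"
  and lat_add: "lat (k + l) = lat k + lat l"
  by (simp_all add: lat_def vec_eq_iff algebra_simps)

text \<open>A Borel fundamental domain. The general notion is needed because a translate or a
  reflection of \<open>torus\<close> is again one, but no longer \<open>torus\<close>
  itself.\<close>

definition tile :: "(real^'d::finite) set \<Rightarrow> bool" where
  "tile D \<longleftrightarrow> D \<in> sets borel \<and> (\<forall>x. \<exists>!k. x + lat k \<in> D)"

lemma torus_borel [measurable]: "(torus :: (real^'d::finite) set) \<in> sets borel"
  unfolding torus_def by measurable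

lemma torus_proj_eq: "torus_proj x = x + lat (\<chi> i. - \<lfloor>(x $ i + pi) / (2 * pi)\<rfloor>)"
  by (simp add: torus_proj_def lat_def vec_eq_iff)

text \<open>The half-open cube makes the integer shift of each coordinate unique, hence a
  floor.\<close>

lemma torus_lat_iff:
  "x + lat k \<in> torus \<longleftrightarrow> k = (\<chi> i. - \<lfloor>(x $ i + pi) / (2 * pi)\<rfloor>)"
proof -
  have "(- pi \<le> x $ i + 2 * pi * of_int m \<and> x $ i + 2 * pi * of_int m < pi) \<longleftrightarrow>
      m = - \<lfloor>(x $ i + pi) / (2 * pi)\<rfloor>" for i and m :: int
  proof -
    have "- pi \<le> x $ i + 2 * pi * of_int m \<longleftrightarrow> of_int (- m) \<le> (x $ i + pi) / (2 * pi)"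
      by (subst pos_le_divide_eq) (auto simp: algebra_simps)
    moreover have "x $ i + 2 * pi * of_int m < pi \<longleftrightarrow> (x $ i + pi) / (2 * pi) < of_int (- m) + 1"
      by (subst pos_divide_less_eq) (auto simp: algebra_simps)
    ultimately show ?thesis
      using floor_eq_iff[of "(x $ i + pi) / (2 * pi)" "- m"] by force
  qed
  then show ?thesis by (simp add: torus_def lat_def vec_eq_iff) 
qed

lemma torus_proj_in: "torus_proj x \<in> torus"
  using torus_lat_iff torus_proj_eq by metis

lemma tile_torus: "tile (torus :: (real^'d::finite) set)"
  unfolding tile_def using torus_lat_iff by auto

lemma periodic_torus_proj: "periodic f \<Longrightarrow> f (torus_proj x) = f x"
  by (simp add: torus_proj_eq periodic_lat)

lemma torus_proj_periodic: "torus_proj (x + lat k) = torus_proj (x :: real^'d::finite)"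
proof -
  have "(y + 2 * pi * of_int m + pi) / (2 * pi) = (y + pi) / (2 * pi) + of_int m" for y :: real and m :: int
    by (simp add: field_simps)
  then show ?thesis
    by (simp add: torus_proj_def lat_def vec_eq_iff distrib_left)
qed

lemma torus_proj_borel [measurable]: "(torus_proj :: real^'d::finite \<Rightarrow> _) \<in> borel_measurable borel"
proof -
  have "(\<lambda>x :: real^'d. torus_proj x \<bullet> b) \<in> borel_measurable borel" if "b \<in> Basis" for b
    using that by (auto simp: torus_proj_def Basis_vec_def inner_axis)
  then show ?thesis using borel_measurable_euclidean_space by blast
qed

text \<open>The unfolding argument: every point has exactly one lattice translate in
  \<open>E\<close>, so this count can be inserted as a factor 1 under the integral over
  \<open>D\<close>. Translating each term by the lattice moves the roles around, and the count of
  translates in \<open>D\<close> disappears in the same way.\<close>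

lemma tile_integral_eq:
  fixes G :: "real^'d::finite \<Rightarrow> ennreal"
  assumes [measurable]: "G \<in> borel_measurable borel" and per: "\<And>k x. G (x + lat k) = G x"
    and D: "tile D" and E: "tile E"
  shows "(\<integral>\<^sup>+x. indicator D x * G x \<partial>lborel) = (\<integral>\<^sup>+x. indicator E x * G x \<partial>lborel)"
proof -
  have [measurable]: "D \<in> sets borel" "E \<in> sets borel" using D E by (auto simp: tile_def)
  have one: "(\<integral>\<^sup>+k. indicator A (x + lat k) \<partial>cs) = (1 :: ennreal)" if "tile A" for A and x :: "real^'d"
  proof -
    from that obtain k where k: "\<And>l. x + lat l \<in> A \<longleftrightarrow> l = k" unfolding tile_def by metis
    have "(\<integral>\<^sup>+l. indicator A (x + lat l) \<partial>cs) = (\<integral>\<^sup>+l. indicator {k} l \<partial>cs)"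
      by (intro nn_integral_cong) (auto simp: indicator_def k)
    then show ?thesis by simp
  qed
  have one': "(\<integral>\<^sup>+k. indicator A (x - lat k) \<partial>cs) = (1 :: ennreal)" if "tile A" for A and x :: "real^'d"
  proof -
    have "bij (uminus :: int^'d \<Rightarrow> _)" by (rule o_bij[of uminus]) (auto simp: o_def)
    from nn_integral_bij_count_space[OF this, of "\<lambda>k. indicator A (x + lat k) :: ennreal"]
    show ?thesis using one[OF that, of x] by (simp add: lat_minus)
  qed
  have "(\<integral>\<^sup>+x. indicator D x * G x \<partial>lborel) =
      (\<integral>\<^sup>+x. (\<integral>\<^sup>+k. indicator E (x + lat k) * (indicator D x * G x) \<partial>cs) \<partial>lborel)"
    by (intro nn_integral_cong) (simp add: nn_integral_multc one[OF E])
  also have "\<dots> = (\<integral>\<^sup>+k. (\<integral>\<^sup>+x. indicator E (x + lat k) * (indicator D x * G x) \<partial>lborel) \<partial>cs)"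
    by (rule nn_integral_sum_swap) (simp_all add: lborel.sigma_finite_measure_axioms)
  also have "\<dots> = (\<integral>\<^sup>+k. (\<integral>\<^sup>+x. indicator E x * (indicator D (x - lat k) * G x) \<partial>lborel) \<partial>cs)"
  proof (rule nn_integral_cong)
    fix k :: "int^'d"
    have "(\<integral>\<^sup>+x. indicator E x * (indicator D (x - lat k) * G x) \<partial>lborel) =
      (\<integral>\<^sup>+x. indicator E x * (indicator D (x - lat k) * G x) \<partial>distr lborel borel ((+) (lat k)))"
      by (simp add: lborel_distr_plus)
    also have "\<dots> = (\<integral>\<^sup>+x. indicator E (x + lat k) * (indicator D x * G x) \<partial>lborel)"
      by (subst nn_integral_distr) (auto simp: add.commute per)
    finally show "(\<integral>\<^sup>+x. indicator E (x + lat k) * (indicator D x * G x) \<partial>lborel) =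
        (\<integral>\<^sup>+x. indicator E x * (indicator D (x - lat k) * G x) \<partial>lborel)" ..
  qed
  also have "\<dots> = (\<integral>\<^sup>+x. (\<integral>\<^sup>+k. indicator E x * (indicator D (x - lat k) * G x) \<partial>cs) \<partial>lborel)"
    by (rule nn_integral_sum_swap[symmetric]) (simp_all add: lborel.sigma_finite_measure_axioms)
  also have "\<dots> = (\<integral>\<^sup>+x. indicator E x * G x \<partial>lborel)"
    by (intro nn_integral_cong) (simp add: nn_integral_cmult nn_integral_multc one'[OF D])
  finally show ?thesis .
qed

section \<open>Lebesgue measure on the torus and its symmetries\<close>

definition tm :: "(real^'d::finite) measure" where "tm = restrict_space lborel torus"

lemma space_tm [simp]: "space tm = torus"
  by (simp add: tm_def space_restrict_space)

lemma integral_tm: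
  fixes f :: "real^'d::finite \<Rightarrow> 'b::{banach,second_countable_topology}"
  shows "(LINT x:torus|lborel. f x) = (\<integral>x. f x \<partial>tm)"
  unfolding tm_def set_lebesgue_integral_def by (rule integral_restrict_space[symmetric]) auto

lemma nn_integral_tm:
  "(\<integral>\<^sup>+x. f x \<partial>tm) = (\<integral>\<^sup>+x. indicator torus x * f x \<partial>lborel)"
  unfolding tm_def by (subst nn_integral_restrict_space) (auto simp: mult.commute)

lemma borel_tm [measurable_dest]: "f \<in> measurable borel N \<Longrightarrow> f \<in> measurable tm N"
  unfolding tm_def by (rule measurable_restrict_space1) simp

lemma pairing_tm: "pairing f g = (\<integral>x. f x * g x \<partial>tm)"
  unfolding pairing_def by (rule integral_tm)

text \<open>The substitution turns the cube into another fundamental domain, and a periodic function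
  has the same integral over all of these.\<close>

lemma nn_integral_tm_affine:
  fixes G :: "real^'d::finite \<Rightarrow> ennreal"
  assumes G: "G \<in> borel_measurable borel" and per: "\<And>k x. G (x + lat k) = G x"
  shows "(\<integral>\<^sup>+y. G (x + y) \<partial>tm) = (\<integral>\<^sup>+y. G y \<partial>tm)"
    and "(\<integral>\<^sup>+y. G (x - y) \<partial>tm) = (\<integral>\<^sup>+y. G y \<partial>tm)"
proof -
  have t1: "tile {y. y - x \<in> torus}"
  proof -
    have "{y. y - x \<in> torus} \<in> sets borel" by measurable
    moreover have "\<exists>!k. y + lat k - x \<in> torus" for y
      using tile_torus unfolding tile_def by (metis add_diff_eq diff_add_eq)
    ultimately show ?thesis by (auto simp: tile_def)
  qed
  have t2: "tile {y. x - y \<in> torus}"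
  proof -
    have m: "{y. x - y \<in> torus} \<in> sets borel" by measurable
    have "\<exists>!k. x - (y + lat k) \<in> torus" for y
    proof -
      obtain k where "\<And>l. (x - y) + lat l \<in> torus \<longleftrightarrow> l = k" using tile_torus unfolding tile_def by metis
      then have "\<And>l. x - (y + lat l) \<in> torus \<longleftrightarrow> - l = k"
        by (metis add_uminus_conv_diff diff_diff_add lat_minus)
      then have "\<And>l. x - (y + lat l) \<in> torus \<longleftrightarrow> l = - k" by (metis minus_minus)
      then show ?thesis by auto
    qed
    with m show ?thesis by (auto simp: tile_def)
  qed
  have "(\<integral>\<^sup>+y. G y \<partial>tm) = (\<integral>\<^sup>+y. indicator {y. y - x \<in> torus} y * G y \<partial>lborel)"
    unfolding nn_integral_tm by (rule tile_integral_eq[OF G per tile_torus t1])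
  also have "\<dots> = (\<integral>\<^sup>+y. indicator {y. y - x \<in> torus} y * G y \<partial>distr lborel borel ((+) x))"
    by (simp add: lborel_distr_plus)
  also have "\<dots> = (\<integral>\<^sup>+y. G (x + y) \<partial>tm)"
    unfolding nn_integral_tm using G
    by (subst nn_integral_distr) (auto intro!: nn_integral_cong simp: indicator_def)
  finally show "(\<integral>\<^sup>+y. G (x + y) \<partial>tm) = (\<integral>\<^sup>+y. G y \<partial>tm)" ..
  have "(\<integral>\<^sup>+y. G y \<partial>tm) = (\<integral>\<^sup>+y. indicator {y. x - y \<in> torus} y * G y \<partial>lborel)"
    unfolding nn_integral_tm by (rule tile_integral_eq[OF G per tile_torus t2])
  also have "\<dots> = (\<integral>\<^sup>+y. indicator {y. x - y \<in> torus} y * G y \<partial>distr lborel borel ((+) x))"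
    by (simp add: lborel_distr_plus)
  also have "\<dots> = (\<integral>\<^sup>+y. indicator torus (- y) * G (x + y) \<partial>lborel)"
    using G by (subst nn_integral_distr) (auto intro!: nn_integral_cong simp: indicator_def)
  also have "\<dots> = (\<integral>\<^sup>+y. indicator torus (- y) * G (x + y) \<partial>distr lborel borel uminus)"
    using lborel_affine_euclidean[where c="\<lambda>_. - 1" and t = "0 :: real^'d"]
    by (simp add: sum_negf euclidean_representation density_1)
  also have "\<dots> = (\<integral>\<^sup>+y. G (x - y) \<partial>tm)"
    unfolding nn_integral_tm using G
    by (subst nn_integral_distr) (auto intro!: nn_integral_cong simp: indicator_def)
  finally show "(\<integral>\<^sup>+y. G (x - y) \<partial>tm) = (\<integral>\<^sup>+y. G y \<partial>tm)" ..
qed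

text \<open>Invariance is recorded as preservation of the measure by maps of the cube into itself,
  so that integrability and Bochner integrals of vector-valued functions transfer at once through
  \<open>distr\<close>.\<close>

lemma distr_tm_affine:
  fixes x :: "real^'d::finite"
  shows "distr tm tm (\<lambda>y. torus_proj (x + y)) = tm" "distr tm tm (\<lambda>y. torus_proj (x - y)) = tm"
proof -
  have m: "(\<lambda>y. torus_proj (g y)) \<in> measurable tm tm" if "g \<in> borel_measurable borel" for g :: "real^'d \<Rightarrow> real^'d"
    unfolding tm_def
    by (rule measurable_restrict_space2) (use that torus_proj_in in \<open>auto intro!: measurable_restrict_space1\<close>)
  have *: "distr tm tm (\<lambda>y. torus_proj (g y)) = tm"
    if g: "g \<in> borel_measurable borel" and eq: "\<And>G :: _ \<Rightarrow> ennreal. G \<in> borel_measurable borel \<Longrightarrow> (\<And>k x. G (x + lat k) = G x) \<Longrightarrow>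
          (\<integral>\<^sup>+y. G (g y) \<partial>tm) = (\<integral>\<^sup>+y. G y \<partial>tm)" for g :: "real^'d \<Rightarrow> real^'d"
  proof (rule measure_eqI)
    fix A :: "(real^'d) set" assume A: "A \<in> sets (distr tm tm (\<lambda>y. torus_proj (g y)))"
    then have A: "A \<in> sets tm" by simp
    then have At: "A \<subseteq> torus" and [measurable]: "A \<in> sets borel"
      unfolding tm_def by (auto simp: sets_restrict_space)
    have "emeasure (distr tm tm (\<lambda>y. torus_proj (g y))) A = (\<integral>\<^sup>+y. indicator A y \<partial>distr tm tm (\<lambda>y. torus_proj (g y)))"
      using A by simp
    also have "\<dots> = (\<integral>\<^sup>+y. indicator A (torus_proj (g y)) \<partial>tm)"
      using A by (subst nn_integral_distr) (auto intro!: m g)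
    also have "\<dots> = (\<integral>\<^sup>+y. indicator A (torus_proj y) \<partial>tm)"
      by (rule eq) (auto simp: torus_proj_periodic)
    also have "\<dots> = (\<integral>\<^sup>+y. indicator A y \<partial>tm)"
    proof (rule nn_integral_cong)
      \<comment> \<open>A point of the cube is its own representative: the zero shift lands in the
        cube, and the shift is unique.\<close>
      fix y :: "real^'d" assume "y \<in> space tm"
      then have "y + lat 0 \<in> torus" by (simp add: lat_def zero_vec_def[symmetric])
      then have "torus_proj y = y" by (simp add: torus_lat_iff torus_proj_eq) (metis \<open>y + lat 0 \<in> torus\<close> torus_lat_iff add.right_neutral lat_diff diff_self)
      then show "indicator A (torus_proj y) = (indicator A y :: ennreal)" by simp
    qed
    also have "\<dots> = emeasure tm A" using A by simp
    finally show "emeasure (distr tm tm (\<lambda>y. torus_proj (g y))) A = emeasure tm A" .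
  qed simp
  show "distr tm tm (\<lambda>y. torus_proj (x + y)) = tm"
    by (rule *) (auto intro: nn_integral_tm_affine)
  show "distr tm tm (\<lambda>y. torus_proj (x - y)) = tm"
    by (rule *) (auto intro: nn_integral_tm_affine)
qed

lemma
  fixes f :: "real^'d::finite \<Rightarrow> 'b::{banach,second_countable_topology}"
  assumes f: "f \<in> borel_measurable borel" "periodic f"
  shows integral_tm_shift: "(\<integral>y. f (x + y) \<partial>tm) = (\<integral>y. f y \<partial>tm)"
    and integral_tm_reflect: "(\<integral>y. f (x - y) \<partial>tm) = (\<integral>y. f y \<partial>tm)"
    and integrable_tm_shift: "integrable tm (\<lambda>y. f (x + y)) \<longleftrightarrow> integrable tm f"
    and integrable_tm_reflect: "integrable tm (\<lambda>y. f (x - y)) \<longleftrightarrow> integrable tm f"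
proof -
  have m: "(\<lambda>y. torus_proj (g y)) \<in> measurable tm tm" if "g \<in> borel_measurable borel" for g :: "real^'d \<Rightarrow> real^'d"
    unfolding tm_def
    by (rule measurable_restrict_space2) (use that torus_proj_in in \<open>auto intro!: measurable_restrict_space1\<close>)
  have m1: "(\<lambda>y. torus_proj (x + y)) \<in> measurable tm tm" "(\<lambda>y. torus_proj (x - y)) \<in> measurable tm tm"
    by (auto intro!: m)
  have ft: "f \<in> borel_measurable tm" using f by (simp add: borel_tm)
  show "(\<integral>y. f (x + y) \<partial>tm) = (\<integral>y. f y \<partial>tm)"
    using integral_distr[OF m1(1) ft] by (simp add: distr_tm_affine periodic_torus_proj[OF f(2)])
  show "(\<integral>y. f (x - y) \<partial>tm) = (\<integral>y. f y \<partial>tm)"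
    using integral_distr[OF m1(2) ft] by (simp add: distr_tm_affine periodic_torus_proj[OF f(2)])
  show "integrable tm (\<lambda>y. f (x + y)) \<longleftrightarrow> integrable tm f"
    using integrable_distr_eq[OF m1(1) ft] by (simp add: distr_tm_affine periodic_torus_proj[OF f(2)])
  show "integrable tm (\<lambda>y. f (x - y)) \<longleftrightarrow> integrable tm f"
    using integrable_distr_eq[OF m1(2) ft] by (simp add: distr_tm_affine periodic_torus_proj[OF f(2)])
qed

text \<open>The half-open cube is squeezed between an open and a closed box of the same
  volume.\<close>

lemma emeasure_tm: "emeasure (tm :: (real^'d::finite) measure) (space tm) = ennreal ((2 * pi) ^ CARD('d))"
proof -
  let ?b = "(\<chi> i. pi) :: real^'d"
  have sub: "box (- ?b) ?b \<subseteq> torus" "torus \<subseteq> cbox (- ?b) ?b"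
    by (auto simp: torus_def mem_box_cart less_imp_le)
  have *: "(\<Prod>b\<in>(Basis :: (real^'d) set). (?b - - ?b) \<bullet> b) = (2 * pi) ^ CARD('d)"
  proof -
    have "(\<Prod>b\<in>(Basis :: (real^'d) set). (?b - - ?b) \<bullet> b) = (\<Prod>b\<in>(Basis :: (real^'d) set). 2 * pi)"
      by (intro prod.cong refl) (auto simp: Basis_vec_def inner_axis)
    then show ?thesis by simp
  qed
  have le: "- ?b \<bullet> b \<le> ?b \<bullet> b" if "b \<in> Basis" for b using that by (auto simp: Basis_vec_def inner_axis)
  have "emeasure lborel (box (- ?b) ?b) = ennreal ((2 * pi) ^ CARD('d))"
    by (subst emeasure_lborel_box) (use le * in auto)
  moreover have "emeasure lborel (cbox (- ?b) ?b) = ennreal ((2 * pi) ^ CARD('d))"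
    by (subst emeasure_lborel_cbox) (use le * in auto)
  moreover have "emeasure lborel (box (- ?b) ?b) \<le> emeasure lborel (torus :: (real^'d) set)"
    "emeasure lborel (torus :: (real^'d) set) \<le> emeasure lborel (cbox (- ?b) ?b)"
    by (rule emeasure_mono; use sub in simp)+
  ultimately show ?thesis
    by (simp add: tm_def emeasure_restrict_space)
qed

lemma finite_measure_tm: "finite_measure (tm :: (real^'d::finite) measure)"
  by (rule finite_measureI) (simp add: emeasure_tm[simplified])

interpretation tm: finite_measure "tm :: (real^'d::finite) measure"
  by (rule finite_measure_tm)

definition vol :: "'d::finite itself \<Rightarrow> real" where "vol _ = (2 * pi) ^ CARD('d)"

lemma vol_pos [simp]: "vol d > 0" "vol d \<noteq> 0" "vol d \<ge> 0"
  by (simp_all add: vol_def)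

lemma measure_tm: "measure (tm :: (real^'d::finite) measure) torus = vol TYPE('d)"
  using emeasure_tm[where 'd='d] by (simp add: vol_def measure_def)

lemma periodic_bounded:
  fixes f :: "real^'d::finite \<Rightarrow> 'b::real_normed_vector"
  assumes "periodic f" "continuous_on UNIV f"
  obtains C where "\<And>x. norm (f x) \<le> C" "C \<ge> 0"
proof -
  let ?b = "(\<chi> i. pi) :: real^'d"
  have "compact (f ` cbox (- ?b) ?b)"
    by (rule compact_continuous_image) (use assms continuous_on_subset in auto)
  then obtain C where C: "\<And>y. y \<in> cbox (- ?b) ?b \<Longrightarrow> norm (f y) \<le> C"
    using compact_imp_bounded bounded_iff by (metis imageI)
  have "norm (f x) \<le> C" for x
  proof -
    have "torus_proj x \<in> cbox (- ?b) ?b"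
      using torus_proj_in[of x] by (auto simp: torus_def mem_box_cart less_imp_le)
    from C[OF this] show ?thesis by (simp add: periodic_torus_proj[OF assms(1)])
  qed
  then show ?thesis using that by (meson norm_ge_zero order_trans)
qed

lemma integrable_tm_bounded:
  fixes f :: "real^'d::finite \<Rightarrow> 'b::{banach,second_countable_topology}"
  assumes "f \<in> borel_measurable borel" "\<And>x. norm (f x) \<le> C"
  shows "integrable tm f"
  by (rule tm.integrable_const_bound[where B = C]) (use assms borel_tm in auto)

lemma integrable_tm_continuous:
  fixes f :: "real^'d::finite \<Rightarrow> 'b::{banach,second_countable_topology}"
  assumes "periodic f" "continuous_on UNIV f"
  shows "integrable tm f"
  using periodic_bounded[OF assms] integrable_tm_bounded
    borel_measurable_continuous_onI[OF assms(2)] by metis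

section \<open>Absolutely convergent Fourier series\<close>

definition ch :: "int^'d::finite \<Rightarrow> real^'d \<Rightarrow> complex" where "ch k x = cis (freq k \<bullet> x)"

lemma freq_add: "freq (k + l) = freq k + freq l" and freq_minus: "freq (- k) = - freq k"
  and freq_diff: "freq (k - l) = freq k - freq l" and freq_0 [simp]: "freq 0 = 0"
  by (simp_all add: freq_def vec_eq_iff)

lemma ch_add: "ch (k + l) x = ch k x * ch l x"
  and ch_diff: "ch (k - l) x = ch k x * cnj (ch l x)"
  and ch_minus: "ch (- k) x = cnj (ch k x)" and ch_0 [simp]: "ch 0 x = 1"
  and norm_ch [simp]: "norm (ch k x) = 1"
  and ch_plus: "ch k (x + y) = ch k x * ch k y"
  and ch_sub: "ch k (x - y) = ch k x * cnj (ch k y)"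
  and ch_at_0 [simp]: "ch k 0 = 1"
  by (simp_all add: ch_def cis_mult cis_cnj freq_add freq_minus freq_diff algebra_simps)

lemma ch_cnj_mult [simp]: "ch k x * cnj (ch k x) = 1" "cnj (ch k x) * ch k x = 1"
  using complex_norm_square[of "ch k x"] by (simp_all add: mult.commute)

lemma continuous_ch [continuous_intros]: "continuous_on A (ch k)"
  unfolding ch_def cis_conv_exp by (intro continuous_intros)

lemma borel_ch [measurable]: "ch k \<in> borel_measurable borel"
  by (rule borel_measurable_continuous_onI) (rule continuous_ch)

lemma ch_lat: "ch k (lat l) = 1"
proof -
  have "freq k \<bullet> lat l = 2 * pi * of_int (\<Sum>i\<in>UNIV. k $ i * l $ i)"
    by (simp add: inner_vec_def freq_def lat_def sum_distrib_left ac_simps)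
  then show ?thesis unfolding ch_def by (simp only: cis_multiple_2pi Ints_of_int)
qed

lemma axis_lat: "axis i (2 * pi) = lat (axis i 1)"
  by (simp add: lat_def axis_def vec_eq_iff)

lemma periodic_ch: "periodic (ch k)"
  by (simp add: periodic_def axis_lat ch_plus ch_lat)

lemma integral_ch: "(\<integral>x. ch (k :: int^'d::finite) x \<partial>tm) = (if k = 0 then vol TYPE('d) else 0)"
proof (cases "k = 0")
  case True then show ?thesis by (simp add: measure_tm scaleR_conv_of_real)
next
  case False
  then obtain i where i: "k $ i \<noteq> 0" by (auto simp: vec_eq_iff)
  \<comment> \<open>Translation by half a wave length changes the sign of the character, so that its
    integral equals its own negative.\<close>
  let ?x = "axis i (pi / of_int (k $ i)) :: real^'d"
  have "ch k ?x = -1" using i by (simp add: ch_def inner_axis freq_def)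
  then have "(\<integral>y. ch k y \<partial>tm) = (\<integral>y. - ch k y \<partial>tm)"
    using integral_tm_shift[OF borel_ch[of k] periodic_ch[of k], of ?x] by (simp add: ch_plus)
  then show ?thesis using False by simp
qed

text \<open>Normalised by the volume, so that the series with these coefficients reproduces the
  function without a factor. \<open>fourier_coeff\<close> of a pairing is not normalised, whence the
  volume factors in the translation between the two.\<close>

definition fc :: "(real^'d::finite \<Rightarrow> complex) \<Rightarrow> int^'d \<Rightarrow> complex" where
  "fc F k = (\<integral>x. F x * ch (- k) x \<partial>tm) / of_real (vol TYPE('d))"

abbreviation cf :: "(real^'d::finite \<Rightarrow> real) \<Rightarrow> int^'d \<Rightarrow> complex" where
  "cf f \<equiv> fc (\<lambda>x. of_real (f x))"

lemma fourier_coeff_pairing: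
  fixes f :: "real^'d::finite \<Rightarrow> real"
  assumes "integrable tm f"
  shows "fourier_coeff (pairing f) k = of_real (vol TYPE('d)) * cf f k"
proof -
  have fm: "f \<in> borel_measurable tm" using assms by auto
  have c: "ch (- k) x = of_real (cos (freq k \<bullet> x)) - \<i> * of_real (sin (freq k \<bullet> x))" for x
    by (simp add: ch_def freq_minus complex_eq_iff)
  have i: "integrable tm (\<lambda>x. f x * cos (freq k \<bullet> x))" "integrable tm (\<lambda>x. f x * sin (freq k \<bullet> x))"
    by (rule Bochner_Integration.integrable_bound[OF assms];
        use fm in \<open>auto simp: abs_mult mult_left_le intro!: borel_measurable_times[OF _ borel_tm]\<close>)+
  have "(\<integral>x. of_real (f x) * ch (- k) x \<partial>tm) =
      (\<integral>x. of_real (f x * cos (freq k \<bullet> x)) - \<i> * of_real (f x * sin (freq k \<bullet> x)) \<partial>tm)"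
    by (intro Bochner_Integration.integral_cong) (auto simp: c algebra_simps)
  also have "\<dots> = of_real (\<integral>x. f x * cos (freq k \<bullet> x) \<partial>tm) - \<i> * of_real (\<integral>x. f x * sin (freq k \<bullet> x) \<partial>tm)"
    using i by (subst Bochner_Integration.integral_diff) (auto simp del: of_real_mult)
  finally show ?thesis
    by (simp add: fc_def fourier_coeff_def pairing_tm complex_eq_iff)
qed

text \<open>Membership in the Wiener algebra, with the coefficients displayed. Continuity, products,
  derivatives and convolutions of such functions can all be read off from the coefficients.\<close>

definition fser :: "(int^'d::finite \<Rightarrow> complex) \<Rightarrow> (real^'d \<Rightarrow> complex) \<Rightarrow> bool" where
  "fser c F \<longleftrightarrow> integrable cs c \<and> (\<forall>x. F x = (\<integral>k. c k * ch k x \<partial>cs))"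

lemma integrable_ch: "integrable cs c \<Longrightarrow> integrable cs (\<lambda>k. c k * ch k x)"
  by (erule Bochner_Integration.integrable_bound) (auto simp: norm_mult)

lemma nn_integral_norm_cs:
  fixes c :: "'k \<Rightarrow> 'b::{banach,second_countable_topology}"
  shows "integrable cs c \<Longrightarrow> (\<integral>\<^sup>+k. norm (c k) \<partial>cs) < \<infinity>"
  unfolding integrable_iff_bounded by blast

lemma fser_bound: "fser c F \<Longrightarrow> norm (F x) \<le> (\<integral>k. norm (c k) \<partial>cs)"
  unfolding fser_def
  using integral_norm_bound[of cs "\<lambda>k. c k * ch k x"] by (simp add: norm_mult)

lemma fser_add: "fser a F \<Longrightarrow> fser b G \<Longrightarrow> fser (\<lambda>k. a k + b k) (\<lambda>x. F x + G x)"
  unfolding fser_def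
  by (auto simp: distrib_right Bochner_Integration.integral_add[OF integrable_ch integrable_ch])

lemma fser_cmult: "fser a F \<Longrightarrow> fser (\<lambda>k. z * a k) (\<lambda>x. z * F x)"
  unfolding fser_def by (auto simp: mult.assoc integrable_ch)

lemma fser_diff: "fser a F \<Longrightarrow> fser b G \<Longrightarrow> fser (\<lambda>k. a k - b k) (\<lambda>x. F x - G x)"
  using fser_add[of a F "\<lambda>k. -1 * b k" "\<lambda>k. -1 * G k"] fser_cmult[of b G "-1"] by simp

lemma fser_zero: "fser (\<lambda>k. 0) (\<lambda>x. 0)"
  by (simp add: fser_def)

lemma fser_sum: "(\<And>i. i \<in> A \<Longrightarrow> fser (a i) (F i)) \<Longrightarrow> fser (\<lambda>k. \<Sum>i\<in>A. a i k) (\<lambda>x. \<Sum>i\<in>A. F i x)"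
  by (induction A rule: infinite_finite_induct) (auto intro: fser_add simp: fser_zero)

lemma integrable_cs_finite:
  fixes c :: "'k \<Rightarrow> 'b::{banach,second_countable_topology}"
  assumes "finite A" "\<And>k. k \<notin> A \<Longrightarrow> c k = 0"
  shows "integrable cs c" "(\<integral>k. c k \<partial>cs) = (\<Sum>k\<in>A. c k)"
proof -
  have f: "finite {a \<in> UNIV. c a \<noteq> 0}" by (rule finite_subset[OF _ assms(1)]) (use assms(2) in auto)
  show "integrable cs c" 
    by (rule integrableI_bounded_set[where A = A and B = "Max (insert 0 (norm ` c ` A))"])
       (use assms in \<open>auto simp: AE_count_space emeasure_count_space less_top[symmetric] intro!: Max_ge\<close>)
  show "(\<integral>k. c k \<partial>cs) = (\<Sum>k\<in>A. c k)"
    by (subst lebesgue_integral_count_space_finite_support[OF f])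
       (rule sum.mono_neutral_left; use assms in auto)
qed

lemma fser_finite:
  assumes "finite A" "\<And>k. k \<notin> A \<Longrightarrow> c k = 0" "\<And>x. F x = (\<Sum>k\<in>A. c k * ch k x)"
  shows "fser c F"
  unfolding fser_def using integrable_cs_finite[of A c] integrable_cs_finite[of A "\<lambda>k. c k * ch k _"] assms
  by (simp cong: sum.cong)

lemma fser_ch: "fser (\<lambda>l. if l = k then 1 else 0) (ch k)"
  by (rule fser_finite[of "{k}"]) auto

lemma fser_const: "fser (\<lambda>l. if l = 0 then z else 0) (\<lambda>x. z)"
  by (rule fser_finite[of "{0}"]) auto

lemma fser_periodic: "fser c F \<Longrightarrow> periodic F"
  by (simp add: fser_def periodic_def axis_lat ch_plus ch_lat)

lemma fser_continuous:
  assumes "fser c F" shows "continuous_on UNIV F"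
proof -
  have "(\<lambda>n. F (X n)) \<longlonglongrightarrow> F x" if "X \<longlonglongrightarrow> x" for X x
  proof -
    have "(\<lambda>n. \<integral>k. c k * ch k (X n) \<partial>cs) \<longlonglongrightarrow> (\<integral>k. c k * ch k x \<partial>cs)"
    proof (rule integral_dominated_convergence[where w = "\<lambda>k. norm (c k)"])
      have "(\<lambda>n. ch k (X n)) \<longlonglongrightarrow> ch k x" for k
        using continuous_on_tendsto_compose[OF continuous_ch[of UNIV k] that] by simp
      then show "AE k in cs. (\<lambda>n. c k * ch k (X n)) \<longlonglongrightarrow> c k * ch k x"
        by (auto intro!: tendsto_intros)
    qed (use assms in \<open>auto simp: fser_def norm_mult\<close>)
    then show ?thesis using assms by (simp add: fser_def)
  qed
  then show ?thesis by (auto simp: continuous_on_sequentially o_def)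
qed

lemma fser_borel: "fser c F \<Longrightarrow> F \<in> borel_measurable borel"
  by (rule borel_measurable_continuous_onI) (rule fser_continuous)

text \<open>Termwise integration and orthogonality of the characters. As the coefficients are thus
  determined by the function, identities between functions turn into identities between
  coefficients.\<close>

lemma fser_fc:
  fixes F :: "real^'d::finite \<Rightarrow> complex"
  assumes "fser c F" shows "fc F k = c k"
proof -
  have "(\<integral>x. F x * ch (- k) x \<partial>tm) = (\<integral>x. (\<integral>l. c l * ch (l - k) x \<partial>cs) \<partial>tm)"
  proof (rule Bochner_Integration.integral_cong)
    fix x :: "real^'d"
    have "F x * ch (- k) x = (\<integral>l. c l * ch l x * ch (- k) x \<partial>cs)"
      using assms by (simp add: fser_def integrable_ch)
    then show "F x * ch (- k) x = (\<integral>l. c l * ch (l - k) x \<partial>cs)"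
      by (simp add: ch_diff ch_minus mult.assoc)
  qed simp
  also have "\<dots> = (\<integral>l. (\<integral>x. c l * ch (l - k) x \<partial>tm) \<partial>cs)"
  proof (rule integral_sum_swap)
    have "(\<integral>\<^sup>+l. (\<integral>\<^sup>+x. norm (c l * ch (l - k) x) \<partial>tm) \<partial>cs) = (\<integral>\<^sup>+l. ennreal (norm (c l)) * emeasure (tm :: (real^'d) measure) torus \<partial>cs)"
      by (simp add: norm_mult)
    also have "\<dots> < \<infinity>"
      using nn_integral_norm_cs[of c] assms emeasure_tm[where 'd='d]
      by (subst nn_integral_multc) (auto simp: fser_def ennreal_mult_less_top less_top)
    finally show "(\<integral>\<^sup>+l. (\<integral>\<^sup>+x. norm (c l * ch (l - k) x) \<partial>tm) \<partial>cs) < \<infinity>" .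
  qed (auto intro: tm.sigma_finite_measure_axioms borel_tm)
  also have "\<dots> = (\<integral>l. (if l = k then c k * of_real (vol TYPE('d)) else 0) \<partial>cs)"
    by (intro Bochner_Integration.integral_cong) (auto simp: integral_ch)
  also have "\<dots> = c k * of_real (vol TYPE('d))"
    by (subst integrable_cs_finite[where A = "{k}"]) auto
  finally show ?thesis by (simp add: fc_def)
qed

definition conv :: "(int^'d::finite \<Rightarrow> complex) \<Rightarrow> (int^'d \<Rightarrow> complex) \<Rightarrow> int^'d \<Rightarrow> complex" where
  "conv a b k = (\<integral>l. a (k - l) * b l \<partial>cs)"

lemma bij_shift: "bij (\<lambda>k. k - l :: int^'d::finite)"
  by (rule o_bij[where g = "\<lambda>k. k + l"]) (auto simp: o_def)

lemma nn_integral_conv_finite: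
  fixes a b :: "int^'d::finite \<Rightarrow> complex"
  assumes "integrable cs a" "integrable cs b"
  shows "(\<integral>\<^sup>+l. (\<integral>\<^sup>+k. norm (a (k - l) * b l) \<partial>cs) \<partial>cs) < \<infinity>"
proof -
  have "(\<integral>\<^sup>+k. norm (a (k - l) * b l) \<partial>cs) = (\<integral>\<^sup>+k. norm (a k) \<partial>cs) * norm (b l)" for l
    using nn_integral_bij_count_space[OF bij_shift, of "\<lambda>k. ennreal (norm (a k))" l]
    by (simp add: norm_mult ennreal_mult nn_integral_multc)
  then have "(\<integral>\<^sup>+l. (\<integral>\<^sup>+k. norm (a (k - l) * b l) \<partial>cs) \<partial>cs) = (\<integral>\<^sup>+k. norm (a k) \<partial>cs) * (\<integral>\<^sup>+l. norm (b l) \<partial>cs)"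
    by (simp add: nn_integral_cmult)
  then show ?thesis using nn_integral_norm_cs[OF assms(1)] nn_integral_norm_cs[OF assms(2)]
    by (simp add: ennreal_mult_less_top)
qed

text \<open>The absolute double series is unchanged by the shift k -> k - l in one index, so the
  Cauchy product may be summed in either order.\<close>

lemma fser_mult:
  assumes F: "fser a F" and G: "fser b G"
  shows "fser (conv a b) (\<lambda>x. F x * G x)"
proof -
  have ab: "integrable cs a" "integrable cs b" using F G by (auto simp: fser_def)
  have *: "(\<integral>\<^sup>+l. (\<integral>\<^sup>+k. norm (a (k - l) * b l * ch k x) \<partial>cs) \<partial>cs) < \<infinity>" for x
    using nn_integral_conv_finite[OF ab] by (simp add: norm_mult)
  have i: "integrable cs (conv a b)"
    using integrable_sum_swap1[OF sigma_finite_cs _ nn_integral_conv_finite[OF ab]]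
    unfolding conv_def by simp
  have "F x * G x = (\<integral>k. conv a b k * ch k x \<partial>cs)" for x
  proof -
    have "F x * G x = (\<integral>l. F x * (b l * ch l x) \<partial>cs)"
      using G by (simp add: fser_def)
    also have "\<dots> = (\<integral>l. (\<integral>k. a (k - l) * b l * ch k x \<partial>cs) \<partial>cs)"
    proof (rule Bochner_Integration.integral_cong)
      fix l
      have "F x = (\<integral>k. a k * ch k x \<partial>cs)" using F by (simp add: fser_def)
      also have "\<dots> = (\<integral>k. a (k - l) * ch (k - l) x \<partial>cs)"
        by (rule integral_bij_count_space[OF bij_shift, symmetric])
      finally have "F x * (b l * ch l x) = (\<integral>k. a (k - l) * ch (k - l) x * (b l * ch l x) \<partial>cs)"
        by simp
      also have "\<dots> = (\<integral>k. a (k - l) * b l * ch k x \<partial>cs)"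
        by (intro Bochner_Integration.integral_cong) (auto simp: ch_diff mult.assoc mult.left_commute)
      finally show "F x * (b l * ch l x) = (\<integral>k. a (k - l) * b l * ch k x \<partial>cs)" .
    qed simp
    also have "\<dots> = (\<integral>k. (\<integral>l. a (k - l) * b l * ch k x \<partial>cs) \<partial>cs)"
      by (rule integral_sum_swap[OF sigma_finite_cs _ *, symmetric]) simp
    finally show ?thesis by (simp add: conv_def)
  qed
  with i show ?thesis by (simp add: fser_def)
qed

text \<open>Differentiation under the sum with only one power of the frequency at hand. The error of
  a single mode is at most twice its frequency, which is the summable majorant, and also at most the
  squared frequency times the step, which gives the limit for each mode.\<close>

lemma fser_has_derivative:
  assumes F: "fser c F" and c: "integrable cs (\<lambda>k. of_real (norm (freq k)) * c k)"
  shows "(F has_derivative (\<lambda>h. \<integral>k. c k * (\<i> * of_real (freq k \<bullet> h)) * ch k x \<partial>cs)) (at x)"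
proof -
  let ?D = "\<lambda>h. \<integral>k. c k * (\<i> * of_real (freq k \<bullet> h)) * ch k x \<partial>cs"
  have i: "integrable cs (\<lambda>k. c k * (\<i> * of_real (freq k \<bullet> h)) * ch k x)" for h
  proof (rule Bochner_Integration.integrable_bound[OF integrable_mult_right[OF c, of "of_real (norm h)"]])
    have "norm (c k) * \<bar>freq k \<bullet> h\<bar> \<le> norm (c k) * (norm (freq k) * norm h)" for k
      by (rule mult_left_mono[OF Cauchy_Schwarz_ineq2]) simp
    then show "AE k in cs. norm (c k * (\<i> * of_real (freq k \<bullet> h)) * ch k x) \<le> norm (of_real (norm h) * (of_real (norm (freq k)) * c k))"
      by (simp add: norm_mult mult_ac)
  qed simp
  have "bounded_linear ?D"
  proof (rule bounded_linear_intro[where K = "\<integral>k. norm (of_real (norm (freq k)) * c k) \<partial>cs"])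
    show "?D (h + h') = ?D h + ?D h'" for h h'
      by (subst Bochner_Integration.integral_add[symmetric, OF i i])
         (simp add: inner_add_right algebra_simps)
    show "?D (r *\<^sub>R h) = r *\<^sub>R ?D h" for r h
      unfolding inner_scaleR_right
      by (subst integral_scaleR_right[symmetric], rule Bochner_Integration.integral_cong)
         (auto simp: scaleR_conv_of_real)
    show "norm (?D h) \<le> norm h * (\<integral>k. norm (of_real (norm (freq k)) * c k) \<partial>cs)" for h
    proof -
      have "norm (?D h) \<le> (\<integral>k. norm (c k * (\<i> * of_real (freq k \<bullet> h)) * ch k x) \<partial>cs)"
        by (rule integral_norm_bound)
      also have "\<dots> \<le> (\<integral>k. norm h * norm (of_real (norm (freq k)) * c k) \<partial>cs)"
      proof (intro integral_mono integrable_norm i integrable_mult_right c)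
        fix k
        have "norm (c k) * \<bar>freq k \<bullet> h\<bar> \<le> norm (c k) * (norm (freq k) * norm h)"
          by (rule mult_left_mono[OF Cauchy_Schwarz_ineq2]) simp
        then show "norm (c k * (\<i> * of_real (freq k \<bullet> h)) * ch k x) \<le> norm h * norm (of_real (norm (freq k)) * c k)"
          by (simp add: norm_mult mult_ac)
      qed
      finally show ?thesis by simp
    qed
  qed
  moreover have "((\<lambda>h. norm (F (x + h) - F x - ?D h) / norm h) \<longlongrightarrow> 0) (at 0)"
    unfolding tendsto_at_iff_sequentially
  proof (intro allI impI)
    fix X :: "nat \<Rightarrow> real^'a" assume X0: "\<forall>n. X n \<in> UNIV - {0}" and X: "X \<longlonglongrightarrow> 0"
    define g where "g n k = norm (c k) * (norm (cis (freq k \<bullet> X n) - 1 - \<i> * of_real (freq k \<bullet> X n)) / norm (X n))" for n k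
    have b1: "norm (cis t - 1 - \<i> * of_real t) \<le> 2 * \<bar>t\<bar>" for t :: real
      using iexp_approx2[of t 1] by (simp add: cis_conv_exp algebra_simps)
    have b2: "norm (cis t - 1 - \<i> * of_real t) \<le> t\<^sup>2 / 2" for t :: real
      using iexp_approx1[of t 1] by (simp add: cis_conv_exp algebra_simps power2_eq_square)
    have gb1: "g n k \<le> 2 * norm (of_real (norm (freq k)) * c k)" for n k
    proof -
      have "norm (cis (freq k \<bullet> X n) - 1 - \<i> * of_real (freq k \<bullet> X n)) / norm (X n) \<le> 2 * norm (freq k)"
        using order_trans[OF b1 mult_left_mono[OF Cauchy_Schwarz_ineq2[of "freq k" "X n"], of 2]] X0[rule_format, of n]
        by (simp add: pos_divide_le_eq mult_ac)
      from mult_left_mono[OF this, of "norm (c k)"] show ?thesis by (simp add: g_def norm_mult mult_ac)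
    qed
    have gb2: "g n k \<le> norm (c k) * (norm (freq k))\<^sup>2 * norm (X n)" for n k
    proof -
      have "(freq k \<bullet> X n)\<^sup>2 \<le> (norm (freq k) * norm (X n))\<^sup>2"
        using Cauchy_Schwarz_ineq2[of "freq k" "X n"] by (metis abs_le_square_iff abs_mult abs_norm_cancel)
      then have "norm (cis (freq k \<bullet> X n) - 1 - \<i> * of_real (freq k \<bullet> X n)) \<le> (norm (freq k) * norm (X n))\<^sup>2"
        using b2[of "freq k \<bullet> X n"] zero_le_power2[of "freq k \<bullet> X n"] by linarith
      then have "norm (cis (freq k \<bullet> X n) - 1 - \<i> * of_real (freq k \<bullet> X n)) / norm (X n) \<le> (norm (freq k))\<^sup>2 * norm (X n)"
        using X0[rule_format, of n] by (simp add: pos_divide_le_eq power_mult_distrib power2_eq_square mult_ac)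
      from mult_left_mono[OF this, of "norm (c k)"] show ?thesis by (simp add: g_def mult_ac)
    qed
    have g0: "g n k \<ge> 0" for n k by (simp add: g_def)
    have gi: "integrable cs (g n)" for n
      by (rule Bochner_Integration.integrable_bound[OF integrable_mult_right[OF integrable_norm[OF c], of 2]])
         (simp_all only: real_norm_def abs_of_nonneg[OF g0] gb1 AE_I2 measurable_count_space_eq1 space_borel, simp_all add: gb1)
    have "(\<lambda>n. \<integral>k. g n k \<partial>cs) \<longlonglongrightarrow> integral\<^sup>L cs (\<lambda>k::int^'a. 0)"
    proof (rule integral_dominated_convergence[where w = "\<lambda>k. 2 * norm (of_real (norm (freq k)) * c k)"])
      show "AE k in cs. (\<lambda>n. g n k) \<longlonglongrightarrow> 0"
      proof (rule AE_I2)
        fix k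
        have "(\<lambda>n. norm (c k) * (norm (freq k))\<^sup>2 * norm (X n)) \<longlonglongrightarrow> 0"
          using tendsto_mult_right_zero[OF tendsto_norm_zero[OF X]] by simp
        then show "(\<lambda>n. g n k) \<longlonglongrightarrow> 0"
          by (rule tendsto_sandwich[OF always_eventually always_eventually tendsto_const, rotated 2]) (simp_all add: gb2 g0)
      qed
      show "AE k in cs. norm (g n k) \<le> 2 * norm (of_real (norm (freq k)) * c k)" for n
        by (rule AE_I2) (simp only: real_norm_def abs_of_nonneg[OF g0] gb1)
      show "integrable cs (\<lambda>k. 2 * norm (of_real (norm (freq k)) * c k))"
        by (rule integrable_mult_right[OF integrable_norm[OF c]])
    qed simp_all
    moreover have "norm (F (x + X n) - F x - ?D (X n)) / norm (X n) \<le> (\<integral>k. g n k \<partial>cs)" for n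
    proof -
      have "F (x + X n) - F x - ?D (X n) = (\<integral>k. c k * ch k x * (cis (freq k \<bullet> X n) - 1 - \<i> * of_real (freq k \<bullet> X n)) \<partial>cs)"
      proof -
        have c': "integrable cs c" using F by (simp add: fser_def)
        have "F (x + X n) - F x - ?D (X n) =
            (\<integral>k. c k * ch k (x + X n) - c k * ch k x - c k * (\<i> * of_real (freq k \<bullet> X n)) * ch k x \<partial>cs)"
          using F by (simp add: fser_def Bochner_Integration.integral_diff integrable_ch[OF c'] i)
        also have "\<dots> = (\<integral>k. c k * ch k x * (cis (freq k \<bullet> X n) - 1 - \<i> * of_real (freq k \<bullet> X n)) \<partial>cs)"
          by (rule Bochner_Integration.integral_cong) (simp_all add: ch_plus algebra_simps, simp add: ch_def)
        finally show ?thesis .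
      qed
      then have "norm (F (x + X n) - F x - ?D (X n)) \<le> (\<integral>k. norm (c k * ch k x * (cis (freq k \<bullet> X n) - 1 - \<i> * of_real (freq k \<bullet> X n))) \<partial>cs)"
        by (simp only: integral_norm_bound)
      then have "norm (F (x + X n) - F x - ?D (X n)) / norm (X n) \<le> (\<integral>k. norm (c k * ch k x * (cis (freq k \<bullet> X n) - 1 - \<i> * of_real (freq k \<bullet> X n))) \<partial>cs) / norm (X n)"
        by (rule divide_right_mono) simp
      then show ?thesis by (simp add: norm_mult g_def flip: integral_divide_zero)
    qed
    ultimately show "((\<lambda>h. norm (F (x + h) - F x - ?D h) / norm h) \<circ> X) \<longlonglongrightarrow> 0"
      unfolding o_def integral_zero
      by - (rule tendsto_sandwich[OF always_eventually always_eventually tendsto_const, rotated 2], blast, simp, blast)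
  qed
  ultimately show ?thesis by (simp add: has_derivative_at)
qed

lemma fser_partial:
  fixes f :: "real^'d::finite \<Rightarrow> real"
  assumes F: "fser c (\<lambda>x. of_real (f x))" and c: "integrable cs (\<lambda>k. of_real (norm (freq k)) * c k)"
  shows "f differentiable at x"
    and "fser (\<lambda>k. \<i> * of_real (freq k $ i) * c k) (\<lambda>x. of_real (partial_d i f x))"
proof -
  let ?D = "\<lambda>x h. \<integral>k. c k * (\<i> * of_real (freq k \<bullet> h)) * ch k x \<partial>cs"
  have D: "((\<lambda>x. of_real (f x) :: complex) has_derivative ?D x) (at x)" for x
    by (rule fser_has_derivative[OF F c])
  have d: "(f has_derivative (\<lambda>h. Re (?D x h))) (at x)" for x
    using bounded_linear.has_derivative[OF bounded_linear_Re D[of x]] by simp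
  then show "f differentiable at x" by (auto simp: differentiable_def)
  \<comment> \<open>The derivative of the embedded real function is itself real, because it is also
    the embedding of the real derivative and derivatives are unique.\<close>
  have eq: "of_real (Re (?D x h)) = ?D x h" for x h
    using fun_cong[OF has_derivative_unique[OF D[of x] has_derivative_of_real[OF d[of x]]], of h] by simp
  have p: "partial_d i f x = Re (?D x (axis i 1))" for x
    unfolding partial_d_def frechet_derivative_at[OF d[of x], symmetric] by (rule refl)
  have "integrable cs (\<lambda>k. \<i> * of_real (freq k $ i) * c k)"
  proof (rule Bochner_Integration.integrable_bound[OF c])
    show "AE k in cs. norm (\<i> * of_real (freq k $ i) * c k) \<le> norm (of_real (norm (freq k)) * c k)"
      by (rule AE_I2, unfold norm_mult norm_of_real norm_ii) (simp add: mult_right_mono component_le_norm_cart del: mult_le_cancel_right)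
  qed simp
  then show "fser (\<lambda>k. \<i> * of_real (freq k $ i) * c k) (\<lambda>x. of_real (partial_d i f x))"
    unfolding fser_def p eq by (simp add: inner_axis mult_ac)
qed

section \<open>Trigonometric polynomials and completeness of the characters\<close>

definition trig_poly :: "(real^'d::finite \<Rightarrow> real) \<Rightarrow> bool" where
  "trig_poly g \<longleftrightarrow> (\<exists>c. finite {k. c k \<noteq> 0} \<and> fser c (\<lambda>x. of_real (g x)))"

lemma trig_poly_const: "trig_poly (\<lambda>x. r)"
  unfolding trig_poly_def using fser_const[of "of_real r"]
  by (intro exI conjI) (rule finite_subset[of _ "{0}"], auto)

lemma trig_poly_add: "trig_poly f \<Longrightarrow> trig_poly g \<Longrightarrow> trig_poly (\<lambda>x. f x + g x)"
  unfolding trig_poly_def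
proof (elim exE conjE)
  fix a b assume *: "finite {k. a k \<noteq> 0}" "finite {k. b k \<noteq> 0}" "fser a (\<lambda>x. complex_of_real (f x))" "fser b (\<lambda>x. complex_of_real (g x))"
  have "finite {k. a k + b k \<noteq> 0}" by (rule finite_subset[OF _ finite_UnI[OF *(1,2)]]) auto
  then show "\<exists>c. finite {k. c k \<noteq> 0} \<and> fser c (\<lambda>x. complex_of_real (f x + g x))"
    using fser_add[OF *(3,4)] by auto
qed

lemma trig_poly_mult: "trig_poly f \<Longrightarrow> trig_poly g \<Longrightarrow> trig_poly (\<lambda>x. f x * g x)"
  unfolding trig_poly_def
proof (elim exE conjE)
  fix a b assume *: "finite {k. a k \<noteq> 0}" "finite {k. b k \<noteq> 0}" "fser a (\<lambda>x. complex_of_real (f x))" "fser b (\<lambda>x. complex_of_real (g x))"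
  \<comment> \<open>The support of a Cauchy product lies in the sum set of the supports.\<close>
  have "{k. conv a b k \<noteq> 0} \<subseteq> (\<lambda>(k, l). k + l) ` ({k. a k \<noteq> 0} \<times> {k. b k \<noteq> 0})"
  proof
    fix k assume "k \<in> {k. conv a b k \<noteq> 0}"
    then have "(\<lambda>l. a (k - l) * b l) \<noteq> (\<lambda>l. 0)" by (auto simp: conv_def simp del: mult_eq_0_iff)
    then have "\<exists>l. a (k - l) * b l \<noteq> 0" by auto
    then obtain l where "a (k - l) \<noteq> 0" "b l \<noteq> 0" by auto
    then show "k \<in> (\<lambda>(k, l). k + l) ` ({k. a k \<noteq> 0} \<times> {k. b k \<noteq> 0})"
      by (intro image_eqI[of _ _ "(k - l, l)"]) auto
  qed
  then have "finite {k. conv a b k \<noteq> 0}" by (rule finite_subset) (use * in auto)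
  then show "\<exists>c. finite {k. c k \<noteq> 0} \<and> fser c (\<lambda>x. complex_of_real (f x * g x))"
    using fser_mult[OF *(3,4)] by auto
qed

lemma trig_poly_sum: "(\<And>i. i \<in> A \<Longrightarrow> trig_poly (f i)) \<Longrightarrow> trig_poly (\<lambda>x. \<Sum>i\<in>A. f i x)"
  by (induction A rule: infinite_finite_induct) (auto intro: trig_poly_add trig_poly_const)

lemma trig_poly_cos_sin: "trig_poly (\<lambda>x. cos (x $ i))" "trig_poly (\<lambda>x. sin (x $ i))"
proof -
  let ?e = "axis i 1 :: int^'a"
  have x: "freq ?e \<bullet> x = x $ i" for x :: "real^'a"
    by (simp add: freq_def inner_vec_def axis_def if_distrib[of of_int] if_distrib[of "\<lambda>u. u * _"] cong: if_cong)
  \<comment> \<open>The two frequencies have to differ, for otherwise the nested \<open>if\<close>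
    below would drop one of the two coefficients.\<close>
  have ne: "?e \<noteq> - ?e"
  proof
    assume "?e = - ?e"
    then have "?e $ i = (- ?e) $ i" by (rule arg_cong)
    then show False by simp
  qed
  have ce: "ch ?e y = Complex (cos (y $ i)) (sin (y $ i))" "ch (- ?e) y = Complex (cos (y $ i)) (- sin (y $ i))" for y
    by (simp_all add: ch_minus) (simp_all add: ch_def x complex_eq_iff)
  have "fser (\<lambda>k. if k = ?e then 1/2 else if k = - ?e then 1/2 else 0) (\<lambda>y. complex_of_real (cos (y $ i)))"
    by (rule fser_finite[of "{?e, - ?e}"]) (use ne in \<open>simp_all add: ce complex_eq_iff\<close>)
  then show "trig_poly (\<lambda>x. cos (x $ i))" unfolding trig_poly_def
    by (intro exI conjI) (rule finite_subset[of _ "{?e, - ?e}"], auto)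
  have "fser (\<lambda>k. if k = ?e then -\<i>/2 else if k = - ?e then \<i>/2 else 0) (\<lambda>y. complex_of_real (sin (y $ i)))"
    by (rule fser_finite[of "{?e, - ?e}"]) (use ne in \<open>simp_all add: ce complex_eq_iff\<close>)
  then show "trig_poly (\<lambda>x. sin (x $ i))" unfolding trig_poly_def
    by (intro exI conjI) (rule finite_subset[of _ "{?e, - ?e}"], auto)
qed

text \<open>Stone-Weierstrass on the image of the torus in \<open>\<complex>\<^sup>d\<close>.\<close>

lemma trig_poly_dense:
  fixes f :: "real^'d::finite \<Rightarrow> real"
  assumes per: "periodic f" and cont: "continuous_on UNIV f" and e: "e > 0"
  obtains p where "trig_poly p" "\<And>x. \<bar>f x - p x\<bar> < e"
proof -
  let ?b = "(\<chi> i. pi) :: real^'d"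
  define E :: "real^'d \<Rightarrow> complex^'d" where "E x = (\<chi> i. cis (x $ i))" for x
  define S where "S = E ` cbox (- ?b) ?b"
  have Ec: "continuous_on A E" for A
    unfolding E_def cis_conv_exp by (intro continuous_intros)
  have Eeq: "f x = f y" if "E x = E y" for x y
  proof -
    have "\<exists>n::int. y $ i = x $ i + 2 * pi * n" for i
    proof -
      have "cis (x $ i) = cis (y $ i)" using that by (auto simp: E_def vec_eq_iff)
      then have "sin (y $ i) = sin (x $ i) \<and> cos (y $ i) = cos (x $ i)" by (simp add: complex_eq_iff)
      then show ?thesis by (simp add: sin_cos_eq_iff)
    qed
    then obtain n where "\<And>i. y $ i = x $ i + 2 * pi * of_int (n i)" by metis
    then have "y = x + lat (\<chi> i. n i)" by (simp add: vec_eq_iff lat_def)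
    then show ?thesis by (simp add: periodic_lat[OF per])
  qed
  \<comment> \<open>\<open>E\<close> identifies only points that differ by the lattice, so a
    periodic function factors through its image; \<open>h\<close> is the factor.\<close>
  define h where "h z = f (SOME x. E x = z)" for z
  have h: "h (E x) = f x" for x
    unfolding h_def by (rule Eeq) (rule someI[of "\<lambda>y. E y = E x"], simp)
  have S: "compact S" unfolding S_def by (rule compact_continuous_image[OF Ec]) simp
  have "compact (f ` cbox (- ?b) ?b)"
    by (rule compact_continuous_image) (use cont continuous_on_subset in auto)
  moreover have "h \<in> S \<rightarrow> f ` cbox (- ?b) ?b" unfolding S_def using h by auto
  \<comment> \<open>Continuity of the factor without an inverse of \<open>E\<close>: its graph is
    compact, as a continuous image of the closed cube, and its values stay in a compact set.\<close>
  moreover have "closed ((\<lambda>z. (z, h z)) ` S)"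
  proof -
    have "(\<lambda>z. (z, h z)) ` S = (\<lambda>x. (E x, f x)) ` cbox (- ?b) ?b" unfolding S_def using h by (auto simp: image_image)
    moreover have "compact ((\<lambda>x. (E x, f x)) ` cbox (- ?b) ?b)"
      by (rule compact_continuous_image[OF continuous_on_Pair[OF Ec continuous_on_subset[OF cont]]]) auto
    ultimately show ?thesis by (simp add: compact_imp_closed)
  qed
  ultimately have "continuous_on S h" by (rule continuous_from_closed_graph)
  then obtain g where g: "real_polynomial_function g" "\<And>z. z \<in> S \<Longrightarrow> \<bar>h z - g z\<bar> < e"
    using Stone_Weierstrass_real_polynomial_function[OF S _ e] by metis
  have "trig_poly (\<lambda>x. g (E x))" using g(1)
  proof induction
    case (linear g)
    \<comment> \<open>A real linear form of \<open>E x\<close> is a combination of cosines and sines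
      of the coordinates; this is the base case of the induction over real polynomials.\<close>
    have "E x = (\<Sum>i\<in>UNIV. cos (x $ i) *\<^sub>R axis i 1 + sin (x $ i) *\<^sub>R axis i \<i>)" for x
      unfolding E_def vec_eq_iff
      by (auto simp: axis_def if_distrib[of "\<lambda>u. _ *\<^sub>R u"] sum.distrib complex_eq_iff cong: if_cong)
    then have "g (E x) = (\<Sum>i\<in>UNIV. cos (x $ i) * g (axis i 1) + sin (x $ i) * g (axis i \<i>))" for x
      using linear by (simp add: linear_simps bounded_linear.linear linear_sum o_def)
    then show ?case
      by (auto intro!: trig_poly_sum trig_poly_add trig_poly_mult trig_poly_const trig_poly_cos_sin)
  qed (auto intro: trig_poly_add trig_poly_mult trig_poly_const)
  moreover have "\<bar>f x - g (E x)\<bar> < e" for x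
  proof -
    have "torus_proj x \<in> cbox (- ?b) ?b"
      using torus_proj_in[of x] by (auto simp: torus_def mem_box_cart less_imp_le)
    then have "E (torus_proj x) \<in> S" by (simp add: S_def)
    moreover have "periodic E" unfolding periodic_def E_def by (auto simp: vec_eq_iff axis_def simp flip: cis_mult)
    then have "E (torus_proj x) = E x" by (rule periodic_torus_proj)
    ultimately show ?thesis using g(2)[of "E x"] h by simp
  qed
  ultimately show ?thesis using that by blast
qed

lemma integral_trig_poly_zero:
  fixes H :: "real^'d::finite \<Rightarrow> complex"
  assumes H: "integrable tm H" and z: "\<And>k. fc H k = 0" and p: "trig_poly p"
  shows "(\<integral>x. H x * of_real (p x) \<partial>tm) = 0"
proof -
  obtain c where c: "finite {k. c k \<noteq> 0}" "fser c (\<lambda>x. complex_of_real (p x))" using p by (auto simp: trig_poly_def)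
  have px: "complex_of_real (p x) = (\<Sum>k | c k \<noteq> 0. c k * ch k x)" for x
    using c(2) integrable_cs_finite(2)[OF c(1), of "\<lambda>k. c k * ch k x"] by (simp add: fser_def)
  have "(\<integral>x. H x * ch k x \<partial>tm) = 0" for k using z[of "- k"] by (simp add: fc_def)
  moreover have "integrable tm (\<lambda>x. H x * ch k x)" for k
    by (rule Bochner_Integration.integrable_bound[OF H]) (use H in \<open>auto simp: norm_mult intro!: borel_measurable_times[OF _ borel_tm]\<close>)
  ultimately have "(\<integral>x. (\<Sum>k | c k \<noteq> 0. c k * (H x * ch k x)) \<partial>tm) = 0"
    by (subst Bochner_Integration.integral_sum) auto
  moreover have "(\<Sum>k | c k \<noteq> 0. c k * (H x * ch k x)) = H x * of_real (p x)" for x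
    by (simp add: px sum_distrib_left mult_ac)
  ultimately show ?thesis by simp
qed

lemma fourier_unique:
  fixes H :: "real^'d::finite \<Rightarrow> complex"
  assumes per: "periodic H" and cont: "continuous_on UNIV H" and z: "\<And>k. fc H k = 0"
  shows "H x = 0"
proof -
  have Hi: "integrable tm H" by (rule integrable_tm_continuous[OF per cont])
  obtain C where C: "\<And>x. norm (H x) \<le> C" "C \<ge> 0" using periodic_bounded[OF per cont] by metis
  have i2: "integrable tm (\<lambda>x. (norm (H x))\<^sup>2)"
    by (rule integrable_tm_continuous) (use per cont in \<open>auto simp: periodic_def intro!: continuous_intros\<close>)
  have "(\<integral>x. (norm (H x))\<^sup>2 \<partial>tm) \<le> 0 + \<epsilon>" if "\<epsilon> > 0" for \<epsilon>
  proof -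
    \<comment> \<open>Real and imaginary part each contribute \<open>e\<close>, so the final bound
      is 2 C e times the volume, that is C \<epsilon> / (C + 1). The summand 1 covers C = 0.\<close>
    define e where "e = \<epsilon> / (2 * (C + 1) * vol TYPE('d))"
    have e: "e > 0" using that C by (simp add: e_def)
    obtain p where p: "trig_poly p" "\<And>x. \<bar>Re (H x) - p x\<bar> < e"
      by (rule trig_poly_dense[of "\<lambda>x. Re (H x)" e]) (use per cont e in \<open>auto simp: periodic_def intro!: continuous_intros\<close>)
    obtain q where q: "trig_poly q" "\<And>x. \<bar>Im (H x) - q x\<bar> < e"
      by (rule trig_poly_dense[of "\<lambda>x. Im (H x)" e]) (use per cont e in \<open>auto simp: periodic_def intro!: continuous_intros\<close>)
    obtain cp cq where pq: "fser cp (\<lambda>x. complex_of_real (p x))" "fser cq (\<lambda>x. complex_of_real (q x))"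
      using p q by (auto simp: trig_poly_def)
    have ip: "integrable tm (\<lambda>x. H x * of_real (r x))" if "fser c (\<lambda>x. complex_of_real (r x))" for c r
      by (rule integrable_tm_continuous)
         (use per cont fser_periodic[OF that] fser_continuous[OF that] in \<open>auto simp: periodic_def intro!: continuous_intros\<close>)
    have "complex_of_real (\<integral>x. (norm (H x))\<^sup>2 \<partial>tm) = (\<integral>x. H x * cnj (H x) \<partial>tm)"
      by (simp add: complex_norm_square del: of_real_power flip: integral_complex_of_real)
    also have "\<dots> = (\<integral>x. H x * cnj (H x) - (H x * of_real (p x) - \<i> * (H x * of_real (q x))) \<partial>tm)"
    proof -
      have "integrable tm (\<lambda>x. H x * cnj (H x))"
        using i2 by (simp add: complex_norm_square[symmetric] del: of_real_power)
      then show ?thesis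
        using ip[OF pq(1)] ip[OF pq(2)] integral_trig_poly_zero[OF Hi z p(1)] integral_trig_poly_zero[OF Hi z q(1)]
        by simp
    qed
    finally have eq: "complex_of_real (\<integral>x. (norm (H x))\<^sup>2 \<partial>tm) = (\<integral>x. H x * cnj (H x) - (H x * of_real (p x) - \<i> * (H x * of_real (q x))) \<partial>tm)" .
    have "(\<integral>x. (norm (H x))\<^sup>2 \<partial>tm) \<le> norm (\<integral>x. H x * cnj (H x) - (H x * of_real (p x) - \<i> * (H x * of_real (q x))) \<partial>tm)"
      unfolding eq[symmetric] norm_of_real by (rule abs_ge_self)
    also have "\<dots> \<le> (\<integral>x. norm (H x * cnj (H x) - (H x * of_real (p x) - \<i> * (H x * of_real (q x)))) \<partial>tm)"
      by (rule integral_norm_bound)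
    also have "\<dots> \<le> (\<integral>x. C * (2 * e) \<partial>(tm :: (real^'d) measure))"
    proof (rule integral_mono, rule integrable_norm)
      have "integrable tm (\<lambda>x. H x * cnj (H x))"
        using i2 by (simp add: complex_norm_square[symmetric] del: of_real_power)
      then show "integrable tm (\<lambda>x. H x * cnj (H x) - (H x * of_real (p x) - \<i> * (H x * of_real (q x))))"
        using ip[OF pq(1)] ip[OF pq(2)] by simp
      fix x
      have "H x * cnj (H x) - (H x * of_real (p x) - \<i> * (H x * of_real (q x))) = H x * Complex (Re (H x) - p x) (q x - Im (H x))"
        by (simp add: complex_eq_iff algebra_simps)
      moreover have "norm (Complex (Re (H x) - p x) (q x - Im (H x))) \<le> 2 * e"
        using cmod_le[of "Complex (Re (H x) - p x) (q x - Im (H x))"] p(2)[of x] q(2)[of x] by simp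
      ultimately show "norm (H x * cnj (H x) - (H x * of_real (p x) - \<i> * (H x * of_real (q x)))) \<le> C * (2 * e)"
        using C by (simp add: norm_mult mult_mono)
    qed (simp_all)
    also have "\<dots> = 2 * C * (e * vol TYPE('d))" by (simp add: measure_tm)
    also have "e * vol TYPE('d) = \<epsilon> / (2 * (C + 1))" by (simp add: e_def)
    also have "2 * C * (\<epsilon> / (2 * (C + 1))) = C * \<epsilon> / (C + 1)" by (simp add: divide_simps)
    also have "\<dots> \<le> \<epsilon>" using C(2) that by (simp add: field_simps)
    finally show ?thesis by simp
  qed
  then have "(\<integral>x. (norm (H x))\<^sup>2 \<partial>tm) \<le> 0" by (rule field_le_epsilon)
  then have z0: "(\<integral>x. (norm (H x))\<^sup>2 \<partial>tm) = 0" by (simp add: order_antisym)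
  have b: "(\<lambda>y. (norm (H y))\<^sup>2) \<in> borel_measurable borel" "periodic (\<lambda>y. (norm (H y))\<^sup>2)"
    using per by (auto simp: periodic_def intro!: borel_measurable_continuous_onI continuous_intros cont)
  \<comment> \<open>An arbitrary point is moved to the origin, which is interior to the cube, so
    that a whole ball around it is seen by the measure.\<close>
  have "(\<integral>y. (norm (H (x + y)))\<^sup>2 \<partial>tm) = 0"
    using integral_tm_shift[OF b, of x] z0 by simp
  moreover have "integrable tm (\<lambda>y. (norm (H (x + y)))\<^sup>2)"
    using i2 integrable_tm_shift[OF b, of x] by simp
  ultimately have ae: "AE y in tm. H (x + y) = 0"
    using integral_nonneg_eq_0_iff_AE[of tm "\<lambda>y. (norm (H (x + y)))\<^sup>2"] by simp
  show "H x = 0"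
  proof (rule ccontr)
    assume "H x \<noteq> 0"
    have "continuous_on UNIV (\<lambda>y. H (x + y))"
      by (rule continuous_on_compose2[OF cont]) (auto intro!: continuous_intros)
    then have "open {y. H (x + y) \<noteq> 0}"
      by (intro open_Collect_neq) (auto intro: continuous_intros)
    then obtain r where r: "r > 0" "ball 0 r \<subseteq> {y. H (x + y) \<noteq> 0}"
      using \<open>H x \<noteq> 0\<close> by (metis (mono_tags, lifting) add.right_neutral mem_Collect_eq open_contains_ball)
    define s where "s = min r pi"
    have s: "s > 0" using r by (simp add: s_def)
    have sub: "ball 0 s \<subseteq> (torus :: (real^'d) set)"
    proof
      fix y :: "real^'d" assume "y \<in> ball 0 s"
      then have "\<bar>y $ i\<bar> < pi" for i using component_le_norm_cart[of y i] by (simp add: s_def)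
      then show "y \<in> torus" unfolding torus_def by (simp add: abs_less_iff less_imp_le) (smt (verit))
    qed
    have "AE y in lborel. y \<in> torus \<longrightarrow> H (x + y) = 0"
      using ae unfolding tm_def by (subst (asm) AE_restrict_space_iff) auto
    then have "AE y in lborel. y \<notin> ball (0 :: real^'d) s"
      by (rule eventually_mono) (use sub r in \<open>auto simp: s_def\<close>)
    then have "emeasure lborel (ball (0 :: real^'d) s) = 0"
      by (subst (asm) AE_iff_measurable[of "ball 0 s"]) auto
    then have "ball (0 :: real^'d) s = {}"
      by (metis emeasure_lborel_ball_finite measure_def content_ball_pos enn2real_0 s order_less_irrefl)
    then show False using s by simp
  qed
qed

text \<open>The sum of the Fourier series is continuous and has the same coefficients as
  \<open>H\<close>, so uniqueness applies to the difference.\<close>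

lemma fourier_inversion:
  fixes H :: "real^'d::finite \<Rightarrow> complex"
  assumes per: "periodic H" and cont: "continuous_on UNIV H" and i: "integrable cs (fc H)"
  shows "fser (fc H) H"
proof -
  have "fser (fc H) (\<lambda>x. \<integral>k. fc H k * ch k x \<partial>cs)" using i by (simp add: fser_def)
  then obtain G where G: "fser (fc H) G" by blast
  have iG: "integrable tm G" "integrable tm H"
    by (rule integrable_tm_continuous fser_periodic[OF G] fser_continuous[OF G] per cont)+
  have im: "integrable tm (\<lambda>x. U x * ch k x)" if "integrable tm U" for U k
    by (rule Bochner_Integration.integrable_bound[OF that])
       (use that in \<open>auto simp: norm_mult intro!: borel_measurable_times[OF _ borel_tm]\<close>)
  have "H x - G x = 0" for x
  proof (rule fourier_unique[of "\<lambda>x. H x - G x"])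
    show "periodic (\<lambda>x. H x - G x)" using per fser_periodic[OF G] by (simp add: periodic_def)
    show "continuous_on UNIV (\<lambda>x. H x - G x)" by (intro continuous_on_diff cont fser_continuous[OF G])
    have "fc (\<lambda>x. H x - G x) k = fc H k - fc G k" for k
      unfolding fc_def left_diff_distrib Bochner_Integration.integral_diff[OF im[OF iG(2)] im[OF iG(1)]]
      by (simp add: diff_divide_distrib)
    then show "fc (\<lambda>x. H x - G x) k = 0" for k using fser_fc[OF G] by simp
  qed
  then have "H = G" by auto
  then show ?thesis using G by simp
qed

section \<open>Sobolev spaces of Fourier coefficients\<close>

definition jb :: "int^'d::finite \<Rightarrow> real" where "jb k = sqrt (1 + (norm (freq k))\<^sup>2)"

lemma jb_ge_1: "1 \<le> jb k" and jb_pos [simp]: "0 < jb k" and jb_nonneg [simp]: "0 \<le> jb k"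
  and jb_nonzero [simp]: "jb k \<noteq> 0"
proof -
  show "1 \<le> jb k" by (simp add: jb_def)
  then show "0 < jb k" "0 \<le> jb k" "jb k \<noteq> 0" by linarith+
qed

lemma jb_powr_sq: "(jb k powr \<gamma>)\<^sup>2 = jb k powr (2 * \<gamma>)"
  by (simp add: power2_eq_square flip: powr_add)

lemma ennreal_square_finite: "(x :: ennreal)\<^sup>2 < \<infinity> \<Longrightarrow> x < \<infinity>"
  by (cases x) (auto simp: power2_eq_square ennreal_top_mult)

lemma jb_sq: "(jb k)\<^sup>2 = 1 + (norm (freq k))\<^sup>2"
  by (simp add: jb_def)

lemma norm_freq_le_jb: "norm (freq k) \<le> jb k"
  unfolding jb_def by (rule real_le_rsqrt) simp

lemma jb_triangle: "jb k \<le> jb (k - l) + jb l"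
proof -
  have "(jb k)\<^sup>2 \<le> (jb (k - l) + jb l)\<^sup>2"
  proof -
    have "norm (freq k) \<le> norm (freq (k - l)) + norm (freq l)"
      using norm_triangle_ineq[of "freq (k - l)" "freq l"] by (simp add: freq_diff)
    then have "(norm (freq k))\<^sup>2 \<le> (norm (freq (k - l)) + norm (freq l))\<^sup>2" by (rule power_mono) simp
    moreover have "norm (freq (k - l)) * norm (freq l) \<le> jb (k - l) * jb l"
      by (intro mult_mono norm_freq_le_jb) auto
    ultimately show ?thesis by (simp add: power2_sum jb_sq)
  qed
  then show ?thesis by (rule power2_le_imp_le) (simp add: add_nonneg_nonneg)
qed

text \<open>The weight at k is controlled by the larger of the weights at k - l and l. This is what
  makes Sobolev spaces of high order algebras.\<close>

lemma jb_powr_triangle: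
  assumes "\<alpha> \<ge> 0" shows "jb k powr \<alpha> \<le> 2 powr \<alpha> * (jb (k - l) powr \<alpha> + jb l powr \<alpha>)"
proof -
  have "jb k powr \<alpha> \<le> (2 * max (jb (k - l)) (jb l)) powr \<alpha>"
    by (rule powr_mono2[OF assms]) (use jb_triangle[of k l] in auto)
  also have "\<dots> = 2 powr \<alpha> * max (jb (k - l)) (jb l) powr \<alpha>"
    by (simp add: powr_mult)
  also have "max (jb (k - l)) (jb l) powr \<alpha> \<le> jb (k - l) powr \<alpha> + jb l powr \<alpha>"
    by (auto simp: max_def)
  finally show ?thesis by simp
qed

text \<open>The squared Sobolev norm as a function of the coefficients. With values in
  \<open>ennreal\<close> it makes sense for every sequence, so estimates need no summability
  conditions.\<close>

definition sn :: "real \<Rightarrow> (int^'d::finite \<Rightarrow> complex) \<Rightarrow> ennreal" where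
  "sn \<alpha> c = (\<integral>\<^sup>+k. ennreal (jb k powr (2 * \<alpha>) * (norm (c k))\<^sup>2) \<partial>cs)"

lemma sobolev_norm2_eq:
  "sobolev_norm2 \<alpha> u = sn \<alpha> (fourier_coeff u)"
  by (simp add: sobolev_norm2_def sn_def jb_def)

lemma sn_cmult: "sn \<alpha> (\<lambda>k. z * c k) = ennreal ((norm z)\<^sup>2) * sn \<alpha> c"
  unfolding sn_def
  by (subst nn_integral_cmult[symmetric]) (auto simp: norm_mult power_mult_distrib ennreal_mult[symmetric] mult_ac)

lemma sobolev_norm2_pairing:
  fixes f :: "real^'d::finite \<Rightarrow> real"
  assumes "integrable tm f"
  shows "sobolev_norm2 \<alpha> (pairing f) = ennreal ((vol TYPE('d))\<^sup>2) * sn \<alpha> (cf f)"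
proof -
  have "fourier_coeff (pairing f) = (\<lambda>k. of_real (vol TYPE('d)) * cf f k)"
    by (rule ext) (rule fourier_coeff_pairing[OF assms])
  then show ?thesis using sn_cmult[of \<alpha> "of_real (vol TYPE('d))" "cf f"]
    by (simp add: sobolev_norm2_eq)
qed

lemma sn_mono: "(\<And>k. norm (a k) \<le> norm (b k)) \<Longrightarrow> sn \<alpha> a \<le> sn \<alpha> b"
  unfolding sn_def by (intro nn_integral_mono ennreal_leI mult_left_mono power_mono) auto

lemma sn_mono_exp: "\<alpha> \<le> \<beta> \<Longrightarrow> sn \<alpha> c \<le> sn \<beta> c"
  unfolding sn_def by (intro nn_integral_mono ennreal_leI mult_right_mono powr_mono) (auto simp: jb_ge_1)

lemma sn_add: "sn \<alpha> (\<lambda>k. a k + b k) \<le> 2 * sn \<alpha> a + 2 * sn \<alpha> b"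
proof -
  have "(norm (a k + b k))\<^sup>2 \<le> 2 * (norm (a k))\<^sup>2 + 2 * (norm (b k))\<^sup>2" for k
  proof -
    have "(norm (a k + b k))\<^sup>2 \<le> (norm (a k) + norm (b k))\<^sup>2"
      by (intro power_mono norm_triangle_ineq) simp
    also have "\<dots> \<le> 2 * (norm (a k))\<^sup>2 + 2 * (norm (b k))\<^sup>2"
      using zero_le_power2[of "norm (a k) - norm (b k)"] by (simp add: power2_sum power2_diff)
    finally show ?thesis .
  qed
  then have "jb k powr (2 * \<alpha>) * (norm (a k + b k))\<^sup>2 \<le>
      2 * (jb k powr (2 * \<alpha>) * (norm (a k))\<^sup>2) + 2 * (jb k powr (2 * \<alpha>) * (norm (b k))\<^sup>2)" for k
    using mult_left_mono[of _ _ "jb k powr (2 * \<alpha>)"] by (fastforce simp: algebra_simps)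
  then have "sn \<alpha> (\<lambda>k. a k + b k) \<le>
      (\<integral>\<^sup>+k. 2 * ennreal (jb k powr (2 * \<alpha>) * (norm (a k))\<^sup>2) + 2 * ennreal (jb k powr (2 * \<alpha>) * (norm (b k))\<^sup>2) \<partial>cs)"
    unfolding sn_def
    by (intro nn_integral_mono) (simp add: ennreal_leI flip: ennreal_plus ennreal_mult' ennreal_numeral)
  also have "\<dots> = 2 * sn \<alpha> a + 2 * sn \<alpha> b"
    unfolding sn_def by (simp add: nn_integral_add nn_integral_cmult)
  finally show ?thesis .
qed

lemma sn_deriv: "sn \<alpha> (\<lambda>k. \<i> * of_real (freq k $ i) * c k) \<le> sn (\<alpha> + 1) c"
  unfolding sn_def
proof (intro nn_integral_mono ennreal_leI)
  fix k :: "int^'a"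
  have "\<bar>freq k $ i\<bar>\<^sup>2 \<le> (jb k)\<^sup>2"
    by (rule power_mono) (use order_trans[OF component_le_norm_cart norm_freq_le_jb] in auto)
  moreover have "jb k powr (2 * (\<alpha> + 1)) = jb k powr (2 * \<alpha>) * (jb k)\<^sup>2"
    by (simp add: distrib_left powr_add)
  ultimately show "jb k powr (2 * \<alpha>) * (norm (\<i> * of_real (freq k $ i) * c k))\<^sup>2 \<le>
      jb k powr (2 * (\<alpha> + 1)) * (norm (c k))\<^sup>2"
    by (simp add: norm_mult power_mult_distrib mult.assoc mult_left_mono mult_right_mono)
qed

text \<open>The d-th power of 1 + |k|^2 dominates the product of the factors 1 + k_i^2. The sum over
  the lattice is thus bounded by a product of one-dimensional sums with exponent p = \<alpha> / d >
  1/2, each compared with the series of n to the power -2p.\<close>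

lemma integrable_jb:
  assumes \<alpha>: "\<alpha> > real CARD('d::finite) / 2"
  shows "integrable cs (\<lambda>k :: int^'d. jb k powr (- 2 * \<alpha>))"
proof -
  define p where "p = \<alpha> / real CARD('d)"
  have p: "p > 1 / 2" using \<alpha> by (simp add: p_def field_simps)
  define h where "h j = (1 + (real_of_int j)\<^sup>2) powr (- p)" for j
  have h0: "h j \<ge> 0" for j by (simp add: h_def)
  have s: "summable (\<lambda>n. real n powr (- 2 * p))" using p by (simp add: summable_real_powr_iff)
  define C where "C = 1 + 2 * (\<Sum>n. real n powr (- 2 * p))"
  have hs: "h summable_on UNIV"
  proof (rule nonneg_bdd_above_summable_on)
    show "bdd_above (sum h ` {F. F \<subseteq> UNIV \<and> finite F})"
    proof (rule bdd_aboveI[of _ C], safe)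
      fix F :: "int set" assume F: "finite F"
      define n where "n = Max (insert 0 ((\<lambda>j. nat \<bar>j\<bar>) ` F))"
      have "nat \<bar>j\<bar> \<le> n" if "j \<in> F" for j unfolding n_def using F that by (intro Max_ge) auto
      then have sub: "F \<subseteq> {0} \<union> int ` {1..n} \<union> (\<lambda>m. - int m) ` {1..n}"
      proof (intro subsetI)
        fix j assume "j \<in> F" and *: "\<And>j. j \<in> F \<Longrightarrow> nat \<bar>j\<bar> \<le> n"
        show "j \<in> {0} \<union> int ` {1..n} \<union> (\<lambda>m. - int m) ` {1..n}"
        proof (cases "j = 0")
          case False
          then have "nat \<bar>j\<bar> \<in> {1..n}" using *[OF \<open>j \<in> F\<close>] by auto
          moreover have "j = int (nat \<bar>j\<bar>) \<or> j = - int (nat \<bar>j\<bar>)" by auto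
          ultimately show ?thesis by blast
        qed simp
      qed
      have hle: "h (int m) \<le> real m powr (- 2 * p)" "h (- int m) \<le> real m powr (- 2 * p)" if "m \<ge> 1" for m
      proof -
        have "(1 + (real m)\<^sup>2) powr (- p) \<le> ((real m)\<^sup>2) powr (- p)"
          by (rule powr_mono2') (use that p in auto)
        also have "\<dots> = real m powr (- 2 * p)"
          using that by (simp add: powr_powr flip: powr_numeral)
        finally show "h (int m) \<le> real m powr (- 2 * p)" "h (- int m) \<le> real m powr (- 2 * p)"
          by (simp_all add: h_def)
      qed
      have "sum h F \<le> sum h ({0} \<union> int ` {1..n} \<union> (\<lambda>m. - int m) ` {1..n})"
        by (rule sum_mono2) (use sub h0 in auto)
      also have "\<dots> \<le> sum h ({0} \<union> int ` {1..n}) + sum h ((\<lambda>m. - int m) ` {1..n})"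
        by (subst sum_Un) (auto intro!: sum_nonneg h0)
      also have "sum h ({0} \<union> int ` {1..n}) \<le> sum h {0} + sum h (int ` {1..n})"
        by (subst sum_Un) (auto intro!: sum_nonneg h0)
      also have "sum h (int ` {1..n}) = (\<Sum>m=1..n. h (int m))" by (subst sum.reindex) auto
      also have "\<dots> \<le> (\<Sum>m=1..n. real m powr (- 2 * p))" by (intro sum_mono hle) auto
      also have "\<dots> \<le> (\<Sum>n. real n powr (- 2 * p))" by (rule sum_le_suminf[OF s]) auto
      also have "sum h ((\<lambda>m. - int m) ` {1..n}) = (\<Sum>m=1..n. h (- int m))" by (subst sum.reindex) (auto simp: inj_on_def)
      also have "\<dots> \<le> (\<Sum>m=1..n. real m powr (- 2 * p))" by (intro sum_mono hle) auto
      also have "\<dots> \<le> (\<Sum>n. real n powr (- 2 * p))" by (rule sum_le_suminf[OF s]) auto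
      finally show "sum h F \<le> C" by (simp add: C_def h_def)
    qed
  qed (rule h0)
  then have "Infinite_Set_Sum.abs_summable_on h UNIV"
    using h0 by (simp flip: abs_summable_equivalent)
  then have "Infinite_Set_Sum.abs_summable_on (\<lambda>g. \<Prod>i\<in>(UNIV :: 'd set). h (g i)) (PiE UNIV (\<lambda>_. UNIV))"
    by (intro abs_summable_on_prod_PiE) auto
  moreover have "bij_betw (\<lambda>k :: int^'d. ($) k) UNIV (PiE UNIV (\<lambda>_. UNIV))"
    by (rule bij_betwI[where g = vec_lambda]) auto
  ultimately have "Infinite_Set_Sum.abs_summable_on (\<lambda>k :: int^'d. \<Prod>i\<in>UNIV. h (k $ i)) UNIV"
    by (subst abs_summable_on_reindex_bij_betw[where B = "PiE UNIV (\<lambda>_. UNIV)" and g = "\<lambda>k. ($) k"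
          and f = "\<lambda>g. \<Prod>i\<in>UNIV. h (g i)"])
  then have i: "integrable cs (\<lambda>k :: int^'d. \<Prod>i\<in>UNIV. h (k $ i))"
    by (simp add: abs_summable_on_def)
  show ?thesis
  proof (rule Bochner_Integration.integrable_bound[OF i])
    have "jb k powr (- 2 * \<alpha>) \<le> (\<Prod>i\<in>UNIV. h (k $ i))" for k :: "int^'d"
    proof -
      have P: "(\<Prod>i\<in>UNIV. 1 + (real_of_int (k $ i))\<^sup>2) > 0" by (intro prod_pos) (simp add: add_pos_nonneg)
      have "(\<Prod>i\<in>UNIV. 1 + (real_of_int (k $ i))\<^sup>2) \<le> (\<Prod>i\<in>(UNIV :: 'd set). (jb k)\<^sup>2)"
      proof (rule prod_mono, safe)
        fix i
        have "\<bar>freq k $ i\<bar>\<^sup>2 \<le> (norm (freq k))\<^sup>2" by (rule power_mono[OF component_le_norm_cart]) simp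
        then show "1 + (real_of_int (k $ i))\<^sup>2 \<le> (jb k)\<^sup>2" by (simp add: jb_sq freq_def)
      qed simp
      also have "\<dots> = jb k powr (2 * real CARD('d))"
        using powr_realpow[of "jb k" "2 * CARD('d)"] by (simp add: power_mult)
      finally have "(jb k powr (2 * real CARD('d))) powr (- p) \<le> (\<Prod>i\<in>UNIV. 1 + (real_of_int (k $ i))\<^sup>2) powr (- p)"
        by (intro powr_mono2') (use P p in auto)
      also have "(jb k powr (2 * real CARD('d))) powr (- p) = jb k powr (- 2 * \<alpha>)"
        by (simp add: powr_powr p_def)
      also have "(\<Prod>i\<in>UNIV. 1 + (real_of_int (k $ i))\<^sup>2) powr (- p) = (\<Prod>i\<in>UNIV. h (k $ i))"
        unfolding h_def by (rule prod_powr_distrib)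
      finally show ?thesis .
    qed
    then show "AE k :: int^'d in cs. norm (jb k powr (- 2 * \<alpha>)) \<le> norm (\<Prod>i\<in>UNIV. h (k $ i))"
      by (simp add: order_trans[OF _ abs_ge_self])
  qed simp
qed

text \<open>The square of the constant in the embedding of the Sobolev space of order \<alpha> into
  the summable sequences, see \<open>sn_l1\<close>.\<close>

definition Zc :: "real \<Rightarrow> 'd::finite itself \<Rightarrow> ennreal" where
  "Zc \<alpha> _ = (\<integral>\<^sup>+k. ennreal (jb (k :: int^'d) powr (- 2 * \<alpha>)) \<partial>cs)"

lemma Zc_finite: "\<alpha> > real CARD('d::finite) / 2 \<Longrightarrow> Zc \<alpha> TYPE('d) < \<infinity>"
  unfolding Zc_def using integrableD(2)[OF integrable_jb[where 'd='d]] by (simp add: less_top) 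

text \<open>Cauchy-Schwarz with the weight on one factor and its inverse on the other: the duality
  of the orders -\<alpha> and \<alpha>. Both sides are kept squared, so that no root of an extended
  number is taken.\<close>

lemma sn_pairing_bound:
  "(\<integral>\<^sup>+k. ennreal (norm (a k * b k)) \<partial>cs)\<^sup>2 \<le> sn (- \<alpha>) a * sn \<alpha> b"
proof -
  have *: "ennreal (norm (a k * b k)) = ennreal (jb k powr (- \<alpha>) * norm (a k)) * ennreal (jb k powr \<alpha> * norm (b k))" for k
    by (simp add: norm_mult powr_minus field_simps flip: ennreal_mult)
  have sq: "(ennreal (jb k powr \<gamma> * norm (c k)))\<^sup>2 = ennreal (jb k powr (2 * \<gamma>) * (norm (c k))\<^sup>2)" for \<gamma> and c :: "_ \<Rightarrow> complex" and k :: "int^'a"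
    by (simp add: ennreal_power power_mult_distrib jb_powr_sq)
  show ?thesis
    unfolding * using Cauchy_Schwarz_nn_integral[of "\<lambda>k. ennreal (jb k powr (- \<alpha>) * norm (a k))" cs "\<lambda>k. ennreal (jb k powr \<alpha> * norm (b k))"]
    by (simp add: sq sn_def)
qed

text \<open>The pairing bound applied to the constant sequence 1, whose squared norm of order
  -\<alpha> is \<open>Zc\<close>.\<close>

lemma sn_l1:
  fixes c :: "int^'d::finite \<Rightarrow> complex"
  shows "(\<integral>\<^sup>+k. ennreal (norm (c k)) \<partial>cs)\<^sup>2 \<le> Zc \<alpha> TYPE('d) * sn \<alpha> c"
  using sn_pairing_bound[of "\<lambda>k. 1" c \<alpha>] by (simp add: sn_def Zc_def)

lemma sn_integrable:
  fixes c :: "int^'d::finite \<Rightarrow> complex"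
  assumes \<alpha>: "\<alpha> > real CARD('d) / 2" and c: "sn \<alpha> c < \<infinity>"
  shows "integrable cs c"
proof (rule integrableI_bounded)
  have "(\<integral>\<^sup>+k. ennreal (norm (c k)) \<partial>cs)\<^sup>2 < \<infinity>"
    using sn_l1[of c \<alpha>] Zc_finite[OF \<alpha>] c by (simp add: ennreal_mult_less_top le_less_trans)
  then show "(\<integral>\<^sup>+k. ennreal (norm (c k)) \<partial>cs) < \<infinity>"
    by (rule ennreal_square_finite)
qed simp

lemma sn_deriv_integrable:
  fixes c :: "int^'d::finite \<Rightarrow> complex"
  assumes \<alpha>: "\<alpha> > real CARD('d) / 2" and c: "sn (\<alpha> + 1) c < \<infinity>"
  shows "integrable cs (\<lambda>k. of_real (norm (freq k)) * c k)"
proof (rule sn_integrable[OF \<alpha>])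
  have "sn \<alpha> (\<lambda>k. of_real (norm (freq k)) * c k) \<le> sn (\<alpha> + 1) c"
    unfolding sn_def
  proof (intro nn_integral_mono ennreal_leI)
    fix k :: "int^'d"
    have "(norm (freq k))\<^sup>2 \<le> (jb k)\<^sup>2" by (rule power_mono[OF norm_freq_le_jb]) simp
    moreover have "jb k powr (2 * (\<alpha> + 1)) = jb k powr (2 * \<alpha>) * (jb k)\<^sup>2"
      by (simp add: distrib_left powr_add)
    ultimately show "jb k powr (2 * \<alpha>) * (norm (of_real (norm (freq k)) * c k))\<^sup>2 \<le>
        jb k powr (2 * (\<alpha> + 1)) * (norm (c k))\<^sup>2"
      by (simp add: norm_mult power_mult_distrib mult.assoc mult_left_mono mult_right_mono)
  qed
  then show "sn \<alpha> (\<lambda>k. of_real (norm (freq k)) * c k) < \<infinity>" using c by (rule le_less_trans)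
qed

lemma ennreal_square_add: "((x :: ennreal) + y)\<^sup>2 \<le> 2 * x\<^sup>2 + 2 * y\<^sup>2"
proof (cases "x = \<infinity> \<or> y = \<infinity>")
  case True then show ?thesis by (auto simp: power2_eq_square ennreal_top_mult ennreal_mult_top)
next
  case False
  then obtain a b where ab: "x = ennreal a" "y = ennreal b" "a \<ge> 0" "b \<ge> 0"
    by (metis ennreal_cases infinity_ennreal_def)
  have "(a + b)\<^sup>2 \<le> 2 * a\<^sup>2 + 2 * b\<^sup>2"
    using zero_le_power2[of "a - b"] by (simp add: power2_sum power2_diff)
  then show ?thesis using ab
    by (simp add: ennreal_power ennreal_leI flip: ennreal_plus ennreal_mult' ennreal_numeral)
qed

text \<open>Young's inequality for the convolution of a square summable with a summable sequence,
  squared. Splitting \<open>R\<close> into two square roots lets Cauchy-Schwarz leave one full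
  factor of the sum of \<open>R\<close> outside.\<close>

lemma young:
  fixes P :: "int^'d::finite \<Rightarrow> real"
  assumes P: "\<And>k. P k \<ge> 0" and R: "\<And>k. R k \<ge> 0"
  shows "(\<integral>\<^sup>+k. (\<integral>\<^sup>+l. ennreal (P (k - l) * R l) \<partial>cs)\<^sup>2 \<partial>cs) \<le>
     (\<integral>\<^sup>+k. ennreal ((P k)\<^sup>2) \<partial>cs) * (\<integral>\<^sup>+k. ennreal (R k) \<partial>cs)\<^sup>2"
proof -
  have "(\<integral>\<^sup>+l. ennreal (P (k - l) * R l) \<partial>cs)\<^sup>2 \<le>
      (\<integral>\<^sup>+l. ennreal ((P (k - l))\<^sup>2 * R l) \<partial>cs) * (\<integral>\<^sup>+l. ennreal (R l) \<partial>cs)" for k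
  proof -
    have 1: "ennreal (P (k - l) * R l) = ennreal (P (k - l) * sqrt (R l)) * ennreal (sqrt (R l))" for l
      using P R by (simp add: mult.assoc flip: ennreal_mult)
    have 2: "(ennreal (P (k - l) * sqrt (R l)))\<^sup>2 = ennreal ((P (k - l))\<^sup>2 * R l)" "(ennreal (sqrt (R l)))\<^sup>2 = ennreal (R l)" for l
      using P R by (simp_all add: ennreal_power power_mult_distrib)
    show ?thesis unfolding 1
      by (rule order_trans[OF Cauchy_Schwarz_nn_integral]) (simp_all add: 2)
  qed
  then have "(\<integral>\<^sup>+k. (\<integral>\<^sup>+l. ennreal (P (k - l) * R l) \<partial>cs)\<^sup>2 \<partial>cs) \<le>
      (\<integral>\<^sup>+k. (\<integral>\<^sup>+l. ennreal ((P (k - l))\<^sup>2 * R l) \<partial>cs) * (\<integral>\<^sup>+l. ennreal (R l) \<partial>cs) \<partial>cs)"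
    by (intro nn_integral_mono)
  also have "\<dots> = (\<integral>\<^sup>+k. (\<integral>\<^sup>+l. ennreal ((P (k - l))\<^sup>2 * R l) \<partial>cs) \<partial>cs) * (\<integral>\<^sup>+l. ennreal (R l) \<partial>cs)"
    by (rule nn_integral_multc) simp
  also have "(\<integral>\<^sup>+k. (\<integral>\<^sup>+l. ennreal ((P (k - l))\<^sup>2 * R l) \<partial>cs) \<partial>cs) =
      (\<integral>\<^sup>+l. (\<integral>\<^sup>+k. ennreal ((P (k - l))\<^sup>2 * R l) \<partial>cs) \<partial>cs)"
    by (rule nn_integral_sum_swap[OF sigma_finite_cs]) simp
  also have "\<dots> = (\<integral>\<^sup>+l. (\<integral>\<^sup>+k. ennreal ((P k)\<^sup>2) \<partial>cs) * ennreal (R l) \<partial>cs)"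
  proof (rule nn_integral_cong)
    fix l :: "int^'d"
    have "(\<integral>\<^sup>+k. ennreal ((P (k - l))\<^sup>2 * R l) \<partial>cs) = (\<integral>\<^sup>+k. ennreal ((P (k - l))\<^sup>2) \<partial>cs) * ennreal (R l)"
      using R by (subst nn_integral_multc[symmetric]) (auto simp: ennreal_mult)
    also have "(\<integral>\<^sup>+k. ennreal ((P (k - l))\<^sup>2) \<partial>cs) = (\<integral>\<^sup>+k. ennreal ((P k)\<^sup>2) \<partial>cs)"
      by (rule nn_integral_bij_count_space[OF bij_shift])
    finally show "(\<integral>\<^sup>+k. ennreal ((P (k - l))\<^sup>2 * R l) \<partial>cs) = (\<integral>\<^sup>+k. ennreal ((P k)\<^sup>2) \<partial>cs) * ennreal (R l)" .
  qed
  also have "\<dots> = (\<integral>\<^sup>+k. ennreal ((P k)\<^sup>2) \<partial>cs) * (\<integral>\<^sup>+l. ennreal (R l) \<partial>cs)"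
    by (rule nn_integral_cmult) simp
  finally show ?thesis by (simp add: power2_eq_square mult.assoc)
qed

text \<open>The power of 2 stems from \<open>jb_powr_triangle\<close>; the 4 is the 2 of the squared
  sum, met once for each of the two factors that may carry the weight.\<close>

definition Calg :: "real \<Rightarrow> 'd::finite itself \<Rightarrow> ennreal" where
  "Calg \<alpha> d = 4 * ennreal ((2 powr \<alpha>)\<^sup>2) * Zc \<alpha> d"

lemma Calg_finite: "\<alpha> > real CARD('d::finite) / 2 \<Longrightarrow> Calg \<alpha> TYPE('d) < \<infinity>"
  unfolding Calg_def by (simp add: ennreal_mult_less_top Zc_finite[simplified])

text \<open>The weight is put on either factor of the product by \<open>jb_powr_triangle\<close>;
  the other factor is then summable by \<open>sn_l1\<close>, and Young's inequality applies to both
  terms.\<close>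

lemma sn_conv:
  fixes a b :: "int^'d::finite \<Rightarrow> complex"
  assumes \<alpha>: "\<alpha> \<ge> 0"
  shows "sn \<alpha> (conv a b) \<le> Calg \<alpha> TYPE('d) * (sn \<alpha> a * sn \<alpha> b)"
proof -
  define W where "W c k = jb k powr \<alpha> * norm (c k)" for c :: "int^'d \<Rightarrow> complex" and k
  have W0: "W c k \<ge> 0" for c k by (simp add: W_def)
  define z where "z = ennreal (2 powr \<alpha>)"
  have snW: "sn \<alpha> c = (\<integral>\<^sup>+k. ennreal ((W c k)\<^sup>2) \<partial>cs)" for c
    unfolding sn_def W_def by (simp add: power_mult_distrib jb_powr_sq)
  have reflect: "(\<integral>\<^sup>+l. f (k - l) l \<partial>cs) = (\<integral>\<^sup>+l. f l (k - l) \<partial>cs)" for f :: "_ \<Rightarrow> _ \<Rightarrow> ennreal" and k :: "int^'d"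
  proof -
    have "bij (\<lambda>l. k - l)" by (rule o_bij[of "\<lambda>l. k - l"]) (auto simp: o_def)
    from nn_integral_bij_count_space[OF this, of "\<lambda>l. f l (k - l)"] show ?thesis by simp
  qed
  define U where "U a b k = (\<integral>\<^sup>+l. ennreal (W a (k - l) * norm (b l)) \<partial>cs)" for a b :: "int^'d \<Rightarrow> complex" and k
  have le: "ennreal (W (conv a b) k) \<le> z * (U a b k + U b a k)" for k
  proof -
    have "ennreal (W (conv a b) k) \<le> (\<integral>\<^sup>+l. ennreal (jb k powr \<alpha> * (norm (a (k - l)) * norm (b l))) \<partial>cs)"
    proof (cases "integrable cs (\<lambda>l. a (k - l) * b l)")
      case True
      have "ennreal (W (conv a b) k) = ennreal (jb k powr \<alpha>) * ennreal (norm (conv a b k))"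
        by (simp add: W_def ennreal_mult)
      also have "ennreal (norm (conv a b k)) \<le> (\<integral>\<^sup>+l. norm (a (k - l) * b l) \<partial>cs)"
        unfolding conv_def by (rule integral_norm_bound_ennreal[OF True])
      also have "ennreal (jb k powr \<alpha>) * (\<integral>\<^sup>+l. norm (a (k - l) * b l) \<partial>cs) = 
          (\<integral>\<^sup>+l. ennreal (jb k powr \<alpha> * (norm (a (k - l)) * norm (b l))) \<partial>cs)"
        by (subst nn_integral_cmult[symmetric]) (auto simp: norm_mult ennreal_mult)
      finally show ?thesis by (simp add: mult_left_mono)
    next
      \<comment> \<open>A divergent series has Bochner integral 0, which satisfies any upper
        bound.\<close>
      case False then show ?thesis by (simp add: W_def conv_def not_integrable_integral_eq)
    qed
    also have "\<dots> \<le> (\<integral>\<^sup>+l. z * (ennreal (W a (k - l) * norm (b l)) + ennreal (W b l * norm (a (k - l)))) \<partial>cs)"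
    proof (intro nn_integral_mono)
      fix l
      have "jb k powr \<alpha> * (norm (a (k - l)) * norm (b l)) \<le>
         (2 powr \<alpha> * (jb (k - l) powr \<alpha> + jb l powr \<alpha>)) * (norm (a (k - l)) * norm (b l))"
        by (rule mult_right_mono[OF jb_powr_triangle[OF \<alpha>]]) simp
      also have "\<dots> = 2 powr \<alpha> * (W a (k - l) * norm (b l) + W b l * norm (a (k - l)))"
        by (simp add: W_def algebra_simps)
      finally show "ennreal (jb k powr \<alpha> * (norm (a (k - l)) * norm (b l))) \<le>
          z * (ennreal (W a (k - l) * norm (b l)) + ennreal (W b l * norm (a (k - l))))"
        unfolding z_def using W0 by (simp add: ennreal_leI flip: ennreal_plus ennreal_mult)
    qed
    also have "\<dots> = z * (U a b k + (\<integral>\<^sup>+l. ennreal (W b l * norm (a (k - l))) \<partial>cs))"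
      unfolding U_def by (simp add: nn_integral_cmult nn_integral_add)
    also have "(\<integral>\<^sup>+l. ennreal (W b l * norm (a (k - l))) \<partial>cs) = U b a k"
      unfolding U_def by (rule reflect[of "\<lambda>x y. ennreal (W b y * norm (a x))" k])
    finally show ?thesis .
  qed
  have "sn \<alpha> (conv a b) \<le> (\<integral>\<^sup>+k. z\<^sup>2 * (2 * (U a b k)\<^sup>2 + 2 * (U b a k)\<^sup>2) \<partial>cs)"
    unfolding snW
  proof (intro nn_integral_mono)
    fix k
    have "ennreal ((W (conv a b) k)\<^sup>2) = (ennreal (W (conv a b) k))\<^sup>2" by (simp add: ennreal_power W0)
    also have "\<dots> \<le> (z * (U a b k + U b a k))\<^sup>2" by (rule power_mono[OF le]) simp
    also have "\<dots> \<le> z\<^sup>2 * (2 * (U a b k)\<^sup>2 + 2 * (U b a k)\<^sup>2)"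
      unfolding power_mult_distrib by (rule mult_left_mono[OF ennreal_square_add]) simp
    finally show "ennreal ((W (conv a b) k)\<^sup>2) \<le> z\<^sup>2 * (2 * (U a b k)\<^sup>2 + 2 * (U b a k)\<^sup>2)" .
  qed
  also have "\<dots> = z\<^sup>2 * (2 * (\<integral>\<^sup>+k. (U a b k)\<^sup>2 \<partial>cs) + 2 * (\<integral>\<^sup>+k. (U b a k)\<^sup>2 \<partial>cs))"
    by (simp add: nn_integral_cmult nn_integral_add)
  also have "\<dots> \<le> z\<^sup>2 * (2 * (sn \<alpha> a * (Zc \<alpha> TYPE('d) * sn \<alpha> b)) + 2 * (sn \<alpha> b * (Zc \<alpha> TYPE('d) * sn \<alpha> a)))"
  proof -
    have "(\<integral>\<^sup>+k. (U a b k)\<^sup>2 \<partial>cs) \<le> sn \<alpha> a * (Zc \<alpha> TYPE('d) * sn \<alpha> b)" for a b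
      unfolding U_def
      by (rule order_trans[OF young]) (auto simp: W0 snW[symmetric] intro!: mult_left_mono sn_l1)
    then show ?thesis by (intro mult_left_mono add_mono) auto
  qed
  also have "\<dots> = Calg \<alpha> TYPE('d) * (sn \<alpha> a * sn \<alpha> b)"
  proof -
    define y where "y = Zc \<alpha> TYPE('d) * (sn \<alpha> a * sn \<alpha> b)"
    have y: "sn \<alpha> a * (Zc \<alpha> TYPE('d) * sn \<alpha> b) = y" "sn \<alpha> b * (Zc \<alpha> TYPE('d) * sn \<alpha> a) = y"
      by (simp_all add: y_def mult_ac)
    have "2 * y + 2 * y = 4 * y" using distrib_right[of 2 2 y] by simp
    then show ?thesis
      unfolding y by (simp add: Calg_def z_def ennreal_power y_def mult_ac)
  qed
  finally show ?thesis .
qed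

text \<open>A cube rather than a ball, to be finite at sight. It is symmetric about the origin, so
  that truncating Hermitian coefficients leaves them Hermitian.\<close>

definition kbox :: "nat \<Rightarrow> (int^'d::finite) set" where "kbox n = {k. \<forall>i. \<bar>k $ i\<bar> \<le> int n}"

lemma finite_kbox [simp]: "finite (kbox n :: (int^'d::finite) set)"
proof -
  have "(kbox n :: (int^'d) set) \<subseteq> vec_lambda ` (PiE UNIV (\<lambda>_. {- int n..int n}))"
  proof
    fix k :: "int^'d" assume "k \<in> kbox n"
    then show "k \<in> vec_lambda ` (PiE UNIV (\<lambda>_. {- int n..int n}))"
      by (intro image_eqI[of _ _ "($) k"]) (auto simp: kbox_def abs_le_iff minus_le_iff)
  qed
  then show ?thesis by (rule finite_subset) (auto intro!: finite_PiE)
qed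

lemma eventually_kbox: "eventually (\<lambda>n. k \<in> kbox n) sequentially"
proof -
  have "k \<in> kbox n" if "n \<ge> Max (range (\<lambda>i. nat \<bar>k $ i\<bar>))" for n
  proof -
    have "nat \<bar>k $ i\<bar> \<le> n" for i using that by (meson Max_ge finite finite_imageI order_trans rangeI)
    then show ?thesis unfolding kbox_def by (auto simp: nat_le_iff)
  qed
  then show ?thesis unfolding eventually_sequentially by blast
qed

lemma sn_tail:
  assumes "sn \<alpha> c < \<infinity>"
  shows "(\<lambda>n. sn \<alpha> (\<lambda>k. if k \<in> kbox n then 0 else c k)) \<longlonglongrightarrow> 0"
proof -
  have "(\<lambda>n. sn \<alpha> (\<lambda>k. if k \<in> kbox n then 0 else c k)) \<longlonglongrightarrow> integral\<^sup>N cs (\<lambda>k::int^'a. 0)"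
    unfolding sn_def
  proof (rule nn_integral_dominated_convergence[where w = "\<lambda>k. ennreal (jb k powr (2 * \<alpha>) * (norm (c k))\<^sup>2)"])
    show "AE k in cs. (\<lambda>n. ennreal (jb k powr (2 * \<alpha>) * (norm (if k \<in> kbox n then 0 else c k))\<^sup>2)) \<longlonglongrightarrow> 0"
    proof (rule AE_I2)
      fix k :: "int^'a"
      show "(\<lambda>n. ennreal (jb k powr (2 * \<alpha>) * (norm (if k \<in> kbox n then 0 else c k))\<^sup>2)) \<longlonglongrightarrow> 0"
        by (rule tendsto_eventually, rule eventually_mono[OF eventually_kbox[of k]]) simp
    qed
  qed (use assms in \<open>auto simp: sn_def\<close>)
  then show ?thesis by simp
qed

lemma l1_tail:
  fixes c :: "int^'d::finite \<Rightarrow> 'b::{banach,second_countable_topology}"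
  assumes "integrable cs c"
  shows "(\<lambda>n. \<integral>k. norm (if k \<in> kbox n then 0 else c k) \<partial>cs) \<longlonglongrightarrow> 0"
proof -
  have "(\<lambda>n. \<integral>k. norm (if k \<in> kbox n then 0 else c k) \<partial>cs) \<longlonglongrightarrow> integral\<^sup>L cs (\<lambda>k::int^'d. 0)"
  proof (rule integral_dominated_convergence[where w = "\<lambda>k. norm (c k)"])
    show "AE k in cs. (\<lambda>n. norm (if k \<in> kbox n then 0 else c k)) \<longlonglongrightarrow> 0"
    proof (rule AE_I2)
      fix k :: "int^'d"
      show "(\<lambda>n. norm (if k \<in> kbox n then 0 else c k)) \<longlonglongrightarrow> 0"
        by (rule tendsto_eventually, rule eventually_mono[OF eventually_kbox[of k]]) simp
    qed
  qed (use assms in auto)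
  then show ?thesis by simp
qed

lemma sum_kbox_tendsto:
  fixes c :: "int^'d::finite \<Rightarrow> 'b::{banach,second_countable_topology}"
  assumes "integrable cs c"
  shows "(\<lambda>n. \<Sum>k\<in>kbox n. c k) \<longlonglongrightarrow> (\<integral>k. c k \<partial>cs)"
proof -
  have eq: "(\<Sum>k\<in>kbox n. c k) = (\<integral>k. (if k \<in> kbox n then c k else 0) \<partial>cs)" for n
    by (subst integrable_cs_finite(2)[where A = "kbox n"]) auto
  show ?thesis unfolding eq
  proof (rule integral_dominated_convergence[where w = "\<lambda>k. norm (c k)"])
    show "AE k in cs. (\<lambda>n. (if k \<in> kbox n then c k else 0)) \<longlonglongrightarrow> c k"
    proof (rule AE_I2)
      fix k
      show "(\<lambda>n. (if k \<in> kbox n then c k else 0)) \<longlonglongrightarrow> c k"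
        by (rule tendsto_eventually, rule eventually_mono[OF eventually_kbox[of k]]) simp
    qed
  qed (use assms in auto)
qed

lemma sobolev_fser:
  fixes f :: "real^'d::finite \<Rightarrow> real"
  assumes "periodic f" "continuous_on UNIV f" "\<alpha> > real CARD('d) / 2" "sn \<alpha> (cf f) < \<infinity>"
  shows "fser (cf f) (\<lambda>x. of_real (f x))"
  by (rule fourier_inversion)
     (use assms sn_integrable in \<open>auto simp: periodic_def intro!: continuous_intros\<close>)

lemma pairing_integrable:
  assumes "sn (- \<alpha>) U < \<infinity>" "sn \<alpha> c < \<infinity>"
  shows "integrable cs (\<lambda>k. U k * c k)"
proof (rule integrableI_bounded)
  have "(\<integral>\<^sup>+k. ennreal (norm (U k * c k)) \<partial>cs)\<^sup>2 < \<infinity>"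
    using sn_pairing_bound[of U c \<alpha>] assms by (simp add: ennreal_mult_less_top le_less_trans)
  then show "(\<integral>\<^sup>+k. ennreal (norm (U k * c k)) \<partial>cs) < \<infinity>"
    by (rule ennreal_square_finite)
qed simp

text \<open>The volume in the unnormalised coefficient of \<open>g\<close> cancels the divisor in
  the definition. The infinite sum of the definition is an integral over \<open>cs\<close> because
  duality makes the series absolutely convergent.\<close>

lemma sobolev_pairing_eq:
  fixes g :: "real^'d::finite \<Rightarrow> real"
  assumes g: "integrable tm g" and u: "sn (- \<alpha>) (fourier_coeff u) < \<infinity>" and sg: "sn \<alpha> (cf g) < \<infinity>"
  shows "sobolev_pairing u g = Re (\<integral>k. fourier_coeff u k * cnj (cf g k) \<partial>cs)"
    and "integrable cs (\<lambda>k. fourier_coeff u k * cnj (cf g k))"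
proof -
  have "sn \<alpha> (\<lambda>k. cnj (cf g k)) < \<infinity>" using sg by (simp add: sn_def)
  from pairing_integrable[OF u this] show i: "integrable cs (\<lambda>k. fourier_coeff u k * cnj (cf g k))" .
  have eq: "Re (fourier_coeff u k * cnj (fourier_coeff (pairing g) k)) =
      vol TYPE('d) * Re (fourier_coeff u k * cnj (cf g k))" for k
    by (simp add: fourier_coeff_pairing[OF g] algebra_simps)
  have "integrable cs (\<lambda>k. vol TYPE('d) * Re (fourier_coeff u k * cnj (cf g k)))"
    by (rule integrable_mult_right[OF integrable_bounded_linear[OF bounded_linear_Re i]])
  then have "Infinite_Set_Sum.abs_summable_on (\<lambda>k. vol TYPE('d) * Re (fourier_coeff u k * cnj (cf g k))) UNIV"
    by (simp add: abs_summable_on_def)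
  from infsetsum_infsum[OF this]
  have "(\<Sum>\<^sub>\<infinity>k. Re (fourier_coeff u k * cnj (fourier_coeff (pairing g) k))) =
      (\<integral>k. vol TYPE('d) * Re (fourier_coeff u k * cnj (cf g k)) \<partial>cs)"
    unfolding eq by (simp add: infsetsum_def)
  also have "\<dots> = vol TYPE('d) * Re (\<integral>k. fourier_coeff u k * cnj (cf g k) \<partial>cs)"
    using integral_bounded_linear[OF bounded_linear_Re i] by simp
  finally show "sobolev_pairing u g = Re (\<integral>k. fourier_coeff u k * cnj (cf g k) \<partial>cs)"
    unfolding sobolev_pairing_def by (simp add: vol_def)
qed

section \<open>The kernel and the transport operator\<close>

lemma nn_integral_powr_finite:
  assumes p: "0 < p" "p < 1"
  shows "(\<integral>\<^sup>+t. ennreal (indicator {- pi..pi} t * \<bar>t\<bar> powr (- p)) \<partial>lborel) < \<infinity>"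
proof -
  define f where "f t = indicator {0..pi} t * \<bar>t\<bar> powr (- p)" for t :: real
  have "((\<lambda>t. t powr (- p)) has_integral (pi powr (- p + 1) / (- p + 1))) {0..pi}"
    by (rule has_integral_powr_from_0) (use p in auto)
  moreover have "f = (\<lambda>x. if x \<in> {0..pi} then x powr (- p) else 0)"
    by (auto simp: f_def)
  ultimately have "(f has_integral (pi powr (- p + 1) / (- p + 1))) UNIV"
    by (simp only: has_integral_restrict_UNIV)
  moreover have "f \<in> borel_measurable borel" "\<And>t. 0 \<le> f t" by (auto simp: f_def[abs_def])
  ultimately have f: "(\<integral>\<^sup>+t. ennreal (f t) \<partial>lborel) = ennreal (pi powr (- p + 1) / (- p + 1))"
    by (intro nn_integral_has_integral_lborel)
  have "(\<integral>\<^sup>+t. ennreal (indicator {- pi..pi} t * \<bar>t\<bar> powr (- p)) \<partial>lborel) \<le>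
      (\<integral>\<^sup>+t. ennreal (f t) + ennreal (f (- t)) \<partial>lborel)"
    by (intro nn_integral_mono) (auto simp: f_def indicator_def)
  also have "\<dots> = (\<integral>\<^sup>+t. ennreal (f t) \<partial>lborel) + (\<integral>\<^sup>+t. ennreal (f (- t)) \<partial>lborel)"
    by (rule nn_integral_add) (auto simp: f_def)
  also have "(\<integral>\<^sup>+t. ennreal (f (- t)) \<partial>lborel) = (\<integral>\<^sup>+t. ennreal (f t) \<partial>lborel)"
    using nn_integral_real_affine[of "\<lambda>t. ennreal (f t)" "-1" 0] by (simp add: f_def)
  finally show ?thesis unfolding f by (rule le_less_trans) simp
qed

text \<open>As \<open>0 powr a\<close> is 0, the bound of the singularity by a product over the
  coordinates fails where a coordinate vanishes; these hyperplanes are discarded as a null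
  set.\<close>

lemma AE_components_nonzero: "AE x in lborel. \<forall>i. (x :: real^'d::finite) $ i \<noteq> 0"
proof -
  have "AE x in lborel. (x :: real^'d) $ i \<noteq> 0" for i
  proof -
    have "{x :: real^'d. x $ i = 0} \<in> null_sets lebesgue"
      using negligible_standard_hyperplane_cart[where k = i] negligible_iff_null_sets by auto
    then have "{x :: real^'d. x $ i = 0} \<in> null_sets lborel"
      by (subst (asm) null_sets_completion_iff) auto
    then show ?thesis by (rule AE_I'[where N = "{x. x $ i = 0}"]) auto
  qed
  then show ?thesis by (simp add: AE_all_countable)
qed

text \<open>For \<open>d \<ge> 2\<close> the singularity \<open>1/|x|\<close> is integrable since \<open>|x|\<^sup>-\<^sup>1 \<le> \<Prod>\<^sub>i |x\<^sub>i|\<^sup>-\<^sup>1\<^sup>/\<^sup>d\<close>.\<close>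

lemma kernel_integrable:
  fixes K :: "real^'d::finite \<Rightarrow> real^'d"
  assumes dim: "CARD('d) \<ge> 2" and K: "K \<in> borel_measurable borel"
    and kernel: "bounded (range K) \<or> (\<exists>C. AE x in lborel. x \<in> torus \<longrightarrow> norm x * norm (K x) \<le> C)"
  shows "integrable tm K"
  using kernel
proof
  assume "bounded (range K)"
  then obtain C where "\<And>x. norm (K x) \<le> C" by (auto simp: bounded_iff)
  then show ?thesis by (rule integrable_tm_bounded[OF K])
next
  assume "\<exists>C. AE x in lborel. x \<in> torus \<longrightarrow> norm x * norm (K x) \<le> C"
  then obtain C0 where C0: "AE x in lborel. x \<in> torus \<longrightarrow> norm x * norm (K x) \<le> C0" ..
  define C where "C = max C0 0"
  have C: "AE x in lborel. x \<in> torus \<longrightarrow> norm x * norm (K x) \<le> C"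
    using C0 by eventually_elim (auto simp: C_def)
  have C_nonneg: "C \<ge> 0" by (simp add: C_def)
  define p where "p = 1 / real CARD('d)"
  have p: "0 < p" "p < 1" using dim by (auto simp: p_def)
  define g where "g t = indicator {- pi..pi} t * \<bar>t\<bar> powr (- p)" for t :: real
  have g0: "g t \<ge> 0" for t by (simp add: g_def)
  have gm [measurable]: "g \<in> borel_measurable borel" unfolding g_def by measurable
  have fin: "(\<integral>\<^sup>+x. (\<Prod>b\<in>Basis. ennreal (g ((x :: real^'d) \<bullet> b))) \<partial>lborel) < \<infinity>"
    using nn_integral_powr_finite[OF p]
    by (subst nn_integral_lborel_prod) (auto simp: g_def power_less_top_ennreal)
  have bound: "AE x in lborel. ennreal (indicator torus x * norm (K x)) \<le> ennreal C * (\<Prod>b\<in>Basis. ennreal (g (x \<bullet> b)))"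
    using C AE_components_nonzero
  proof eventually_elim
    fix x :: "real^'d"
    assume x: "x \<in> torus \<longrightarrow> norm x * norm (K x) \<le> C" and nz: "\<forall>i. x $ i \<noteq> 0"
    show "ennreal (indicator torus x * norm (K x)) \<le> ennreal C * (\<Prod>b\<in>Basis. ennreal (g (x \<bullet> b)))"
    proof (cases "x \<in> torus")
      case True
      have nzb: "x \<bullet> b \<noteq> 0" and inb: "x \<bullet> b \<in> {- pi..pi}" if "b \<in> Basis" for b
        using that nz True by (auto simp: Basis_vec_def inner_axis torus_def less_imp_le)
      have x0: "norm x > 0" using nz by (auto simp: vec_eq_iff)
      have "(\<Prod>b\<in>(Basis :: (real^'d) set). norm x powr (- p)) \<le> (\<Prod>b\<in>Basis. g (x \<bullet> b))"
      proof (rule prod_mono, safe)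
        fix b :: "real^'d" assume b: "b \<in> Basis"
        have "norm x powr (- p) \<le> \<bar>x \<bullet> b\<bar> powr (- p)"
          by (rule powr_mono2') (use p nzb[OF b] Basis_le_norm[OF b, of x] in auto)
        then show "norm x powr (- p) \<le> g (x \<bullet> b)" using inb[OF b] by (simp add: g_def)
      qed simp
      also have "(\<Prod>b\<in>(Basis :: (real^'d) set). norm x powr (- p)) = norm x powr (- p * real CARD('d))"
        using x0 by (simp add: powr_powr powr_realpow[symmetric])
      also have "\<dots> = 1 / norm x" using x0 by (simp add: p_def powr_minus_divide)
      finally have "C * (1 / norm x) \<le> C * (\<Prod>b\<in>Basis. g (x \<bullet> b))"
        by (rule mult_left_mono[OF _ C_nonneg])
      moreover have "norm (K x) \<le> C * (1 / norm x)" using x True x0 by (simp add: field_simps)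
      ultimately have "norm (K x) \<le> C * (\<Prod>b\<in>Basis. g (x \<bullet> b))" by simp
      then show ?thesis using True C_nonneg
        by (simp add: prod_ennreal g0 ennreal_leI prod_nonneg flip: ennreal_mult)
    qed simp
  qed
  show ?thesis
  proof (rule integrableI_bounded)
    show "K \<in> borel_measurable tm" using K by (rule borel_tm)
    have "(\<integral>\<^sup>+x. ennreal (norm (K x)) \<partial>tm) = (\<integral>\<^sup>+x. ennreal (indicator torus x * norm (K x)) \<partial>lborel)"
      unfolding nn_integral_tm by (intro nn_integral_cong) (auto simp: indicator_def)
    also have "\<dots> \<le> (\<integral>\<^sup>+x. ennreal C * (\<Prod>b\<in>Basis. ennreal (g ((x :: real^'d) \<bullet> b))) \<partial>lborel)"
      by (rule nn_integral_mono_AE[OF bound])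
    also have "\<dots> = ennreal C * (\<integral>\<^sup>+x. (\<Prod>b\<in>Basis. ennreal (g ((x :: real^'d) \<bullet> b))) \<partial>lborel)"
      by (rule nn_integral_cmult) measurable
    also have "\<dots> < \<infinity>" using fin by (simp add: ennreal_mult_less_top)
    finally show "(\<integral>\<^sup>+x. ennreal (norm (K x)) \<partial>tm) < \<infinity>" .
  qed
qed

text \<open>Not normalised, in contrast to \<open>fc\<close>: in this form it is the multiplier by
  which convolution acts on normalised coefficients.\<close>

definition khat :: "(real^'d::finite \<Rightarrow> complex) \<Rightarrow> int^'d \<Rightarrow> complex" where
  "khat M k = (\<integral>z. M z * ch (- k) z \<partial>tm)"

lemma norm_khat: "norm (khat M k) \<le> (\<integral>z. norm (M z) \<partial>tm)"
  unfolding khat_def using integral_norm_bound[of tm "\<lambda>z. M z * ch (- k) z"] by (simp add: norm_mult)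

text \<open>An integrable kernel acts on an absolutely convergent series as a bounded multiplier.
  The kernel itself may be singular; no Fourier series of it is ever summed.\<close>

lemma fser_kernel:
  fixes M :: "real^'d::finite \<Rightarrow> complex"
  assumes M: "M \<in> borel_measurable borel" "periodic M" "integrable tm M" and F: "fser c F"
  shows "fser (\<lambda>k. khat M k * c k) (\<lambda>x. \<integral>y. F y * M (x - y) \<partial>tm)"
proof -
  have ci: "integrable cs c" using F by (simp add: fser_def)
  have "integrable cs (\<lambda>k. khat M k * c k)"
  proof (rule Bochner_Integration.integrable_bound[OF integrable_mult_right[OF ci, of "of_real (\<integral>z. norm (M z) \<partial>tm)"]])
    show "AE k in cs. norm (khat M k * c k) \<le> norm (of_real (\<integral>z. norm (M z) \<partial>tm) * c k)"
      by (rule AE_I2) (simp add: norm_mult mult_right_mono norm_khat order_trans[OF norm_khat abs_ge_self])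
  qed simp
  moreover have "(\<integral>y. F y * M (x - y) \<partial>tm) = (\<integral>k. khat M k * c k * ch k x \<partial>cs)" for x
  proof -
    have mx: "(\<lambda>y. M (x - y)) \<in> borel_measurable borel" by (rule measurable_compose[OF _ M(1)]) simp
    have Mx: "integrable tm (\<lambda>y. M (x - y))" using integrable_tm_reflect[OF M(1,2), of x] M(3) by simp
    have "(\<integral>y. F y * M (x - y) \<partial>tm) = (\<integral>y. (\<integral>k. c k * ch k y * M (x - y) \<partial>cs) \<partial>tm)"
      using F by (intro Bochner_Integration.integral_cong) (auto simp: fser_def integrable_ch)
    also have "\<dots> = (\<integral>k. (\<integral>y. c k * ch k y * M (x - y) \<partial>tm) \<partial>cs)"
    proof (rule integral_sum_swap)
      show "sigma_finite_measure (tm :: (real^'d) measure)" by (rule tm.sigma_finite_measure_axioms)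
      show "(\<lambda>y. c k * ch k y * M (x - y)) \<in> borel_measurable tm" for k
        using mx by (intro borel_tm) measurable
      have "(\<integral>\<^sup>+y. ennreal (norm (c k * ch k y * M (x - y))) \<partial>tm) = ennreal (norm (c k)) * (\<integral>\<^sup>+y. ennreal (norm (M (x - y))) \<partial>tm)" for k
        using mx
        by (subst nn_integral_cmult[symmetric]) (auto simp: norm_mult ennreal_mult intro!: borel_tm)
      then have "(\<integral>\<^sup>+k. (\<integral>\<^sup>+y. ennreal (norm (c k * ch k y * M (x - y))) \<partial>tm) \<partial>cs) =
          (\<integral>\<^sup>+k. ennreal (norm (c k)) \<partial>cs) * (\<integral>\<^sup>+y. ennreal (norm (M (x - y))) \<partial>tm)"
        by (simp add: nn_integral_multc)
      also have "\<dots> < \<infinity>"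
        using ci Mx unfolding integrable_iff_bounded by (simp add: ennreal_mult_less_top)
      finally show "(\<integral>\<^sup>+k. (\<integral>\<^sup>+y. ennreal (norm (c k * ch k y * M (x - y))) \<partial>tm) \<partial>cs) < \<infinity>" .
    qed
    also have "\<dots> = (\<integral>k. khat M k * c k * ch k x \<partial>cs)"
    proof (rule Bochner_Integration.integral_cong)
      fix k :: "int^'d"
      \<comment> \<open>Splitting off the character at x leaves a periodic function of x - y, whose
        integral no longer depends on x.\<close>
      define G where "G z = M z * ch (- k) z" for z
      have "c k * ch k y * M (x - y) = c k * ch k x * G (x - y)" for y
        by (simp add: G_def ch_sub ch_minus) (simp add: ch_cnj_mult(1) mult.assoc[symmetric] mult.commute)?
      then have "(\<integral>y. c k * ch k y * M (x - y) \<partial>tm) = c k * ch k x * (\<integral>y. G (x - y) \<partial>tm)"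
        by (simp only: integral_mult_right_zero)
      also have "(\<integral>y. G (x - y) \<partial>tm) = khat M k"
      proof -
        have "(\<integral>y. G (x - y) \<partial>tm) = (\<integral>y. G y \<partial>tm)"
          by (rule integral_tm_reflect)
             (use M(1,2) periodic_ch[of "- k"] in \<open>auto simp: G_def[abs_def] periodic_def\<close>)
        then show ?thesis by (simp add: G_def khat_def)
      qed
      finally show "(\<integral>y. c k * ch k y * M (x - y) \<partial>tm) = khat M k * c k * ch k x" by (simp add: mult_ac)
    qed simp
    finally show ?thesis .
  qed
  ultimately show ?thesis by (simp add: fser_def)
qed

definition dcf :: "'d \<Rightarrow> (int^'d::finite \<Rightarrow> complex) \<Rightarrow> int^'d \<Rightarrow> complex" where
  "dcf i c k = \<i> * of_real (freq k $ i) * c k"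

text \<open>The Fourier coefficients of the transport operator, in terms of those of the density and of
  the function it is applied to.\<close>

definition tr :: "(real^'d::finite \<Rightarrow> real^'d) \<Rightarrow> (real^'d \<Rightarrow> real^'d) \<Rightarrow>
    (int^'d \<Rightarrow> complex) \<Rightarrow> (int^'d \<Rightarrow> complex) \<Rightarrow> int^'d \<Rightarrow> complex" where
  "tr K F r c k = (\<Sum>i\<in>UNIV. conv (\<lambda>k. khat (\<lambda>z. of_real (K z $ i)) k * r k) (dcf i c) k
     + khat (\<lambda>z. of_real (K (- z) $ i)) k * conv r (dcf i c) k
     + conv (cf (\<lambda>x. F x $ i)) (dcf i c) k)"

text \<open>Both alternatives for the kernel yield integrability over one period; this is the form
  in which the kernel enters the multiplier bounds.\<close>

locale kernel =
  fixes K :: "real^'d::finite \<Rightarrow> real^'d"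
  assumes K_borel: "K \<in> borel_measurable borel" and K_periodic: "periodic K"
    and K_integrable: "integrable tm K"
begin

definition \<kappa> :: real where "\<kappa> = (\<integral>z. norm (K z) \<partial>tm)"

lemma K_component:
  "(\<lambda>z. complex_of_real (K z $ i)) \<in> borel_measurable borel" "periodic (\<lambda>z. complex_of_real (K z $ i))"
  "integrable tm (\<lambda>z. complex_of_real (K z $ i))"
  "(\<lambda>z. complex_of_real (K (- z) $ i)) \<in> borel_measurable borel" "periodic (\<lambda>z. complex_of_real (K (- z) $ i))"
  "integrable tm (\<lambda>z. complex_of_real (K (- z) $ i))"
proof -
  have m: "(\<lambda>z. K z $ i) \<in> borel_measurable borel"
    by (rule measurable_compose[OF K_borel]) simp
  show "(\<lambda>z. complex_of_real (K z $ i)) \<in> borel_measurable borel" using m by measurable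
  show "(\<lambda>z. complex_of_real (K (- z) $ i)) \<in> borel_measurable borel"
    using measurable_compose[OF borel_measurable_uminus[OF measurable_ident_sets[OF refl]] m] by simp
  show p1: "periodic (\<lambda>z. complex_of_real (K z $ i))" using K_periodic by (simp add: periodic_def)
  show "periodic (\<lambda>z. complex_of_real (K (- z) $ i))"
    unfolding periodic_def
  proof (intro allI)
    fix x :: "real^'d" and j
    show "complex_of_real (K (- (x + axis j (2 * pi))) $ i) = complex_of_real (K (- x) $ i)"
      using K_periodic[unfolded periodic_def, rule_format, of "- x - axis j (2 * pi)" j] by simp
  qed
  show i1: "integrable tm (\<lambda>z. complex_of_real (K z $ i))"
    using integrable_bounded_linear[OF bounded_linear_vec_nth[of i] K_integrable] by simp
  show "integrable tm (\<lambda>z. complex_of_real (K (- z) $ i))"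
    using integrable_tm_reflect[OF \<open>(\<lambda>z. complex_of_real (K z $ i)) \<in> borel_measurable borel\<close> p1, of 0] i1 by simp
qed

lemma K_reflect: "integrable tm (\<lambda>y. K (x - y))" "integrable tm (\<lambda>y. K (y - x))"
  using integrable_tm_reflect[OF K_borel K_periodic, of x] integrable_tm_shift[OF K_borel K_periodic, of "- x"] K_integrable
  by simp_all

lemma integral_norm_K_reflect: "(\<integral>z. norm (K (- z)) \<partial>tm) = \<kappa>"
proof -
  have "(\<lambda>z. norm (K z)) \<in> borel_measurable borel" using K_borel by measurable
  moreover have "periodic (\<lambda>z. norm (K z))" using K_periodic by (simp add: periodic_def)
  ultimately show ?thesis using integral_tm_reflect[of "\<lambda>z. norm (K z)" 0] by (simp add: \<kappa>_def)
qed

lemma norm_khat_le: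
  "norm (khat (\<lambda>z. complex_of_real (K z $ i)) k) \<le> \<kappa>"
  "norm (khat (\<lambda>z. complex_of_real (K (- z) $ i)) k) \<le> \<kappa>"
proof -
  have "(\<integral>z. norm (complex_of_real (K z $ i)) \<partial>tm) \<le> \<kappa>" unfolding \<kappa>_def
    by (rule integral_mono) (use integrable_norm[OF K_component(3)[of i]] K_integrable in \<open>auto simp: component_le_norm_cart\<close>)
  then show "norm (khat (\<lambda>z. complex_of_real (K z $ i)) k) \<le> \<kappa>" using norm_khat[of "\<lambda>z. complex_of_real (K z $ i)" k] by linarith
  have "(\<integral>z. norm (complex_of_real (K (- z) $ i)) \<partial>tm) \<le> (\<integral>z. norm (K (- z)) \<partial>tm)"
    by (rule integral_mono) (use integrable_norm[OF K_component(6)[of i]] K_reflect(1)[of 0] in \<open>auto simp: component_le_norm_cart\<close>)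
  then show "norm (khat (\<lambda>z. complex_of_real (K (- z) $ i)) k) \<le> \<kappa>"
    using norm_khat[of "\<lambda>z. complex_of_real (K (- z) $ i)" k] integral_norm_K_reflect by linarith
qed

lemma integrable_bounded_K:
  fixes g :: "real^'d \<Rightarrow> real"
  assumes "fser c (\<lambda>x. of_real (g x))"
  shows "integrable tm (\<lambda>y. g y *\<^sub>R K (x - y))" "integrable tm (\<lambda>y. g y * K (y - x) $ i)"
proof -
  have m: "g \<in> borel_measurable borel"
    using measurable_compose[OF fser_borel[OF assms], of Re borel] by simp
  have b: "\<bar>g y\<bar> \<le> (\<integral>k. norm (c k) \<partial>cs)" for y using fser_bound[OF assms, of y] by simp
  show "integrable tm (\<lambda>y. g y *\<^sub>R K (x - y))"
  proof (rule Bochner_Integration.integrable_bound[OF integrable_scaleR_right[OF K_reflect(1)[of x], of "\<integral>k. norm (c k) \<partial>cs"]])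
    show "(\<lambda>y. g y *\<^sub>R K (x - y)) \<in> borel_measurable tm"
      using K_reflect(1)[of x] borel_tm[OF m] by measurable
    show "AE y in tm. norm (g y *\<^sub>R K (x - y)) \<le> norm ((\<integral>k. norm (c k) \<partial>cs) *\<^sub>R K (x - y))"
      by (rule AE_I2) (simp add: mult_right_mono[OF b])
  qed
  have i: "integrable tm (\<lambda>y. K (y - x) $ i)"
    using integrable_bounded_linear[OF bounded_linear_vec_nth[of i] K_reflect(2)[of x]] .
  show "integrable tm (\<lambda>y. g y * K (y - x) $ i)"
  proof (rule Bochner_Integration.integrable_bound[OF integrable_mult_right[OF i, of "\<integral>k. norm (c k) \<partial>cs"]])
    show "(\<lambda>y. g y * K (y - x) $ i) \<in> borel_measurable tm"
      using i borel_tm[OF m] by measurable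
    show "AE y in tm. norm (g y * K (y - x) $ i) \<le> norm ((\<integral>k. norm (c k) \<partial>cs) * K (y - x) $ i)"
      by (rule AE_I2) (simp add: abs_mult mult_right_mono[OF b])
  qed
qed

lemma fser_convolution:
  assumes r: "fser r (\<lambda>x. of_real (\<rho> x))"
  shows "fser (\<lambda>k. khat (\<lambda>z. of_real (K z $ i)) k * r k) (\<lambda>x. of_real (convolution K \<rho> x $ i))"
proof -
  have "complex_of_real (convolution K \<rho> x $ i) = (\<integral>y. of_real (\<rho> y) * of_real (K (x - y) $ i) \<partial>tm)" for x
  proof -
    have "convolution K \<rho> x $ i = (\<integral>y. (\<rho> y *\<^sub>R K (x - y)) $ i \<partial>tm)"
      unfolding convolution_def integral_tm
      by (rule integral_bounded_linear[OF bounded_linear_vec_nth integrable_bounded_K(1)[OF r], symmetric])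
    then show ?thesis by (simp flip: integral_complex_of_real)
  qed
  then show ?thesis using fser_kernel[OF K_component(1,2,3) r, of i] by simp
qed

lemma fser_reflected_convolution:
  assumes g: "\<And>i. fser (b i) (\<lambda>x. of_real (g x $ i))"
  shows "fser (\<lambda>k. \<Sum>i\<in>UNIV. khat (\<lambda>z. of_real (K (- z) $ i)) k * b i k)
    (\<lambda>x. of_real (reflected_convolution K g x))"
proof -
  have "complex_of_real (reflected_convolution K g x) =
      (\<Sum>i\<in>UNIV. \<integral>y. of_real (g y $ i) * of_real (K (- (x - y)) $ i) \<partial>tm)" for x
  proof -
    have "reflected_convolution K g x = (\<integral>y. (\<Sum>i\<in>UNIV. g y $ i * K (y - x) $ i) \<partial>tm)"
      unfolding reflected_convolution_def integral_tm by (simp add: inner_vec_def mult.commute)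
    also have "\<dots> = (\<Sum>i\<in>UNIV. \<integral>y. g y $ i * K (y - x) $ i \<partial>tm)"
      by (rule Bochner_Integration.integral_sum) (rule integrable_bounded_K(2)[OF g])
    finally show ?thesis by (simp flip: integral_complex_of_real)
  qed
  moreover have "fser (\<lambda>k. \<Sum>i\<in>UNIV. khat (\<lambda>z. of_real (K (- z) $ i)) k * b i k)
      (\<lambda>x. \<Sum>i\<in>UNIV. \<integral>y. of_real (g y $ i) * of_real (K (- (x - y)) $ i) \<partial>tm)"
    by (rule fser_sum) (rule fser_kernel[OF K_component(4,5,6) g])
  ultimately show ?thesis by simp
qed

lemma fser_dual_transport:
  assumes r: "fser r (\<lambda>x. of_real (\<rho> x))"
    and F: "\<And>i. fser (cf (\<lambda>x. F x $ i)) (\<lambda>x. of_real (F x $ i))"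
    and f: "fser c (\<lambda>x. of_real (f x))" "integrable cs (\<lambda>k. of_real (norm (freq k)) * c k)"
  shows "fser (tr K F r c) (\<lambda>x. of_real (dual_transport K F \<rho> f x))"
proof -
  have d: "fser (dcf i c) (\<lambda>x. of_real (grad f x $ i))" for i
    using fser_partial(2)[OF f, of i] by (simp add: grad_def dcf_def[abs_def])
  have e: "fser (conv r (dcf i c)) (\<lambda>x. of_real ((\<rho> x *\<^sub>R grad f x) $ i))" for i
    using fser_mult[OF r d] by simp
  have "fser (\<lambda>k. (\<Sum>i\<in>UNIV. conv (\<lambda>k. khat (\<lambda>z. of_real (K z $ i)) k * r k) (dcf i c) k)
        + (\<Sum>i\<in>UNIV. khat (\<lambda>z. of_real (K (- z) $ i)) k * conv r (dcf i c) k)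
        + (\<Sum>i\<in>UNIV. conv (cf (\<lambda>x. F x $ i)) (dcf i c) k))
      (\<lambda>x. (\<Sum>i\<in>UNIV. of_real (convolution K \<rho> x $ i) * of_real (grad f x $ i))
        + of_real (reflected_convolution K (\<lambda>y. \<rho> y *\<^sub>R grad f y) x)
        + (\<Sum>i\<in>UNIV. of_real (F x $ i) * of_real (grad f x $ i)))"
    by (intro fser_add fser_sum fser_mult fser_convolution fser_reflected_convolution r F d e)
  then show ?thesis
    by (simp add: tr_def[abs_def] dual_transport_def inner_vec_def sum.distrib)
qed

end

section \<open>Boundedness and linearity of the transport operator on coefficients\<close>

lemma sn_sum:
  assumes "\<And>i. i \<in> A \<Longrightarrow> sn \<alpha> (a i) \<le> B"
  shows "sn \<alpha> (\<lambda>k. \<Sum>i\<in>A. a i k) \<le> ennreal ((real (card A))\<^sup>2) * B"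
proof (cases "finite A")
  case True
  have "sn \<alpha> (\<lambda>k. \<Sum>i\<in>A. a i k) \<le> (\<integral>\<^sup>+k. ennreal (card A) * (\<Sum>i\<in>A. ennreal (jb k powr (2 * \<alpha>) * (norm (a i k))\<^sup>2)) \<partial>cs)"
    unfolding sn_def
  proof (intro nn_integral_mono)
    fix k
    have "(norm (\<Sum>i\<in>A. a i k))\<^sup>2 \<le> (\<Sum>i\<in>A. norm (a i k))\<^sup>2"
      by (rule power_mono[OF norm_sum]) simp
    also have "\<dots> \<le> (\<Sum>i\<in>A. (norm (a i k))\<^sup>2) * real (card A)" by (rule sum_squared_le_sum_of_squares)
    finally have "jb k powr (2 * \<alpha>) * (norm (\<Sum>i\<in>A. a i k))\<^sup>2 \<le> jb k powr (2 * \<alpha>) * ((\<Sum>i\<in>A. (norm (a i k))\<^sup>2) * real (card A))"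
      by (rule mult_left_mono) simp
    also have "\<dots> = real (card A) * (\<Sum>i\<in>A. jb k powr (2 * \<alpha>) * (norm (a i k))\<^sup>2)"
      by (simp add: sum_distrib_left mult_ac)
    finally show "ennreal (jb k powr (2 * \<alpha>) * (norm (\<Sum>i\<in>A. a i k))\<^sup>2) \<le>
        ennreal (card A) * (\<Sum>i\<in>A. ennreal (jb k powr (2 * \<alpha>) * (norm (a i k))\<^sup>2))"
      by (simp add: sum_nonneg ennreal_leI flip: ennreal_mult)
  qed
  also have "\<dots> = ennreal (card A) * (\<Sum>i\<in>A. sn \<alpha> (a i))"
    unfolding sn_def by (simp add: nn_integral_cmult nn_integral_sum del: sum_ennreal)
  also have "\<dots> \<le> ennreal (card A) * (\<Sum>i\<in>A. B)"
    by (intro mult_left_mono sum_mono assms) auto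
  also have "\<dots> = ennreal ((real (card A))\<^sup>2) * B"
    by (simp add: ennreal_of_nat_eq_real_of_nat power2_eq_square ennreal_mult mult.assoc)
  finally show ?thesis .
next
  case False then show ?thesis by (simp add: sn_def)
qed

lemma sn_mult_bounded:
  assumes "\<And>k. norm (m k) \<le> C"
  shows "sn \<alpha> (\<lambda>k. m k * c k) \<le> ennreal (C\<^sup>2) * sn \<alpha> c"
proof -
  have C: "C \<ge> 0" using assms[of 0] norm_ge_zero order_trans by blast
  have "sn \<alpha> (\<lambda>k. m k * c k) \<le> sn \<alpha> (\<lambda>k. of_real C * c k)"
    by (rule sn_mono) (simp add: norm_mult mult_right_mono assms C)
  also have "\<dots> = ennreal (C\<^sup>2) * sn \<alpha> c" by (simp add: sn_cmult)
  finally show ?thesis .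
qed

text \<open>One derivative is spent on the gradient. The kernel multipliers are bounded by
  \<open>\<kappa>\<close>, and the remaining products are estimated in the algebra of order
  \<alpha>. The factors 2 come from \<open>sn_add\<close>, the squared dimension from the sum over
  the coordinates.\<close>

lemma (in kernel) sn_tr:
  fixes F :: "real^'d \<Rightarrow> real^'d"
  assumes \<alpha>: "\<alpha> > real CARD('d) / 2"
    and r: "sn \<alpha> r \<le> R" and F: "\<And>i. sn \<alpha> (cf (\<lambda>x. F x $ i)) \<le> R"
  shows "sn \<alpha> (tr K F r c) \<le>
    ennreal ((real CARD('d))\<^sup>2) * (2 * (2 * (Calg \<alpha> TYPE('d) * (ennreal (\<kappa>\<^sup>2) * R)) + 2 * (ennreal (\<kappa>\<^sup>2) * (Calg \<alpha> TYPE('d) * R)))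
      + 2 * (Calg \<alpha> TYPE('d) * R)) * sn (\<alpha> + 1) c"
proof -
  have \<alpha>0: "\<alpha> \<ge> 0" using \<alpha> by (meson divide_nonneg_nonneg less_imp_le of_nat_0_le_iff order_trans zero_le_numeral)
  have d: "sn \<alpha> (dcf i c) \<le> sn (\<alpha> + 1) c" for i
    unfolding dcf_def[abs_def] by (rule sn_deriv)
  let ?S = "sn (\<alpha> + 1) c" and ?C = "Calg \<alpha> TYPE('d)"
  have cv: "sn \<alpha> (conv a (dcf i c)) \<le> ?C * B * ?S" if "sn \<alpha> a \<le> B" for a B i
    by (rule order_trans[OF sn_conv[OF \<alpha>0]]) (auto simp: mult.assoc intro!: mult_left_mono mult_mono that d)
  have t1: "sn \<alpha> (conv (\<lambda>k. khat (\<lambda>z. of_real (K z $ i)) k * r k) (dcf i c)) \<le> ?C * (ennreal (\<kappa>\<^sup>2) * R) * ?S" for i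
    by (rule cv, rule order_trans[OF sn_mult_bounded[OF norm_khat_le(1)]]) (auto intro!: mult_left_mono r)
  have t2: "sn \<alpha> (\<lambda>k. khat (\<lambda>z. of_real (K (- z) $ i)) k * conv r (dcf i c) k) \<le> ennreal (\<kappa>\<^sup>2) * (?C * R) * ?S" for i
    by (rule order_trans[OF sn_mult_bounded[OF norm_khat_le(2)]]) (auto simp: mult.assoc[of "ennreal _"] intro!: mult_left_mono cv r)
  have t3: "sn \<alpha> (conv (cf (\<lambda>x. F x $ i)) (dcf i c)) \<le> ?C * R * ?S" for i
    by (rule cv[OF F])
  let ?B = "(2 * (2 * (?C * (ennreal (\<kappa>\<^sup>2) * R)) + 2 * (ennreal (\<kappa>\<^sup>2) * (?C * R))) + 2 * (?C * R)) * ?S"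
  have "sn \<alpha> (\<lambda>k. conv (\<lambda>k. khat (\<lambda>z. of_real (K z $ i)) k * r k) (dcf i c) k
     + khat (\<lambda>z. of_real (K (- z) $ i)) k * conv r (dcf i c) k
     + conv (cf (\<lambda>x. F x $ i)) (dcf i c) k) \<le> 2 * (2 * (?C * (ennreal (\<kappa>\<^sup>2) * R) * ?S) + 2 * (ennreal (\<kappa>\<^sup>2) * (?C * R) * ?S)) + 2 * (?C * R * ?S)" for i
    by (rule order_trans[OF sn_add] add_mono mult_left_mono t1 t2 t3 zero_le)+
  also have "\<dots> = ?B" by (simp add: distrib_left distrib_right mult.assoc)
  finally have "sn \<alpha> (tr K F r c) \<le> ennreal ((real CARD('d))\<^sup>2) * ?B"
    unfolding tr_def[abs_def] by (intro sn_sum)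
  then show ?thesis by (simp add: mult.assoc)
qed

text \<open>The same bound with one real constant for all densities of norm at most
  \<open>R\<close>, which later gives an estimate uniform in time.\<close>

lemma (in kernel) sn_tr_bound:
  fixes F :: "real^'d \<Rightarrow> real^'d"
  assumes \<alpha>: "\<alpha> > real CARD('d) / 2" and R: "R < \<infinity>"
  obtains C where "C \<ge> 0" "\<And>r c. sn \<alpha> r \<le> R \<Longrightarrow> (\<And>i. sn \<alpha> (cf (\<lambda>x. F x $ i)) \<le> R) \<Longrightarrow>
    sn \<alpha> (tr K F r c) \<le> ennreal C * sn (\<alpha> + 1) c"
proof -
  let ?C = "Calg \<alpha> TYPE('d)"
  let ?X = "ennreal ((real CARD('d))\<^sup>2) * (2 * (2 * (?C * (ennreal (\<kappa>\<^sup>2) * R)) + 2 * (ennreal (\<kappa>\<^sup>2) * (?C * R))) + 2 * (?C * R))"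
  have "?X < \<infinity>" using R Calg_finite[OF \<alpha>] by (simp add: ennreal_mult_less_top ennreal_add_eq_top less_top)
  then obtain C where "C \<ge> 0" "?X = ennreal C" by (metis ennreal_cases infinity_ennreal_def less_irrefl)
  then show ?thesis using that[of C] sn_tr[OF \<alpha>] by metis
qed

lemma conv_diff:
  assumes a: "integrable cs a" and b: "integrable cs b" "integrable cs b'"
  shows "conv a (\<lambda>l. b l - b' l) k = conv a b k - conv a b' k"
proof -
  obtain C where C: "\<And>l. norm (a l) \<le> C"
  proof
    fix l
    have "norm (a l) = (\<integral>k. norm (if k = l then a k else 0) \<partial>cs)"
      by (subst integrable_cs_finite(2)[where A = "{l}"]) auto
    also have "\<dots> \<le> (\<integral>k. norm (a k) \<partial>cs)"
      by (rule integral_mono) (use a integrable_cs_finite(1)[where A = "{l}" and c = "\<lambda>k. if k = l then a k else 0"] in auto)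
    finally show "norm (a l) \<le> (\<integral>k. norm (a k) \<partial>cs)" .
  qed
  have "integrable cs (\<lambda>l. a (k - l) * b l)" if "integrable cs b" for b
  proof (rule Bochner_Integration.integrable_bound[OF integrable_mult_right[OF integrable_norm[OF that], of C]])
    show "AE l in cs. norm (a (k - l) * b l) \<le> norm (C * norm (b l))"
      by (rule AE_I2) (simp add: norm_mult abs_mult mult_right_mono order_trans[OF C abs_ge_self])
  qed simp
  then show ?thesis using b by (simp add: conv_def right_diff_distrib)
qed

lemma dcf_diff: "dcf i (\<lambda>k. c k - c' k) = (\<lambda>k. dcf i c k - dcf i c' k)"
  by (simp add: dcf_def algebra_simps fun_eq_iff)

lemma (in kernel) tr_diff:
  fixes F :: "real^'d \<Rightarrow> real^'d"
  assumes r: "integrable cs r" and F: "\<And>i. integrable cs (cf (\<lambda>x. F x $ i))"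
    and c: "\<And>i. integrable cs (dcf i c)" "\<And>i. integrable cs (dcf i c')"
  shows "tr K F r (\<lambda>k. c k - c' k) k = tr K F r c k - tr K F r c' k"
proof -
  have kr: "integrable cs (\<lambda>k. khat (\<lambda>z. of_real (K z $ i)) k * r k)" for i
  proof (rule Bochner_Integration.integrable_bound[OF integrable_mult_right[OF integrable_norm[OF r], of \<kappa>]])
    show "AE k in cs. norm (khat (\<lambda>z. of_real (K z $ i)) k * r k) \<le> norm (\<kappa> * norm (r k))"
      by (rule AE_I2) (simp add: norm_mult abs_mult mult_right_mono order_trans[OF norm_khat_le(1) abs_ge_self])
  qed simp
  show ?thesis
    unfolding tr_def dcf_diff conv_diff[OF kr c] conv_diff[OF r c] conv_diff[OF F c]
    by (simp add: algebra_simps sum_subtractf sum.distrib)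
qed

section \<open>Sobolev regularity of the elements of \<open>C\<^sup>\<gamma>\<close>\<close>

text \<open>Fatou's lemma along growing cubes. It reduces a bound of the whole series to bounds of
  finite sums, the form in which Bessel's inequality provides them.\<close>

lemma nn_integral_cs_le:
  fixes g :: "int^'d::finite \<Rightarrow> real"
  assumes g: "\<And>k. g k \<ge> 0" and B: "\<And>n. (\<Sum>k\<in>kbox n. g k) \<le> B"
  shows "(\<integral>\<^sup>+k. ennreal (g k) \<partial>cs) \<le> ennreal B"
proof -
  define u where "u n k = ennreal (if k \<in> kbox n then g k else 0)" for n k
  have "(\<lambda>n. u n k) \<longlonglongrightarrow> ennreal (g k)" for k
    by (rule tendsto_eventually, rule eventually_mono[OF eventually_kbox[of k]]) (simp add: u_def)
  then have "liminf (\<lambda>n. u n k) = ennreal (g k)" for k by (intro lim_imp_Liminf) auto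
  then have "(\<integral>\<^sup>+k. ennreal (g k) \<partial>cs) \<le> liminf (\<lambda>n. \<integral>\<^sup>+k. u n k \<partial>cs)"
    using nn_integral_liminf[of u cs] by simp
  also have "\<dots> \<le> limsup (\<lambda>n. \<integral>\<^sup>+k. u n k \<partial>cs)" by (rule Liminf_le_Limsup) simp
  also have "\<dots> \<le> ennreal B"
  proof (rule Limsup_bounded, rule always_eventually, rule allI)
    fix n
    have "(\<integral>\<^sup>+k. u n k \<partial>cs) = (\<Sum>k\<in>kbox n. u n k)"
      by (rule nn_integral_count_space'[of "kbox n"]) (auto simp: u_def)
    also have "\<dots> = ennreal (\<Sum>k\<in>kbox n. g k)" using g by (subst sum_ennreal[symmetric]) (auto simp: u_def)
    finally show "(\<integral>\<^sup>+k. u n k \<partial>cs) \<le> ennreal B" using B by (simp add: ennreal_leI)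
  qed
  finally show ?thesis .
qed

lemma cf_mult_integral:
  "(\<integral>x. F x * ch (- k) x \<partial>tm) = of_real (vol TYPE('d)) * fc F (k :: int^'d::finite)"
  by (simp add: fc_def)

lemma integrable_mult_ch:
  fixes F :: "real^'d::finite \<Rightarrow> complex"
  assumes "integrable tm F" shows "integrable tm (\<lambda>x. F x * ch k x)"
  by (rule Bochner_Integration.integrable_bound[OF assms])
     (use assms in \<open>auto simp: norm_mult intro!: borel_measurable_times[OF _ borel_tm]\<close>)

text \<open>The integral of |F - p|^2 is nonnegative for the partial Fourier sum p over
  \<open>A\<close>; expanding it gives the inequality, with the mean of |F|^2 estimated by the
  squared supremum.\<close>

lemma bessel:
  fixes F :: "real^'d::finite \<Rightarrow> complex"
  assumes per: "periodic F" and cont: "continuous_on UNIV F" and B: "\<And>x. norm (F x) \<le> B" and A: "finite A"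
  shows "(\<Sum>k\<in>A. (norm (fc F k))\<^sup>2) \<le> B\<^sup>2"
proof -
  define S where "S = (\<Sum>k\<in>A. (norm (fc F k))\<^sup>2)"
  define p where "p x = (\<Sum>k\<in>A. fc F k * ch k x)" for x
  have fp: "fser (\<lambda>k. if k \<in> A then fc F k else 0) p"
    by (rule fser_finite[OF A]) (auto simp: p_def)
  have i: "integrable tm F" "integrable tm p"
    by (rule integrable_tm_continuous per cont fser_periodic[OF fp] fser_continuous[OF fp])+
  have mp: "(\<integral>x. G x * cnj (p x) \<partial>tm) = of_real (vol TYPE('d)) * (\<Sum>k\<in>A. cnj (fc F k) * fc G k)"
    if G: "integrable tm G" for G
  proof -
    have "(\<integral>x. G x * cnj (p x) \<partial>tm) = (\<integral>x. (\<Sum>k\<in>A. cnj (fc F k) * (G x * ch (- k) x)) \<partial>tm)"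
      by (intro Bochner_Integration.integral_cong) (auto simp: p_def sum_distrib_left ch_minus mult_ac)
    also have "\<dots> = (\<Sum>k\<in>A. cnj (fc F k) * (\<integral>x. G x * ch (- k) x \<partial>tm))"
      by (subst Bochner_Integration.integral_sum) (auto intro: integrable_mult_ch[OF G])
    finally show ?thesis by (simp add: cf_mult_integral sum_distrib_left mult_ac)
  qed
  have cSS: "(\<Sum>k\<in>A. cnj (fc F k) * fc F k) = of_real S"
    by (simp add: S_def complex_norm_square mult.commute del: of_real_power)
  have Fp: "(\<integral>x. F x * cnj (p x) \<partial>tm) = of_real (vol TYPE('d) * S)"
    using mp[OF i(1)] by (simp add: cSS)
  have pp: "(\<integral>x. p x * cnj (p x) \<partial>tm) = of_real (vol TYPE('d) * S)"
    using mp[OF i(2)] by (simp add: cSS fser_fc[OF fp] cong: sum.cong)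
  have j: "integrable tm (\<lambda>x. F x * cnj (F x))" "integrable tm (\<lambda>x. F x * cnj (p x))"
    "integrable tm (\<lambda>x. p x * cnj (p x))" "integrable tm (\<lambda>x. cnj (F x) * p x)"
    by (rule integrable_tm_continuous;
        use per cont fser_periodic[OF fp] fser_continuous[OF fp] in \<open>auto simp: periodic_def intro!: continuous_intros\<close>)+
  have pF: "(\<integral>x. cnj (F x) * p x \<partial>tm) = of_real (vol TYPE('d) * S)"
  proof -
    have "(\<integral>x. cnj (F x) * p x \<partial>tm) = (\<integral>x. cnj (F x * cnj (p x)) \<partial>tm)" by simp
    also have "\<dots> = cnj (\<integral>x. F x * cnj (p x) \<partial>tm)" by (rule integral_bounded_linear[OF bounded_linear_cnj j(2)])
    finally show ?thesis by (simp add: Fp)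
  qed
  have "complex_of_real (\<integral>x. (norm (F x - p x))\<^sup>2 \<partial>tm) = (\<integral>x. F x * cnj (F x) - F x * cnj (p x) - cnj (F x) * p x + p x * cnj (p x) \<partial>tm)"
    unfolding integral_complex_of_real[symmetric]
    by (intro Bochner_Integration.integral_cong) (simp_all only: complex_norm_square, simp add: algebra_simps)
  also have "\<dots> = (\<integral>x. F x * cnj (F x) \<partial>tm) - of_real (vol TYPE('d) * S)"
    using j by (simp add: Fp pp pF del: of_real_mult)
  also have "(\<integral>x. F x * cnj (F x) \<partial>tm) = complex_of_real (\<integral>x. (norm (F x))\<^sup>2 \<partial>tm)"
    unfolding integral_complex_of_real[symmetric] by (simp only: complex_norm_square)
  finally have "complex_of_real (\<integral>x. (norm (F x - p x))\<^sup>2 \<partial>tm) = complex_of_real ((\<integral>x. (norm (F x))\<^sup>2 \<partial>tm) - vol TYPE('d) * S)"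
    by (simp only: of_real_diff)
  then have eq: "(\<integral>x. (norm (F x - p x))\<^sup>2 \<partial>tm) = (\<integral>x. (norm (F x))\<^sup>2 \<partial>tm) - vol TYPE('d) * S"
    by (simp only: of_real_eq_iff)
  have "0 \<le> (\<integral>x. (norm (F x - p x))\<^sup>2 \<partial>tm)" by simp
  then have "vol TYPE('d) * S \<le> (\<integral>x. (norm (F x))\<^sup>2 \<partial>tm)" using eq by linarith
  also have "\<dots> \<le> (\<integral>x. B\<^sup>2 \<partial>(tm :: (real^'d) measure))"
  proof (rule integral_mono)
    show "integrable tm (\<lambda>x. (norm (F x))\<^sup>2)"
      by (rule integrable_tm_continuous) (use per cont in \<open>auto simp: periodic_def intro!: continuous_intros\<close>)
    show "(norm (F x))\<^sup>2 \<le> B\<^sup>2" for x using B[of x] by (simp add: power_mono)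
  qed simp
  also have "\<dots> = vol TYPE('d) * B\<^sup>2" by (simp add: measure_tm)
  finally show ?thesis by (simp add: S_def)
qed

lemma has_derivative_shift:
  "(f has_derivative D) (at (x + a)) \<longleftrightarrow> ((\<lambda>y. f (y + a)) has_derivative D) (at x)"
  unfolding has_derivative_at by (simp add: ac_simps)

lemma periodic_partial_d:
  assumes "periodic f" shows "periodic (partial_d i f)"
proof -
  have "(\<lambda>y. f (y + axis j (2 * pi))) = f" for j using assms by (auto simp: periodic_def)
  then have "frechet_derivative f (at (x + axis j (2 * pi))) = frechet_derivative f (at x)" for x j
    unfolding frechet_derivative_def has_derivative_shift by simp
  then show ?thesis by (simp add: periodic_def partial_d_def)
qed

lemma C_diff_continuous: "C_diff m f \<Longrightarrow> continuous_on UNIV f"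
  by (cases m) (auto intro: differentiable_imp_continuous_on)

lemma partial_d_line:
  fixes f :: "real^'d::finite \<Rightarrow> real"
  assumes "f differentiable_on UNIV"
  shows "((\<lambda>s. f (x + s *\<^sub>R axis i 1)) has_real_derivative partial_d i f (x + s *\<^sub>R axis i 1)) (at s)"
proof -
  let ?y = "x + s *\<^sub>R axis i 1"
  have "(f has_derivative frechet_derivative f (at ?y)) (at ?y)"
    using assms by (simp add: differentiable_on_def frechet_derivative_works)
  moreover have "((\<lambda>s. x + s *\<^sub>R axis i 1) has_derivative (\<lambda>s. s *\<^sub>R axis i 1)) (at s)"
    by (auto intro!: derivative_eq_intros)
  ultimately have "((\<lambda>s. f (x + s *\<^sub>R axis i 1)) has_derivative (\<lambda>s. frechet_derivative f (at ?y) (s *\<^sub>R axis i 1))) (at s)"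
    using has_derivative_compose by blast
  moreover have "frechet_derivative f (at ?y) (s *\<^sub>R axis i 1) = s * partial_d i f ?y" for s
    using linear_frechet_derivative[of f "at ?y"] assms
    by (simp add: partial_d_def linear_cmul differentiable_on_def)
  moreover have "(\<lambda>s. s * partial_d i f ?y) = times (partial_d i f ?y)" by (simp add: fun_eq_iff mult.commute)
  ultimately show ?thesis by (simp add: has_field_derivative_def)
qed

text \<open>Integration by parts is replaced by difference quotients. Translation invariance turns
  the coefficient of the quotient with step h into that of \<open>f\<close> times (cis (h k_i) - 1)
  / h, and the mean value theorem bounds the quotients by the supremum of the derivative, which
  permits dominated convergence.\<close>

lemma cf_partial_d:
  fixes f :: "real^'d::finite \<Rightarrow> real"
  assumes f: "C_diff (Suc m) f" and per: "periodic f"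
  shows "cf (partial_d i f) k = \<i> * of_real (freq k $ i) * cf f k"
proof -
  let ?e = "axis i 1 :: real^'d"
  have df: "f differentiable_on UNIV" and cd: "continuous_on UNIV (partial_d i f)" and cont: "continuous_on UNIV f"
    using f C_diff_continuous by (auto intro: differentiable_imp_continuous_on)
  obtain B where B: "\<And>x. norm (partial_d i f x) \<le> B"
    using periodic_bounded[OF periodic_partial_d[OF per] cd] by metis
  define h where "h n = 1 / real (Suc n)" for n
  have h0: "h n > 0" for n by (simp add: h_def)
  have hlim: "h \<longlonglongrightarrow> 0" unfolding h_def by (rule LIMSEQ_Suc[OF lim_1_over_n])
  have hat: "filterlim h (at 0) sequentially"
    unfolding filterlim_at using hlim h0 by (auto intro!: always_eventually simp: less_imp_neq[THEN not_sym])
  define q where "q n x = (f (x + h n *\<^sub>R ?e) - f x) / h n" for n x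
  have qb: "\<bar>q n x\<bar> \<le> B" for n x
  proof -
    have "\<exists>z. 0 < z \<and> z < h n \<and> f (x + h n *\<^sub>R ?e) - f (x + 0 *\<^sub>R ?e) = (h n - 0) * partial_d i f (x + z *\<^sub>R ?e)"
      by (rule MVT2) (use h0 partial_d_line[OF df] in auto)
    then obtain z where "f (x + h n *\<^sub>R ?e) - f x = h n * partial_d i f (x + z *\<^sub>R ?e)" by auto
    then show ?thesis using B[of "x + z *\<^sub>R ?e"] h0[of n] by (simp add: q_def)
  qed
  have ql: "(\<lambda>n. q n x) \<longlonglongrightarrow> partial_d i f x" for x
  proof -
    have "((\<lambda>s. (f (x + (0 + s) *\<^sub>R ?e) - f (x + 0 *\<^sub>R ?e)) / s) \<longlongrightarrow> partial_d i f (x + 0 *\<^sub>R ?e)) (at 0)"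
      using partial_d_line[OF df, of x i 0] unfolding DERIV_def .
    then show ?thesis using filterlim_compose[OF _ hat] by (simp add: q_def[abs_def]) 
  qed
  have qm: "q n \<in> borel_measurable borel" for n
  proof (rule borel_measurable_continuous_onI)
    have "continuous_on UNIV (\<lambda>x. f (x + h n *\<^sub>R ?e))"
      by (rule continuous_on_compose2[OF cont]) (auto intro!: continuous_intros)
    then show "continuous_on UNIV (q n)" unfolding q_def using h0[of n] cont by (auto intro!: continuous_intros)
  qed
  have "(\<lambda>n. \<integral>x. of_real (q n x) * ch (- k) x \<partial>tm) \<longlonglongrightarrow> (\<integral>x. of_real (partial_d i f x) * ch (- k) x \<partial>tm)"
  proof (rule integral_dominated_convergence[where w = "\<lambda>_. B"])
    show "(\<lambda>x. of_real (partial_d i f x) * ch (- k) x) \<in> borel_measurable tm"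
      using borel_measurable_continuous_onI[OF cd] borel_ch[of "- k"] by (intro borel_tm) measurable
    show "(\<lambda>x. of_real (q n x) * ch (- k) x) \<in> borel_measurable tm" for n
      using qm[of n] borel_ch[of "- k"] by (intro borel_tm) measurable
    show "AE x in tm. (\<lambda>n. of_real (q n x) * ch (- k) x) \<longlonglongrightarrow> of_real (partial_d i f x) * ch (- k) x"
      by (intro AE_I2 tendsto_intros ql)
    show "AE x in tm. norm (of_real (q n x) * ch (- k) x) \<le> B" for n
      by (rule AE_I2) (simp add: norm_mult qb)
  qed simp
  moreover have "(\<integral>x. of_real (q n x) * ch (- k) x \<partial>tm) = of_real (vol TYPE('d)) * cf f k * ((cis (h n * freq k $ i) - 1) / h n)" for n
  proof -
    define G where "G x = complex_of_real (f x) * ch (- k) x" for x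
    have Gc: "continuous_on UNIV G" unfolding G_def using cont by (intro continuous_intros)
    have Gp: "periodic G" using per periodic_ch[of "- k"] by (simp add: G_def periodic_def)
    have Gi: "integrable tm G" by (rule integrable_tm_continuous[OF Gp Gc])
    have Gm: "G \<in> borel_measurable borel" by (rule borel_measurable_continuous_onI[OF Gc])
    have Gs: "integrable tm (\<lambda>x. G (h n *\<^sub>R ?e + x))" using integrable_tm_shift[OF Gm Gp] Gi by blast
    have ck: "ch k (h n *\<^sub>R ?e) = cis (h n * freq k $ i)" by (simp add: ch_def inner_axis)
    have "of_real (q n x) * ch (- k) x = (ch k (h n *\<^sub>R ?e) * G (h n *\<^sub>R ?e + x) - G x) / h n" for x
    proof -
      have "ch k (h n *\<^sub>R ?e) * ch (- k) (h n *\<^sub>R ?e) = 1" by (simp add: ch_minus)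
      then have "ch k (h n *\<^sub>R ?e) * G (h n *\<^sub>R ?e + x) = of_real (f (x + h n *\<^sub>R ?e)) * ch (- k) x"
        by (simp add: G_def ch_plus[of "- k"] add.commute)
      then show ?thesis by (simp only:) (simp add: q_def G_def diff_divide_distrib left_diff_distrib)
    qed
    then have "(\<integral>x. of_real (q n x) * ch (- k) x \<partial>tm) = (ch k (h n *\<^sub>R ?e) * (\<integral>x. G (h n *\<^sub>R ?e + x) \<partial>tm) - (\<integral>x. G x \<partial>tm)) / h n"
      using Gi Gs by (simp only: integral_divide_zero Bochner_Integration.integral_diff integrable_mult_right integral_mult_right_zero)
    also have "(\<integral>x. G (h n *\<^sub>R ?e + x) \<partial>tm) = (\<integral>x. G x \<partial>tm)" by (rule integral_tm_shift[OF Gm Gp])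
    also have "(\<integral>x. G x \<partial>tm) = of_real (vol TYPE('d)) * cf f k" unfolding G_def by (rule cf_mult_integral)
    finally show ?thesis by (simp add: ck algebra_simps diff_divide_distrib)
  qed
  moreover have "(\<lambda>n. of_real (vol TYPE('d)) * cf f k * ((cis (h n * freq k $ i) - 1) / h n)) \<longlonglongrightarrow>
      of_real (vol TYPE('d)) * cf f k * (\<i> * of_real (freq k $ i))"
  proof -
    have hc: "filterlim (\<lambda>n. complex_of_real (h n)) (at 0) sequentially"
      unfolding filterlim_at
      using tendsto_of_real[OF hlim, where 'a = complex] h0 by (auto intro!: always_eventually simp: less_imp_neq[THEN not_sym])
    have "((\<lambda>z. exp (\<i> * of_real (freq k $ i) * z)) has_field_derivative \<i> * of_real (freq k $ i)) (at 0)"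
      by (auto intro!: derivative_eq_intros)
    then have "((\<lambda>z. (exp (\<i> * of_real (freq k $ i) * z) - 1) / z) \<longlongrightarrow> \<i> * of_real (freq k $ i)) (at 0)"
      by (simp add: DERIV_def)
    from filterlim_compose[OF this hc]
    have "(\<lambda>n. (cis (h n * freq k $ i) - 1) / h n) \<longlonglongrightarrow> \<i> * of_real (freq k $ i)"
      by (simp add: cis_conv_exp mult_ac)
    then show ?thesis by (rule tendsto_mult_left)
  qed
  ultimately have "(\<integral>x. of_real (partial_d i f x) * ch (- k) x \<partial>tm) = of_real (vol TYPE('d)) * cf f k * (\<i> * of_real (freq k $ i))"
    using LIMSEQ_unique by simp
  then show ?thesis unfolding cf_mult_integral by simp
qed

lemma C_diff_funpow:
  fixes f :: "real^'d::finite \<Rightarrow> real"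
  assumes "C_diff m f" "periodic f"
  shows "continuous_on UNIV ((partial_d i ^^ m) f) \<and> periodic ((partial_d i ^^ m) f) \<and>
     cf ((partial_d i ^^ m) f) k = (\<i> * of_real (freq k $ i)) ^ m * cf f k"
  using assms
proof (induction m arbitrary: f)
  case (Suc m)
  have "C_diff m (partial_d i f)" "periodic (partial_d i f)"
    using Suc.prems periodic_partial_d by auto
  from Suc.IH[OF this] cf_partial_d[OF Suc.prems, of i k] show ?case
    by (simp only: funpow_Suc_right o_apply) (simp add: mult_ac)
qed simp

lemma C_diff_norm_bound:
  assumes N: "C_diff_norm m f = ennreal N" "N \<ge> 0" and "length js \<le> m"
  shows "\<bar>foldr partial_d js f x\<bar> \<le> N"
proof -
  have "ennreal \<bar>foldr partial_d js f x\<bar> \<le> (SUP x. ennreal \<bar>foldr partial_d js f x\<bar>)" by (rule SUP_upper) simp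
  also have "\<dots> \<le> C_diff_norm m f" unfolding C_diff_norm_def by (rule SUP_upper) (use assms in simp)
  finally show ?thesis using N by simp
qed

lemma power_sum_le:
  fixes a :: "'i \<Rightarrow> real"
  assumes "finite I" "I \<noteq> {}" "\<And>i. i \<in> I \<Longrightarrow> a i \<ge> 0"
  shows "(\<Sum>i\<in>I. a i) ^ m \<le> real (card I) ^ m * (\<Sum>i\<in>I. a i ^ m)"
proof -
  obtain j where j: "j \<in> I" "\<And>i. i \<in> I \<Longrightarrow> a i \<le> a j"
  proof -
    have "Max (a ` I) \<in> a ` I" using assms by (intro Max_in) auto
    then obtain j where "j \<in> I" "a j = Max (a ` I)" by auto
    moreover have "a i \<le> Max (a ` I)" if "i \<in> I" for i using assms that by (intro Max_ge) auto
    ultimately show ?thesis using that[of j] by simp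
  qed
  have "(\<Sum>i\<in>I. a i) ^ m \<le> (real (card I) * a j) ^ m"
    by (intro power_mono sum_bounded_above sum_nonneg assms j)
  also have "\<dots> = real (card I) ^ m * a j ^ m" by (rule power_mult_distrib)
  also have "a j ^ m \<le> (\<Sum>i\<in>I. a i ^ m)"
    using member_le_sum[OF j(1), of "\<lambda>i. a i ^ m"] assms by auto
  finally show ?thesis by (simp add: mult_left_mono)
qed

text \<open>Bessel's inequality is used for \<open>f\<close> and for its d pure derivatives of order
  m. Mixed derivatives can be left out because the power (1 + |k|^2)^m is dominated by 1 plus the
  sum of the k_i^(2m). The constants: 2^m and d^m from splitting powers of sums, 1 + d from the
  number of functions.\<close>

lemma sn_C_diff:
  fixes f :: "real^'d::finite \<Rightarrow> real"
  assumes f: "C_diff m f" "periodic f" and N: "C_diff_norm m f = ennreal N" "N \<ge> 0"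
  shows "sn (real m) (cf f) \<le> ennreal (2 ^ m * real CARD('d) ^ m * (1 + real CARD('d)) * N\<^sup>2)"
proof -
  let ?d = "real CARD('d)"
  have fb: "(\<Sum>k\<in>A. (norm (cf f k))\<^sup>2) \<le> N\<^sup>2" if "finite A" for A :: "(int^'d) set"
    by (rule bessel) (use that f C_diff_continuous[OF f(1)] C_diff_norm_bound[OF N, of "[]"] in \<open>auto simp: periodic_def intro!: continuous_intros\<close>)
  have db: "(\<Sum>k\<in>A. (norm ((\<i> * of_real (freq k $ i)) ^ m * cf f k))\<^sup>2) \<le> N\<^sup>2" if "finite A" for A :: "(int^'d) set" and i
  proof -
    let ?g = "(partial_d i ^^ m) f"
    note g = C_diff_funpow[OF f, of i]
    have "\<bar>?g x\<bar> \<le> N" for x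
      using C_diff_norm_bound[OF N, of "replicate m i" x] by simp
    then have "(\<Sum>k\<in>A. (norm (cf ?g k))\<^sup>2) \<le> N\<^sup>2"
      by (intro bessel) (use that g in \<open>auto simp: periodic_def intro!: continuous_intros\<close>)
    then show ?thesis using g by simp
  qed
  show ?thesis unfolding sn_def
  proof (rule nn_integral_cs_le)
    fix n
    have pw: "jb k powr (2 * real m) * (norm (cf f k))\<^sup>2 \<le>
        2 ^ m * ?d ^ m * ((norm (cf f k))\<^sup>2 + (\<Sum>i\<in>UNIV. (norm ((\<i> * of_real (freq k $ i)) ^ m * cf f k))\<^sup>2))" for k :: "int^'d"
    proof -
      let ?S = "(norm (freq k))\<^sup>2"
      have "jb k powr (2 * real m) = (1 + ?S) ^ m"
        using powr_realpow[of "jb k" "2 * m"] by (simp add: power_mult jb_sq)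
      \<comment> \<open>A sum of two terms is a sum over \<open>bool\<close>.\<close>
      also have "\<dots> \<le> 2 ^ m * (1 + ?S ^ m)"
        using power_sum_le[of "UNIV :: bool set" "\<lambda>b. if b then 1 else ?S" m] by (simp add: UNIV_bool add.commute)
      also have "?S ^ m \<le> ?d ^ m * (\<Sum>i\<in>UNIV. ((freq k $ i)\<^sup>2) ^ m)"
        using power_sum_le[of "UNIV :: 'd set" "\<lambda>i. (freq k $ i)\<^sup>2" m]
        by (simp add: norm_vec_def L2_set_def sum_nonneg)
      also have "1 + ?d ^ m * (\<Sum>i\<in>UNIV. ((freq k $ i)\<^sup>2) ^ m) \<le> ?d ^ m * (1 + (\<Sum>i\<in>UNIV. ((freq k $ i)\<^sup>2) ^ m))"
        by (simp add: distrib_left one_le_power)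
      finally have "jb k powr (2 * real m) \<le> 2 ^ m * (?d ^ m * (1 + (\<Sum>i\<in>UNIV. ((freq k $ i)\<^sup>2) ^ m)))" by simp
      then have "jb k powr (2 * real m) * (norm (cf f k))\<^sup>2 \<le> 2 ^ m * (?d ^ m * (1 + (\<Sum>i\<in>UNIV. ((freq k $ i)\<^sup>2) ^ m))) * (norm (cf f k))\<^sup>2"
        by (rule mult_right_mono) simp
      also have "\<dots> = 2 ^ m * ?d ^ m * ((norm (cf f k))\<^sup>2 + (\<Sum>i\<in>UNIV. (norm ((\<i> * of_real (freq k $ i)) ^ m * cf f k))\<^sup>2))"
      proof -
        have "(norm ((\<i> * of_real (freq k $ i)) ^ m * cf f k))\<^sup>2 = ((freq k $ i)\<^sup>2) ^ m * (norm (cf f k))\<^sup>2" for i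
        proof -
          have "(norm ((\<i> * of_real (freq k $ i)) ^ m * cf f k))\<^sup>2 = (\<bar>freq k $ i\<bar> ^ m)\<^sup>2 * (norm (cf f k))\<^sup>2"
            by (simp only: norm_mult norm_power norm_ii norm_of_real mult_1 power_mult_distrib power_one)
          also have "(\<bar>freq k $ i\<bar> ^ m)\<^sup>2 = ((freq k $ i)\<^sup>2) ^ m"
            by (metis power2_abs power_mult mult.commute)
          finally show ?thesis .
        qed
        then show ?thesis by (simp only: sum_distrib_right[symmetric]) (simp only: mult.assoc distrib_right mult_1)
      qed
      finally show ?thesis .
    qed
    have "(\<Sum>k\<in>kbox n. jb k powr (2 * real m) * (norm (cf f k))\<^sup>2) \<le>
        (\<Sum>k\<in>kbox n. 2 ^ m * ?d ^ m * ((norm (cf f k))\<^sup>2 + (\<Sum>i\<in>UNIV. (norm ((\<i> * of_real (freq k $ i)) ^ m * cf f k))\<^sup>2)))"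
      by (rule sum_mono[OF pw])
    also have "\<dots> = 2 ^ m * ?d ^ m * ((\<Sum>k\<in>kbox n. (norm (cf f k))\<^sup>2) + (\<Sum>i\<in>UNIV. \<Sum>k\<in>kbox n. (norm ((\<i> * of_real (freq k $ i)) ^ m * cf f k))\<^sup>2))"
      by (subst sum.swap) (simp add: sum_distrib_left[symmetric] sum.distrib)
    also have "\<dots> \<le> 2 ^ m * ?d ^ m * (N\<^sup>2 + (\<Sum>i\<in>(UNIV :: 'd set). N\<^sup>2))"
      by (intro mult_left_mono add_mono sum_mono fb db) auto
    also have "\<dots> = 2 ^ m * ?d ^ m * (1 + ?d) * N\<^sup>2" by (simp add: algebra_simps)
    finally show "(\<Sum>k\<in>kbox n. jb k powr (2 * real m) * (norm (cf f k))\<^sup>2) \<le> 2 ^ m * ?d ^ m * (1 + ?d) * N\<^sup>2" .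
  qed simp
qed

section \<open>Littlewood-Paley blocks and Besov regularity\<close>

definition lpw :: "(real^'d::finite \<Rightarrow> real) \<Rightarrow> (real^'d \<Rightarrow> real) \<Rightarrow> nat \<Rightarrow> int^'d \<Rightarrow> real" where
  "lpw \<zeta> \<theta> n k = (case n of 0 \<Rightarrow> \<zeta> (freq k) | Suc j \<Rightarrow> \<theta> (freq k /\<^sub>R 2 ^ j))"

lemma finite_freq_bounded: "finite {k :: int^'d::finite. norm (freq k) \<le> R}"
proof (rule finite_subset[OF _ finite_kbox[of "nat \<lceil>R\<rceil>"]])
  show "{k :: int^'d. norm (freq k) \<le> R} \<subseteq> kbox (nat \<lceil>R\<rceil>)"
  proof
    fix k :: "int^'d" assume k: "k \<in> {k. norm (freq k) \<le> R}"
    have "\<bar>k $ i\<bar> \<le> int (nat \<lceil>R\<rceil>)" for i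
    proof -
      have "real_of_int \<bar>k $ i\<bar> \<le> R" using component_le_norm_cart[of "freq k" i] k by (simp add: freq_def)
      then show ?thesis by linarith
    qed
    then show "k \<in> kbox (nat \<lceil>R\<rceil>)" by (simp add: kbox_def)
  qed
qed

lemma lpw_facts:
  fixes \<zeta> \<theta> :: "real^'d::finite \<Rightarrow> real"
  assumes "dyadic_partition \<zeta> \<theta>"
  obtains R where "R \<ge> 0" "\<And>n k. lpw \<zeta> \<theta> n k \<noteq> 0 \<Longrightarrow> norm (freq k) \<le> R * 2 ^ n"
    "\<And>n k. lpw \<zeta> \<theta> n k \<ge> 0" "\<And>k. (\<lambda>n. lpw \<zeta> \<theta> n k) sums 1"
proof -
  have e1: "\<exists>R. \<forall>x. R < norm x \<longrightarrow> \<zeta> x = 0" using assms unfolding dyadic_partition_def by (elim conjE)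
  have e2: "\<exists>r>0. \<exists>R. \<forall>x. norm x < r \<or> R < norm x \<longrightarrow> \<theta> x = 0" using assms unfolding dyadic_partition_def by (elim conjE)
  obtain R1 where R1: "\<And>x. R1 < norm x \<Longrightarrow> \<zeta> x = 0" using e1 by metis
  obtain r R2 where R2: "\<And>x. norm x < r \<or> R2 < norm x \<Longrightarrow> \<theta> x = 0" using e2 by metis
  define R where "R = max 0 (max R1 R2)"
  show ?thesis
  proof (rule that[of R])
    show "R \<ge> 0" by (simp add: R_def)
    have e31: "\<forall>x. 0 \<le> \<zeta> x" using assms unfolding dyadic_partition_def by (elim conjE)
    have e32: "\<forall>x. 0 \<le> \<theta> x" using assms unfolding dyadic_partition_def by (elim conjE)
    have e33: "\<forall>x. (\<lambda>j. \<theta> (x /\<^sub>R 2 ^ j)) sums (1 - \<zeta> x)" using assms unfolding dyadic_partition_def by (elim conjE)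
    note e3 = e31 e32 e33
    show "lpw \<zeta> \<theta> n k \<ge> 0" for n k using e3(1,2) by (simp add: lpw_def split: nat.split)
    show "norm (freq k) \<le> R * 2 ^ n" if "lpw \<zeta> \<theta> n k \<noteq> 0" for n k
    proof (cases n)
      case 0
      then have "\<not> R1 < norm (freq k)" using that R1[of "freq k"] by (intro notI) (simp add: lpw_def)
      then show ?thesis using 0 by (simp add: R_def)
    next
      case (Suc j)
      then have "norm (freq k /\<^sub>R 2 ^ j) \<le> R2" 
        using that R2[of "freq k /\<^sub>R 2 ^ j"] by (intro leI notI) (simp only: lpw_def nat.case simp_thms)
      then have "norm (freq k) \<le> R2 * 2 ^ j" by (simp add: norm_power field_simps)
      also have "\<dots> \<le> R * 2 ^ n" unfolding Suc by (intro mult_mono) (auto simp: R_def)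
      finally show ?thesis .
    qed
    show "(\<lambda>n. lpw \<zeta> \<theta> n k) sums 1" for k
    proof -
      have "(\<lambda>j. \<theta> (freq k /\<^sub>R 2 ^ j)) sums (1 - \<zeta> (freq k))" using e3(3) by blast
      then show ?thesis using sums_Suc_iff[of "\<lambda>n. lpw \<zeta> \<theta> n k" "1 - \<zeta> (freq k)"] by (simp add: lpw_def)
    qed
  qed
qed

text \<open>The extra derivative in the Besov norm pays for the passage from suprema to a square
  sum. Each frequency k is charged to one block n in which its weight is at least c0 q^n; such a
  block exists, for otherwise the weights at k would add up to at most 1/2 instead of 1. Thus only
  the upper bound of the supports is needed, not their precise position. Bessel's inequality bounds
  the energy of each block by its supremum.\<close>

lemma sn_besov:
  fixes \<zeta> \<theta> :: "real^'d::finite \<Rightarrow> real"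
  assumes part: "dyadic_partition \<zeta> \<theta>" and \<beta>: "\<beta> \<ge> 0"
  obtains C where "C > 0" "\<And>f N. periodic f \<Longrightarrow> continuous_on UNIV f \<Longrightarrow>
    besov_norm \<zeta> \<theta> (\<beta> + 1) f = ennreal N \<Longrightarrow> N \<ge> 0 \<Longrightarrow> sn \<beta> (cf f) \<le> ennreal (C * N\<^sup>2)"
proof -
  obtain R where R: "R \<ge> 0" "\<And>n k. lpw \<zeta> \<theta> n k \<noteq> 0 \<Longrightarrow> norm (freq k) \<le> R * 2 ^ n"
    "\<And>n k. lpw \<zeta> \<theta> n k \<ge> 0" "\<And>k. (\<lambda>n. lpw \<zeta> \<theta> n k) sums 1"
    using lpw_facts[OF part] by metis
  \<comment> \<open>With q^2 = 1/2 the small weight costs a factor 2^n, half of the gain 4^-n that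
    comes from the extra derivative. The choice of \<open>c0\<close> makes the series of c0 q^n
    equal to 1/2.\<close>
  define q where "q = (2 :: real) powr (- 1/2)"
  have q: "0 < q" "q < 1" by (auto simp: q_def powr_less_one)
  have q2: "q\<^sup>2 = 1/2" unfolding q_def by (simp add: power2_eq_square powr_minus_divide flip: powr_add)
  define c0 where "c0 = (1 - q) / 2"
  have c0: "c0 > 0" using q by (simp add: c0_def)
  \<comment> \<open>The last power of 2 accounts for the numbering of the blocks: block n carries
    the Besov weight with n - 1.\<close>
  define D where "D = (1 + R) powr (2 * \<beta>) / c0\<^sup>2 * 2 powr (2 * (\<beta> + 1))"
  have D: "D > 0" using R c0 by (simp add: D_def)
  have ex: "\<exists>n. lpw \<zeta> \<theta> n k \<ge> c0 * q ^ n" for k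
  proof (rule ccontr)
    assume "\<not> ?thesis"
    then have l: "lpw \<zeta> \<theta> n k \<le> c0 * q ^ n" for n by (meson less_imp_le not_le)
    have "(\<lambda>n. c0 * q ^ n) sums (c0 * (1 / (1 - q)))"
      by (intro sums_mult geometric_sums) (use q in auto)
    from sums_le[OF l R(4) this] show False using q by (simp add: c0_def)
  qed
  show ?thesis
  proof (rule that[of "2 * D"])
    show "2 * D > 0" using D by simp
    fix f :: "real^'d \<Rightarrow> real" and N
    assume f: "periodic f" "continuous_on UNIV f" and N: "besov_norm \<zeta> \<theta> (\<beta> + 1) f = ennreal N" "N \<ge> 0"
    have fi: "integrable tm f" by (rule integrable_tm_continuous[OF f])
    have block: "(\<integral>\<^sup>+k. ennreal ((lpw \<zeta> \<theta> n k)\<^sup>2 * (norm (cf f k))\<^sup>2) \<partial>cs) \<le> ennreal ((2 powr (- (real n - 1) * (\<beta> + 1)) * N)\<^sup>2)" for n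
    proof -
      define A where "A = {k :: int^'d. norm (freq k) \<le> R * 2 ^ n}"
      have A: "finite A" unfolding A_def by (rule finite_freq_bounded)
      define p where "p x = (\<Sum>k\<in>A. of_real (lpw \<zeta> \<theta> n k) * cf f k * ch k x)" for x
      have z: "lpw \<zeta> \<theta> n k = 0" if "k \<notin> A" for k using that R(2) by (auto simp: A_def)
      have lp: "lp_block \<zeta> \<theta> n f x = p x" for x
      proof -
        have "(\<Sum>\<^sub>\<infinity>k. of_real (case n of 0 \<Rightarrow> \<zeta> (freq k) | Suc j \<Rightarrow> \<theta> (freq k /\<^sub>R 2 ^ j)) * fourier_coeff (pairing f) k * cis (freq k \<bullet> x)) =
            (\<Sum>\<^sub>\<infinity>k\<in>A. of_real (lpw \<zeta> \<theta> n k) * fourier_coeff (pairing f) k * cis (freq k \<bullet> x))"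
          by (rule infsum_cong_neutral) (use z in \<open>auto simp: lpw_def[symmetric]\<close>)
        also have "\<dots> = (\<Sum>k\<in>A. of_real (lpw \<zeta> \<theta> n k) * fourier_coeff (pairing f) k * cis (freq k \<bullet> x))"
          by (rule infsum_finite[OF A])
        finally show ?thesis
          unfolding lp_block_def p_def
          by (simp add: fourier_coeff_pairing[OF fi] ch_def vol_def sum_divide_distrib mult.assoc)
      qed
      have fp: "fser (\<lambda>k. of_real (lpw \<zeta> \<theta> n k) * cf f k) p"
        by (rule fser_finite[OF A]) (auto simp: p_def z)
      have pb: "norm (p x) \<le> 2 powr (- (real n - 1) * (\<beta> + 1)) * N" for x
      proof -
        have "ennreal (2 powr ((real n - 1) * (\<beta> + 1)) * norm (p x)) \<le> (SUP x. ennreal (2 powr ((real n - 1) * (\<beta> + 1)) * cmod (lp_block \<zeta> \<theta> n f x)))"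
          unfolding lp by (rule SUP_upper) simp
        also have "\<dots> \<le> besov_norm \<zeta> \<theta> (\<beta> + 1) f" unfolding besov_norm_def by (rule SUP_upper) simp
        finally have "2 powr ((real n - 1) * (\<beta> + 1)) * norm (p x) \<le> N" using N by simp
        then have "2 powr (- (real n - 1) * (\<beta> + 1)) * (2 powr ((real n - 1) * (\<beta> + 1)) * norm (p x)) \<le> 2 powr (- (real n - 1) * (\<beta> + 1)) * N"
          by (rule mult_left_mono) simp
        moreover have "2 powr (- (real n - 1) * (\<beta> + 1)) * 2 powr ((real n - 1) * (\<beta> + 1)) = 1"
          unfolding mult_minus_left powr_minus by simp
        ultimately show ?thesis by (simp only: mult.assoc[symmetric] mult_1)
      qed
      show ?thesis
      proof (rule nn_integral_cs_le)
        fix m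
        have "(\<Sum>k\<in>kbox m. (norm (fc p k))\<^sup>2) \<le> (2 powr (- (real n - 1) * (\<beta> + 1)) * N)\<^sup>2"
          by (rule bessel[OF fser_periodic[OF fp] fser_continuous[OF fp] pb finite_kbox])
        then show "(\<Sum>k\<in>kbox m. (lpw \<zeta> \<theta> n k)\<^sup>2 * (norm (cf f k))\<^sup>2) \<le> (2 powr (- (real n - 1) * (\<beta> + 1)) * N)\<^sup>2"
          by (simp add: fser_fc[OF fp] norm_mult power_mult_distrib)
      qed simp
    qed
    have pw: "ennreal (jb k powr (2 * \<beta>) * (norm (cf f k))\<^sup>2) \<le>
        (\<integral>\<^sup>+n. ennreal ((1 + R) powr (2 * \<beta>) / c0\<^sup>2 * 2 powr (real n * (2 * \<beta>)) * 2 ^ n * ((lpw \<zeta> \<theta> n k)\<^sup>2 * (norm (cf f k))\<^sup>2)) \<partial>cs)" for k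
    proof -
      obtain n where n: "lpw \<zeta> \<theta> n k \<ge> c0 * q ^ n" using ex by blast
      then have pos: "lpw \<zeta> \<theta> n k > 0" using c0 q by (metis less_le_trans mult_pos_pos zero_less_power)
      have "jb k \<le> 1 + norm (freq k)" by (rule power2_le_imp_le) (auto simp: jb_sq power2_sum)
      also have "\<dots> \<le> 1 * 2 ^ n + R * 2 ^ n" using R(2)[of n k] pos by (intro add_mono) auto
      finally have "jb k \<le> (1 + R) * 2 ^ n" by (simp add: algebra_simps)
      then have "jb k powr (2 * \<beta>) \<le> ((1 + R) * 2 ^ n) powr (2 * \<beta>)" using \<beta> by (intro powr_mono2) auto
      also have "\<dots> = (1 + R) powr (2 * \<beta>) * 2 powr (real n * (2 * \<beta>))"
        using R by (simp add: powr_mult powr_powr flip: powr_realpow)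
      finally have j: "jb k powr (2 * \<beta>) \<le> (1 + R) powr (2 * \<beta>) * 2 powr (real n * (2 * \<beta>))" .
      have "(c0 * q ^ n)\<^sup>2 \<le> (lpw \<zeta> \<theta> n k)\<^sup>2" using n c0 q by (intro power_mono) auto
      moreover have "(c0 * q ^ n)\<^sup>2 = c0\<^sup>2 / 2 ^ n"
        by (simp add: power_mult_distrib power_mult[symmetric] mult.commute[of n] power_mult q2 power_one_over divide_simps)
      ultimately have "c0\<^sup>2 / 2 ^ n \<le> (lpw \<zeta> \<theta> n k)\<^sup>2" by (simp only:)
      then have "c0\<^sup>2 \<le> (lpw \<zeta> \<theta> n k)\<^sup>2 * 2 ^ n" by (simp add: pos_divide_le_eq)
      then have "1 \<le> (lpw \<zeta> \<theta> n k)\<^sup>2 * 2 ^ n / c0\<^sup>2" using c0 by (simp add: pos_le_divide_eq)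
      then have "jb k powr (2 * \<beta>) * 1 \<le> ((1 + R) powr (2 * \<beta>) * 2 powr (real n * (2 * \<beta>))) * ((lpw \<zeta> \<theta> n k)\<^sup>2 * 2 ^ n / c0\<^sup>2)"
        by (intro mult_mono j) auto
      then have "jb k powr (2 * \<beta>) * (norm (cf f k))\<^sup>2 \<le> ((1 + R) powr (2 * \<beta>) * 2 powr (real n * (2 * \<beta>))) * ((lpw \<zeta> \<theta> n k)\<^sup>2 * 2 ^ n / c0\<^sup>2) * (norm (cf f k))\<^sup>2"
        by (intro mult_right_mono) auto
      then have "ennreal (jb k powr (2 * \<beta>) * (norm (cf f k))\<^sup>2) \<le>
          ennreal ((1 + R) powr (2 * \<beta>) / c0\<^sup>2 * 2 powr (real n * (2 * \<beta>)) * 2 ^ n * ((lpw \<zeta> \<theta> n k)\<^sup>2 * (norm (cf f k))\<^sup>2))"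
        by (intro ennreal_leI) (simp add: mult_ac)
      also have "\<dots> \<le> (\<integral>\<^sup>+n. ennreal ((1 + R) powr (2 * \<beta>) / c0\<^sup>2 * 2 powr (real n * (2 * \<beta>)) * 2 ^ n * ((lpw \<zeta> \<theta> n k)\<^sup>2 * (norm (cf f k))\<^sup>2)) \<partial>cs)"
        by (rule nn_integral_ge_point) simp
      finally show ?thesis .
    qed
    have "sn \<beta> (cf f) \<le> (\<integral>\<^sup>+k. (\<integral>\<^sup>+n. ennreal ((1 + R) powr (2 * \<beta>) / c0\<^sup>2 * 2 powr (real n * (2 * \<beta>)) * 2 ^ n * ((lpw \<zeta> \<theta> n k)\<^sup>2 * (norm (cf f k))\<^sup>2)) \<partial>cs) \<partial>cs)"
      unfolding sn_def by (intro nn_integral_mono pw)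
    also have "\<dots> = (\<integral>\<^sup>+n. (\<integral>\<^sup>+k. ennreal ((1 + R) powr (2 * \<beta>) / c0\<^sup>2 * 2 powr (real n * (2 * \<beta>)) * 2 ^ n * ((lpw \<zeta> \<theta> n k)\<^sup>2 * (norm (cf f k))\<^sup>2)) \<partial>cs) \<partial>cs)"
      by (rule nn_integral_sum_swap[OF sigma_finite_cs]) simp
    also have "\<dots> \<le> (\<integral>\<^sup>+n. ennreal (D * N\<^sup>2) * ennreal ((1/2) ^ n) \<partial>cs)"
    proof (rule nn_integral_mono)
      fix n
      let ?E = "(1 + R) powr (2 * \<beta>) / c0\<^sup>2 * 2 powr (real n * (2 * \<beta>)) * 2 ^ n"
      have "(\<integral>\<^sup>+k. ennreal (?E * ((lpw \<zeta> \<theta> n k)\<^sup>2 * (norm (cf f k))\<^sup>2)) \<partial>cs) = ennreal ?E * (\<integral>\<^sup>+k. ennreal ((lpw \<zeta> \<theta> n k)\<^sup>2 * (norm (cf f k))\<^sup>2) \<partial>cs)"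
        by (subst nn_integral_cmult[symmetric]) (auto simp: ennreal_mult[symmetric])
      also have "\<dots> \<le> ennreal ?E * ennreal ((2 powr (- (real n - 1) * (\<beta> + 1)) * N)\<^sup>2)"
        by (rule mult_left_mono[OF block]) simp
      also have "\<dots> = ennreal (D * N\<^sup>2 * (1/2) ^ n)"
      proof -
        \<comment> \<open>The count of exponents: 2 n \<beta> from the Sobolev weight and n from the
          small block weight, against 2 (n - 1)(\<beta> + 1) from the block, leave -n up to a
          constant. This is the geometric series summed at the end.\<close>
        have "2 powr (real n * (2 * \<beta>)) * 2 ^ n * (2 powr (- (real n - 1) * (\<beta> + 1)))\<^sup>2 = 2 powr (2 * (\<beta> + 1)) * (1/2) ^ n"
        proof -
          have "2 powr (real n * (2 * \<beta>)) * 2 ^ n * (2 powr (- (real n - 1) * (\<beta> + 1)))\<^sup>2 =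
              2 powr (real n * (2 * \<beta>)) * 2 powr real n * (2 powr (- (real n - 1) * (\<beta> + 1)) * 2 powr (- (real n - 1) * (\<beta> + 1)))"
            by (simp only: power2_eq_square powr_realpow[OF zero_less_numeral])
          also have "\<dots> = 2 powr (real n * (2 * \<beta>) + real n + (- (real n - 1) * (\<beta> + 1) + - (real n - 1) * (\<beta> + 1)))"
            by (simp only: powr_add)
          also have "\<dots> = 2 powr (2 * (\<beta> + 1) + - real n)" by (rule arg_cong[where f = "\<lambda>u. 2 powr u"]) (simp add: algebra_simps)
          also have "\<dots> = 2 powr (2 * (\<beta> + 1)) * (1/2) ^ n" 
            by (simp only: powr_add powr_minus powr_realpow[OF zero_less_numeral] power_one_over inverse_eq_divide)
          finally show ?thesis .
        qed
        then have "?E * (2 powr (- (real n - 1) * (\<beta> + 1)) * N)\<^sup>2 = D * N\<^sup>2 * (1/2) ^ n"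
          by (simp add: D_def power_mult_distrib mult_ac) (simp add: mult.assoc[symmetric] mult.commute)?
        then show ?thesis by (simp flip: ennreal_mult)
      qed
      also have "\<dots> = ennreal (D * N\<^sup>2) * ennreal ((1/2) ^ n)" using D by (simp add: ennreal_mult)
      finally show "(\<integral>\<^sup>+k. ennreal (?E * ((lpw \<zeta> \<theta> n k)\<^sup>2 * (norm (cf f k))\<^sup>2)) \<partial>cs) \<le> ennreal (D * N\<^sup>2) * ennreal ((1/2) ^ n)" .
    qed
    also have "\<dots> = ennreal (D * N\<^sup>2) * (\<integral>\<^sup>+n. ennreal ((1/2) ^ n) \<partial>cs)"
      by (rule nn_integral_cmult) simp
    also have "(\<integral>\<^sup>+n. ennreal ((1/2) ^ n) \<partial>cs) = 2"
      by (subst nn_integral_count_space_nat, subst suminf_ennreal2) (auto simp: suminf_geometric)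
    finally show "sn \<beta> (cf f) \<le> ennreal (2 * D * N\<^sup>2)"
      using D by (simp add: mult_ac ennreal_mult)
  qed
qed

text \<open>Joins the two meanings of the Hoelder scale. For integer order even the order \<beta> +
  1 is controlled and then weakened. The bound is quantitative so that it can be applied to
  differences; an infinite norm makes it trivial.\<close>

lemma sn_C_norm:
  fixes \<zeta> \<theta> :: "real^'d::finite \<Rightarrow> real"
  assumes part: "dyadic_partition \<zeta> \<theta>" and \<beta>: "\<beta> \<ge> 0"
  obtains C where "C > 0" "\<And>f. periodic f \<Longrightarrow> continuous_on UNIV f \<Longrightarrow>
    (\<beta> + 1 \<in> \<nat> \<longrightarrow> C_diff (nat \<lfloor>\<beta> + 1\<rfloor>) f) \<Longrightarrow> sn \<beta> (cf f) \<le> ennreal C * (C_norm \<zeta> \<theta> (\<beta> + 1) f)\<^sup>2"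
proof (cases "\<beta> + 1 \<in> \<nat>")
  case True
  then obtain m where m: "\<beta> + 1 = real m" by (auto elim: Nats_cases)
  let ?C = "2 ^ m * real CARD('d) ^ m * (1 + real CARD('d))"
  have C: "?C > 0" by (simp add: add_pos_nonneg)
  show ?thesis
  proof (rule that[OF C])
    fix f :: "real^'d \<Rightarrow> real"
    assume f: "periodic f" "\<beta> + 1 \<in> \<nat> \<longrightarrow> C_diff (nat \<lfloor>\<beta> + 1\<rfloor>) f"
    then have cd: "C_diff m f" using True by (simp add: m)
    have Cn: "C_norm \<zeta> \<theta> (\<beta> + 1) f = C_diff_norm m f" using True by (simp add: C_norm_def m)
    show "sn \<beta> (cf f) \<le> ennreal ?C * (C_norm \<zeta> \<theta> (\<beta> + 1) f)\<^sup>2"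
    proof (cases "C_diff_norm m f")
      case (real N)
      have "sn \<beta> (cf f) \<le> sn (real m) (cf f)" by (rule sn_mono_exp) (use m in simp)
      also have "\<dots> \<le> ennreal (?C * N\<^sup>2)" by (rule sn_C_diff[OF cd f(1) real(2,1)])
      finally show ?thesis unfolding Cn real(2) using real(1) C by (simp add: ennreal_mult ennreal_power)
    next
      case top
      then show ?thesis using C by (simp add: Cn power2_eq_square ennreal_mult_top)
    qed
  qed
next
  case False
  obtain C where C: "C > 0" "\<And>f N. periodic f \<Longrightarrow> continuous_on UNIV f \<Longrightarrow>
    besov_norm \<zeta> \<theta> (\<beta> + 1) f = ennreal N \<Longrightarrow> N \<ge> 0 \<Longrightarrow> sn \<beta> (cf f) \<le> ennreal (C * N\<^sup>2)"
    using sn_besov[OF part \<beta>] by metis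
  show ?thesis
  proof (rule that[OF C(1)])
    fix f :: "real^'d \<Rightarrow> real"
    assume f: "periodic f" "continuous_on UNIV f"
    have Cn: "C_norm \<zeta> \<theta> (\<beta> + 1) f = besov_norm \<zeta> \<theta> (\<beta> + 1) f" using False by (simp add: C_norm_def)
    show "sn \<beta> (cf f) \<le> ennreal C * (C_norm \<zeta> \<theta> (\<beta> + 1) f)\<^sup>2"
    proof (cases "besov_norm \<zeta> \<theta> (\<beta> + 1) f")
      case (real N)
      from C(2)[OF f real(2,1)] show ?thesis unfolding Cn real(2) using real(1) C(1) by (simp add: ennreal_mult ennreal_power)
    next
      case top
      then show ?thesis using C(1) by (simp add: Cn power2_eq_square ennreal_mult_top)
    qed
  qed
qed

section \<open>The backward equation in Fourier coefficients\<close>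

lemma LINT_on:
  fixes f :: "real \<Rightarrow> 'b::{banach,second_countable_topology}"
  assumes "A \<in> sets lebesgue"
  shows "(LINT r:A|lebesgue. f r) = (\<integral>r. f r \<partial>lebesgue_on A)"
  unfolding set_lebesgue_integral_def using assms by (subst integral_restrict_space) auto

lemma AE_lebesgue_on_subset:
  assumes "AE r in lebesgue_on B. P r" "A \<subseteq> B" "A \<in> sets lebesgue" "B \<in> sets lebesgue"
  shows "AE r in lebesgue_on A. P r"
proof -
  have "AE r in lebesgue. r \<in> B \<longrightarrow> P r" using assms by (subst (asm) AE_restrict_space_iff) auto
  then have "AE r in lebesgue. r \<in> A \<longrightarrow> P r" by (rule AE_mp) (use assms in auto)
  then show ?thesis using assms by (subst AE_restrict_space_iff) auto
qed

lemma nn_integral_lebesgue_on_subset: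
  assumes "A \<subseteq> B" "A \<in> sets lebesgue" "B \<in> sets lebesgue"
  shows "(\<integral>\<^sup>+r. f r \<partial>lebesgue_on A) \<le> (\<integral>\<^sup>+r. f r \<partial>lebesgue_on B)"
  using assms by (simp add: nn_integral_restrict_space) (intro nn_integral_mono, auto simp: indicator_def)

lemma finite_lebesgue_on: "finite_measure (lebesgue_on {a..b :: real})"
  by (rule finite_measure_lebesgue_on) simp

lemma ennreal_le_one_plus_square: "(x :: ennreal)\<^sup>2 \<le> y \<Longrightarrow> x \<le> 1 + y"
proof -
  assume *: "x\<^sup>2 \<le> y"
  have "x \<le> 1 + x\<^sup>2"
  proof (cases x)
    case (real r)
    have "r \<le> 1 + r\<^sup>2" using zero_le_power2[of "r - 1/2"] by (simp add: power2_diff power2_eq_square algebra_simps)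
    then show ?thesis using real by (simp add: ennreal_power flip: ennreal_plus ennreal_1)
  qed (simp add: power2_eq_square ennreal_top_mult)
  also have "\<dots> \<le> 1 + y" using * by (rule add_left_mono)
  finally show "x \<le> 1 + y" .
qed

text \<open>Linear in \<open>sn\<close>, hence ready to be integrated in time; the price is the
  additive constant, harmless on a bounded interval.\<close>

lemma l1_le_sn:
  fixes c :: "int^'d::finite \<Rightarrow> complex"
  shows "(\<integral>\<^sup>+k. ennreal (norm (c k)) \<partial>cs) \<le> 1 + Zc \<alpha> TYPE('d) * sn \<alpha> c"
  by (rule ennreal_le_one_plus_square[OF sn_l1])

lemma borel_measurable_sn:
  fixes u :: "'a \<Rightarrow> int^'d::finite \<Rightarrow> complex"
  assumes "\<And>k. (\<lambda>r. u r k) \<in> borel_measurable M"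
  shows "(\<lambda>r. sn \<alpha> (u r)) \<in> borel_measurable M"
proof -
  have "(\<lambda>(r, k). ennreal (jb k powr (2 * \<alpha>) * (norm (u r k))\<^sup>2)) \<in> borel_measurable (M \<Otimes>\<^sub>M cs)"
    by (rule measurable_pair_cs) (use assms in measurable)
  from sigma_finite_measure.borel_measurable_nn_integral[OF sigma_finite_cs this]
  show ?thesis by (simp add: sn_def)
qed

text \<open>Lebesgue measure is complete, so functions known only up to null sets inherit
  measurability. This matters because pairings and Laplacians are identified with measurable series
  only for almost every time.\<close>

lemma borel_measurable_lebesgue_on_AE:
  fixes f g :: "real \<Rightarrow> 'b::euclidean_space"
  assumes "f \<in> borel_measurable (lebesgue_on A)" "AE r in lebesgue_on A. f r = g r" "A \<in> sets lebesgue"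
  shows "g \<in> borel_measurable (lebesgue_on A)"
proof -
  have A: "A \<inter> space lebesgue \<in> sets lebesgue" using assms(3) by simp
  have "(\<lambda>r. indicator A r *\<^sub>R f r) \<in> borel_measurable lebesgue"
    using assms(1) by (simp only: borel_measurable_restrict_space_iff[OF A])
  moreover have "AE r in lebesgue. indicator A r *\<^sub>R f r = indicator A r *\<^sub>R g r"
    using assms(2) unfolding AE_restrict_space_iff[OF A] by eventually_elim (auto simp: indicator_def)
  ultimately have "(\<lambda>r. indicator A r *\<^sub>R g r) \<in> borel_measurable lebesgue" by (rule borel_measurable_AE)
  then show ?thesis by (simp only: borel_measurable_restrict_space_iff[OF A])
qed

text \<open>Exchanges the time integral at each point with the series. Integrability in time of the
  squared norm of order \<alpha> > d/2 gives the absolute double integral required by Fubini.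
  Measurability of \<open>G\<close> in time is not assumed but follows from that of the
  coefficients.\<close>

lemma fser_time_integral:
  fixes u :: "real \<Rightarrow> int^'d::finite \<Rightarrow> complex" and G :: "real \<Rightarrow> real^'d \<Rightarrow> real"
    and a b :: real
  defines "M \<equiv> lebesgue_on {a..b}"
  assumes \<alpha>: "\<alpha> > real CARD('d) / 2"
    and u: "\<And>k. (\<lambda>r. u r k) \<in> borel_measurable M"
    and fin: "(\<integral>\<^sup>+r. sn \<alpha> (u r) \<partial>M) < \<infinity>"
    and G: "AE r in M. fser (u r) (\<lambda>x. of_real (G r x))"
  shows "fser (\<lambda>k. \<integral>r. u r k \<partial>M) (\<lambda>x. of_real (\<integral>r. G r x \<partial>M))"
    and "integrable M (\<lambda>r. u r k)"
proof -
  interpret finite_measure M unfolding M_def by (rule finite_lebesgue_on)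
  have sf: "sigma_finite_measure M" by (rule sigma_finite_measure_axioms)
  have snm: "(\<lambda>r. sn \<alpha> (u r)) \<in> borel_measurable M" by (rule borel_measurable_sn[OF u])
  have "(\<integral>\<^sup>+r. (\<integral>\<^sup>+k. norm (u r k) \<partial>cs) \<partial>M) \<le> (\<integral>\<^sup>+r. 1 + Zc \<alpha> TYPE('d) * sn \<alpha> (u r) \<partial>M)"
    by (intro nn_integral_mono l1_le_sn)
  also have "\<dots> = emeasure M (space M) + Zc \<alpha> TYPE('d) * (\<integral>\<^sup>+r. sn \<alpha> (u r) \<partial>M)"
    using snm by (simp add: nn_integral_add nn_integral_cmult)
  also have "\<dots> < \<infinity>"
    using fin Zc_finite[OF \<alpha>] by (simp add: ennreal_mult_eq_top_iff less_top[symmetric])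
  finally have n: "(\<integral>\<^sup>+r. (\<integral>\<^sup>+k. norm (u r k) \<partial>cs) \<partial>M) < \<infinity>" .
  moreover have "(\<integral>\<^sup>+r. (\<integral>\<^sup>+k. norm (u r k) \<partial>cs) \<partial>M) = (\<integral>\<^sup>+k. (\<integral>\<^sup>+r. norm (u r k) \<partial>M) \<partial>cs)"
    by (rule nn_integral_sum_swap[OF sf]) (use u in measurable)
  ultimately have n': "(\<integral>\<^sup>+k. (\<integral>\<^sup>+r. norm (u r k) \<partial>M) \<partial>cs) < \<infinity>" by simp
  show ui: "integrable M (\<lambda>r. u r k)" for k
  proof (rule integrableI_bounded[OF u])
    have "(\<integral>\<^sup>+r. norm (u r k) \<partial>M) \<le> (\<integral>\<^sup>+k. (\<integral>\<^sup>+r. norm (u r k) \<partial>M) \<partial>cs)"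
      by (rule nn_integral_ge_point) simp
    then show "(\<integral>\<^sup>+r. norm (u r k) \<partial>M) < \<infinity>" using n' by (rule le_less_trans)
  qed
  have ci: "integrable cs (\<lambda>k. \<integral>r. u r k \<partial>M)"
    by (rule integrable_sum_swap2[OF sf u n'])
  have "of_real (\<integral>r. G r x \<partial>M) = (\<integral>k. (\<integral>r. u r k \<partial>M) * ch k x \<partial>cs)" for x
  proof -
    have m: "(\<lambda>r. u r k * ch k x) \<in> borel_measurable M" for k using u[of k] by measurable
    have n'': "(\<integral>\<^sup>+k. (\<integral>\<^sup>+r. norm (u r k * ch k x) \<partial>M) \<partial>cs) < \<infinity>" using n' by (simp add: norm_mult)
    have i: "integrable M (\<lambda>r. \<integral>k. u r k * ch k x \<partial>cs)" by (rule integrable_sum_swap1[OF sf m n''])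
    have ae: "AE r in M. (\<integral>k. u r k * ch k x \<partial>cs) = complex_of_real (G r x)"
      using G by eventually_elim (auto simp: fser_def)
    have Gm: "(\<lambda>r. complex_of_real (G r x)) \<in> borel_measurable M"
      using borel_measurable_integrable[OF i] ae unfolding M_def by (rule borel_measurable_lebesgue_on_AE) simp
    have "of_real (\<integral>r. G r x \<partial>M) = (\<integral>r. complex_of_real (G r x) \<partial>M)" by simp
    also have "\<dots> = (\<integral>r. (\<integral>k. u r k * ch k x \<partial>cs) \<partial>M)"
      by (rule integral_cong_AE) (use ae Gm i in auto)
    also have "\<dots> = (\<integral>k. (\<integral>r. u r k * ch k x \<partial>M) \<partial>cs)" by (rule integral_sum_swap[OF sf m n''])
    finally show ?thesis by simp
  qed
  then show "fser (\<lambda>k. \<integral>r. u r k \<partial>M) (\<lambda>x. of_real (\<integral>r. G r x \<partial>M))" using ci by (simp add: fser_def)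
qed

section \<open>Continuous paths of coefficients\<close>

definition Cs :: "real \<Rightarrow> real \<Rightarrow> (real \<Rightarrow> int^'d::finite \<Rightarrow> complex) \<Rightarrow> bool" where
  "Cs T \<alpha> U \<longleftrightarrow> (\<forall>t\<in>{0..T}. sn \<alpha> (U t) < \<infinity> \<and>
     ((\<lambda>s. sn \<alpha> (\<lambda>k. U s k - U t k)) \<longlongrightarrow> 0) (at t within {0..T}))"

text \<open>The norm along the path is not known to be a continuous function with values in
  \<open>ennreal\<close>, so compactness is used through bisection on local bounds.\<close>

lemma locally_bounded_imp_bounded:
  fixes N :: "real \<Rightarrow> ennreal"
  assumes loc: "\<And>t. t \<in> {0..T} \<Longrightarrow> \<exists>B<\<infinity>. N t \<le> B \<and> eventually (\<lambda>s. N s \<le> B) (at t within {0..T})"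
  shows "\<exists>B<\<infinity>. \<forall>t\<in>{0..T}. N t \<le> B"
proof (cases "0 \<le> T")
  case True
  define P where "P a b \<longleftrightarrow> (\<exists>B<\<infinity>. \<forall>t\<in>{a..b} \<inter> {0..T}. N t \<le> B)" for a b
  have "P 0 T"
  proof (rule Bolzano[OF True])
    fix a b c assume "P a b" "P b c" "a \<le> b" "b \<le> c"
    then obtain B1 B2 where B: "B1 < \<infinity>" "\<And>t. t \<in> {a..b} \<inter> {0..T} \<Longrightarrow> N t \<le> B1"
      "B2 < \<infinity>" "\<And>t. t \<in> {b..c} \<inter> {0..T} \<Longrightarrow> N t \<le> B2" unfolding P_def by blast
    have "N t \<le> max B1 B2" if "t \<in> {a..c} \<inter> {0..T}" for t
      using B(2)[of t] B(4)[of t] that by (cases "t \<le> b") (auto simp: le_max_iff_disj)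
    moreover have "max B1 B2 < \<infinity>" using B(1,3) by (simp add: max_def)
    ultimately show "P a c" unfolding P_def by blast
  next
    fix x assume x: "0 \<le> x" "x \<le> T"
    then obtain B where B: "B < \<infinity>" "N x \<le> B" "eventually (\<lambda>s. N s \<le> B) (at x within {0..T})"
      using loc[of x] by auto
    then obtain d where d: "d > 0" "\<And>s. s \<in> {0..T} \<Longrightarrow> s \<noteq> x \<Longrightarrow> dist s x < d \<Longrightarrow> N s \<le> B"
      unfolding eventually_at by auto
    have "P a b" if "a \<le> x \<and> x \<le> b \<and> b - a < d" for a b
      unfolding P_def
    proof (intro exI[of _ B] conjI ballI B(1))
      fix s assume "s \<in> {a..b} \<inter> {0..T}"
      then show "N s \<le> B" using d(2)[of s] B(2) that by (cases "s = x") (auto simp: dist_real_def)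
    qed
    then show "\<exists>d>0. \<forall>a b. a \<le> x \<and> x \<le> b \<and> b - a < d \<longrightarrow> P a b" using d(1) by blast
  qed
  then show ?thesis by (auto simp: P_def)
next
  case False then show ?thesis by (intro exI[of _ 0]) auto
qed

lemma ennreal_tendsto_0_less:
  fixes f :: "'a \<Rightarrow> ennreal"
  assumes "(f \<longlongrightarrow> 0) F" "0 < e" shows "eventually (\<lambda>x. f x < e) F"
  by (rule order_tendstoD(2)[OF assms])

lemma Cs_bounded:
  assumes "Cs T \<alpha> U"
  obtains B where "B \<ge> 0" "\<And>t. t \<in> {0..T} \<Longrightarrow> sn \<alpha> (U t) \<le> ennreal B"
proof -
  have "\<exists>B<\<infinity>. \<forall>t\<in>{0..T}. sn \<alpha> (U t) \<le> B"
  proof (rule locally_bounded_imp_bounded)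
    fix t assume t: "t \<in> {0..T}"
    let ?B = "2 + 2 * sn \<alpha> (U t)"
    have fin: "sn \<alpha> (U t) < \<infinity>" using assms t by (auto simp: Cs_def)
    have "eventually (\<lambda>s. sn \<alpha> (\<lambda>k. U s k - U t k) < 1) (at t within {0..T})"
      by (rule ennreal_tendsto_0_less) (use assms t in \<open>auto simp: Cs_def\<close>)
    then have "eventually (\<lambda>s. sn \<alpha> (U s) \<le> ?B) (at t within {0..T})"
    proof eventually_elim
      case (elim s)
      have "sn \<alpha> (\<lambda>k. (U s k - U t k) + U t k) \<le> 2 * sn \<alpha> (\<lambda>k. U s k - U t k) + 2 * sn \<alpha> (U t)" by (rule sn_add)
      also have "\<dots> \<le> 2 * 1 + 2 * sn \<alpha> (U t)" using elim by (intro add_mono mult_left_mono) auto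
      finally show ?case by simp
    qed
    moreover have "sn \<alpha> (U t) \<le> ?B"
    proof -
      have "1 * sn \<alpha> (U t) \<le> 2 * sn \<alpha> (U t)" by (rule mult_right_mono) auto
      also have "\<dots> \<le> ?B" by simp
      finally show ?thesis by simp
    qed
    moreover have "?B < \<infinity>" using fin by (simp add: ennreal_mult_less_top)
    ultimately show "\<exists>B<\<infinity>. sn \<alpha> (U t) \<le> B \<and> eventually (\<lambda>s. sn \<alpha> (U s) \<le> B) (at t within {0..T})"
      by (intro exI[of _ ?B]) auto
  qed
  then obtain B where B: "B < \<infinity>" "\<And>t. t \<in> {0..T} \<Longrightarrow> sn \<alpha> (U t) \<le> B" by blast
  then obtain b where "b \<ge> 0" "B = ennreal b" by (cases B) auto
  then show ?thesis using that B by auto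
qed

lemma sn_ge_point: "ennreal (jb k powr (2 * \<alpha>) * (norm (c k))\<^sup>2) \<le> sn \<alpha> c"
  unfolding sn_def by (rule nn_integral_ge_point) simp

lemma norm_le_sn:
  assumes "sn \<alpha> c \<le> ennreal B" "B \<ge> 0"
  shows "norm (c k) \<le> jb k powr (- \<alpha>) * sqrt B"
proof -
  have "jb k powr (2 * \<alpha>) * (norm (c k))\<^sup>2 \<le> B"
    using order_trans[OF sn_ge_point assms(1)] assms(2) by simp
  then have "(jb k powr \<alpha> * norm (c k))\<^sup>2 \<le> B" by (simp add: power_mult_distrib jb_powr_sq)
  then have "jb k powr \<alpha> * norm (c k) \<le> sqrt B" by (rule real_le_rsqrt)
  then have "jb k powr (- \<alpha>) * (jb k powr \<alpha> * norm (c k)) \<le> jb k powr (- \<alpha>) * sqrt B"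
    by (rule mult_left_mono) simp
  then show ?thesis by (simp add: powr_minus field_simps)
qed

lemma sn_tendsto_0_coeff:
  assumes "((\<lambda>s. sn \<alpha> (c s)) \<longlongrightarrow> 0) G"
  shows "((\<lambda>s. c s k) \<longlongrightarrow> 0) G"
proof (rule tendstoI)
  fix e :: real assume e: "e > 0"
  define w where "w = jb k powr (2 * \<alpha>)"
  have w: "w > 0" by (simp add: w_def)
  have "eventually (\<lambda>s. sn \<alpha> (c s) < ennreal (w * e\<^sup>2)) G"
    by (rule ennreal_tendsto_0_less[OF assms]) (use e w in simp)
  then show "eventually (\<lambda>s. dist (c s k) 0 < e) G"
  proof eventually_elim
    case (elim s)
    have "ennreal (w * (norm (c s k))\<^sup>2) < ennreal (w * e\<^sup>2)"
      using order_le_less_trans[OF sn_ge_point[of k \<alpha> "c s"] elim] by (simp add: w_def)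
    then have "w * (norm (c s k))\<^sup>2 < w * e\<^sup>2" using w e by (simp add: ennreal_less_iff)
    then have "(norm (c s k))\<^sup>2 < e\<^sup>2" using w by simp
    then show ?case using e by (simp add: power_less_imp_less_base)
  qed
qed

lemma Cs_continuous:
  assumes "Cs T \<alpha> U" shows "continuous_on {0..T} (\<lambda>t. U t k)"
  unfolding continuous_on_def
proof
  fix t assume t: "t \<in> {0..T}"
  have "((\<lambda>s. U s k - U t k) \<longlongrightarrow> 0) (at t within {0..T})"
    by (rule sn_tendsto_0_coeff[of \<alpha> "\<lambda>s k. U s k - U t k"]) (use assms t in \<open>auto simp: Cs_def\<close>)
  then show "((\<lambda>s. U s k) \<longlongrightarrow> U t k) (at t within {0..T})" by (rule LIM_zero_cancel)
qed

lemma continuous_measurable_lebesgue_on: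
  fixes f :: "real \<Rightarrow> 'b::euclidean_space"
  assumes "continuous_on {0..T} f" "{a..b} \<subseteq> {0..T}"
  shows "f \<in> borel_measurable (lebesgue_on {a..b})"
  by (rule continuous_imp_measurable_on_sets_lebesgue) (use continuous_on_subset[OF assms] in auto)

lemma fourier_coeff_diff:
  "fourier_coeff (\<lambda>\<phi>. u \<phi> - v \<phi>) = (\<lambda>k. fourier_coeff u k - fourier_coeff v k)"
  by (simp add: fourier_coeff_def fun_eq_iff complex_eq_iff)

lemma C_sobolev_Cs: "C_sobolev T \<alpha> u \<Longrightarrow> Cs T \<alpha> (\<lambda>t. fourier_coeff (u t))"
  unfolding C_sobolev_def Cs_def sobolev_def sobolev_norm2_eq fourier_coeff_diff by auto

lemma Cs_cmult:
  assumes "Cs T \<alpha> (\<lambda>t k. of_real z * U t k)" "z \<noteq> 0"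
  shows "Cs T \<alpha> U"
  unfolding Cs_def
proof (intro ballI conjI)
  fix t assume t: "t \<in> {0..T}"
  have z: "ennreal ((norm (complex_of_real (1 / z)))\<^sup>2) < \<infinity>" by simp
  have eq: "sn \<alpha> c = ennreal ((norm (complex_of_real (1 / z)))\<^sup>2) * sn \<alpha> (\<lambda>k. of_real z * c k)" for c
    by (subst sn_cmult[symmetric]) (use assms(2) in simp)
  have 1: "sn \<alpha> (\<lambda>k. of_real z * U t k) < \<infinity>"
    "((\<lambda>s. sn \<alpha> (\<lambda>k. of_real z * U s k - of_real z * U t k)) \<longlongrightarrow> 0) (at t within {0..T})"
    using assms(1) t by (auto simp: Cs_def)
  show "sn \<alpha> (U t) < \<infinity>" using 1(1) by (subst eq) (simp add: ennreal_mult_less_top)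
  have "((\<lambda>s. ennreal ((norm (complex_of_real (1 / z)))\<^sup>2) * sn \<alpha> (\<lambda>k. of_real z * (U s k - U t k))) \<longlongrightarrow> ennreal ((norm (complex_of_real (1 / z)))\<^sup>2) * 0) (at t within {0..T})"
    using 1(2) by (intro ennreal_tendsto_cmult) (auto simp: right_diff_distrib)
  then show "((\<lambda>s. sn \<alpha> (\<lambda>k. U s k - U t k)) \<longlongrightarrow> 0) (at t within {0..T})"
    by (subst eq) simp
qed

lemma pairing_Cs:
  fixes f :: "real \<Rightarrow> real^'d::finite \<Rightarrow> real"
  assumes "C_sobolev T \<alpha> (\<lambda>s. pairing (f s))" "\<And>s. s \<in> {0..T} \<Longrightarrow> integrable tm (f s)"
  shows "Cs T \<alpha> (\<lambda>s. cf (f s))"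
proof (rule Cs_cmult)
  have eq: "fourier_coeff (pairing (f s)) = (\<lambda>k. of_real (vol TYPE('d)) * cf (f s) k)" if "s \<in> {0..T}" for s
    using fourier_coeff_pairing[OF assms(2)[OF that]] by (rule ext)
  have "Cs T \<alpha> (\<lambda>t. fourier_coeff (pairing (f t)))" by (rule C_sobolev_Cs[OF assms(1)])
  then have C: "sn \<alpha> (fourier_coeff (pairing (f t))) < \<infinity>"
    "((\<lambda>s. sn \<alpha> (\<lambda>k. fourier_coeff (pairing (f s)) k - fourier_coeff (pairing (f t)) k)) \<longlongrightarrow> 0) (at t within {0..T})"
    if "t \<in> {0..T}" for t using that by (auto simp: Cs_def)
  show "Cs T \<alpha> (\<lambda>s k. of_real (vol TYPE('d)) * cf (f s) k)"
    unfolding Cs_def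
  proof (intro ballI conjI)
    fix t assume t: "t \<in> {0..T}"
    show "sn \<alpha> (\<lambda>k. of_real (vol TYPE('d)) * cf (f t) k) < \<infinity>" using C(1)[OF t] by (simp add: eq[OF t])
    have "eventually (\<lambda>s. sn \<alpha> (\<lambda>k. fourier_coeff (pairing (f s)) k - fourier_coeff (pairing (f t)) k) =
        sn \<alpha> (\<lambda>k. of_real (vol TYPE('d)) * cf (f s) k - of_real (vol TYPE('d)) * cf (f t) k)) (at t within {0..T})"
      unfolding eventually_at by (intro exI[of _ 1]) (auto simp: eq[OF t] eq)
    then show "((\<lambda>s. sn \<alpha> (\<lambda>k. of_real (vol TYPE('d)) * cf (f s) k - of_real (vol TYPE('d)) * cf (f t) k)) \<longlongrightarrow> 0) (at t within {0..T})"
      using C(2)[OF t] by (rule Lim_transform_eventually[rotated])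
  qed
qed simp

lemma partial_d_lincomb:
  fixes f g :: "real^'d::finite \<Rightarrow> real"
  assumes "f differentiable_on UNIV" "g differentiable_on UNIV"
  shows "partial_d i (\<lambda>x. a * f x + b * g x) = (\<lambda>x. a * partial_d i f x + b * partial_d i g x)"
    "(\<lambda>x. a * f x + b * g x) differentiable_on UNIV"
proof -
  have d: "(f has_derivative frechet_derivative f (at x)) (at x)" "(g has_derivative frechet_derivative g (at x)) (at x)" for x
    using assms by (auto simp: differentiable_on_def frechet_derivative_works)
  have D: "((\<lambda>x. a * f x + b * g x) has_derivative (\<lambda>h. a * frechet_derivative f (at x) h + b * frechet_derivative g (at x) h)) (at x)" for x
    by (intro has_derivative_add has_derivative_mult_right d)
  show "(\<lambda>x. a * f x + b * g x) differentiable_on UNIV"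
    using D by (auto simp: differentiable_on_def differentiable_def)
  show "partial_d i (\<lambda>x. a * f x + b * g x) = (\<lambda>x. a * partial_d i f x + b * partial_d i g x)"
    unfolding partial_d_def frechet_derivative_at[OF D, symmetric] by (rule refl)
qed

lemma C_diff_lincomb:
  "C_diff m f \<Longrightarrow> C_diff m g \<Longrightarrow> C_diff m (\<lambda>x. a * f x + b * g x)"
  by (induction m arbitrary: f g) (auto simp: partial_d_lincomb intro!: continuous_intros)

lemma cf_diff:
  assumes "integrable tm f" "integrable tm g"
  shows "cf (\<lambda>x. f x - g x) k = cf f k - cf g k"
proof -
  have "integrable tm (\<lambda>x. complex_of_real (f x) * ch (- k) x)" "integrable tm (\<lambda>x. complex_of_real (g x) * ch (- k) x)"
    by (rule integrable_mult_ch, use assms in simp)+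
  then show ?thesis
    unfolding fc_def of_real_diff left_diff_distrib by (simp add: diff_divide_distrib)
qed

section \<open>The density and the force in Sobolev terms\<close>

locale density_path = kernel K for K :: "real^'d::finite \<Rightarrow> real^'d" +
  fixes T \<beta> :: real and \<rho> :: "real \<Rightarrow> real^'d \<Rightarrow> real" and F :: "real^'d \<Rightarrow> real^'d"
    and \<zeta> \<theta> :: "real^'d \<Rightarrow> real"
  assumes T: "T > 0" and beta: "\<beta> > real CARD('d) / 2" and part: "dyadic_partition \<zeta> \<theta>"
    and rho_path: "C_path \<zeta> \<theta> T (\<beta> + 1) \<rho>" and F_space: "\<And>i. C_space \<zeta> \<theta> (\<beta> + 1) (\<lambda>x. F x $ i)"
    and rho_prob: "\<And>t. t \<in> {0..T} \<Longrightarrow> probability_density (\<rho> t)"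
begin

lemma beta_nonneg: "\<beta> \<ge> 0" and beta1: "\<beta> + 1 > real CARD('d) / 2" and beta2: "\<beta> + 2 > real CARD('d) / 2"
proof -
  have "real CARD('d) / 2 \<ge> 0" by simp
  then show "\<beta> \<ge> 0" "\<beta> + 1 > real CARD('d) / 2" "\<beta> + 2 > real CARD('d) / 2" using beta by linarith+
qed

lemma rho_regular:
  assumes "t \<in> {0..T}"
  shows "periodic (\<rho> t)" "continuous_on UNIV (\<rho> t)" "integrable tm (\<rho> t)"
    "\<beta> + 1 \<in> \<nat> \<longrightarrow> C_diff (nat \<lfloor>\<beta> + 1\<rfloor>) (\<rho> t)" "C_norm \<zeta> \<theta> (\<beta> + 1) (\<rho> t) < \<infinity>"
proof -
  have "C_space \<zeta> \<theta> (\<beta> + 1) (\<rho> t)" using rho_path assms unfolding C_path_def by blast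
  then show "periodic (\<rho> t)" "continuous_on UNIV (\<rho> t)"
    "\<beta> + 1 \<in> \<nat> \<longrightarrow> C_diff (nat \<lfloor>\<beta> + 1\<rfloor>) (\<rho> t)" "C_norm \<zeta> \<theta> (\<beta> + 1) (\<rho> t) < \<infinity>"
    unfolding C_space_def by blast+
  then show "integrable tm (\<rho> t)" by (intro integrable_tm_continuous)
qed

text \<open>\<open>sn_C_norm\<close> applied to the differences of the density at two times carries
  the continuity over to the Sobolev norm.\<close>

lemma rho_Cs: "Cs T \<beta> (\<lambda>t. cf (\<rho> t))"
proof -
  obtain C where C: "C > 0" "\<And>f. periodic f \<Longrightarrow> continuous_on UNIV f \<Longrightarrow>
    (\<beta> + 1 \<in> \<nat> \<longrightarrow> C_diff (nat \<lfloor>\<beta> + 1\<rfloor>) f) \<Longrightarrow> sn \<beta> (cf f) \<le> ennreal C * (C_norm \<zeta> \<theta> (\<beta> + 1) f)\<^sup>2"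
    using sn_C_norm[OF part beta_nonneg] by metis
  show ?thesis unfolding Cs_def
  proof (intro ballI conjI)
    fix t assume t: "t \<in> {0..T}"
    show "sn \<beta> (cf (\<rho> t)) < \<infinity>"
      by (rule le_less_trans[OF C(2)]) (use rho_regular[OF t] in \<open>auto simp: ennreal_mult_less_top power_less_top_ennreal\<close>)
    define N where "N s = C_norm \<zeta> \<theta> (\<beta> + 1) (\<lambda>x. \<rho> s x - \<rho> t x)" for s
    have N: "(N \<longlongrightarrow> 0) (at t within {0..T})" using rho_path t unfolding N_def[abs_def] C_path_def by blast
    have le: "sn \<beta> (\<lambda>k. cf (\<rho> s) k - cf (\<rho> t) k) \<le> ennreal C * (N s)\<^sup>2" if s: "s \<in> {0..T}" for s
    proof -
      have "sn \<beta> (cf (\<lambda>x. \<rho> s x - \<rho> t x)) \<le> ennreal C * (C_norm \<zeta> \<theta> (\<beta> + 1) (\<lambda>x. \<rho> s x - \<rho> t x))\<^sup>2"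
      proof (rule C(2))
        show "periodic (\<lambda>x. \<rho> s x - \<rho> t x)" using rho_regular(1)[OF s] rho_regular(1)[OF t] by (simp add: periodic_def)
        show "continuous_on UNIV (\<lambda>x. \<rho> s x - \<rho> t x)"
          using rho_regular(2)[OF s] rho_regular(2)[OF t] by (intro continuous_intros)
        show "\<beta> + 1 \<in> \<nat> \<longrightarrow> C_diff (nat \<lfloor>\<beta> + 1\<rfloor>) (\<lambda>x. \<rho> s x - \<rho> t x)"
          using C_diff_lincomb[of _ "\<rho> s" "\<rho> t" 1 "- 1"] rho_regular(4)[OF s] rho_regular(4)[OF t] by simp
      qed
      moreover have "cf (\<lambda>x. \<rho> s x - \<rho> t x) = (\<lambda>k. cf (\<rho> s) k - cf (\<rho> t) k)"
        by (rule ext) (rule cf_diff[OF rho_regular(3)[OF s] rho_regular(3)[OF t]])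
      ultimately show ?thesis by (simp add: N_def)
    qed
    have "((\<lambda>s. ennreal C * (N s * N s)) \<longlongrightarrow> ennreal C * (0 * 0)) (at t within {0..T})"
      by (intro tendsto_mult_ennreal tendsto_const N) auto
    then have lim: "((\<lambda>s. ennreal C * (N s)\<^sup>2) \<longlongrightarrow> 0) (at t within {0..T})" by (simp add: power2_eq_square)
    show "((\<lambda>s. sn \<beta> (\<lambda>k. cf (\<rho> s) k - cf (\<rho> t) k)) \<longlongrightarrow> 0) (at t within {0..T})"
    proof (rule tendsto_sandwich[OF _ _ tendsto_const lim])
      show "\<forall>\<^sub>F s in at t within {0..T}. sn \<beta> (\<lambda>k. cf (\<rho> s) k - cf (\<rho> t) k) \<le> ennreal C * (N s)\<^sup>2"
        unfolding eventually_at using le by (intro exI[of _ 1]) auto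
    qed simp
  qed
qed

lemma rho_fser: "t \<in> {0..T} \<Longrightarrow> fser (cf (\<rho> t)) (\<lambda>x. of_real (\<rho> t x))"
  using rho_Cs rho_regular beta by (intro sobolev_fser) (auto simp: Cs_def)

lemma F_sn: "sn \<beta> (cf (\<lambda>x. F x $ i)) < \<infinity>"
proof -
  obtain C where C: "C > 0" "\<And>f. periodic f \<Longrightarrow> continuous_on UNIV f \<Longrightarrow>
    (\<beta> + 1 \<in> \<nat> \<longrightarrow> C_diff (nat \<lfloor>\<beta> + 1\<rfloor>) f) \<Longrightarrow> sn \<beta> (cf f) \<le> ennreal C * (C_norm \<zeta> \<theta> (\<beta> + 1) f)\<^sup>2"
    using sn_C_norm[OF part beta_nonneg] by metis
  show ?thesis
    by (rule le_less_trans[OF C(2)]) (use F_space[of i] in \<open>auto simp: C_space_def ennreal_mult_less_top power_less_top_ennreal\<close>)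
qed

lemma F_fser: "fser (cf (\<lambda>x. F x $ i)) (\<lambda>x. of_real (F x $ i))"
  using F_space[of i] F_sn[of i] beta by (intro sobolev_fser) (auto simp: C_space_def)

text \<open>The density path is bounded in norm over [0,T], so one constant serves all times; the
  norms of all components of \<open>F\<close> are added to it to dominate each of them.\<close>

lemma tr_bound:
  obtains C where "C \<ge> 0" "\<And>t c. t \<in> {0..T} \<Longrightarrow> sn \<beta> (tr K F (cf (\<rho> t)) c) \<le> ennreal C * sn (\<beta> + 1) c"
proof -
  obtain B where B: "B \<ge> 0" "\<And>t. t \<in> {0..T} \<Longrightarrow> sn \<beta> (cf (\<rho> t)) \<le> ennreal B" using Cs_bounded[OF rho_Cs] by metis
  define R where "R = ennreal B + (\<Sum>i\<in>UNIV. sn \<beta> (cf (\<lambda>x. F x $ i)))"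
  have R: "R < \<infinity>" using F_sn by (simp add: R_def less_top[symmetric])
  obtain C where "C \<ge> 0" and C: "\<And>r c. sn \<beta> r \<le> R \<Longrightarrow> (\<And>i. sn \<beta> (cf (\<lambda>x. F x $ i)) \<le> R) \<Longrightarrow>
    sn \<beta> (tr K F r c) \<le> ennreal C * sn (\<beta> + 1) c"
    using sn_tr_bound[OF beta R, of F] by metis
  have FR: "sn \<beta> (cf (\<lambda>x. F x $ i)) \<le> R" for i
    unfolding R_def by (rule order_trans[OF member_le_sum[of i UNIV "\<lambda>i. sn \<beta> (cf (\<lambda>x. F x $ i))"]]) auto
  have rR: "sn \<beta> (cf (\<rho> t)) \<le> R" if "t \<in> {0..T}" for t
    unfolding R_def using B(2)[OF that] by (rule order_trans) simp
  show ?thesis using that[OF \<open>C \<ge> 0\<close>] C[OF rR FR] by blast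
qed

lemma tr_measurable:
  assumes "{a..b} \<subseteq> {0..T}" and c: "\<And>k. (\<lambda>r. c r k) \<in> borel_measurable (lebesgue_on {a..b})"
  shows "(\<lambda>r. tr K F (cf (\<rho> r)) (c r) k) \<in> borel_measurable (lebesgue_on {a..b})"
proof -
  note [measurable] = c
  have [measurable]: "(\<lambda>r. cf (\<rho> r) k) \<in> borel_measurable (lebesgue_on {a..b})" for k
    by (rule continuous_measurable_lebesgue_on[OF Cs_continuous[OF rho_Cs] assms(1)])
  show ?thesis unfolding tr_def conv_def dcf_def
    by (intro borel_measurable_sum borel_measurable_add borel_measurable_times borel_measurable_sum_cs) measurable
qed

lemma dual_transport_fser:
  assumes t: "t \<in> {0..T}" and f: "fser c (\<lambda>x. of_real (f x))" and c: "sn (\<beta> + 1) c < \<infinity>"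
  shows "fser (tr K F (cf (\<rho> t)) c) (\<lambda>x. of_real (dual_transport K F (\<rho> t) f x))"
  by (rule fser_dual_transport[OF rho_fser[OF t] F_fser f sn_deriv_integrable[OF beta c]])

end

section \<open>Regularity and coefficient form of the backward solution\<close>

locale backward = density_path K T \<beta> \<rho> F \<zeta> \<theta>
  for K :: "real^'d::finite \<Rightarrow> real^'d" and T \<beta> :: real and \<rho> :: "real \<Rightarrow> real^'d \<Rightarrow> real"
    and F :: "real^'d \<Rightarrow> real^'d" and \<zeta> \<theta> :: "real^'d \<Rightarrow> real" +
  fixes \<sigma> t :: real and \<phi> :: "real^'d \<Rightarrow> real" and f :: "real \<Rightarrow> real^'d \<Rightarrow> real"
  assumes t: "t \<in> {0..T}" and sol: "backward_solution \<beta> \<sigma> K F \<rho> t \<phi> f"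
begin

lemma f_regular: "s \<in> {0..t} \<Longrightarrow> periodic (f s)" "s \<in> {0..t} \<Longrightarrow> continuous_on UNIV (f s)"
  "s \<in> {0..t} \<Longrightarrow> integrable tm (f s)"
proof -
  have r: "\<forall>s\<in>{0..t}. periodic (f s) \<and> continuous_on UNIV (f s)"
    using sol unfolding backward_solution_def by (elim conjE)
  show "periodic (f s)" "continuous_on UNIV (f s)" if "s \<in> {0..t}" using r that by blast+
  then show "s \<in> {0..t} \<Longrightarrow> integrable tm (f s)" by (rule integrable_tm_continuous)
qed

lemma f_Cs: "Cs t (\<beta> + 1) (\<lambda>s. cf (f s))"
proof (rule pairing_Cs[OF _ f_regular(3)])
  show "C_sobolev t (\<beta> + 1) (\<lambda>s. pairing (f s))"
    using sol unfolding backward_solution_def by (elim conjE)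
qed

lemma f_sn: "s \<in> {0..t} \<Longrightarrow> sn (\<beta> + 1) (cf (f s)) < \<infinity>"
  using f_Cs by (auto simp: Cs_def)

lemma f_fser: "s \<in> {0..t} \<Longrightarrow> fser (cf (f s)) (\<lambda>x. of_real (f s x))"
  by (rule sobolev_fser[OF f_regular(1,2) beta1 f_sn])

lemma f_measurable: "{a..b} \<subseteq> {0..t} \<Longrightarrow> (\<lambda>s. cf (f s) k) \<in> borel_measurable (lebesgue_on {a..b})"
  by (rule continuous_measurable_lebesgue_on[OF Cs_continuous[OF f_Cs]])

lemma f_L2: "(\<integral>\<^sup>+s. sn (\<beta> + 2) (cf (f s)) \<partial>lebesgue_on {0..t}) < \<infinity>"
proof -
  have L: "(\<integral>\<^sup>+s. sobolev_norm2 (\<beta> + 2) (pairing (f s)) \<partial>lebesgue_on {0..t}) < \<infinity>"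
    using sol unfolding backward_solution_def L2_sobolev_def by (elim conjE)
  have "(\<integral>\<^sup>+s. sobolev_norm2 (\<beta> + 2) (pairing (f s)) \<partial>lebesgue_on {0..t}) =
      (\<integral>\<^sup>+s. ennreal ((vol TYPE('d))\<^sup>2) * sn (\<beta> + 2) (cf (f s)) \<partial>lebesgue_on {0..t})"
    by (rule nn_integral_cong) (simp add: sobolev_norm2_pairing f_regular)
  also have "\<dots> = ennreal ((vol TYPE('d))\<^sup>2) * (\<integral>\<^sup>+s. sn (\<beta> + 2) (cf (f s)) \<partial>lebesgue_on {0..t})"
    by (rule nn_integral_cmult, rule borel_measurable_sn, rule f_measurable) simp
  finally show ?thesis using L by (auto simp: ennreal_mult_less_top)
qed

lemma f_AE: "AE s in lebesgue_on {0..t}. sn (\<beta> + 2) (cf (f s)) < \<infinity>"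
proof -
  have "(\<lambda>s. sn (\<beta> + 2) (cf (f s))) \<in> borel_measurable (lebesgue_on {0..t})"
    by (rule borel_measurable_sn) (rule f_measurable, simp)
  from nn_integral_PInf_AE[OF this] f_L2 show ?thesis by (simp add: less_top)
qed

definition lap :: "real \<Rightarrow> int^'d \<Rightarrow> complex" where
  "lap s k = - of_real ((norm (freq k))\<^sup>2) * cf (f s) k"

text \<open>The second derivatives are classical only at times when the solution lies in the space
  of order \<beta> + 2, which by \<open>f_AE\<close> is almost every time.\<close>

lemma lap_fser:
  assumes s: "s \<in> {0..t}" and fin: "sn (\<beta> + 2) (cf (f s)) < \<infinity>"
  shows "fser (lap s) (\<lambda>x. of_real (laplacian (f s) x))"
proof -
  let ?c = "cf (f s)"
  have 1: "fser (dcf i ?c) (\<lambda>x. of_real (partial_d i (f s) x))" for i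
    using fser_partial(2)[OF f_fser[OF s] sn_deriv_integrable[OF beta f_sn[OF s]]]
    by (simp add: dcf_def[abs_def])
  have 2: "sn (\<beta> + 1) (dcf i ?c) < \<infinity>" for i
    using sn_deriv[of "\<beta> + 1" i ?c] fin by (simp add: dcf_def[abs_def] add.assoc)
  have "fser (dcf i (dcf i ?c)) (\<lambda>x. of_real (partial_d i (partial_d i (f s)) x))" for i
    using fser_partial(2)[OF 1 sn_deriv_integrable[OF beta 2]] by (simp add: dcf_def[abs_def])
  then have "fser (\<lambda>k. \<Sum>i\<in>UNIV. dcf i (dcf i ?c) k) (\<lambda>x. \<Sum>i\<in>UNIV. of_real (partial_d i (partial_d i (f s)) x))"
    by (intro fser_sum)
  moreover have "(\<Sum>i\<in>UNIV. dcf i (dcf i ?c) k) = lap s k" for k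
  proof -
    have "(\<Sum>i\<in>UNIV. dcf i (dcf i ?c) k) = (\<Sum>i\<in>UNIV. - of_real ((freq k $ i)\<^sup>2) * ?c k)"
      by (simp add: dcf_def power2_eq_square mult_ac) (simp add: mult.assoc[symmetric])?
    also have "\<dots> = - of_real (\<Sum>i\<in>UNIV. (freq k $ i)\<^sup>2) * ?c k"
      by (simp add: sum_distrib_right sum_negf)
    also have "(\<Sum>i\<in>UNIV. (freq k $ i)\<^sup>2) = (norm (freq k))\<^sup>2"
      by (simp add: norm_vec_def L2_set_def sum_nonneg)
    finally show ?thesis by (simp add: lap_def)
  qed
  ultimately show ?thesis by (simp add: laplacian_def)
qed

lemma sn_lap: "sn \<beta> (lap s) \<le> sn (\<beta> + 2) (cf (f s))"
  unfolding sn_def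
proof (intro nn_integral_mono ennreal_leI)
  fix k :: "int^'d"
  have "((norm (freq k))\<^sup>2)\<^sup>2 \<le> ((jb k)\<^sup>2)\<^sup>2" by (intro power_mono norm_freq_le_jb) auto
  moreover have "jb k powr (2 * (\<beta> + 2)) = jb k powr (2 * \<beta>) * ((jb k)\<^sup>2)\<^sup>2"
    using powr_realpow[of "jb k" 4] by (simp add: distrib_left powr_add)
  ultimately show "jb k powr (2 * \<beta>) * (norm (lap s k))\<^sup>2 \<le> jb k powr (2 * (\<beta> + 2)) * (norm (cf (f s) k))\<^sup>2"
    by (simp add: lap_def norm_mult norm_power power_mult_distrib mult.assoc mult_left_mono mult_right_mono del: power_mult[symmetric])
qed

definition tf :: "real \<Rightarrow> int^'d \<Rightarrow> complex" where "tf r = tr K F (cf (\<rho> r)) (cf (f r))"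

text \<open>Minus the time derivative of the coefficients of the backward solution, as the equation
  is integrated from s up to the terminal time.\<close>

definition G :: "real \<Rightarrow> int^'d \<Rightarrow> complex" where "G r k = of_real \<sigma> * lap r k + tf r k"

lemma sub_T: "{0..t} \<subseteq> {0..T}" using t by auto

lemma tf_bound: obtains C where "C \<ge> 0" "\<And>r. r \<in> {0..t} \<Longrightarrow> sn \<beta> (tf r) \<le> ennreal C"
proof -
  obtain C where C: "C \<ge> 0" "\<And>t c. t \<in> {0..T} \<Longrightarrow> sn \<beta> (tr K F (cf (\<rho> t)) c) \<le> ennreal C * sn (\<beta> + 1) c"
    using tr_bound by metis
  obtain B where B: "B \<ge> 0" "\<And>s. s \<in> {0..t} \<Longrightarrow> sn (\<beta> + 1) (cf (f s)) \<le> ennreal B" using Cs_bounded[OF f_Cs] by metis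
  show ?thesis
  proof (rule that[of "C * B"])
    show "C * B \<ge> 0" using C B by simp
    fix r assume r: "r \<in> {0..t}"
    have "sn \<beta> (tf r) \<le> ennreal C * sn (\<beta> + 1) (cf (f r))" unfolding tf_def using C(2) r sub_T by blast
    also have "\<dots> \<le> ennreal C * ennreal B" by (rule mult_left_mono[OF B(2)[OF r]]) simp
    finally show "sn \<beta> (tf r) \<le> ennreal (C * B)" using C B by (simp add: ennreal_mult)
  qed
qed

lemma tf_measurable: "{a..b} \<subseteq> {0..t} \<Longrightarrow> (\<lambda>r. tf r k) \<in> borel_measurable (lebesgue_on {a..b})"
  unfolding tf_def by (rule tr_measurable) (use f_measurable sub_T in auto)

lemma lap_measurable: "{a..b} \<subseteq> {0..t} \<Longrightarrow> (\<lambda>r. lap r k) \<in> borel_measurable (lebesgue_on {a..b})"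
  unfolding lap_def using f_measurable[of a b k] by measurable

text \<open>All terms of the pointwise equation are absolutely convergent series after integration
  in time, so equality of the functions at every x gives equality of the coefficients.\<close>

lemma f_time_eq:
  assumes s: "s \<in> {0..t}"
  shows "cf (f s) k = cf (f t) k + (\<integral>r. G r k \<partial>lebesgue_on {s..t})"
    and "integrable (lebesgue_on {s..t}) (\<lambda>r. G r k)"
proof -
  let ?M = "lebesgue_on {s..t}"
  have st: "{s..t} \<subseteq> {0..t}" using s by auto
  have lf: "(\<integral>\<^sup>+r. sn \<beta> (lap r) \<partial>?M) < \<infinity>"
  proof -
    have "(\<integral>\<^sup>+r. sn \<beta> (lap r) \<partial>?M) \<le> (\<integral>\<^sup>+r. sn (\<beta> + 2) (cf (f r)) \<partial>?M)" by (rule nn_integral_mono) (rule sn_lap)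
    also have "\<dots> \<le> (\<integral>\<^sup>+r. sn (\<beta> + 2) (cf (f r)) \<partial>lebesgue_on {0..t})"
      by (rule nn_integral_lebesgue_on_subset[OF st]) auto
    finally show ?thesis using f_L2 by (rule le_less_trans)
  qed
  have la: "AE r in ?M. fser (lap r) (\<lambda>x. of_real (laplacian (f r) x))"
  proof -
    have "AE r in ?M. sn (\<beta> + 2) (cf (f r)) < \<infinity>" by (rule AE_lebesgue_on_subset[OF f_AE st]) auto
    then show ?thesis by (rule AE_mp) (rule AE_I2, use st lap_fser in \<open>auto simp: space_restrict_space\<close>)
  qed
  have tfin: "(\<integral>\<^sup>+r. sn \<beta> (tf r) \<partial>?M) < \<infinity>"
  proof -
    interpret finite_measure ?M by (rule finite_lebesgue_on)
    obtain C where C: "C \<ge> 0" "\<And>r. r \<in> {0..t} \<Longrightarrow> sn \<beta> (tf r) \<le> ennreal C" using tf_bound by metis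
    have em: "emeasure ?M (space ?M) < \<infinity>" by (simp add: less_top[symmetric])
    have "(\<integral>\<^sup>+r. sn \<beta> (tf r) \<partial>?M) \<le> (\<integral>\<^sup>+r. ennreal C \<partial>?M)"
      by (rule nn_integral_mono) (use C(2) st in \<open>auto simp: space_restrict_space\<close>)
    also have "\<dots> = ennreal C * emeasure ?M (space ?M)" by (rule nn_integral_const)
    also have "\<dots> < \<infinity>" using em by (simp add: ennreal_mult_less_top)
    finally show ?thesis .
  qed
  have ta: "AE r in ?M. fser (tf r) (\<lambda>x. of_real (dual_transport K F (\<rho> r) (f r) x))"
  proof (rule AE_I2)
    fix r assume "r \<in> space ?M"
    then have "r \<in> {0..t}" using st by (auto simp: space_restrict_space)
    then show "fser (tf r) (\<lambda>x. of_real (dual_transport K F (\<rho> r) (f r) x))"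
      unfolding tf_def using sub_T by (intro dual_transport_fser f_fser f_sn) auto
  qed
  note L = fser_time_integral[OF beta lap_measurable[OF st] lf la]
  note R = fser_time_integral[OF beta tf_measurable[OF st] tfin ta]
  have tt: "t \<in> {0..t}" using t by auto
  have eq: "f s x = \<phi> x + \<sigma> * (LINT r:{s..t}|lebesgue. laplacian (f r) x)
          + (LINT r:{s..t}|lebesgue. dual_transport K F (\<rho> r) (f r) x)" if "s \<in> {0..t}" for s x
    using sol that unfolding backward_solution_def by (elim conjE) blast
  \<comment> \<open>At s = t both integrals run over a single point and vanish.\<close>
  have phi: "f t = \<phi>"
  proof
    fix x
    have "emeasure lebesgue {t} = 0" by simp
    then have "(LINT r:{t..t}|lebesgue. g r) = 0" for g :: "real \<Rightarrow> real"
      unfolding set_lebesgue_integral_def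
      by (intro integral_eq_zero_AE) (rule AE_I'[of "{t}"], auto simp: null_sets_def indicator_def split: if_splits)
    then show "f t x = \<phi> x" using eq[OF tt, of x] by simp
  qed
  have "fser (\<lambda>k. cf (f t) k + of_real \<sigma> * (\<integral>r. lap r k \<partial>?M) + (\<integral>r. tf r k \<partial>?M))
      (\<lambda>x. of_real (f t x) + of_real \<sigma> * of_real (\<integral>r. laplacian (f r) x \<partial>?M) + of_real (\<integral>r. dual_transport K F (\<rho> r) (f r) x \<partial>?M))"
    by (intro fser_add fser_cmult L R f_fser tt)
  moreover have "(\<lambda>x. complex_of_real (f s x)) = (\<lambda>x. of_real (f t x) + of_real \<sigma> * of_real (\<integral>r. laplacian (f r) x \<partial>?M) + of_real (\<integral>r. dual_transport K F (\<rho> r) (f r) x \<partial>?M))"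
    by (rule ext) (simp add: eq[OF s] phi LINT_on)
  ultimately have "fser (\<lambda>k. cf (f t) k + of_real \<sigma> * (\<integral>r. lap r k \<partial>?M) + (\<integral>r. tf r k \<partial>?M)) (\<lambda>x. of_real (f s x))"
    by (simp only:)
  from fser_fc[OF this]
  have "cf (f s) k = cf (f t) k + of_real \<sigma> * (\<integral>r. lap r k \<partial>?M) + (\<integral>r. tf r k \<partial>?M)" .
  also have "\<dots> = cf (f t) k + (\<integral>r. G r k \<partial>?M)"
    using L(2)[of k] R(2)[of k] by (simp add: G_def)
  finally show "cf (f s) k = cf (f t) k + (\<integral>r. G r k \<partial>?M)" .
  show "integrable ?M (\<lambda>r. G r k)" unfolding G_def using L(2)[of k] R(2)[of k] by auto
qed

lemma f_terminal: "f t = \<phi>"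
proof
  fix x
  have "(LINT r:{t..t}|lebesgue. g r) = 0" for g :: "real \<Rightarrow> real"
    unfolding set_lebesgue_integral_def
    by (intro integral_eq_zero_AE) (rule AE_I'[of "{t}"], auto simp: null_sets_def indicator_def split: if_splits)
  moreover have "f t x = \<phi> x + \<sigma> * (LINT r:{t..t}|lebesgue. laplacian (f r) x)
          + (LINT r:{t..t}|lebesgue. dual_transport K F (\<rho> r) (f r) x)"
    using sol t unfolding backward_solution_def by (elim conjE) auto
  ultimately show "f t x = \<phi> x" by simp
qed

end

section \<open>Trigonometric polynomials as test functions\<close>

lemma fser_integrable: "fser c F \<Longrightarrow> integrable cs c"
  unfolding fser_def by (elim conjE)

text \<open>The real part is taken term by term, so that this is a real function for any
  coefficients. It has the coefficients \<open>c\<close> on \<open>A\<close> when \<open>A\<close>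
  is symmetric and \<open>c\<close> is Hermitian.\<close>

definition tpf :: "(int^'d::finite) set \<Rightarrow> (int^'d \<Rightarrow> complex) \<Rightarrow> real^'d \<Rightarrow> real" where
  "tpf A c x = (\<Sum>k\<in>A. Re (c k * ch k x))"

lemma tpf_has_derivative:
  "(tpf A c has_derivative (\<lambda>h. \<Sum>k\<in>A. Re (c k * (\<i> * of_real (freq k \<bullet> h)) * ch k x))) (at x)"
proof -
  have "((\<lambda>x. Re (c k * ch k x)) has_derivative (\<lambda>h. Re (c k * (\<i> * of_real (freq k \<bullet> h)) * ch k x))) (at x)" for k
  proof -
    have "integrable cs (\<lambda>l. of_real (norm (freq l)) * (if l = k then 1 else 0 :: complex))"
      by (rule integrable_cs_finite(1)[of "{k}"]) auto
    from fser_has_derivative[OF fser_ch this, of x]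
    have "(ch k has_derivative (\<lambda>h. \<i> * of_real (freq k \<bullet> h) * ch k x)) (at x)"
      by (subst (asm) integrable_cs_finite(2)[where A = "{k}"]) auto
    from bounded_linear.has_derivative[OF bounded_linear_Re has_derivative_mult_right[OF this, of "c k"]]
    show ?thesis by (simp only: mult.assoc)
  qed
  then show ?thesis unfolding tpf_def by (intro has_derivative_sum)
qed

lemma partial_d_tpf: "partial_d i (tpf A c) = tpf A (dcf i c)"
proof
  fix x
  show "partial_d i (tpf A c) x = tpf A (dcf i c) x"
    unfolding partial_d_def frechet_derivative_at[OF tpf_has_derivative, symmetric]
    by (simp add: tpf_def dcf_def inner_axis mult_ac)
qed

lemma C_diff_tpf: "C_diff m (tpf A c)"
proof (induction m arbitrary: c)
  case 0
  show ?case
    unfolding C_diff.simps continuous_on_eq_continuous_within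
    using has_derivative_continuous[OF tpf_has_derivative] by blast
next
  case (Suc m)
  have "tpf A c differentiable_on UNIV"
    using tpf_has_derivative[of A c] by (auto simp: differentiable_on_def differentiable_def)
  then show ?case using Suc by (simp add: partial_d_tpf)
qed

lemma periodic_tpf: "periodic (tpf A c)"
proof -
  have "ch k (x + axis i (2 * pi)) = ch k x" for k and x :: "real^'a" and i
    using periodic_ch[of k] unfolding periodic_def by blast
  then show ?thesis unfolding periodic_def tpf_def by simp
qed

lemma test_function_tpf: "test_function (tpf A c)"
  by (simp add: test_function_def smooth_def C_diff_tpf periodic_tpf)

lemma laplacian_tpf: "laplacian (tpf A c) = tpf A (\<lambda>k. - of_real ((norm (freq k))\<^sup>2) * c k)"
proof
  fix x
  have "(\<Sum>i\<in>UNIV. dcf i (dcf i c) k) = - of_real ((norm (freq k))\<^sup>2) * c k" for k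
  proof -
    have "(\<Sum>i\<in>UNIV. dcf i (dcf i c) k) = (\<Sum>i\<in>UNIV. - of_real ((freq k $ i)\<^sup>2) * c k)"
      by (simp add: dcf_def power2_eq_square mult_ac) (simp add: mult.assoc[symmetric])?
    also have "\<dots> = - of_real (\<Sum>i\<in>UNIV. (freq k $ i)\<^sup>2) * c k"
      by (simp add: sum_distrib_right sum_negf)
    also have "(\<Sum>i\<in>UNIV. (freq k $ i)\<^sup>2) = (norm (freq k))\<^sup>2"
      by (simp add: norm_vec_def L2_set_def sum_nonneg)
    finally show ?thesis .
  qed
  then have "tpf A (\<lambda>k. - of_real ((norm (freq k))\<^sup>2) * c k) x = tpf A (\<lambda>k. \<Sum>i\<in>UNIV. dcf i (dcf i c) k) x"
    by simp
  also have "\<dots> = laplacian (tpf A c) x"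
    by (simp add: laplacian_def partial_d_tpf) (simp add: tpf_def sum_distrib_right sum.swap[of _ A])
  finally show "laplacian (tpf A c) x = tpf A (\<lambda>k. - of_real ((norm (freq k))\<^sup>2) * c k) x" ..
qed

lemma cos_tpf: "(\<lambda>x. cos (freq k \<bullet> x)) = tpf {k} (\<lambda>_. 1)" and sin_tpf: "(\<lambda>x. sin (freq k \<bullet> x)) = tpf {k} (\<lambda>_. - \<i>)"
  by (simp_all add: tpf_def ch_def fun_eq_iff)

lemma distribution_lincomb:
  "distribution u \<Longrightarrow> test_function \<phi> \<Longrightarrow> test_function \<psi> \<Longrightarrow> u (\<lambda>x. a * \<phi> x + b * \<psi> x) = a * u \<phi> + b * u \<psi>"
  unfolding distribution_def by blast

text \<open>Linearity alone, one frequency at a time. The conjugate on \<open>c\<close> balances the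
  conjugated character in \<open>fourier_coeff\<close>.\<close>

lemma distribution_tpf:
  assumes u: "distribution u" and A: "finite A"
  shows "u (tpf A c) = Re (\<Sum>k\<in>A. fourier_coeff u k * cnj (c k))"
  using A
proof induction
  case empty
  have "tpf {} c = (\<lambda>x. 0 * tpf {} c x + 0 * tpf {} c x)" by (simp add: tpf_def fun_eq_iff)
  then have "u (tpf {} c) = 0" using distribution_lincomb[OF u test_function_tpf test_function_tpf, of 0 "{}" c 0 "{}" c] by simp
  then show ?case by simp
next
  case (insert k A)
  have 1: "(\<lambda>x. Re (c k * ch k x)) = (\<lambda>x. Re (c k) * cos (freq k \<bullet> x) + (- Im (c k)) * sin (freq k \<bullet> x))"
    by (simp add: ch_def fun_eq_iff)
  have single: "(\<lambda>x. Re (c k * ch k x)) = tpf {k} c" by (simp add: tpf_def fun_eq_iff)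
  have "u (tpf {k} c) = Re (c k) * u (\<lambda>x. cos (freq k \<bullet> x)) + (- Im (c k)) * u (\<lambda>x. sin (freq k \<bullet> x))"
    unfolding single[symmetric] 1 by (rule distribution_lincomb[OF u]) (simp_all add: cos_tpf sin_tpf test_function_tpf)
  moreover have "tpf (insert k A) c = (\<lambda>x. 1 * tpf {k} c x + 1 * tpf A c x)"
    using insert by (simp add: tpf_def fun_eq_iff)
  then have "u (tpf (insert k A) c) = 1 * u (tpf {k} c) + 1 * u (tpf A c)"
    by (simp only: distribution_lincomb[OF u test_function_tpf test_function_tpf])
  ultimately show ?case
    using insert by (simp add: fourier_coeff_def)
qed

lemma cf_hermitian:
  fixes f :: "real^'d::finite \<Rightarrow> real"
  assumes "integrable tm f"
  shows "cf f (- k) = cnj (cf f k)"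
proof -
  have i: "integrable tm (\<lambda>x. complex_of_real (f x) * ch (- k) x)"
    by (rule integrable_mult_ch) (use assms in simp)
  have "cf f (- k) = (\<integral>x. cnj (complex_of_real (f x) * ch (- k) x) \<partial>tm) / of_real (vol TYPE('d))"
    by (simp add: fc_def ch_minus)
  also have "(\<integral>x. cnj (complex_of_real (f x) * ch (- k) x) \<partial>tm) = cnj (\<integral>x. complex_of_real (f x) * ch (- k) x \<partial>tm)"
    by (rule integral_bounded_linear[OF bounded_linear_cnj i])
  finally show ?thesis by (simp add: fc_def)
qed

abbreviation trunc :: "nat \<Rightarrow> (int^'d::finite \<Rightarrow> complex) \<Rightarrow> int^'d \<Rightarrow> complex" where
  "trunc n c \<equiv> (\<lambda>k. if k \<in> kbox n then c k else 0)"

lemma fser_tpf: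
  assumes herm: "\<And>k. c (- k) = cnj (c k)"
  shows "fser (trunc n c) (\<lambda>x. of_real (tpf (kbox n) c x))"
proof (rule fser_finite[OF finite_kbox])
  fix x
  define S where "S = (\<Sum>k\<in>kbox n. c k * ch k x)"
  \<comment> \<open>Hermitian coefficients on a symmetric cube: conjugation only reverses the order
    of summation, so the sum is real.\<close>
  have "cnj S = (\<Sum>k\<in>kbox n. c (- k) * ch (- k) x)" by (simp add: S_def herm ch_minus)
  also have "\<dots> = S" unfolding S_def
    by (rule sum.reindex_bij_witness[of _ uminus uminus]) (auto simp: kbox_def)
  finally have "Im (cnj S) = Im S" by (rule arg_cong)
  then have "S = of_real (Re S)" by (simp add: complex_eq_iff)
  also have "Re S = tpf (kbox n) c x" by (simp only: S_def tpf_def Re_sum)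
  finally show "of_real (tpf (kbox n) c x) = (\<Sum>k\<in>kbox n. trunc n c k * ch k x)"
    by (simp add: S_def cong: sum.cong)
qed auto

lemma sn_trunc_le: "sn \<alpha> (trunc n c) \<le> sn \<alpha> c"
  by (rule sn_mono) simp

lemma sn_finite_support:
  assumes "finite A" "\<And>k. k \<notin> A \<Longrightarrow> c k = 0" shows "sn \<alpha> c < \<infinity>"
proof -
  have "sn \<alpha> c = (\<Sum>k\<in>A. ennreal (jb k powr (2 * \<alpha>) * (norm (c k))\<^sup>2))"
    unfolding sn_def by (rule nn_integral_count_space'[OF assms(1)]) (use assms(2) in auto)
  then show ?thesis using assms(1) by (simp add: less_top[symmetric])
qed

section \<open>Fourier truncation of smooth functions\<close>

lemma C_diff_foldr:
  assumes "smooth f" "periodic f"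
  shows "smooth (foldr partial_d js f)" "periodic (foldr partial_d js f)"
proof -
  have "smooth (foldr partial_d js f) \<and> periodic (foldr partial_d js f)"
    using assms
  proof (induction js)
    case (Cons i js)
    have "C_diff m (partial_d i (foldr partial_d js f))" for m
      using Cons C_diff.simps(2)[of m "foldr partial_d js f"] unfolding smooth_def by blast
    then show ?case using Cons periodic_partial_d by (auto simp: smooth_def)
  qed simp
  then show "smooth (foldr partial_d js f)" "periodic (foldr partial_d js f)" by auto
qed

lemma smooth_continuous: "smooth f \<Longrightarrow> continuous_on UNIV f"
  unfolding smooth_def using C_diff.simps(1) by blast

lemma finite_lists_le: "finite {js :: 'd::finite list. length js \<le> m}"
  using finite_lists_length_le[of "UNIV :: 'd set" m] by simp

lemma C_diff_norm_finite:
  fixes f :: "real^'d::finite \<Rightarrow> real"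
  assumes "smooth f" "periodic f"
  obtains N where "C_diff_norm m f = ennreal N" "N \<ge> 0"
proof -
  have "\<exists>B. \<forall>x. \<bar>foldr partial_d js f x\<bar> \<le> B" for js
  proof -
    obtain B where "\<And>x. norm (foldr partial_d js f x) \<le> B"
      using periodic_bounded[OF C_diff_foldr(2)[OF assms] smooth_continuous[OF C_diff_foldr(1)[OF assms]]] by blast
    then show ?thesis by auto
  qed
  then obtain B where B: "\<And>js x. \<bar>foldr partial_d js f x\<bar> \<le> B js" by metis
  have "C_diff_norm m f \<le> (\<Sum>js\<in>{js. length js \<le> m}. ennreal (B js))"
    unfolding C_diff_norm_def
  proof (intro SUP_least)
    fix js x assume "js \<in> {js :: 'd list. length js \<le> m}"
    then have "ennreal (B js) \<le> (\<Sum>js\<in>{js. length js \<le> m}. ennreal (B js))"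
      by (intro member_le_sum[OF _ _ finite_lists_le]) auto
    then show "ennreal \<bar>foldr partial_d js f x\<bar> \<le> (\<Sum>js\<in>{js. length js \<le> m}. ennreal (B js))"
      by (rule order_trans[OF ennreal_leI[OF B]])
  qed
  also have "\<dots> < \<infinity>" by (simp add: finite_lists_le)
  finally show ?thesis using that by (cases "C_diff_norm m f") auto
qed

lemma smooth_fser:
  fixes f :: "real^'d::finite \<Rightarrow> real"
  assumes "smooth f" "periodic f"
  shows "fser (cf f) (\<lambda>x. of_real (f x))"
proof -
  \<comment> \<open>The dimension is an integer order above d/2, as the embedding requires.\<close>
  let ?m = "CARD('d)"
  obtain N where N: "C_diff_norm ?m f = ennreal N" "N \<ge> 0" using C_diff_norm_finite[OF assms] by metis
  have "C_diff ?m f" using assms(1) unfolding smooth_def by blast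
  from sn_C_diff[OF this assms(2) N] have "sn (real ?m) (cf f) < \<infinity>" by (rule le_less_trans) simp
  moreover have "real ?m > real CARD('d) / 2" by simp
  ultimately show ?thesis by (intro sobolev_fser[OF assms(2) smooth_continuous[OF assms(1)]])
qed

lemma fser_integrable_tm: "fser c (\<lambda>x. of_real (f x)) \<Longrightarrow> integrable tm f"
  using integrable_tm_continuous[OF fser_periodic fser_continuous, of c "\<lambda>x. complex_of_real (f x)"]
    integrable_bounded_linear[OF bounded_linear_Re, of tm "\<lambda>x. complex_of_real (f x)"] by simp

lemma tpf_approx:
  assumes f: "fser (cf f) (\<lambda>x. of_real (f x))"
  shows "\<bar>f x - tpf (kbox n) (cf f) x\<bar> \<le> (\<integral>k. norm (if k \<in> kbox n then 0 else cf f k) \<partial>cs)"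
proof -
  have "fser (\<lambda>k. cf f k - trunc n (cf f) k) (\<lambda>x. of_real (f x) - of_real (tpf (kbox n) (cf f) x))"
    by (rule fser_diff[OF f fser_tpf]) (rule cf_hermitian[OF fser_integrable_tm[OF f]])
  from fser_bound[OF this, of x]
  have "norm (complex_of_real (f x - tpf (kbox n) (cf f) x)) \<le> (\<integral>k. norm (cf f k - trunc n (cf f) k) \<partial>cs)" by simp
  also have "(\<integral>k. norm (cf f k - trunc n (cf f) k) \<partial>cs) = (\<integral>k. norm (if k \<in> kbox n then 0 else cf f k) \<partial>cs)"
    by (intro Bochner_Integration.integral_cong) auto
  finally show ?thesis by (simp only: norm_of_real)
qed

text \<open>Truncation commutes with derivatives, so the truncation error of a derivative is the
  derivative of the truncation error. The factors 1 and -1 keep the linear combination in the shape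
  of \<open>partial_d_lincomb\<close>.\<close>

lemma foldr_partial_d_diff:
  assumes "smooth f" "periodic f"
  shows "foldr partial_d js (\<lambda>x. 1 * f x + (- 1) * tpf A (cf f) x) =
    (\<lambda>x. 1 * foldr partial_d js f x + (- 1) * tpf A (cf (foldr partial_d js f)) x)"
proof (induction js)
  case (Cons i js)
  let ?g = "foldr partial_d js f"
  note g = C_diff_foldr[OF assms, of js]
  have d: "?g differentiable_on UNIV" using g(1) C_diff.simps(2)[of 0 ?g] unfolding smooth_def by blast
  have t: "tpf A (cf ?g) differentiable_on UNIV" using C_diff_tpf[of "Suc 0" A "cf ?g"] by simp
  have "dcf i (cf ?g) = cf (partial_d i ?g)"
    using cf_partial_d[of 0 ?g i] g unfolding smooth_def by (auto simp: dcf_def fun_eq_iff)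
  then show ?case using Cons partial_d_lincomb(1)[OF d t, of i 1 "- 1"] by (simp add: partial_d_tpf)
qed simp

text \<open>A distribution has finite order m, and for a smooth function the truncations converge
  uniformly together with each of the finitely many derivatives up to order m, because each
  derivative again has summable coefficients.\<close>

lemma distribution_approx:
  fixes u :: "'d::finite functional"
  assumes u: "distribution u" and \<phi>: "test_function \<phi>"
  shows "(\<lambda>n. u (tpf (kbox n) (cf \<phi>))) \<longlonglongrightarrow> u \<phi>"
proof -
  have f: "smooth \<phi>" "periodic \<phi>" using \<phi> by (auto simp: test_function_def)
  obtain m C where C: "\<And>\<psi>. test_function \<psi> \<Longrightarrow> ennreal \<bar>u \<psi>\<bar> \<le> ennreal C * C_diff_norm m \<psi>"
    using u unfolding distribution_def by blast
  define tail where "tail js n = (\<integral>k. norm (if k \<in> kbox n then 0 else cf (foldr partial_d js \<phi>) k) \<partial>cs)" for js n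
  have tl: "(\<lambda>n. tail js n) \<longlonglongrightarrow> 0" for js
    unfolding tail_def
    by (rule l1_tail[OF fser_integrable[OF smooth_fser[OF C_diff_foldr[OF f]]]])
  have tail0: "tail js n \<ge> 0" for js n unfolding tail_def by simp
  have bound: "\<bar>u (tpf (kbox n) (cf \<phi>)) - u \<phi>\<bar> \<le> max C 0 * (\<Sum>js\<in>{js. length js \<le> m}. tail js n)" for n
  proof -
    let ?\<psi> = "\<lambda>x. 1 * \<phi> x + (- 1) * tpf (kbox n) (cf \<phi>) x"
    have tp: "smooth (tpf (kbox n) (cf \<phi>))" "periodic (tpf (kbox n) (cf \<phi>))"
      using test_function_tpf by (auto simp: test_function_def)
    have "test_function ?\<psi>"
      unfolding test_function_def smooth_def
    proof (intro conjI allI)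
      show "C_diff m ?\<psi>" for m
        by (rule C_diff_lincomb) (use f tp in \<open>auto simp: smooth_def\<close>)
      show "periodic ?\<psi>" using f tp by (simp add: periodic_def)
    qed
    then have "ennreal \<bar>u ?\<psi>\<bar> \<le> ennreal C * C_diff_norm m ?\<psi>" by (rule C)
    also have "\<dots> \<le> ennreal (max C 0) * C_diff_norm m ?\<psi>"
      by (intro mult_right_mono ennreal_leI) auto
    also have "\<dots> \<le> ennreal (max C 0) * (\<Sum>js\<in>{js. length js \<le> m}. ennreal (tail js n))"
      unfolding C_diff_norm_def
    proof (intro mult_left_mono SUP_least)
      fix js x assume js: "js \<in> {js :: 'd list. length js \<le> m}"
      have "\<bar>foldr partial_d js ?\<psi> x\<bar> \<le> tail js n"
        unfolding foldr_partial_d_diff[OF f] tail_def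
        using tpf_approx[OF smooth_fser[OF C_diff_foldr[OF f, of js]], of x n] by simp
      then have "ennreal \<bar>foldr partial_d js ?\<psi> x\<bar> \<le> ennreal (tail js n)" by (rule ennreal_leI)
      also have "\<dots> \<le> (\<Sum>js\<in>{js. length js \<le> m}. ennreal (tail js n))"
        by (intro member_le_sum[OF js _ finite_lists_le]) auto
      finally show "ennreal \<bar>foldr partial_d js ?\<psi> x\<bar> \<le> (\<Sum>js\<in>{js. length js \<le> m}. ennreal (tail js n))" .
    qed simp
    also have "ennreal (max C 0) * (\<Sum>js\<in>{js. length js \<le> m}. ennreal (tail js n)) =
        ennreal (max C 0 * (\<Sum>js\<in>{js. length js \<le> m}. tail js n))"
      by (simp add: ennreal_mult sum_nonneg tail0)
    finally have "\<bar>u ?\<psi>\<bar> \<le> max C 0 * (\<Sum>js\<in>{js. length js \<le> m}. tail js n)"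
      by (simp add: sum_nonneg tail0)
    moreover have "u ?\<psi> = 1 * u \<phi> + (- 1) * u (tpf (kbox n) (cf \<phi>))"
      by (rule distribution_lincomb[OF u \<phi> test_function_tpf])
    ultimately show ?thesis by (simp add: abs_minus_commute)
  qed
  have "(\<lambda>n. max C 0 * (\<Sum>js\<in>{js. length js \<le> m}. tail js n)) \<longlonglongrightarrow> max C 0 * (\<Sum>js\<in>{js :: 'd list. length js \<le> m}. 0)"
    by (intro tendsto_mult_left tendsto_sum tl)
  then have "(\<lambda>n. max C 0 * (\<Sum>js\<in>{js. length js \<le> m}. tail js n)) \<longlonglongrightarrow> 0" by simp
  then have "(\<lambda>n. u (tpf (kbox n) (cf \<phi>)) - u \<phi>) \<longlonglongrightarrow> 0"
    by (rule Lim_null_comparison[rotated]) (simp add: bound)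
  then show ?thesis by (rule LIM_zero_cancel)
qed

section \<open>Testing the equation against the backward solution\<close>

lemma integral_lebesgue_on_sub:
  fixes g :: "real \<Rightarrow> 'b::{banach,second_countable_topology}"
  assumes "{a..b} \<subseteq> {0..t}"
  shows "(\<integral>r. g r \<partial>lebesgue_on {a..b}) = (\<integral>r. indicator {a..b} r *\<^sub>R g r \<partial>lebesgue_on {0..t})"
proof -
  have "(\<integral>r. g r \<partial>lebesgue_on {a..b}) = (\<integral>r. indicator {a..b} r *\<^sub>R g r \<partial>lebesgue)"
    by (subst integral_restrict_space) auto
  also have "\<dots> = (\<integral>r. indicator {0..t} r *\<^sub>R (indicator {a..b} r *\<^sub>R g r) \<partial>lebesgue)"
    by (rule Bochner_Integration.integral_cong) (use assms in \<open>auto simp: indicator_def\<close>)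
  also have "\<dots> = (\<integral>r. indicator {a..b} r *\<^sub>R g r \<partial>lebesgue_on {0..t})"
    by (subst integral_restrict_space) auto
  finally show ?thesis .
qed

lemma indicator_Ioc_measurable:
  "(indicator {s<..s'} :: real \<Rightarrow> real) \<in> borel_measurable (lebesgue_on {0..t})"
  "(indicator {s..s'} :: real \<Rightarrow> real) \<in> borel_measurable (lebesgue_on {0..t})"
  by (rule measurable_restrict_space1, rule borel_measurable_indicator, simp)+

lemma integrable_indicator_on:
  fixes g :: "real \<Rightarrow> 'b::{banach,second_countable_topology}"
  assumes "integrable (lebesgue_on {0..t}) g"
  shows "integrable (lebesgue_on {0..t}) (\<lambda>r. indicator {s<..s'} r *\<^sub>R g r)"
    "integrable (lebesgue_on {0..t}) (\<lambda>r. indicator {s..s'} r *\<^sub>R g r)"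
proof -
  have g: "g \<in> borel_measurable (lebesgue_on {0..t})" using assms by (rule borel_measurable_integrable)
  show "integrable (lebesgue_on {0..t}) (\<lambda>r. indicator {s<..s'} r *\<^sub>R g r)"
    by (rule Bochner_Integration.integrable_bound[OF assms borel_measurable_scaleR[OF indicator_Ioc_measurable(1) g]])
       (simp add: indicator_def)
  show "integrable (lebesgue_on {0..t}) (\<lambda>r. indicator {s..s'} r *\<^sub>R g r)"
    by (rule Bochner_Integration.integrable_bound[OF assms borel_measurable_scaleR[OF indicator_Ioc_measurable(2) g]])
       (simp add: indicator_def)
qed

lemma AE_neq_lebesgue_on: "AE r in lebesgue_on {0..t :: real}. r \<noteq> s"
proof -
  have "AE r in lebesgue. r \<noteq> s" using AE_completion[OF AE_lborel_singleton[of s]] .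
  then show ?thesis by (subst AE_restrict_space_iff) auto
qed

text \<open>Left-open intervals are used so that the pieces of a partition are disjoint. The first
  identity is then exact; in the second the integrands differ only at an end point.\<close>

lemma integral_increment:
  fixes g :: "real \<Rightarrow> 'b::{banach,second_countable_topology}"
  assumes g: "integrable (lebesgue_on {0..t}) g" and s: "0 \<le> s" "s \<le> s'" "s' \<le> t"
  shows "(LINT r:{0..s'}|lebesgue. g r) - (LINT r:{0..s}|lebesgue. g r) =
      (\<integral>r. indicator {s<..s'} r *\<^sub>R g r \<partial>lebesgue_on {0..t})"
    and "(\<integral>r. g r \<partial>lebesgue_on {s..t}) - (\<integral>r. g r \<partial>lebesgue_on {s'..t}) =
      (\<integral>r. indicator {s<..s'} r *\<^sub>R g r \<partial>lebesgue_on {0..t})"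
proof -
  let ?M = "lebesgue_on {0..t}"
  have L: "(LINT r:{0..u}|lebesgue. g r) = (\<integral>r. indicator {0..u} r *\<^sub>R g r \<partial>?M)" if "u \<le> t" for u
    using that by (subst LINT_on) (auto intro!: integral_lebesgue_on_sub)
  have "(\<integral>r. indicator {0..s'} r *\<^sub>R g r \<partial>?M) - (\<integral>r. indicator {0..s} r *\<^sub>R g r \<partial>?M) =
      (\<integral>r. indicator {0..s'} r *\<^sub>R g r - indicator {0..s} r *\<^sub>R g r \<partial>?M)"
    by (rule Bochner_Integration.integral_diff[symmetric]) (rule integrable_indicator_on[OF g])+
  also have "\<dots> = (\<integral>r. indicator {s<..s'} r *\<^sub>R g r \<partial>?M)"
    by (rule Bochner_Integration.integral_cong) (use s in \<open>auto simp: indicator_def\<close>)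
  finally show "(LINT r:{0..s'}|lebesgue. g r) - (LINT r:{0..s}|lebesgue. g r) =
      (\<integral>r. indicator {s<..s'} r *\<^sub>R g r \<partial>lebesgue_on {0..t})"
    using s by (simp add: L)
  have R: "(\<integral>r. g r \<partial>lebesgue_on {u..t}) = (\<integral>r. indicator {u..t} r *\<^sub>R g r \<partial>?M)" if "0 \<le> u" for u
    by (rule integral_lebesgue_on_sub) (use that in auto)
  have "(\<integral>r. indicator {s..t} r *\<^sub>R g r \<partial>?M) - (\<integral>r. indicator {s'..t} r *\<^sub>R g r \<partial>?M) =
      (\<integral>r. indicator {s..t} r *\<^sub>R g r - indicator {s'..t} r *\<^sub>R g r \<partial>?M)"
    by (rule Bochner_Integration.integral_diff[symmetric]) (rule integrable_indicator_on[OF g])+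
  also have "\<dots> = (\<integral>r. indicator {s<..s'} r *\<^sub>R g r \<partial>?M)"
  proof (rule integral_cong_AE)
    show "AE r in ?M. indicator {s..t} r *\<^sub>R g r - indicator {s'..t} r *\<^sub>R g r = indicator {s<..s'} r *\<^sub>R g r"
      using AE_neq_lebesgue_on[where t = t and s = s] AE_neq_lebesgue_on[where t = t and s = s']
      by eventually_elim (use s in \<open>auto simp: indicator_def\<close>)
  qed (use integrable_indicator_on[OF g] in \<open>auto intro!: borel_measurable_diff\<close>)
  finally show "(\<integral>r. g r \<partial>lebesgue_on {s..t}) - (\<integral>r. g r \<partial>lebesgue_on {s'..t}) =
      (\<integral>r. indicator {s<..s'} r *\<^sub>R g r \<partial>lebesgue_on {0..t})"
    using s by (simp add: R)
qed

lemma borel_measurable_cnjI: "g \<in> borel_measurable M \<Longrightarrow> (\<lambda>x. cnj (g x)) \<in> borel_measurable M"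
  by (rule measurable_compose[OF _ borel_measurable_continuous_onI[OF continuous_on_cnj[OF continuous_on_id]]])

text \<open>The filter excludes the point r itself, but the sequences of grid points may hit it;
  continuity at r covers both.\<close>

lemma at_within_sequence:
  fixes r :: real
  assumes "((\<lambda>s. g s) \<longlongrightarrow> g r) (at r within S)" "X \<longlonglongrightarrow> r" "\<And>m. X m \<in> S"
  shows "(\<lambda>m. g (X m)) \<longlonglongrightarrow> g r"
proof -
  have "continuous (at r within S) g" using assms(1) by (simp add: continuous_within)
  from continuous_within_tendsto_compose'[OF this assms(3,2)] show ?thesis .
qed

abbreviation (in backward) \<psi> :: "nat \<Rightarrow> real \<Rightarrow> real^'d \<Rightarrow> real" where "\<psi> n s \<equiv> tpf (kbox n) (cf (f s))"

section \<open>A single trajectory: pairings and increments\<close>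

locale spde_path = backward K T \<beta> \<rho> F \<zeta> \<theta> \<sigma> t \<phi> f
  for K :: "real^'d::finite \<Rightarrow> real^'d" and T \<beta> :: real and \<rho> :: "real \<Rightarrow> real^'d \<Rightarrow> real"
    and F :: "real^'d \<Rightarrow> real^'d" and \<zeta> \<theta> :: "real^'d \<Rightarrow> real"
    and \<sigma> t :: real and \<phi> :: "real^'d \<Rightarrow> real" and f :: "real \<Rightarrow> real^'d \<Rightarrow> real" +
  fixes \<eta> :: "real \<Rightarrow> 'd functional"
  assumes eta_C: "C_sobolev T (- \<beta> - 2) \<eta>" and eta_L2: "L2_sobolev T (- \<beta>) \<eta>"
begin

definition U :: "real \<Rightarrow> int^'d \<Rightarrow> complex" where "U r = fourier_coeff (\<eta> r)"

abbreviation M0 :: "real measure" where "M0 \<equiv> lebesgue_on {0..t}"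

lemma t0: "0 \<le> t" using t by simp

lemma dist_eta: "r \<in> {0..t} \<Longrightarrow> distribution (\<eta> r)"
  using eta_C sub_T unfolding C_sobolev_def sobolev_def by blast

lemma U_continuous: "continuous_on {0..t} (\<lambda>r. U r k)"
  unfolding U_def using Cs_continuous[OF C_sobolev_Cs[OF eta_C]] sub_T by (rule continuous_on_subset)

lemma U_measurable: "(\<lambda>r. U r k) \<in> borel_measurable M0"
  by (rule continuous_measurable_lebesgue_on[OF U_continuous]) simp

lemma snU_measurable: "(\<lambda>r. sn (- \<beta>) (U r)) \<in> borel_measurable M0"
  by (rule borel_measurable_sn) (rule U_measurable)

lemma snU_finite: "(\<integral>\<^sup>+r. sn (- \<beta>) (U r) \<partial>M0) < \<infinity>"
proof -
  have "(\<integral>\<^sup>+r. sobolev_norm2 (- \<beta>) (\<eta> r) \<partial>lebesgue_on {0..T}) < \<infinity>"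
    using eta_L2 unfolding L2_sobolev_def by (elim conjE)
  then have "(\<integral>\<^sup>+r. sn (- \<beta>) (U r) \<partial>lebesgue_on {0..T}) < \<infinity>"
    by (simp only: sobolev_norm2_eq U_def)
  then show ?thesis
    by (rule le_less_trans[OF nn_integral_lebesgue_on_subset[OF sub_T], rotated 2]) auto
qed

lemma snU_AE: "AE r in M0. sn (- \<beta>) (U r) < \<infinity>"
  using nn_integral_PInf_AE[OF snU_measurable] snU_finite by (simp add: less_top)

definition nU :: "real \<Rightarrow> real" where "nU r = enn2real (sn (- \<beta>) (U r))"

lemma nU_integrable: "integrable M0 nU"
proof (rule integrableI_bounded)
  show "nU \<in> borel_measurable M0" unfolding nU_def using snU_measurable by measurable
  have "(\<integral>\<^sup>+r. ennreal (norm (nU r)) \<partial>M0) \<le> (\<integral>\<^sup>+r. sn (- \<beta>) (U r) \<partial>M0)"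
  proof (rule nn_integral_mono)
    fix r
    show "ennreal (norm (nU r)) \<le> sn (- \<beta>) (U r)"
      by (cases "sn (- \<beta>) (U r)") (auto simp: nU_def)
  qed
  then show "(\<integral>\<^sup>+r. ennreal (norm (nU r)) \<partial>M0) < \<infinity>" using snU_finite by (rule le_less_trans)
qed

lemma nU_nonneg: "nU r \<ge> 0" by (simp add: nU_def)

definition ctr :: "real \<Rightarrow> (int^'d \<Rightarrow> complex) \<Rightarrow> complex" where
  "ctr r c = (\<integral>k. U r k * cnj (tr K F (cf (\<rho> r)) c k) \<partial>cs)"

lemma sn_cnj: "sn \<alpha> (\<lambda>k. cnj (c k)) = sn \<alpha> c"
  by (simp add: sn_def)

lemma pairing_le:
  assumes u: "sn (- \<beta>) (U r) < \<infinity>" and c: "sn \<beta> c \<le> ennreal B" "B \<ge> 0"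
  shows "integrable cs (\<lambda>k. U r k * cnj (c k))" "(\<integral>k. norm (U r k * cnj (c k)) \<partial>cs) \<le> sqrt (nU r * B)"
proof -
  have cf: "sn \<beta> (\<lambda>k. cnj (c k)) < \<infinity>" unfolding sn_cnj using c(1) by (rule le_less_trans) simp
  show i: "integrable cs (\<lambda>k. U r k * cnj (c k))" by (rule pairing_integrable[OF u cf])
  have "(ennreal (\<integral>k. norm (U r k * cnj (c k)) \<partial>cs))\<^sup>2 = (\<integral>\<^sup>+k. ennreal (norm (U r k * cnj (c k))) \<partial>cs)\<^sup>2"
    by (subst nn_integral_eq_integral) (use integrable_norm[OF i] in auto)
  also have "\<dots> \<le> sn (- \<beta>) (U r) * sn \<beta> (\<lambda>k. cnj (c k))" by (rule sn_pairing_bound)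
  also have "\<dots> \<le> ennreal (nU r) * ennreal B"
    using u c(1) unfolding sn_cnj nU_def by (intro mult_mono) (auto simp: less_top)
  finally have "(\<integral>k. norm (U r k * cnj (c k)) \<partial>cs)\<^sup>2 \<le> nU r * B"
    using c(2) nU_nonneg by (simp add: ennreal_power flip: ennreal_mult)
  then show "(\<integral>k. norm (U r k * cnj (c k)) \<partial>cs) \<le> sqrt (nU r * B)" by (rule real_le_rsqrt)
qed

text \<open>The constant of \<open>tr_bound\<close>, fixed by choice so that majorants in different
  lemmas share it.\<close>

definition Ctr :: real where
  "Ctr = (SOME C. C \<ge> 0 \<and> (\<forall>t\<in>{0..T}. \<forall>c. sn \<beta> (tr K F (cf (\<rho> t)) c) \<le> ennreal C * sn (\<beta> + 1) c))"

lemma Ctr: "Ctr \<ge> 0" "r \<in> {0..t} \<Longrightarrow> sn \<beta> (tr K F (cf (\<rho> r)) c) \<le> ennreal Ctr * sn (\<beta> + 1) c"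
proof -
  have "\<exists>C. C \<ge> 0 \<and> (\<forall>t\<in>{0..T}. \<forall>c. sn \<beta> (tr K F (cf (\<rho> t)) c) \<le> ennreal C * sn (\<beta> + 1) c)"
  proof -
    obtain C where "C \<ge> 0" "\<And>t c. t \<in> {0..T} \<Longrightarrow> sn \<beta> (tr K F (cf (\<rho> t)) c) \<le> ennreal C * sn (\<beta> + 1) c"
      using tr_bound by blast
    then show ?thesis by blast
  qed
  from someI_ex[OF this] have *: "Ctr \<ge> 0 \<and> (\<forall>t\<in>{0..T}. \<forall>c. sn \<beta> (tr K F (cf (\<rho> t)) c) \<le> ennreal Ctr * sn (\<beta> + 1) c)"
    unfolding Ctr_def .
  then show "Ctr \<ge> 0" by blast
  show "sn \<beta> (tr K F (cf (\<rho> r)) c) \<le> ennreal Ctr * sn (\<beta> + 1) c" if "r \<in> {0..t}"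
    using * that sub_T by blast
qed

lemma ctr_bound:
  assumes r: "r \<in> {0..t}" and u: "sn (- \<beta>) (U r) < \<infinity>" and c: "sn (\<beta> + 1) c \<le> ennreal B" "B \<ge> 0"
  shows "integrable cs (\<lambda>k. U r k * cnj (tr K F (cf (\<rho> r)) c k))" "norm (ctr r c) \<le> sqrt (nU r * (Ctr * B))"
proof -
  have "sn \<beta> (tr K F (cf (\<rho> r)) c) \<le> ennreal Ctr * sn (\<beta> + 1) c" by (rule Ctr(2)[OF r])
  also have "\<dots> \<le> ennreal Ctr * ennreal B" by (rule mult_left_mono[OF c(1)]) simp
  also have "\<dots> = ennreal (Ctr * B)" using Ctr(1) c(2) by (simp add: ennreal_mult)
  finally have *: "sn \<beta> (tr K F (cf (\<rho> r)) c) \<le> ennreal (Ctr * B)" .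
  have CB: "Ctr * B \<ge> 0" using Ctr(1) c(2) by simp
  show "integrable cs (\<lambda>k. U r k * cnj (tr K F (cf (\<rho> r)) c k))" by (rule pairing_le(1)[OF u * CB])
  show "norm (ctr r c) \<le> sqrt (nU r * (Ctr * B))"
    unfolding ctr_def by (rule order_trans[OF integral_norm_bound pairing_le(2)[OF u * CB]])
qed

text \<open>Turns the square root in the duality bound into a majorant affine in \<open>nU\<close>,
  which is integrable in time.\<close>

lemma sqrt_le_one_plus: "x \<ge> 0 \<Longrightarrow> sqrt x \<le> 1 + x"
  by (rule real_le_lsqrt) (auto simp: power2_eq_square algebra_simps)

lemma ctr_diff:
  assumes r: "r \<in> {0..t}" and u: "sn (- \<beta>) (U r) < \<infinity>"
    and c: "sn (\<beta> + 1) c < \<infinity>" "sn (\<beta> + 1) c' < \<infinity>"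
  shows "ctr r (\<lambda>k. c k - c' k) = ctr r c - ctr r c'"
proof -
  have rT: "r \<in> {0..T}" using r sub_T by blast
  have d: "integrable cs (dcf i c)" if "sn (\<beta> + 1) c < \<infinity>" for c :: "int^'d \<Rightarrow> complex" and i
    by (rule sn_integrable[OF beta]) (use le_less_trans[OF sn_deriv that] in \<open>simp add: dcf_def[abs_def]\<close>)
  have eq: "tr K F (cf (\<rho> r)) (\<lambda>k. c k - c' k) k = tr K F (cf (\<rho> r)) c k - tr K F (cf (\<rho> r)) c' k" for k
    by (rule tr_diff[OF fser_integrable[OF rho_fser[OF rT]] fser_integrable[OF F_fser] d[OF c(1)] d[OF c(2)]])
  have i: "integrable cs (\<lambda>k. U r k * cnj (tr K F (cf (\<rho> r)) c k))" if c: "sn (\<beta> + 1) c < \<infinity>" for c :: "int^'d \<Rightarrow> complex"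
  proof -
    obtain B where "sn (\<beta> + 1) c = ennreal B" "B \<ge> 0" using c by (cases "sn (\<beta> + 1) c") auto
    then show ?thesis using ctr_bound(1)[OF r u, of c B] by simp
  qed
  show ?thesis
    unfolding ctr_def eq complex_cnj_diff right_diff_distrib
    by (rule Bochner_Integration.integral_diff[OF i[OF c(1)] i[OF c(2)]])
qed

text \<open>Continuity of the transport pairing in the norm of order \<beta> + 1. It serves both
  limits: freezing the backward solution at nearby grid times, and removing the Fourier
  cut-off.\<close>

lemma ctr_tendsto:
  assumes r: "r \<in> {0..t}" and u: "sn (- \<beta>) (U r) < \<infinity>"
    and c: "\<And>m. sn (\<beta> + 1) (c m) < \<infinity>" "sn (\<beta> + 1) c' < \<infinity>"
    and lim: "(\<lambda>m. sn (\<beta> + 1) (\<lambda>k. c m k - c' k)) \<longlonglongrightarrow> 0"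
  shows "(\<lambda>m. ctr r (c m)) \<longlonglongrightarrow> ctr r c'"
proof -
  define N where "N m = enn2real (sn (\<beta> + 1) (\<lambda>k. c m k - c' k))" for m
  have fin: "sn (\<beta> + 1) (\<lambda>k. c m k - c' k) < \<infinity>" for m
  proof -
    have "sn (\<beta> + 1) (\<lambda>k. c m k + (- 1) * c' k) \<le> 2 * sn (\<beta> + 1) (c m) + 2 * sn (\<beta> + 1) (\<lambda>k. (- 1) * c' k)"
      by (rule sn_add)
    also have "\<dots> < \<infinity>" unfolding sn_cmult using c by (simp add: ennreal_mult_less_top)
    finally show ?thesis by simp
  qed
  have Neq: "sn (\<beta> + 1) (\<lambda>k. c m k - c' k) = ennreal (N m)" for m
    using fin[of m] by (simp add: N_def less_top)
  have N0: "N m \<ge> 0" for m by (simp add: N_def)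
  have "(\<lambda>m. ennreal (N m)) \<longlonglongrightarrow> ennreal 0" using lim by (simp add: Neq)
  then have Nl: "N \<longlonglongrightarrow> 0" using N0 by (subst (asm) tendsto_ennreal_iff) auto
  have "(\<lambda>m. sqrt (nU r * (Ctr * N m))) \<longlonglongrightarrow> sqrt (nU r * (Ctr * 0))"
    by (intro tendsto_intros Nl)
  then have sl: "(\<lambda>m. sqrt (nU r * (Ctr * N m))) \<longlonglongrightarrow> 0" by simp
  have "norm (ctr r (c m) - ctr r c') \<le> sqrt (nU r * (Ctr * N m))" for m
    using ctr_bound(2)[OF r u, of "\<lambda>k. c m k - c' k" "N m"] ctr_diff[OF r u c(1) c(2)] N0 Neq by simp
  then have "(\<lambda>m. ctr r (c m) - ctr r c') \<longlonglongrightarrow> 0"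
    by (intro Lim_null_comparison[OF _ sl] always_eventually) auto
  then show ?thesis by (rule LIM_zero_cancel)
qed

lemma ctr_measurable: "(\<lambda>r. ctr r (c r)) \<in> borel_measurable M0"
  if c: "\<And>k. (\<lambda>r. c r k) \<in> borel_measurable M0"
proof -
  have "(\<lambda>r. tr K F (cf (\<rho> r)) (c r) k) \<in> borel_measurable M0" for k
    by (rule tr_measurable[OF sub_T]) (rule c)
  then show ?thesis unfolding ctr_def
    by (intro borel_measurable_sum_cs borel_measurable_times borel_measurable_cnjI U_measurable)
qed

text \<open>The Hermitian condition makes the polynomial a real function with coefficients
  \<open>trunc n c\<close>; those of its transport then lie in the space of order \<beta>, dual to
  that of the distribution.\<close>

lemma sp_eq:
  assumes r: "r \<in> {0..t}" and u: "sn (- \<beta>) (U r) < \<infinity>" and herm: "\<And>k. c (- k) = cnj (c k)"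
  shows "sobolev_pairing (\<eta> r) (dual_transport K F (\<rho> r) (tpf (kbox n) c)) = Re (ctr r (trunc n c))"
proof -
  have rT: "r \<in> {0..T}" using r sub_T by blast
  have fin: "sn (\<beta> + 1) (trunc n c) < \<infinity>" by (rule sn_finite_support[OF finite_kbox]) auto
  have fs: "fser (tr K F (cf (\<rho> r)) (trunc n c)) (\<lambda>x. of_real (dual_transport K F (\<rho> r) (tpf (kbox n) c) x))"
    by (rule dual_transport_fser[OF rT _ fin], rule fser_tpf, rule herm)
  have cfe: "cf (dual_transport K F (\<rho> r) (tpf (kbox n) c)) = tr K F (cf (\<rho> r)) (trunc n c)"
    by (rule ext) (rule fser_fc[OF fs])
  have "sn \<beta> (tr K F (cf (\<rho> r)) (trunc n c)) < \<infinity>"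
    by (rule le_less_trans[OF Ctr(2)[OF r]]) (use fin in \<open>simp add: ennreal_mult_less_top\<close>)
  then have "sn \<beta> (cf (dual_transport K F (\<rho> r) (tpf (kbox n) c))) < \<infinity>" by (simp only: cfe)
  from sobolev_pairing_eq(1)[OF fser_integrable_tm[OF fs] _ this, of "\<eta> r"] u
  show ?thesis unfolding ctr_def cfe U_def .
qed

definition lp :: "nat \<Rightarrow> real \<Rightarrow> (int^'d \<Rightarrow> complex) \<Rightarrow> complex" where
  "lp n r c = (\<Sum>k\<in>kbox n. U r k * cnj (c k))"

lemma eta_tpf: "r \<in> {0..t} \<Longrightarrow> \<eta> r (tpf (kbox n) c) = Re (lp n r c)"
  unfolding lp_def U_def by (rule distribution_tpf[OF dist_eta finite_kbox])

abbreviation Dl :: "(int^'d \<Rightarrow> complex) \<Rightarrow> int^'d \<Rightarrow> complex" where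
  "Dl c \<equiv> (\<lambda>k. - of_real ((norm (freq k))\<^sup>2) * c k)"

text \<open>A bound for a single mode over all times. It is finite because the trajectory is
  continuous in a space of very negative order, and it is used only in sums over finitely many
  modes.\<close>

definition Ub :: "int^'d \<Rightarrow> real" where "Ub k = (SOME B. B \<ge> 0 \<and> (\<forall>r\<in>{0..t}. norm (U r k) \<le> B))"

lemma Ub: "Ub k \<ge> 0" "r \<in> {0..t} \<Longrightarrow> norm (U r k) \<le> Ub k"
proof -
  have "bounded ((\<lambda>r. U r k) ` {0..t})"
    by (rule compact_imp_bounded[OF compact_continuous_image[OF U_continuous]]) simp
  then obtain B where B: "\<forall>x\<in>(\<lambda>r. U r k) ` {0..t}. norm x \<le> B" unfolding bounded_iff by blast
  then have "\<exists>B. B \<ge> 0 \<and> (\<forall>r\<in>{0..t}. norm (U r k) \<le> B)"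
    by (intro exI[of _ "max B 0"]) (auto simp: le_max_iff_disj)
  from someI_ex[OF this] have "Ub k \<ge> 0 \<and> (\<forall>r\<in>{0..t}. norm (U r k) \<le> Ub k)" unfolding Ub_def .
  then show "Ub k \<ge> 0" "r \<in> {0..t} \<Longrightarrow> norm (U r k) \<le> Ub k" by auto
qed

lemma lp_bound:
  assumes "r \<in> {0..t}" "\<And>k. norm (c k) \<le> b k"
  shows "norm (lp n r c) \<le> (\<Sum>k\<in>kbox n. Ub k * b k)"
proof -
  have "norm (lp n r c) \<le> (\<Sum>k\<in>kbox n. norm (U r k * cnj (c k)))" unfolding lp_def by (rule norm_sum)
  also have "\<dots> \<le> (\<Sum>k\<in>kbox n. Ub k * b k)"
    by (rule sum_mono) (use Ub assms in \<open>auto simp: norm_mult intro!: mult_mono\<close>)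
  finally show ?thesis .
qed

text \<open>The drift of the equation tested against the trigonometric polynomial with coefficients \<open>c\<close>.\<close>

definition dr :: "nat \<Rightarrow> (int^'d \<Rightarrow> complex) \<Rightarrow> real \<Rightarrow> real" where
  "dr n c r = Re (of_real \<sigma> * lp n r (Dl c) + ctr r (trunc n c))"

lemma lp_measurable:
  assumes "\<And>k. (\<lambda>r. c r k) \<in> borel_measurable M0"
  shows "(\<lambda>r. lp n r (c r)) \<in> borel_measurable M0"
  unfolding lp_def
  by (intro borel_measurable_sum borel_measurable_times borel_measurable_cnjI U_measurable assms)

lemma borel_measurable_ReI: "g \<in> borel_measurable M \<Longrightarrow> (\<lambda>r. Re (g r)) \<in> borel_measurable M"
  by measurable

lemma integrable_M0_bounded:
  fixes g :: "real \<Rightarrow> real"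
  assumes "g \<in> borel_measurable M0" "AE r in M0. norm (g r) \<le> a + b * nU r"
  shows "integrable M0 g"
proof (rule Bochner_Integration.integrable_bound[of M0 "\<lambda>r. a + b * nU r"])
  interpret finite_measure M0 by (rule finite_lebesgue_on)
  show "integrable M0 (\<lambda>r. a + b * nU r)"
    by (intro Bochner_Integration.integrable_add integrable_const integrable_mult_right nU_integrable)
  show "AE r in M0. norm (g r) \<le> norm (a + b * nU r)"
    using assms(2) by eventually_elim auto
qed (rule assms(1))

lemma AE_M0_in: "AE r in M0. r \<in> {0..t}"
  by (rule AE_I2) (simp add: space_restrict_space)

text \<open>One half of the product rule: the test function stays fixed while the distribution
  moves. The equation is needed at the two end points only, and the initial value \<open>x0\<close>
  cancels in the difference.\<close>

lemma spde_increment: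
  assumes c: "\<And>k. c (- k) = cnj (c k)" and s: "0 \<le> s" "s \<le> s'" "s' \<le> t"
    and eq: "\<And>u. u \<in> {s, s'} \<Longrightarrow> \<eta> u (tpf (kbox n) c) - x0 =
      (LINT r:{0..u}|lebesgue. \<sigma> * \<eta> r (laplacian (tpf (kbox n) c)))
      + (LINT r:{0..u}|lebesgue. sobolev_pairing (\<eta> r) (dual_transport K F (\<rho> r) (tpf (kbox n) c))) + N u"
  shows "integrable M0 (dr n c)"
    and "\<eta> s' (tpf (kbox n) c) - \<eta> s (tpf (kbox n) c) =
      (\<integral>r. indicator {s<..s'} r *\<^sub>R dr n c r \<partial>M0) + (N s' - N s)"
proof -
  let ?\<psi> = "tpf (kbox n) c"
  define a where "a r = \<sigma> * \<eta> r (laplacian ?\<psi>)" for r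
  define b where "b r = sobolev_pairing (\<eta> r) (dual_transport K F (\<rho> r) ?\<psi>)" for r
  have aeq: "a r = Re (of_real \<sigma> * lp n r (Dl c))" if "r \<in> {0..t}" for r
    unfolding a_def laplacian_tpf eta_tpf[OF that] by simp
  have ami: "(\<lambda>r. Re (of_real \<sigma> * lp n r (Dl c))) \<in> borel_measurable M0"
    by (intro borel_measurable_ReI borel_measurable_times borel_measurable_const lp_measurable)
  have am: "a \<in> borel_measurable M0"
    by (rule measurable_cong[THEN iffD1, OF _ ami]) (simp add: space_restrict_space aeq)
  have "\<bar>a r\<bar> \<le> \<bar>\<sigma>\<bar> * (\<Sum>k\<in>kbox n. Ub k * norm (Dl c k))" if "r \<in> {0..t}" for r
  proof -
    have "\<bar>a r\<bar> \<le> norm (of_real \<sigma> * lp n r (Dl c))" unfolding aeq[OF that] by (rule abs_Re_le_cmod)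
    also have "\<dots> = \<bar>\<sigma>\<bar> * norm (lp n r (Dl c))" by (simp only: norm_mult norm_of_real)
    also have "\<dots> \<le> \<bar>\<sigma>\<bar> * (\<Sum>k\<in>kbox n. Ub k * norm (Dl c k))"
      by (intro mult_left_mono lp_bound that order_refl) simp
    finally show ?thesis .
  qed
  then have ai: "integrable M0 a"
    by (intro integrable_M0_bounded[OF am, of "\<bar>\<sigma>\<bar> * (\<Sum>k\<in>kbox n. Ub k * norm (Dl c k))" 0])
       (rule eventually_mono[OF AE_M0_in], simp)
  have beq: "b r = Re (ctr r (trunc n c))" if "r \<in> {0..t}" "sn (- \<beta>) (U r) < \<infinity>" for r
    unfolding b_def by (rule sp_eq[OF that]) (rule c)
  have bae: "AE r in M0. Re (ctr r (trunc n c)) = b r"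
    using AE_M0_in snU_AE by eventually_elim (simp only: beq)
  have bmi: "(\<lambda>r. Re (ctr r (trunc n c))) \<in> borel_measurable M0"
    by (intro borel_measurable_ReI ctr_measurable) simp
  \<comment> \<open>The pairing agrees with the measurable series only at times when the
    distribution lies in the space of order -\<beta>, hence almost everywhere.\<close>
  have bm: "b \<in> borel_measurable M0" by (rule borel_measurable_lebesgue_on_AE[OF bmi bae]) simp
  obtain B where B: "sn (\<beta> + 1) (trunc n c) = ennreal B" "B \<ge> 0"
    using sn_finite_support[OF finite_kbox, of n "trunc n c" "\<beta> + 1"] by (cases "sn (\<beta> + 1) (trunc n c)") auto
  have bi: "integrable M0 b"
  proof (rule integrable_M0_bounded[OF bm])
    show "AE r in M0. norm (b r) \<le> 1 + Ctr * B * nU r"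
      using AE_M0_in snU_AE
    proof eventually_elim
      case (elim r)
      have "norm (b r) \<le> norm (ctr r (trunc n c))" unfolding beq[OF elim] real_norm_def by (rule abs_Re_le_cmod)
      also have "\<dots> \<le> sqrt (nU r * (Ctr * B))" by (rule ctr_bound(2)[OF elim]) (simp_all add: B)
      also have "\<dots> \<le> 1 + nU r * (Ctr * B)" by (rule sqrt_le_one_plus) (simp add: nU_nonneg Ctr(1) B(2))
      finally show ?case by (simp add: mult_ac)
    qed
  qed
  have dae: "AE r in M0. a r + b r = dr n c r"
    using AE_M0_in bae by eventually_elim (simp add: dr_def aeq)
  have dm: "dr n c \<in> borel_measurable M0"
    by (rule borel_measurable_lebesgue_on_AE[OF borel_measurable_add[OF am bm] dae]) simp
  have abi: "integrable M0 (\<lambda>r. a r + b r)" by (rule Bochner_Integration.integrable_add[OF ai bi])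
  show di: "integrable M0 (dr n c)"
    using integrable_cong_AE[OF borel_measurable_add[OF am bm] dm dae] abi by simp
  have "\<eta> s' ?\<psi> - \<eta> s ?\<psi> = ((LINT r:{0..s'}|lebesgue. a r) - (LINT r:{0..s}|lebesgue. a r))
      + ((LINT r:{0..s'}|lebesgue. b r) - (LINT r:{0..s}|lebesgue. b r)) + (N s' - N s)"
    using eq[of s] eq[of s'] unfolding a_def b_def by simp
  also have "\<dots> = (\<integral>r. indicator {s<..s'} r *\<^sub>R a r \<partial>M0) + (\<integral>r. indicator {s<..s'} r *\<^sub>R b r \<partial>M0) + (N s' - N s)"
    by (simp only: integral_increment(1)[OF ai s] integral_increment(1)[OF bi s])
  also have "(\<integral>r. indicator {s<..s'} r *\<^sub>R a r \<partial>M0) + (\<integral>r. indicator {s<..s'} r *\<^sub>R b r \<partial>M0) =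
      (\<integral>r. indicator {s<..s'} r *\<^sub>R a r + indicator {s<..s'} r *\<^sub>R b r \<partial>M0)"
    by (rule Bochner_Integration.integral_add[symmetric]) (rule integrable_indicator_on[OF ai] integrable_indicator_on[OF bi])+
  also have "\<dots> = (\<integral>r. indicator {s<..s'} r *\<^sub>R dr n c r \<partial>M0)"
  proof (rule integral_cong_AE)
    show "AE r in M0. indicator {s<..s'} r *\<^sub>R a r + indicator {s<..s'} r *\<^sub>R b r = indicator {s<..s'} r *\<^sub>R dr n c r"
      using dae by eventually_elim (simp add: scaleR_add_right[symmetric] del: real_scaleR_def)
  qed (use integrable_indicator_on[OF ai] integrable_indicator_on[OF bi] integrable_indicator_on[OF di] in
       \<open>auto intro!: borel_measurable_add simp del: real_scaleR_def\<close>)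
  finally show "\<eta> s' ?\<psi> - \<eta> s ?\<psi> = (\<integral>r. indicator {s<..s'} r *\<^sub>R dr n c r \<partial>M0) + (N s' - N s)" .
qed

abbreviation c :: "real \<Rightarrow> int^'d \<Rightarrow> complex" where "c s \<equiv> cf (f s)"

lemma c_herm: "s \<in> {0..t} \<Longrightarrow> c s (- k) = cnj (c s k)"
  by (rule cf_hermitian[OF f_regular(3)])

lemma G_integrable: "integrable M0 (\<lambda>r. G r k)"
  using f_time_eq(2)[of 0] t0 by simp

lemma c_increment:
  assumes "0 \<le> s" "s \<le> s'" "s' \<le> t"
  shows "c s' k - c s k = - (\<integral>r. indicator {s<..s'} r *\<^sub>R G r k \<partial>M0)"
  using f_time_eq(1)[of s k] f_time_eq(1)[of s' k] integral_increment(2)[OF G_integrable assms, of k] assms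
  by (simp add: algebra_simps)

text \<open>The other half of the product rule: the distribution is frozen at the right end point
  while the truncated backward solution moves according to its equation in coefficients.\<close>

lemma eta_increment:
  assumes s: "0 \<le> s" "s \<le> s'" "s' \<le> t"
  shows "integrable M0 (\<lambda>r. Re (lp n s' (G r)))"
    and "\<eta> s' (\<psi> n s') - \<eta> s' (\<psi> n s) = - (\<integral>r. indicator {s<..s'} r *\<^sub>R Re (lp n s' (G r)) \<partial>M0)"
proof -
  have i: "integrable M0 (\<lambda>r. U s' k * cnj (G r k))" for k
    by (intro integrable_mult_right integrable_bounded_linear[OF bounded_linear_cnj G_integrable])
  have il: "integrable M0 (\<lambda>r. lp n s' (G r))" unfolding lp_def by (intro Bochner_Integration.integrable_sum i)
  show "integrable M0 (\<lambda>r. Re (lp n s' (G r)))" by (rule integrable_bounded_linear[OF bounded_linear_Re il])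
  have s': "s' \<in> {0..t}" using s by auto
  define I where "I = (\<integral>r. indicator {s<..s'} r *\<^sub>R lp n s' (G r) \<partial>M0)"
  have E1: "U s' k * cnj (c s' k - c s k) = - (\<integral>r. indicator {s<..s'} r *\<^sub>R (U s' k * cnj (G r k)) \<partial>M0)" for k
  proof -
    have "cnj (\<integral>r. indicator {s<..s'} r *\<^sub>R G r k \<partial>M0) = (\<integral>r. cnj (indicator {s<..s'} r *\<^sub>R G r k) \<partial>M0)"
      by (rule integral_bounded_linear[OF bounded_linear_cnj integrable_indicator_on(1)[OF G_integrable], symmetric])
    then have "U s' k * cnj (\<integral>r. indicator {s<..s'} r *\<^sub>R G r k \<partial>M0) = (\<integral>r. U s' k * cnj (indicator {s<..s'} r *\<^sub>R G r k) \<partial>M0)"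
      by (simp only: integral_mult_right_zero)
    moreover have "U s' k * cnj (indicator {s<..s'} r *\<^sub>R G r k) = indicator {s<..s'} r *\<^sub>R (U s' k * cnj (G r k))" for r
      by (simp add: indicator_def)
    ultimately show ?thesis unfolding c_increment[OF s] complex_cnj_minus mult_minus_right by simp
  qed
  have E2: "(\<Sum>k\<in>kbox n. \<integral>r. indicator {s<..s'} r *\<^sub>R (U s' k * cnj (G r k)) \<partial>M0) = I"
    unfolding I_def lp_def scaleR_sum_right
    by (rule Bochner_Integration.integral_sum[symmetric]) (rule integrable_indicator_on(1)[OF i])
  have E: "(\<Sum>k\<in>kbox n. U s' k * cnj (c s' k - c s k)) = - I"
    unfolding E1 sum_negf E2 ..
  have ReI: "Re I = (\<integral>r. indicator {s<..s'} r *\<^sub>R Re (lp n s' (G r)) \<partial>M0)"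
    unfolding I_def
    using integral_bounded_linear[OF bounded_linear_Re integrable_indicator_on(1)[OF il, of s s']] by simp
  have "\<eta> s' (\<psi> n s') - \<eta> s' (\<psi> n s) = Re (\<Sum>k\<in>kbox n. U s' k * cnj (c s' k - c s k))"
    unfolding eta_tpf[OF s'] lp_def by (simp add: sum_subtractf right_diff_distrib)
  then show "\<eta> s' (\<psi> n s') - \<eta> s' (\<psi> n s) = - (\<integral>r. indicator {s<..s'} r *\<^sub>R Re (lp n s' (G r)) \<partial>M0)"
    unfolding E ReI[symmetric] by simp
qed

end

lemma continuous_on_sequence:
  fixes g :: "real \<Rightarrow> 'b::topological_space"
  assumes "continuous_on S g" "r \<in> S" "X \<longlonglongrightarrow> r" "\<And>m. X m \<in> S"
  shows "(\<lambda>m. g (X m)) \<longlonglongrightarrow> g r"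
  by (rule at_within_sequence[OF _ assms(3,4)]) (use assms(1,2) in \<open>auto simp: continuous_on_def\<close>)

section \<open>Uniform partitions of the time interval\<close>

context backward
begin

definition sp :: "nat \<Rightarrow> nat \<Rightarrow> real" where "sp m j = t * real j / real m"

lemma sp_0 [simp]: "sp m 0 = 0" and sp_last: "m \<ge> 1 \<Longrightarrow> sp m m = t"
  by (simp_all add: sp_def)

lemma sp_mono: "i \<le> j \<Longrightarrow> sp m i \<le> sp m j"
  unfolding sp_def using t by (intro divide_right_mono mult_left_mono) auto

lemma sp_in: "j \<le> m \<Longrightarrow> sp m j \<in> {0..t}"
proof (cases "m = 0")
  case True then show ?thesis using t by (simp add: sp_def)
next
  case False
  assume "j \<le> m"
  then show ?thesis using sp_mono[of 0 j m] sp_mono[of j m m] sp_last[of m] False by simp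
qed

text \<open>The left-open intervals of the partition cover (0,t] without overlap, so a sum weighted
  by their indicators reduces to one term. The point 0 lies in none of them.\<close>

lemma sp_index:
  assumes r: "0 < r" "r \<le> t" and m: "m \<ge> 1"
  obtains j where "j < m" "sp m j < r" "r \<le> sp m (Suc j)"
    "\<And>a :: nat \<Rightarrow> real. (\<Sum>i<m. indicator {sp m i<..sp m (Suc i)} r *\<^sub>R a i) = a j"
proof -
  \<comment> \<open>In units of the mesh, r lies in the interval whose index is the ceiling of x
    minus 1.\<close>
  define x where "x = r * real m / t"
  have x: "0 < x" "x \<le> real m" using r m by (auto simp: x_def field_simps)
  have iff: "sp m i < r \<and> r \<le> sp m (Suc i) \<longleftrightarrow> \<lceil>x\<rceil> = int i + 1" for i
  proof -
    have "sp m i < r \<longleftrightarrow> real i < x" using r m by (simp add: sp_def x_def field_simps)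
    moreover have "r \<le> sp m (Suc i) \<longleftrightarrow> x \<le> real i + 1" using r m by (simp add: sp_def x_def field_simps)
    ultimately show ?thesis using ceiling_eq_iff[of x "int i + 1"] by auto
  qed
  define j where "j = nat (\<lceil>x\<rceil> - 1)"
  have c1: "\<lceil>x\<rceil> \<ge> 1" using x(1) by linarith
  have c2: "\<lceil>x\<rceil> \<le> int m" using x(2) by (simp add: ceiling_le_iff)
  have "int j = \<lceil>x\<rceil> - 1" unfolding j_def by (rule nat_0_le) (use c1 in linarith)
  then have j: "\<lceil>x\<rceil> = int j + 1" "j < m" using c2 by linarith+
  have ind: "indicator {sp m i<..sp m (Suc i)} r = (if i = j then 1 else 0 :: real)" for i
    using iff[of i] j(1) by (auto simp: indicator_def)
  have "(\<Sum>i<m. indicator {sp m i<..sp m (Suc i)} r *\<^sub>R a i) = a j" for a :: "nat \<Rightarrow> real"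
    unfolding ind using j(2) by (simp add: if_distrib[of "\<lambda>u. u * _"] cong: if_cong)
  then show ?thesis using that[OF j(2)] iff[of j] j(1) by blast
qed

lemma sp_limits:
  assumes j: "\<And>m. j m < Suc m" "\<And>m. sp (Suc m) (j m) < r" "\<And>m. r \<le> sp (Suc m) (Suc (j m))"
  shows "(\<lambda>m. sp (Suc m) (j m)) \<longlonglongrightarrow> r" "(\<lambda>m. sp (Suc m) (Suc (j m))) \<longlonglongrightarrow> r"
proof -
  have diff: "sp (Suc m) (Suc (j m)) - sp (Suc m) (j m) = t / real (Suc m)" for m
    by (simp add: sp_def diff_divide_distrib[symmetric] algebra_simps)
  have z: "(\<lambda>m. t / real (Suc m)) \<longlonglongrightarrow> 0"
    using LIMSEQ_Suc[OF tendsto_mult_right_zero[OF lim_1_over_n, of t]] by simp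
  show "(\<lambda>m. sp (Suc m) (j m)) \<longlonglongrightarrow> r"
  proof (rule LIM_zero_cancel, rule Lim_null_comparison[OF _ z], rule always_eventually, rule allI)
    show "norm (sp (Suc m) (j m) - r) \<le> t / real (Suc m)" for m using j[of m] diff[of m] by simp
  qed
  show "(\<lambda>m. sp (Suc m) (Suc (j m))) \<longlonglongrightarrow> r"
  proof (rule LIM_zero_cancel, rule Lim_null_comparison[OF _ z], rule always_eventually, rule allI)
    show "norm (sp (Suc m) (Suc (j m)) - r) \<le> t / real (Suc m)" for m using j[of m] diff[of m] by simp
  qed
qed

text \<open>A Riemann sum, with left end points, for the stochastic integral of the truncated
  backward solution against the noise.\<close>

definition ns :: "(real \<Rightarrow> 'd functional) \<Rightarrow> nat \<Rightarrow> nat \<Rightarrow> real" where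
  "ns N n m = (\<Sum>j<m. N (sp m (Suc j)) (\<psi> n (sp m j)) - N (sp m j) (\<psi> n (sp m j)))"

end

section \<open>The drift error of the discretisation\<close>

context spde_path
begin

text \<open>What the drift of the distribution, tested at the left end point, and the motion of the
  backward solution, tested at the right end point, fail to cancel on the j-th interval.\<close>

definition Phi :: "nat \<Rightarrow> nat \<Rightarrow> nat \<Rightarrow> real \<Rightarrow> real" where
  "Phi n m j r = dr n (c (sp m j)) r - Re (lp n (sp m (Suc j)) (G r))"

definition Em :: "nat \<Rightarrow> nat \<Rightarrow> real \<Rightarrow> real" where
  "Em n m r = (\<Sum>j<m. indicator {sp m j<..sp m (Suc j)} r *\<^sub>R Phi n m j r)"

text \<open>The error that survives refinement of the partition: the first term transports the
  truncated solution, the second truncates the transported one. The Laplacian commutes with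
  truncation and is gone.\<close>

definition En :: "nat \<Rightarrow> real \<Rightarrow> real" where
  "En n r = Re (ctr r (trunc n (c r)) - lp n r (tf r))"

lemma Em_eq_Phi:
  assumes r: "0 < r" "r \<le> t" and m: "m \<ge> 1"
  obtains j where "j < m" "sp m j < r" "r \<le> sp m (Suc j)" "\<And>n. Em n m r = Phi n m j r"
proof -
  obtain j where j: "j < m" "sp m j < r" "r \<le> sp m (Suc j)"
    "\<And>a :: nat \<Rightarrow> real. (\<Sum>i<m. indicator {sp m i<..sp m (Suc i)} r *\<^sub>R a i) = a j"
    by (rule sp_index[OF r m]) (rule that)
  show ?thesis by (rule that[OF j(1-3)]) (simp only: Em_def j(4))
qed

context
  fixes N :: "real \<Rightarrow> 'd functional" and x0 :: "'d functional"
  assumes eq: "\<And>n m i j. m \<ge> 1 \<Longrightarrow> i \<le> m \<Longrightarrow> j \<le> m \<Longrightarrow>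
    \<eta> (sp m j) (\<psi> n (sp m i)) - x0 (\<psi> n (sp m i)) =
      (LINT r:{0..sp m j}|lebesgue. \<sigma> * \<eta> r (laplacian (\<psi> n (sp m i))))
      + (LINT r:{0..sp m j}|lebesgue. sobolev_pairing (\<eta> r) (dual_transport K F (\<rho> r) (\<psi> n (sp m i))))
      + N (sp m j) (\<psi> n (sp m i))"
begin

text \<open>The product rule on one interval. Changing the distribution first, against the
  polynomial of the left end point, and the polynomial second makes the noise enter through
  increments with a frozen test function.\<close>

lemma Phi_increment:
  assumes j: "j < m"
  shows "integrable M0 (Phi n m j)"
    and "\<eta> (sp m (Suc j)) (\<psi> n (sp m (Suc j))) - \<eta> (sp m j) (\<psi> n (sp m j)) =
      (\<integral>r. indicator {sp m j<..sp m (Suc j)} r *\<^sub>R Phi n m j r \<partial>M0)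
      + (N (sp m (Suc j)) (\<psi> n (sp m j)) - N (sp m j) (\<psi> n (sp m j)))"
proof -
  let ?s = "sp m j" and ?s' = "sp m (Suc j)"
  have s: "0 \<le> ?s" "?s \<le> ?s'" "?s' \<le> t" using sp_in[of j m] sp_in[of "Suc j" m] sp_mono[of j "Suc j" m] j by auto
  have sin: "?s \<in> {0..t}" using s by auto
  have eqs: "\<eta> s (\<psi> n ?s) - x0 (\<psi> n ?s) =
      (LINT r:{0..s}|lebesgue. \<sigma> * \<eta> r (laplacian (\<psi> n ?s)))
      + (LINT r:{0..s}|lebesgue. sobolev_pairing (\<eta> r) (dual_transport K F (\<rho> r) (\<psi> n ?s)))
      + N s (\<psi> n ?s)" if "s \<in> {?s, ?s'}" for s
    using that eq[of m j j n] eq[of m j "Suc j" n] j by auto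
  note A = spde_increment[OF c_herm[OF sin] s eqs]
  note B = eta_increment[OF s]
  show "integrable M0 (Phi n m j)"
    unfolding Phi_def[abs_def] by (rule Bochner_Integration.integrable_diff[OF A(1) B(1)])
  have "(\<integral>r. indicator {?s<..?s'} r *\<^sub>R Phi n m j r \<partial>M0) =
      (\<integral>r. indicator {?s<..?s'} r *\<^sub>R dr n (c ?s) r - indicator {?s<..?s'} r *\<^sub>R Re (lp n ?s' (G r)) \<partial>M0)"
    by (simp only: Phi_def scaleR_diff_right)
  also have "\<dots> = (\<integral>r. indicator {?s<..?s'} r *\<^sub>R dr n (c ?s) r \<partial>M0) - (\<integral>r. indicator {?s<..?s'} r *\<^sub>R Re (lp n ?s' (G r)) \<partial>M0)"
    by (rule Bochner_Integration.integral_diff[OF integrable_indicator_on(1)[OF A(1)] integrable_indicator_on(1)[OF B(1)[of n]]])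
  finally show "\<eta> ?s' (\<psi> n ?s') - \<eta> ?s (\<psi> n ?s) =
      (\<integral>r. indicator {?s<..?s'} r *\<^sub>R Phi n m j r \<partial>M0) + (N ?s' (\<psi> n ?s) - N ?s (\<psi> n ?s))"
    using A(2) B(2)[of n] by linarith
qed

lemma Em_integral:
  assumes m: "m \<ge> 1"
  shows "integrable M0 (Em n m)" "\<eta> t (\<psi> n t) - \<eta> 0 (\<psi> n 0) - ns N n m = (\<integral>r. Em n m r \<partial>M0)"
proof -
  have i: "integrable M0 (\<lambda>r. indicator {sp m j<..sp m (Suc j)} r *\<^sub>R Phi n m j r)" if "j < m" for j
    by (rule integrable_indicator_on(1)[OF Phi_increment(1)[OF that]])
  show "integrable M0 (Em n m)"
    unfolding Em_def[abs_def] by (rule Bochner_Integration.integrable_sum) (use i in auto)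
  have "\<eta> t (\<psi> n t) - \<eta> 0 (\<psi> n 0) = (\<Sum>j<m. \<eta> (sp m (Suc j)) (\<psi> n (sp m (Suc j))) - \<eta> (sp m j) (\<psi> n (sp m j)))"
    using sum_lessThan_telescope[of "\<lambda>j. \<eta> (sp m j) (\<psi> n (sp m j))" m] sp_last[OF m] by simp
  also have "\<dots> = (\<Sum>j<m. (\<integral>r. indicator {sp m j<..sp m (Suc j)} r *\<^sub>R Phi n m j r \<partial>M0)
      + (N (sp m (Suc j)) (\<psi> n (sp m j)) - N (sp m j) (\<psi> n (sp m j))))"
    by (rule sum.cong[OF refl]) (rule Phi_increment(2), simp)
  also have "\<dots> = (\<Sum>j<m. \<integral>r. indicator {sp m j<..sp m (Suc j)} r *\<^sub>R Phi n m j r \<partial>M0) + ns N n m"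
    by (simp only: sum.distrib ns_def)
  also have "(\<Sum>j<m. \<integral>r. indicator {sp m j<..sp m (Suc j)} r *\<^sub>R Phi n m j r \<partial>M0) = (\<integral>r. Em n m r \<partial>M0)"
    unfolding Em_def by (rule Bochner_Integration.integral_sum[symmetric]) (use i in auto)
  finally show "\<eta> t (\<psi> n t) - \<eta> 0 (\<psi> n 0) - ns N n m = (\<integral>r. Em n m r \<partial>M0)" by simp
qed

lemma c_bounds:
  "\<exists>B\<ge>0. \<forall>s\<in>{0..t}. sn (\<beta> + 1) (c s) \<le> ennreal B \<and>
    (\<forall>k. norm (c s k) \<le> jb k powr (- (\<beta> + 1)) * sqrt B) \<and> sn \<beta> (tf s) \<le> ennreal (Ctr * B) \<and>
    (\<forall>k. norm (tf s k) \<le> jb k powr (- \<beta>) * sqrt (Ctr * B))"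
proof -
  obtain B where B: "B \<ge> 0" "\<And>s. s \<in> {0..t} \<Longrightarrow> sn (\<beta> + 1) (c s) \<le> ennreal B"
    using Cs_bounded[OF f_Cs] by blast
  have tb: "sn \<beta> (tf r) \<le> ennreal (Ctr * B)" if r: "r \<in> {0..t}" for r
  proof -
    have "sn \<beta> (tf r) \<le> ennreal Ctr * sn (\<beta> + 1) (c r)" unfolding tf_def by (rule Ctr(2)[OF r])
    also have "\<dots> \<le> ennreal Ctr * ennreal B" by (rule mult_left_mono[OF B(2)[OF r]]) simp
    also have "\<dots> = ennreal (Ctr * B)" using Ctr(1) B(1) by (simp add: ennreal_mult)
    finally show ?thesis .
  qed
  have "norm (tf r k) \<le> jb k powr (- \<beta>) * sqrt (Ctr * B)" if "r \<in> {0..t}" for r k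
    by (rule norm_le_sn[OF tb[OF that]]) (simp add: Ctr(1) B(1))
  then show ?thesis using B tb norm_le_sn[OF B(2) B(1)] by (intro exI[of _ B]) blast
qed

text \<open>The majorant depends on the cut-off n but not on the partition: \<open>lb\<close> and
  \<open>gb\<close> bound the Laplacian and the time derivative mode by mode, and only the finitely
  many modes in the cube are summed.\<close>

lemma Em_bound: "\<exists>a b. \<forall>m\<ge>1. \<forall>r. 0 < r \<longrightarrow> r \<le> t \<longrightarrow> sn (- \<beta>) (U r) < \<infinity> \<longrightarrow> \<bar>Em n m r\<bar> \<le> a + b * nU r"
proof -
  obtain B where B: "B \<ge> 0" "\<And>s. s \<in> {0..t} \<Longrightarrow> sn (\<beta> + 1) (c s) \<le> ennreal B"
    "\<And>s k. s \<in> {0..t} \<Longrightarrow> norm (c s k) \<le> jb k powr (- (\<beta> + 1)) * sqrt B"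
    "\<And>r. r \<in> {0..t} \<Longrightarrow> sn \<beta> (tf r) \<le> ennreal (Ctr * B)"
    "\<And>r k. r \<in> {0..t} \<Longrightarrow> norm (tf r k) \<le> jb k powr (- \<beta>) * sqrt (Ctr * B)"
    using c_bounds by blast
  define lb where "lb k = (norm (freq k))\<^sup>2 * (jb k powr (- (\<beta> + 1)) * sqrt B)" for k :: "int^'d"
  define gb where "gb k = \<bar>\<sigma>\<bar> * lb k + jb k powr (- \<beta>) * sqrt (Ctr * B)" for k :: "int^'d"
  have lb: "norm (Dl (c s) k) \<le> lb k" if "s \<in> {0..t}" for s k
    using B(3)[OF that, of k] by (simp add: lb_def norm_mult norm_power mult_left_mono)
  have gb: "norm (G r k) \<le> gb k" if "r \<in> {0..t}" for r k
  proof -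
    have "norm (G r k) \<le> norm (of_real \<sigma> * lap r k) + norm (tf r k)" unfolding G_def by (rule norm_triangle_ineq)
    also have "norm (of_real \<sigma> * lap r k) = \<bar>\<sigma>\<bar> * norm (Dl (c r) k)" by (simp only: lap_def norm_mult norm_of_real)
    also have "\<bar>\<sigma>\<bar> * norm (Dl (c r) k) + norm (tf r k) \<le> gb k"
      unfolding gb_def by (intro add_mono mult_left_mono lb that B(5)) simp
    finally show ?thesis .
  qed
  define a where "a = \<bar>\<sigma>\<bar> * (\<Sum>k\<in>kbox n. Ub k * lb k) + 1 + (\<Sum>k\<in>kbox n. Ub k * gb k)"
  have "\<bar>Em n m r\<bar> \<le> a + Ctr * B * nU r" if m: "m \<ge> 1" and r: "0 < r" "r \<le> t" and u: "sn (- \<beta>) (U r) < \<infinity>" for m r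
  proof -
    obtain j where j: "j < m" "sp m j < r" "r \<le> sp m (Suc j)" "\<And>n. Em n m r = Phi n m j r"
      using Em_eq_Phi[OF r m] by blast
    have rin: "r \<in> {0..t}" using r by simp
    have s: "sp m j \<in> {0..t}" "sp m (Suc j) \<in> {0..t}" using sp_in[of j m] sp_in[of "Suc j" m] j(1) by auto
    have 1: "norm (lp n r (Dl (c (sp m j)))) \<le> (\<Sum>k\<in>kbox n. Ub k * lb k)" by (rule lp_bound[OF rin lb[OF s(1)]])
    have 2: "norm (lp n (sp m (Suc j)) (G r)) \<le> (\<Sum>k\<in>kbox n. Ub k * gb k)" by (rule lp_bound[OF s(2) gb[OF rin]])
    have 3: "norm (ctr r (trunc n (c (sp m j)))) \<le> 1 + nU r * (Ctr * B)"
    proof -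
      have "norm (ctr r (trunc n (c (sp m j)))) \<le> sqrt (nU r * (Ctr * B))"
        by (rule ctr_bound(2)[OF rin u order_trans[OF sn_trunc_le B(2)[OF s(1)]] B(1)])
      also have "\<dots> \<le> 1 + nU r * (Ctr * B)" by (rule sqrt_le_one_plus) (simp add: nU_nonneg Ctr(1) B(1))
      finally show ?thesis .
    qed
    have "\<bar>Em n m r\<bar> \<le> \<bar>dr n (c (sp m j)) r\<bar> + \<bar>Re (lp n (sp m (Suc j)) (G r))\<bar>"
      unfolding j(4) Phi_def by (rule abs_triangle_ineq4)
    also have "\<bar>Re (lp n (sp m (Suc j)) (G r))\<bar> \<le> (\<Sum>k\<in>kbox n. Ub k * gb k)"
      using abs_Re_le_cmod 2 by (rule order_trans)
    also have "\<bar>dr n (c (sp m j)) r\<bar> \<le> norm (of_real \<sigma> * lp n r (Dl (c (sp m j))) + ctr r (trunc n (c (sp m j))))"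
      unfolding dr_def by (rule abs_Re_le_cmod)
    also have "\<dots> \<le> norm (of_real \<sigma> * lp n r (Dl (c (sp m j)))) + norm (ctr r (trunc n (c (sp m j))))"
      by (rule norm_triangle_ineq)
    also have "norm (of_real \<sigma> * lp n r (Dl (c (sp m j)))) = \<bar>\<sigma>\<bar> * norm (lp n r (Dl (c (sp m j))))"
      by (simp only: norm_mult norm_of_real)
    also have "\<dots> \<le> \<bar>\<sigma>\<bar> * (\<Sum>k\<in>kbox n. Ub k * lb k)" by (rule mult_left_mono[OF 1]) simp
    also note 3
    finally show ?thesis by (simp add: a_def algebra_simps)
  qed
  then show ?thesis by blast
qed

text \<open>Both end points of the interval around r shrink to r. The backward solution converges in
  the norm of order \<beta> + 1, which the transport pairing needs; for the distribution convergence
  of the single modes is enough, as it is taken at the right end point only in a finite sum.\<close>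

lemma Em_tendsto:
  assumes r: "0 < r" "r \<le> t" and u: "sn (- \<beta>) (U r) < \<infinity>"
  shows "(\<lambda>m. Em n (Suc m) r) \<longlonglongrightarrow> En n r"
proof -
  have rin: "r \<in> {0..t}" using r by simp
  have "\<exists>j. j < Suc m \<and> sp (Suc m) j < r \<and> r \<le> sp (Suc m) (Suc j) \<and> (\<forall>n. Em n (Suc m) r = Phi n (Suc m) j r)" for m
  proof -
    obtain j where "j < Suc m" "sp (Suc m) j < r" "r \<le> sp (Suc m) (Suc j)" "\<And>n. Em n (Suc m) r = Phi n (Suc m) j r"
      using Em_eq_Phi[OF r, of "Suc m"] by auto
    then show ?thesis by blast
  qed
  then obtain j where j: "\<And>m. j m < Suc m" "\<And>m. sp (Suc m) (j m) < r" "\<And>m. r \<le> sp (Suc m) (Suc (j m))"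
    "\<And>m n. Em n (Suc m) r = Phi n (Suc m) (j m) r" by metis
  define lo where "lo m = sp (Suc m) (j m)" for m
  define hi where "hi m = sp (Suc m) (Suc (j m))" for m
  have lin: "lo m \<in> {0..t}" "hi m \<in> {0..t}" for m
    using sp_in[of "j m" "Suc m"] sp_in[of "Suc (j m)" "Suc m"] j(1)[of m] by (auto simp: lo_def hi_def)
  have ll: "lo \<longlonglongrightarrow> r" and hl: "hi \<longlonglongrightarrow> r"
    unfolding lo_def hi_def by (rule sp_limits[OF j(1-3)])+
  have cl: "(\<lambda>m. c (lo m) k) \<longlonglongrightarrow> c r k" for k
    by (rule continuous_on_sequence[OF Cs_continuous[OF f_Cs] rin ll lin(1)])
  have ul: "(\<lambda>m. U (hi m) k) \<longlonglongrightarrow> U r k" for k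
    by (rule continuous_on_sequence[OF U_continuous rin hl lin(2)])
  have l1: "(\<lambda>m. lp n r (Dl (c (lo m)))) \<longlonglongrightarrow> lp n r (Dl (c r))"
    unfolding lp_def by (intro tendsto_intros cl)
  have l3: "(\<lambda>m. lp n (hi m) (G r)) \<longlonglongrightarrow> lp n r (G r)"
    unfolding lp_def by (intro tendsto_intros ul)
  have l2: "(\<lambda>m. ctr r (trunc n (c (lo m)))) \<longlonglongrightarrow> ctr r (trunc n (c r))"
  proof (rule ctr_tendsto[OF rin u])
    show "sn (\<beta> + 1) (trunc n (c (lo m))) < \<infinity>" for m by (rule sn_finite_support[OF finite_kbox]) auto
    show "sn (\<beta> + 1) (trunc n (c r)) < \<infinity>" by (rule sn_finite_support[OF finite_kbox]) auto
    have g: "(\<lambda>m. sn (\<beta> + 1) (\<lambda>k. c (lo m) k - c r k)) \<longlonglongrightarrow> sn (\<beta> + 1) (\<lambda>k. c r k - c r k)"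
    proof (rule at_within_sequence[OF _ ll lin(1), where g = "\<lambda>s. sn (\<beta> + 1) (\<lambda>k. c s k - c r k)"])
      show "((\<lambda>s. sn (\<beta> + 1) (\<lambda>k. c s k - c r k)) \<longlongrightarrow> sn (\<beta> + 1) (\<lambda>k. c r k - c r k)) (at r within {0..t})"
        using f_Cs rin by (simp add: Cs_def sn_def)
    qed
    have "sn (\<beta> + 1) (\<lambda>k. c r k - c r k) = 0" by (simp add: sn_def)
    then have g0: "(\<lambda>m. sn (\<beta> + 1) (\<lambda>k. c (lo m) k - c r k)) \<longlonglongrightarrow> 0" using g by simp
    show "(\<lambda>m. sn (\<beta> + 1) (\<lambda>k. trunc n (c (lo m)) k - trunc n (c r) k)) \<longlonglongrightarrow> 0"
    proof (rule tendsto_sandwich[OF _ _ tendsto_const g0])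
      show "\<forall>\<^sub>F m in sequentially. sn (\<beta> + 1) (\<lambda>k. trunc n (c (lo m)) k - trunc n (c r) k) \<le> sn (\<beta> + 1) (\<lambda>k. c (lo m) k - c r k)"
        by (intro always_eventually allI sn_mono) simp
    qed simp
  qed
  have "(\<lambda>m. Re (of_real \<sigma> * lp n r (Dl (c (lo m))) + ctr r (trunc n (c (lo m)))) - Re (lp n (hi m) (G r)))
      \<longlonglongrightarrow> Re (of_real \<sigma> * lp n r (Dl (c r)) + ctr r (trunc n (c r))) - Re (lp n r (G r))"
    by (intro tendsto_diff tendsto_Re tendsto_add tendsto_mult_left l1 l2 l3)
  moreover have "Em n (Suc m) r = Re (of_real \<sigma> * lp n r (Dl (c (lo m))) + ctr r (trunc n (c (lo m)))) - Re (lp n (hi m) (G r))" for m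
    by (simp only: j(4) Phi_def dr_def lo_def hi_def)
  moreover have "Re (of_real \<sigma> * lp n r (Dl (c r)) + ctr r (trunc n (c r))) - Re (lp n r (G r)) = En n r"
  proof -
    \<comment> \<open>Here the Laplacian of the backward equation meets that of the limit equation
      at the same time r and cancels exactly.\<close>
    have "lp n r (G r) = of_real \<sigma> * lp n r (Dl (c r)) + lp n r (tf r)"
      by (simp add: lp_def G_def lap_def sum.distrib[symmetric] sum_distrib_left algebra_simps)
    then show ?thesis by (simp add: En_def)
  qed
  ultimately show ?thesis by simp
qed

text \<open>Both terms have the limit \<open>ctr r (c r)\<close>: the first by continuity of the
  transport pairing, the second as partial sums of an absolutely convergent series.\<close>

lemma En_tendsto:
  assumes r: "r \<in> {0..t}" and u: "sn (- \<beta>) (U r) < \<infinity>"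
  shows "(\<lambda>n. En n r) \<longlonglongrightarrow> 0"
proof -
  have fin: "sn (\<beta> + 1) (c r) < \<infinity>" by (rule f_sn[OF r])
  have l1: "(\<lambda>n. ctr r (trunc n (c r))) \<longlonglongrightarrow> ctr r (c r)"
  proof (rule ctr_tendsto[OF r u _ fin])
    show "sn (\<beta> + 1) (trunc n (c r)) < \<infinity>" for n by (rule sn_finite_support[OF finite_kbox]) auto
    have eq: "sn (\<beta> + 1) (\<lambda>k. trunc n (c r) k - c r k) = sn (\<beta> + 1) (\<lambda>k. if k \<in> kbox n then 0 else c r k)" for n
      by (intro antisym sn_mono) auto
    show "(\<lambda>n. sn (\<beta> + 1) (\<lambda>k. trunc n (c r) k - c r k)) \<longlonglongrightarrow> 0"
      unfolding eq by (rule sn_tail[OF fin])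
  qed
  obtain B where B: "sn (\<beta> + 1) (c r) = ennreal B" "B \<ge> 0" using fin by (cases "sn (\<beta> + 1) (c r)") auto
  have "integrable cs (\<lambda>k. U r k * cnj (tr K F (cf (\<rho> r)) (c r) k))"
    by (rule ctr_bound(1)[OF r u _ B(2)]) (simp add: B(1))
  from sum_kbox_tendsto[OF this]
  have l2: "(\<lambda>n. lp n r (tf r)) \<longlonglongrightarrow> ctr r (c r)" unfolding lp_def tf_def ctr_def .
  have "(\<lambda>n. Re (ctr r (trunc n (c r)) - lp n r (tf r))) \<longlonglongrightarrow> Re (ctr r (c r) - ctr r (c r))"
    by (intro tendsto_Re tendsto_diff l1 l2)
  then show ?thesis by (simp only: En_def diff_self zero_complex.simps)
qed

text \<open>In contrast to \<open>Em_bound\<close> this is uniform in the cut-off: duality controls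
  the full series and the bounds \<open>Ub\<close> of single modes do not enter. The 2 stems from
  two uses of \<open>sqrt_le_one_plus\<close>.\<close>

lemma En_bound: "\<exists>b. \<forall>n. \<forall>r\<in>{0..t}. sn (- \<beta>) (U r) < \<infinity> \<longrightarrow> \<bar>En n r\<bar> \<le> 2 + b * nU r"
proof -
  obtain B where B0: "B \<ge> 0" "\<And>s. s \<in> {0..t} \<Longrightarrow> sn (\<beta> + 1) (c s) \<le> ennreal B"
    "\<And>s k. s \<in> {0..t} \<Longrightarrow> norm (c s k) \<le> jb k powr (- (\<beta> + 1)) * sqrt B"
    "\<And>r. r \<in> {0..t} \<Longrightarrow> sn \<beta> (tf r) \<le> ennreal (Ctr * B)"
    "\<And>r k. r \<in> {0..t} \<Longrightarrow> norm (tf r k) \<le> jb k powr (- \<beta>) * sqrt (Ctr * B)"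
    using c_bounds by blast
  note B = B0(1,2,4)
  have CB: "Ctr * B \<ge> 0" using Ctr(1) B(1) by simp
  have "\<bar>En n r\<bar> \<le> 2 + (2 * (Ctr * B)) * nU r" if r: "r \<in> {0..t}" and u: "sn (- \<beta>) (U r) < \<infinity>" for n r
  proof -
    have s: "sqrt (nU r * (Ctr * B)) \<le> 1 + nU r * (Ctr * B)" by (rule sqrt_le_one_plus) (simp add: nU_nonneg Ctr(1) B(1))
    have 1: "norm (ctr r (trunc n (c r))) \<le> sqrt (nU r * (Ctr * B))"
      by (rule ctr_bound(2)[OF r u order_trans[OF sn_trunc_le B(2)[OF r]] B(1)])
    note p = pairing_le[OF u B(3)[OF r] CB]
    have "norm (lp n r (tf r)) \<le> (\<Sum>k\<in>kbox n. norm (U r k * cnj (tf r k)))" unfolding lp_def by (rule norm_sum)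
    also have "\<dots> = (\<integral>k. (if k \<in> kbox n then norm (U r k * cnj (tf r k)) else 0) \<partial>cs)"
      by (subst integrable_cs_finite(2)[where A = "kbox n"]) auto
    also have "\<dots> \<le> (\<integral>k. norm (U r k * cnj (tf r k)) \<partial>cs)"
      by (rule integral_mono) (use integrable_norm[OF p(1)] in \<open>auto intro: integrable_cs_finite(1)[OF finite_kbox]\<close>)
    also note p(2)
    finally have 2: "norm (lp n r (tf r)) \<le> sqrt (nU r * (Ctr * B))" .
    have "\<bar>En n r\<bar> \<le> norm (ctr r (trunc n (c r)) - lp n r (tf r))" unfolding En_def by (rule abs_Re_le_cmod)
    also have "\<dots> \<le> norm (ctr r (trunc n (c r))) + norm (lp n r (tf r))" by (rule norm_triangle_ineq4)
    finally show ?thesis using 1 2 s by (simp add: mult_ac)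
  qed
  then show ?thesis by blast
qed

lemma En_measurable: "En n \<in> borel_measurable M0"
proof -
  have cm: "(\<lambda>r. c r k) \<in> borel_measurable M0" for k by (rule f_measurable) simp
  have "(\<lambda>r. trunc n (c r) k) \<in> borel_measurable M0" for k
    by (cases "k \<in> kbox n") (simp_all add: cm)
  then show ?thesis unfolding En_def[abs_def]
    by (intro borel_measurable_ReI borel_measurable_diff ctr_measurable lp_measurable tf_measurable) auto
qed

text \<open>The deterministic core: for one trajectory the value at time t is an iterated limit of
  initial value plus noise sum. The inner limit is left as an existential, since only its existence
  and its own limit matter for the law.\<close>

lemma path_limit:
  assumes \<phi>: "test_function \<phi>"
  shows "\<exists>X. (\<forall>n. (\<lambda>m. \<eta> 0 (\<psi> n 0) + ns N n (Suc m)) \<longlonglongrightarrow> X n) \<and> X \<longlonglongrightarrow> \<eta> t \<phi>"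
proof (intro exI conjI allI)
  define R where "R n = (\<integral>r. En n r \<partial>M0)" for n
  interpret fm: finite_measure M0 by (rule finite_lebesgue_on)
  have lin_i: "integrable M0 (\<lambda>r. a + b * nU r)" for a b
    by (intro Bochner_Integration.integrable_add fm.integrable_const integrable_mult_right nU_integrable)
  show "(\<lambda>m. \<eta> 0 (\<psi> n 0) + ns N n (Suc m)) \<longlonglongrightarrow> \<eta> t (\<psi> n t) - R n" for n
  proof -
    obtain a b where ab: "\<And>m r. m \<ge> 1 \<Longrightarrow> 0 < r \<Longrightarrow> r \<le> t \<Longrightarrow> sn (- \<beta>) (U r) < \<infinity> \<Longrightarrow> \<bar>Em n m r\<bar> \<le> a + b * nU r"
      using Em_bound[of n] by blast
    have "(\<lambda>m. \<integral>r. Em n (Suc m) r \<partial>M0) \<longlonglongrightarrow> R n"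
      unfolding R_def
    proof (rule integral_dominated_convergence[where w = "\<lambda>r. a + b * nU r"])
      show "En n \<in> borel_measurable M0" by (rule En_measurable)
      show "Em n (Suc m) \<in> borel_measurable M0" for m
        by (rule borel_measurable_integrable[OF Em_integral(1)]) simp
      show "integrable M0 (\<lambda>r. a + b * nU r)" by (rule lin_i)
      show "AE r in M0. (\<lambda>m. Em n (Suc m) r) \<longlonglongrightarrow> En n r"
        using AE_M0_in snU_AE AE_neq_lebesgue_on[where t = t and s = 0]
        by eventually_elim (rule Em_tendsto, auto)
      show "AE r in M0. norm (Em n (Suc m) r) \<le> a + b * nU r" for m
        using AE_M0_in snU_AE AE_neq_lebesgue_on[where t = t and s = 0]
        by eventually_elim (simp only: real_norm_def, rule ab, auto)
    qed
    then have "(\<lambda>m. \<eta> t (\<psi> n t) - (\<integral>r. Em n (Suc m) r \<partial>M0)) \<longlonglongrightarrow> \<eta> t (\<psi> n t) - R n"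
      by (intro tendsto_diff tendsto_const)
    moreover have "\<eta> t (\<psi> n t) - (\<integral>r. Em n (Suc m) r \<partial>M0) = \<eta> 0 (\<psi> n 0) + ns N n (Suc m)" for m
      using Em_integral(2)[of "Suc m" n] by simp
    ultimately show ?thesis by simp
  qed
  have "R \<longlonglongrightarrow> (\<integral>r. 0 \<partial>M0)"
  proof -
    obtain b where b: "\<And>n r. r \<in> {0..t} \<Longrightarrow> sn (- \<beta>) (U r) < \<infinity> \<Longrightarrow> \<bar>En n r\<bar> \<le> 2 + b * nU r"
      using En_bound by blast
    show ?thesis unfolding R_def
    proof (rule integral_dominated_convergence[where w = "\<lambda>r. 2 + b * nU r"])
      show "En n \<in> borel_measurable M0" for n by (rule En_measurable)
      show "integrable M0 (\<lambda>r. 2 + b * nU r)" by (rule lin_i)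
      show "AE r in M0. (\<lambda>n. En n r) \<longlonglongrightarrow> 0"
        using AE_M0_in snU_AE by eventually_elim (rule En_tendsto)
      show "AE r in M0. norm (En n r) \<le> 2 + b * nU r" for n
        using AE_M0_in snU_AE by eventually_elim (simp only: real_norm_def, rule b)
    qed simp
  qed
  then have "R \<longlonglongrightarrow> 0" by simp
  \<comment> \<open>At the terminal time the backward solution is the test function itself, so its
    truncations converge against any distribution.\<close>
  moreover have "(\<lambda>n. \<eta> t (\<psi> n t)) \<longlonglongrightarrow> \<eta> t \<phi>"
    unfolding f_terminal using t0 by (intro distribution_approx[OF dist_eta \<phi>]) simp
  ultimately have "(\<lambda>n. \<eta> t (\<psi> n t) - R n) \<longlonglongrightarrow> \<eta> t \<phi> - 0" by (intro tendsto_diff)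
  then show "(\<lambda>n. \<eta> t (\<psi> n t) - R n) \<longlonglongrightarrow> \<eta> t \<phi>" by simp
qed

end

end

section \<open>Centred Gaussian variables\<close>

text \<open>Scaling a standard normal variable describes the degenerate case v = 0 and the proper
  one by the same formula.\<close>

lemma normal_law:
  assumes v: "0 \<le> v"
  shows "(if v = 0 then return borel 0 else density lborel (\<lambda>x. ennreal (normal_density 0 (sqrt v) x))) =
    distr std_normal_distribution borel (\<lambda>x. sqrt v * x)"
proof (cases "v = 0")
  case True
  interpret S: real_distribution std_normal_distribution by (rule real_dist_normal_dist)
  show ?thesis using True S.emeasure_space_1
    by (auto intro!: measure_eqI simp: emeasure_distr indicator_def split: if_splits)
next
  case False
  interpret S: real_distribution std_normal_distribution by (rule real_dist_normal_dist)
  have "distributed std_normal_distribution lborel (\<lambda>x. x) std_normal_density"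
    using distr_id2[of lborel std_normal_distribution] by (simp add: distributed_def)
  then have "distributed std_normal_distribution lborel (\<lambda>x. 0 + sqrt v * x) (normal_density (0 + sqrt v * 0) (\<bar>sqrt v\<bar> * 1))"
    by (rule S.normal_density_affine) (use False in auto)
  then have "distr std_normal_distribution lborel (\<lambda>x. sqrt v * x) = density lborel (normal_density 0 (sqrt v))"
    using v by (simp add: distributed_def)
  moreover have "distr std_normal_distribution lborel (\<lambda>x. sqrt v * x) = distr std_normal_distribution borel (\<lambda>x. sqrt v * x)"
    by (rule distr_cong) auto
  ultimately show ?thesis using False by simp
qed

lemma centered_normal_iff:
  "centered_normal P X v \<longleftrightarrow> X \<in> borel_measurable P \<and> 0 \<le> v \<and>
     distr P borel X = distr std_normal_distribution borel (\<lambda>x. sqrt v * x)"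
  unfolding centered_normal_def using normal_law by (cases "0 \<le> v") simp_all

text \<open>Levy's uniqueness theorem. In terms of characteristic functions sums and limits of
  Gaussian variables need no case distinction at variance 0.\<close>

lemma centered_normal_char_iff:
  assumes P: "prob_space P"
  shows "centered_normal P X v \<longleftrightarrow> X \<in> borel_measurable P \<and> 0 \<le> v \<and>
    (\<forall>l. (\<integral>\<omega>. iexp (l * X \<omega>) \<partial>P) = of_real (exp (- (l\<^sup>2 * v / 2))))"
proof -
  interpret S: real_distribution std_normal_distribution by (rule real_dist_normal_dist)
  interpret P: prob_space P by (rule P)
  have c1: "char (distr P borel X) s = (\<integral>\<omega>. iexp (s * X \<omega>) \<partial>P)" if "X \<in> borel_measurable P" for s
    unfolding char_def by (rule integral_distr[OF that]) simp
  have c2: "char (distr std_normal_distribution borel (\<lambda>x. sqrt v * x)) s = of_real (exp (- (s\<^sup>2 * v / 2)))" if "0 \<le> v" for s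
  proof -
    have "char (distr std_normal_distribution borel (\<lambda>x. sqrt v * x)) s = char std_normal_distribution (s * sqrt v)"
      unfolding char_def by (subst integral_distr) (auto simp: mult.assoc)
    then show ?thesis using that by (simp add: char_std_normal_distribution power_mult_distrib)
  qed
  have r1: "real_distribution (distr P borel X)" if "X \<in> borel_measurable P"
    using that by (rule P.real_distribution_distr)
  have r2: "real_distribution (distr std_normal_distribution borel (\<lambda>x. sqrt v * x))"
    by (rule S.real_distribution_distr) simp
  show ?thesis
  proof
    assume "centered_normal P X v"
    then have *: "X \<in> borel_measurable P" "0 \<le> v"
      "distr P borel X = distr std_normal_distribution borel (\<lambda>x. sqrt v * x)" by (auto simp: centered_normal_iff)
    show "X \<in> borel_measurable P \<and> 0 \<le> v \<and> (\<forall>l. (\<integral>\<omega>. iexp (l * X \<omega>) \<partial>P) = of_real (exp (- (l\<^sup>2 * v / 2))))"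
      using * c1[OF *(1)] c2[OF *(2)] by simp
  next
    assume *: "X \<in> borel_measurable P \<and> 0 \<le> v \<and> (\<forall>l. (\<integral>\<omega>. iexp (l * X \<omega>) \<partial>P) = of_real (exp (- (l\<^sup>2 * v / 2))))"
    have "char (distr P borel X) = char (distr std_normal_distribution borel (\<lambda>x. sqrt v * x))"
      using * c1 c2 by (intro ext) simp
    then have "distr P borel X = distr std_normal_distribution borel (\<lambda>x. sqrt v * x)"
      using Levy_uniqueness[OF r1 r2] * by blast
    then show "centered_normal P X v" using * by (simp add: centered_normal_iff)
  qed
qed

lemma centered_normal_moments:
  assumes "centered_normal P X v"
  shows "integrable P (\<lambda>\<omega>. X \<omega> ^ k)"
    and "(\<integral>\<omega>. (X \<omega>)\<^sup>2 \<partial>P) = v"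
    and "(\<integral>\<omega>. X \<omega> ^ 4 \<partial>P) = 3 * v\<^sup>2"
proof -
  have X: "X \<in> borel_measurable P" and v: "0 \<le> v"
    and d: "distr P borel X = distr std_normal_distribution borel (\<lambda>x. sqrt v * x)"
    using assms by (auto simp: centered_normal_iff)
  have i: "integrable (distr P borel X) (\<lambda>x. x ^ k)" for k
    unfolding d by (subst integrable_distr_eq) (auto simp: power_mult_distrib intro!: integrable_mult_right integrable_std_normal_distribution_moment)
  show "integrable P (\<lambda>\<omega>. X \<omega> ^ k)" using i[of k] by (subst (asm) integrable_distr_eq) (use X in auto)
  have m: "(\<integral>\<omega>. X \<omega> ^ (2 * k) \<partial>P) = v ^ k * (fact (2 * k) / (2 ^ k * fact k))" for k
  proof -
    have "(\<integral>\<omega>. X \<omega> ^ (2 * k) \<partial>P) = (\<integral>x. x ^ (2 * k) \<partial>distr P borel X)"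
      by (rule integral_distr[OF X, symmetric]) simp
    also have "\<dots> = (\<integral>x. sqrt v ^ (2 * k) * x ^ (2 * k) \<partial>std_normal_distribution)"
      unfolding d by (subst integral_distr) (auto simp: power_mult_distrib)
    also have "sqrt v ^ (2 * k) = v ^ k" using v by (simp add: power_mult)
    also have "(\<integral>x. v ^ k * x ^ (2 * k) \<partial>std_normal_distribution) = v ^ k * (fact (2 * k) / (2 ^ k * fact k))"
      using std_normal_distribution_even_moments[of k] by simp
    finally show ?thesis .
  qed
  show "(\<integral>\<omega>. (X \<omega>)\<^sup>2 \<partial>P) = v" using m[of 1] by simp
  show "(\<integral>\<omega>. X \<omega> ^ 4 \<partial>P) = 3 * v\<^sup>2" using m[of 2] by (simp add: fact_numeral)
qed

text \<open>Only second and fourth moments are used, with the value (1 + 3) / 2 = 2 in the constant.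
  What matters later is the order 3/2 in the variance.\<close>

lemma centered_normal_third_moment:
  assumes P: "prob_space P" and X: "centered_normal P X v"
  shows "(\<integral>\<omega>. \<bar>X \<omega>\<bar> ^ 3 \<partial>P) \<le> 2 * (v * sqrt v)"
proof -
  note m = centered_normal_moments[OF X]
  have v: "0 \<le> v" and Xm: "X \<in> borel_measurable P" using X by (auto simp: centered_normal_def)
  have i3: "integrable P (\<lambda>\<omega>. \<bar>X \<omega>\<bar> ^ 3)" using integrable_abs[OF m(1)[of 3]] by (simp add: power_abs)
  show ?thesis
  proof (cases "v = 0")
    case True
    then have "integral\<^sup>L P (\<lambda>\<omega>. (X \<omega>)\<^sup>2) = 0" using m(2) by simp
    then have "AE \<omega> in P. (X \<omega>)\<^sup>2 = 0" by (subst (asm) integral_nonneg_eq_0_iff_AE) (use m(1)[of 2] in auto)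
    then have "AE \<omega> in P. \<bar>X \<omega>\<bar> ^ 3 = 0" by eventually_elim simp
    then have "(\<integral>\<omega>. \<bar>X \<omega>\<bar> ^ 3 \<partial>P) = 0" by (rule integral_eq_zero_AE)
    then show ?thesis using True by simp
  next
    case False
    then have v0: "sqrt v > 0" using v by simp
    \<comment> \<open>The arithmetic-geometric mean of q x^2 and x^4 / q. The choice q = sqrt v, the
      standard deviation, gives both terms the same order in v.\<close>
    have pt: "\<bar>x\<bar> ^ 3 \<le> (q * x\<^sup>2 + x ^ 4 / q) / 2" if "q > 0" for x q :: real
    proof -
      have "0 \<le> \<bar>x\<bar>\<^sup>2 * (q - \<bar>x\<bar>)\<^sup>2" by simp
      then have "2 * \<bar>x\<bar> ^ 3 * q \<le> \<bar>x\<bar>\<^sup>2 * (q * q) + \<bar>x\<bar> ^ 4"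
        by (simp add: power2_diff algebra_simps power2_eq_square power3_eq_cube power4_eq_xxxx)
      then show ?thesis using that by (simp add: field_simps)
    qed
    have "(\<integral>\<omega>. \<bar>X \<omega>\<bar> ^ 3 \<partial>P) \<le> (\<integral>\<omega>. (sqrt v * (X \<omega>)\<^sup>2 + X \<omega> ^ 4 / sqrt v) / 2 \<partial>P)"
      by (rule integral_mono) (use i3 pt[OF v0] m(1) in auto)
    also have "\<dots> = (sqrt v * v + 3 * (v\<^sup>2 / sqrt v)) / 2" using m by simp
    also have "v\<^sup>2 / sqrt v = v * sqrt v" using v0 v by (simp add: field_simps power2_eq_square)
    finally show ?thesis by simp
  qed
qed

lemma borel_measurable_iexp:
  fixes X :: "'w \<Rightarrow> real"
  assumes "X \<in> borel_measurable P"
  shows "(\<lambda>\<omega>. iexp (l * X \<omega>)) \<in> borel_measurable P"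
  by (rule measurable_compose[OF assms borel_measurable_continuous_onI]) (intro continuous_intros)

text \<open>Characteristic functions are bounded by 1 and pass to the almost sure limit by dominated
  convergence. The limit is only defined up to a null set, so its measurability is a separate
  assumption.\<close>

lemma centered_normal_limit:
  assumes P: "prob_space P" and X: "\<And>n. centered_normal P (X n) (v n)"
    and v: "v \<longlonglongrightarrow> w" and lim: "AE \<omega> in P. (\<lambda>n. X n \<omega>) \<longlonglongrightarrow> Y \<omega>" and Y: "Y \<in> borel_measurable P"
  shows "centered_normal P Y w"
proof -
  interpret P: prob_space P by (rule P)
  note X' = X[unfolded centered_normal_char_iff[OF P]]
  have w: "0 \<le> w" by (rule LIMSEQ_le_const[OF v]) (use X' in auto)
  have "(\<integral>\<omega>. iexp (l * Y \<omega>) \<partial>P) = of_real (exp (- (l\<^sup>2 * w / 2)))" for l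
  proof (rule LIMSEQ_unique)
    show "(\<lambda>n. \<integral>\<omega>. iexp (l * X n \<omega>) \<partial>P) \<longlonglongrightarrow> (\<integral>\<omega>. iexp (l * Y \<omega>) \<partial>P)"
    proof (rule integral_dominated_convergence[where w = "\<lambda>_. 1"])
      show "AE \<omega> in P. (\<lambda>n. iexp (l * X n \<omega>)) \<longlonglongrightarrow> iexp (l * Y \<omega>)"
        using lim by eventually_elim (intro tendsto_intros)
    qed (use X' Y in \<open>auto simp del: of_real_mult intro!: borel_measurable_iexp\<close>)
    have "(\<lambda>n. of_real (exp (- (l\<^sup>2 * v n / 2))) :: complex) \<longlonglongrightarrow> of_real (exp (- (l\<^sup>2 * w / 2)))"
      by (intro tendsto_intros v) auto
    then show "(\<lambda>n. \<integral>\<omega>. iexp (l * X n \<omega>) \<partial>P) \<longlonglongrightarrow> of_real (exp (- (l\<^sup>2 * w / 2)))" using X' by simp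
  qed
  then show ?thesis using w Y by (simp add: centered_normal_char_iff[OF P])
qed

text \<open>An increment of order 3/2 > 1 forces the derivative to vanish. As the sign of
  \<open>C\<close> is not assumed, the proof passes to its absolute value.\<close>

lemma three_halves_constant:
  fixes h :: "real \<Rightarrow> complex"
  assumes "\<And>x y. a \<le> x \<Longrightarrow> x \<le> y \<Longrightarrow> y \<le> b \<Longrightarrow> norm (h y - h x) \<le> C * ((y - x) * sqrt (y - x))"
    and "a \<le> b"
  shows "h b = h a"
proof -
  have bd: "norm (h y - h x) \<le> \<bar>C\<bar> * sqrt \<bar>y - x\<bar> * \<bar>y - x\<bar>" if "x \<in> {a..b}" "y \<in> {a..b}" for x y
  proof -
    have "norm (h (max x y) - h (min x y)) \<le> C * ((max x y - min x y) * sqrt (max x y - min x y))"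
      by (rule assms(1)) (use that in auto)
    also have "\<dots> \<le> \<bar>C\<bar> * ((max x y - min x y) * sqrt (max x y - min x y))" by (rule mult_right_mono) auto
    finally show ?thesis by (auto simp: max_def min_def norm_minus_commute abs_real_def mult_ac split: if_splits)
  qed
  have "\<exists>c. \<forall>x\<in>{a..b}. h x = c"
  proof (rule has_derivative_zero_constant)
    fix x assume x: "x \<in> {a..b}"
    show "(h has_derivative (\<lambda>_. 0)) (at x within {a..b})"
      unfolding has_derivative_within
    proof (intro conjI bounded_linear_zero, rule Lim_null_comparison)
      show "\<forall>\<^sub>F y in at x within {a..b}. norm ((1 / norm (y - x)) *\<^sub>R (h y - (h x + 0))) \<le> \<bar>C\<bar> * sqrt \<bar>y - x\<bar>"
        using bd[OF x] by (auto simp: eventually_at_filter divide_simps intro!: always_eventually)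
      have "((\<lambda>y. \<bar>C\<bar> * sqrt \<bar>y - x\<bar>) \<longlongrightarrow> \<bar>C\<bar> * sqrt \<bar>x - x\<bar>) (at x within {a..b})"
        by (intro tendsto_intros)
      then show "((\<lambda>y. \<bar>C\<bar> * sqrt \<bar>y - x\<bar>) \<longlongrightarrow> 0) (at x within {a..b})" by simp
    qed
  qed simp
  then show ?thesis using assms(2) by force
qed

section \<open>Martingales with Gaussian increments\<close>

text \<open>The weight \<open>f\<close> need not be bounded; integrability of the product is enough.
  This is what allows the weight to contain the value of the martingale itself.\<close>

lemma cond_exp_bounded_integral:
  assumes P: "prob_space P" and sub: "subalgebra P G" and f: "f \<in> borel_measurable G"
    and int: "integrable P (\<lambda>\<omega>. f \<omega> * Y \<omega>)" and Y: "Y \<in> borel_measurable P"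
    and ce: "AE \<omega> in P. real_cond_exp P G Y \<omega> = Z \<omega>" and Z: "Z \<in> borel_measurable P"
  shows "(\<integral>\<omega>. f \<omega> * Y \<omega> \<partial>P) = (\<integral>\<omega>. f \<omega> * Z \<omega> \<partial>P)"
proof -
  interpret P: prob_space P by (rule P)
  interpret S: sigma_finite_subalgebra P G
    by (rule finite_measure_subalgebra_is_sigma_finite) (unfold_locales, rule sub)
  have fm: "f \<in> borel_measurable P" by (rule measurable_from_subalg[OF sub f])
  have "(\<integral>\<omega>. f \<omega> * Y \<omega> \<partial>P) = (\<integral>\<omega>. f \<omega> * real_cond_exp P G Y \<omega> \<partial>P)"
    by (rule S.real_cond_exp_intg(2)[OF int f Y, symmetric])
  also have "\<dots> = (\<integral>\<omega>. f \<omega> * Z \<omega> \<partial>P)"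
    by (rule integral_cong_AE) (use ce fm Z in auto)
  finally show ?thesis .
qed

text \<open>A scalar martingale with deterministic quadratic variation \<open>A\<close>. Normality
  is assumed for values and increments only, not jointly with the past of the filtration; the
  relation to the past has to come from the two martingale properties. The Lipschitz condition turns
  powers of the variance into powers of the time step.\<close>

locale gaussian_martingale =
  fixes P :: "'w measure" and \<F> :: "real \<Rightarrow> 'w measure" and T :: real
    and M :: "real \<Rightarrow> 'w \<Rightarrow> real" and A :: "real \<Rightarrow> real" and L :: real
  assumes basis: "stochastic_basis P \<F>"
    and mart: "martingale P \<F> T M"
    and mart2: "martingale P \<F> T (\<lambda>t \<omega>. (M t \<omega>)\<^sup>2 - A t)"
    and normal: "\<And>t. t \<in> {0..T} \<Longrightarrow> \<exists>v. centered_normal P (M t) v"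
    and normal_diff: "\<And>s t. s \<in> {0..T} \<Longrightarrow> t \<in> {0..T} \<Longrightarrow> \<exists>v. centered_normal P (\<lambda>\<omega>. M t \<omega> - M s \<omega>) v"
    and lipschitz: "\<And>s t. 0 \<le> s \<Longrightarrow> s \<le> t \<Longrightarrow> t \<le> T \<Longrightarrow> A t - A s \<le> L * (t - s)"
begin

sublocale prob_space P using basis by (simp add: stochastic_basis_def)

lemma sub: "subalgebra P (\<F> s)" using basis by (simp add: stochastic_basis_def)

lemma mono: "s \<le> u \<Longrightarrow> f \<in> borel_measurable (\<F> s) \<Longrightarrow> f \<in> borel_measurable (\<F> u)"
proof -
  assume "s \<le> u" "f \<in> borel_measurable (\<F> s)"
  moreover have "filtration (space P) \<F>" using basis by (simp add: stochastic_basis_def)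
  then have "space (\<F> s) = space (\<F> u)" "sets (\<F> s) \<subseteq> sets (\<F> u)" if "s \<le> u"
    using that by (auto simp: filtration_def)
  ultimately show ?thesis by (auto simp: measurable_def)
qed

lemma M_ad: "t \<in> {0..T} \<Longrightarrow> M t \<in> borel_measurable (\<F> t)"
  using mart by (simp add: martingale_def)

lemma M_meas: "t \<in> {0..T} \<Longrightarrow> M t \<in> borel_measurable P"
  by (rule measurable_from_subalg[OF sub M_ad])

lemma M_sq: "t \<in> {0..T} \<Longrightarrow> integrable P (\<lambda>\<omega>. (M t \<omega>)\<^sup>2)"
  using normal centered_normal_moments(1) by blast

context
  fixes s u :: real
  assumes su: "0 \<le> s" "s \<le> u" "u \<le> T"
begin

lemma sin: "s \<in> {0..T}" and uin: "u \<in> {0..T}" using su by auto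

abbreviation "D \<equiv> \<lambda>\<omega>. M u \<omega> - M s \<omega>"

lemma D_meas: "D \<in> borel_measurable P" by (intro borel_measurable_diff M_meas sin uin)

lemma D_pow: "integrable P (\<lambda>\<omega>. D \<omega> ^ k)"
  using normal_diff[OF sin uin] centered_normal_moments(1) by blast

lemma prod_integrable: "integrable P (\<lambda>\<omega>. M s \<omega> * M u \<omega>)"
proof (rule Bochner_Integration.integrable_bound)
  show "integrable P (\<lambda>\<omega>. (M s \<omega>)\<^sup>2 + (M u \<omega>)\<^sup>2)" by (intro Bochner_Integration.integrable_add M_sq sin uin)
  have "\<bar>x * y\<bar> \<le> x\<^sup>2 + y\<^sup>2" for x y :: real
    using sum_squares_bound[of x y] sum_squares_bound[of x "- y"] by (simp add: abs_if)
  then show "AE \<omega> in P. norm (M s \<omega> * M u \<omega>) \<le> norm ((M s \<omega>)\<^sup>2 + (M u \<omega>)\<^sup>2)" by simp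
qed (intro borel_measurable_times M_meas sin uin)

lemma bounded_times:
  fixes Z g :: "'w \<Rightarrow> real"
  assumes "Z \<in> borel_measurable (\<F> s)" "\<And>\<omega>. \<bar>Z \<omega>\<bar> \<le> B" "integrable P g"
  shows "integrable P (\<lambda>\<omega>. Z \<omega> * g \<omega>)"
proof (rule Bochner_Integration.integrable_bound)
  show "integrable P (\<lambda>\<omega>. B * g \<omega>)" using assms(3) by simp
  show "(\<lambda>\<omega>. Z \<omega> * g \<omega>) \<in> borel_measurable P"
    using measurable_from_subalg[OF sub assms(1)] assms(3) by measurable
  show "AE \<omega> in P. norm (Z \<omega> * g \<omega>) \<le> norm (B * g \<omega>)"
    using assms(2) by (intro always_eventually allI) (simp add: abs_mult, rule mult_right_mono, auto intro: order_trans[OF _ abs_ge_self])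
qed

text \<open>The first two conditional moments of an increment given the past, in weak form with a
  bounded weight \<open>Z\<close>.\<close>

lemma increment_moments:
  fixes Z :: "'w \<Rightarrow> real"
  assumes Z: "Z \<in> borel_measurable (\<F> s)" and B: "\<And>\<omega>. \<bar>Z \<omega>\<bar> \<le> B"
  shows "(\<integral>\<omega>. Z \<omega> * D \<omega> \<partial>P) = 0"
    and "(\<integral>\<omega>. Z \<omega> * (D \<omega>)\<^sup>2 \<partial>P) = (A u - A s) * (\<integral>\<omega>. Z \<omega> \<partial>P)"
proof -
  have Mi: "integrable P (M r)" if "r \<in> {0..T}" for r using mart that by (simp add: martingale_def)
  have sq: "integrable P (\<lambda>\<omega>. (M r \<omega>)\<^sup>2 - A r)" if "r \<in> {0..T}" for r using M_sq[OF that] by simp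
  have ce: "AE \<omega> in P. real_cond_exp P (\<F> s) (M u) \<omega> = M s \<omega>"
    using mart su by (auto simp: martingale_def)
  have ce2: "AE \<omega> in P. real_cond_exp P (\<F> s) (\<lambda>\<omega>. (M u \<omega>)\<^sup>2 - A u) \<omega> = (M s \<omega>)\<^sup>2 - A s"
    using mart2 su by (auto simp: martingale_def)
  note bt = bounded_times[OF Z B]
  have e1: "(\<integral>\<omega>. Z \<omega> * M u \<omega> \<partial>P) = (\<integral>\<omega>. Z \<omega> * M s \<omega> \<partial>P)"
    by (rule cond_exp_bounded_integral[OF prob_space_axioms sub Z bt[OF Mi[OF uin]] M_meas[OF uin] ce M_meas[OF sin]])
  show "(\<integral>\<omega>. Z \<omega> * D \<omega> \<partial>P) = 0"
    using e1 bt[OF Mi[OF uin]] bt[OF Mi[OF sin]] by (simp add: right_diff_distrib)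
  have e2: "(\<integral>\<omega>. Z \<omega> * ((M u \<omega>)\<^sup>2 - A u) \<partial>P) = (\<integral>\<omega>. Z \<omega> * ((M s \<omega>)\<^sup>2 - A s) \<partial>P)"
    by (rule cond_exp_bounded_integral[OF prob_space_axioms sub Z bt[OF sq[OF uin]] _ ce2])
      (use M_meas[OF uin] M_meas[OF sin] in auto)
  \<comment> \<open>The mixed term of the square: the martingale property is tested with the
    unbounded weight \<open>Z \<omega> * M s \<omega>\<close>, admissible because the product of
    both values is integrable.\<close>
  have e3: "(\<integral>\<omega>. (Z \<omega> * M s \<omega>) * M u \<omega> \<partial>P) = (\<integral>\<omega>. (Z \<omega> * M s \<omega>) * M s \<omega> \<partial>P)"
  proof (rule cond_exp_bounded_integral[OF prob_space_axioms sub _ _ M_meas[OF uin] ce M_meas[OF sin]])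
    show "(\<lambda>\<omega>. Z \<omega> * M s \<omega>) \<in> borel_measurable (\<F> s)" by (rule borel_measurable_times[OF Z M_ad[OF sin]])
    show "integrable P (\<lambda>\<omega>. Z \<omega> * M s \<omega> * M u \<omega>)" using bt[OF prod_integrable] by (simp add: mult.assoc)
  qed
  have Zi: "integrable P Z" using bt[of "\<lambda>_. 1"] by simp
  have "(\<integral>\<omega>. Z \<omega> * (D \<omega>)\<^sup>2 \<partial>P) = (\<integral>\<omega>. Z \<omega> * ((M u \<omega>)\<^sup>2 - A u) + Z \<omega> * ((M s \<omega>)\<^sup>2 - A s) + (A u + A s) * Z \<omega>
      - 2 * (Z \<omega> * (M s \<omega> * M u \<omega>)) \<partial>P)"
    by (rule Bochner_Integration.integral_cong) (auto simp: algebra_simps power2_eq_square)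
  also have "\<dots> = 2 * (\<integral>\<omega>. Z \<omega> * ((M s \<omega>)\<^sup>2 - A s) \<partial>P) + (A u + A s) * (\<integral>\<omega>. Z \<omega> \<partial>P) - 2 * (\<integral>\<omega>. Z \<omega> * (M s \<omega> * M u \<omega>) \<partial>P)"
    using e2 bt[OF sq[OF uin]] bt[OF sq[OF sin]] bt[OF prod_integrable] Zi by simp
  also have "(\<integral>\<omega>. Z \<omega> * (M s \<omega> * M u \<omega>) \<partial>P) = (\<integral>\<omega>. Z \<omega> * (M s \<omega>)\<^sup>2 \<partial>P)"
    using e3 by (simp add: mult.assoc power2_eq_square)
  also have "(\<integral>\<omega>. Z \<omega> * ((M s \<omega>)\<^sup>2 - A s) \<partial>P) = (\<integral>\<omega>. Z \<omega> * (M s \<omega>)\<^sup>2 \<partial>P) - A s * (\<integral>\<omega>. Z \<omega> \<partial>P)"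
    using bt[OF M_sq[OF sin]] Zi by (simp add: right_diff_distrib mult.commute[of _ "A s"])
  finally show "(\<integral>\<omega>. Z \<omega> * (D \<omega>)\<^sup>2 \<partial>P) = (A u - A s) * (\<integral>\<omega>. Z \<omega> \<partial>P)" by (simp add: algebra_simps)
qed

lemma D_normal: "centered_normal P D (A u - A s)"
proof -
  obtain v where v: "centered_normal P D v" using normal_diff[OF sin uin] by blast
  have "(\<integral>\<omega>. (D \<omega>)\<^sup>2 \<partial>P) = A u - A s" using increment_moments(2)[of "\<lambda>_. 1" 1] prob_space by simp
  then show ?thesis using v centered_normal_moments(2)[OF v] by simp
qed

lemma increment_moments_complex:
  fixes Z :: "'w \<Rightarrow> complex"
  assumes Z: "Z \<in> borel_measurable (\<F> s)" and B: "\<And>\<omega>. norm (Z \<omega>) \<le> B"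
  shows "integrable P (\<lambda>\<omega>. Z \<omega> * of_real (D \<omega> ^ k))"
    and "(\<integral>\<omega>. Z \<omega> * of_real (D \<omega>) \<partial>P) = 0"
    and "(\<integral>\<omega>. Z \<omega> * of_real ((D \<omega>)\<^sup>2) \<partial>P) = of_real (A u - A s) * (\<integral>\<omega>. Z \<omega> \<partial>P)"
proof -
  have Zm: "Z \<in> borel_measurable P" by (rule measurable_from_subalg[OF sub Z])
  show i: "integrable P (\<lambda>\<omega>. Z \<omega> * of_real (D \<omega> ^ k))" for k
  proof (rule Bochner_Integration.integrable_bound)
    show "integrable P (\<lambda>\<omega>. B * D \<omega> ^ k)" using D_pow[of k] by simp
    show "AE \<omega> in P. norm (Z \<omega> * of_real (D \<omega> ^ k)) \<le> norm (B * D \<omega> ^ k)"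
    proof (intro always_eventually allI)
      fix \<omega>
      have "norm (Z \<omega>) * \<bar>D \<omega> ^ k\<bar> \<le> \<bar>B\<bar> * \<bar>D \<omega> ^ k\<bar>"
        by (rule mult_right_mono[OF order_trans[OF B abs_ge_self]]) simp
      then show "norm (Z \<omega> * of_real (D \<omega> ^ k)) \<le> norm (B * D \<omega> ^ k)"
        by (simp only: norm_mult norm_of_real real_norm_def)
    qed
  qed (use Zm D_meas in measurable)
  have Zi: "integrable P Z" using i[of 0] by simp
  have re: "(\<lambda>\<omega>. Re (Z \<omega>)) \<in> borel_measurable (\<F> s)" "(\<lambda>\<omega>. Im (Z \<omega>)) \<in> borel_measurable (\<F> s)" using Z by auto
  have bd: "\<bar>Re (Z \<omega>)\<bar> \<le> B" "\<bar>Im (Z \<omega>)\<bar> \<le> B" for \<omega>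
    using B[of \<omega>] abs_Re_le_cmod[of "Z \<omega>"] abs_Im_le_cmod[of "Z \<omega>"] by linarith+
  note r = increment_moments[OF re(1) bd(1)] and m = increment_moments[OF re(2) bd(2)]
  have RI: "Re (\<integral>\<omega>. Z \<omega> * of_real (D \<omega> ^ k) \<partial>P) = (\<integral>\<omega>. Re (Z \<omega>) * D \<omega> ^ k \<partial>P)"
    "Im (\<integral>\<omega>. Z \<omega> * of_real (D \<omega> ^ k) \<partial>P) = (\<integral>\<omega>. Im (Z \<omega>) * D \<omega> ^ k \<partial>P)" for k
    using integral_Re[OF i[of k]] integral_Im[OF i[of k]] by (simp_all del: of_real_power)
  show "(\<integral>\<omega>. Z \<omega> * of_real (D \<omega>) \<partial>P) = 0"
    using RI[of 1] r(1) m(1) by (simp add: complex_eq_iff)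
  show "(\<integral>\<omega>. Z \<omega> * of_real ((D \<omega>)\<^sup>2) \<partial>P) = of_real (A u - A s) * (\<integral>\<omega>. Z \<omega> \<partial>P)"
    using RI[of 2] r(2) m(2) integral_Re[OF Zi] integral_Im[OF Zi] by (simp add: complex_eq_iff)
qed

text \<open>The exponential is expanded to second order. The known conditional moments evaluate the
  polynomial part; the remainder is at most |l D|^3 / 6, and the third moment of the increment is at
  most twice the power 3/2 of its variance.\<close>

lemma taylor_error:
  fixes Z :: "'w \<Rightarrow> complex"
  assumes Z: "Z \<in> borel_measurable (\<F> s)" and B: "\<And>\<omega>. norm (Z \<omega>) \<le> 1"
  shows "norm ((\<integral>\<omega>. Z \<omega> * iexp (l * D \<omega>) \<partial>P) - (1 - of_real (l\<^sup>2 * (A u - A s) / 2)) * (\<integral>\<omega>. Z \<omega> \<partial>P))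
    \<le> \<bar>l\<bar> ^ 3 * ((A u - A s) * sqrt (A u - A s))"
proof -
  have Zm: "Z \<in> borel_measurable P" by (rule measurable_from_subalg[OF sub Z])
  note i = increment_moments_complex[OF Z B]
  let ?T = "\<lambda>\<omega>. Z \<omega> + (\<i> * of_real l) * (Z \<omega> * of_real (D \<omega>)) - of_real (l\<^sup>2 / 2) * (Z \<omega> * of_real ((D \<omega>)\<^sup>2))"
  have Ti: "integrable P ?T"
    using i(1)[of 0] i(1)[of 1] i(1)[of 2] by (intro Bochner_Integration.integrable_add Bochner_Integration.integrable_diff integrable_mult_right) simp_all
  have Wi: "integrable P (\<lambda>\<omega>. Z \<omega> * iexp (l * D \<omega>))"
  proof (rule Bochner_Integration.integrable_bound)
    show "integrable P (\<lambda>_. 1 :: real)" by simp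
    show "(\<lambda>\<omega>. Z \<omega> * iexp (l * D \<omega>)) \<in> borel_measurable P"
      by (rule borel_measurable_times[OF Zm borel_measurable_iexp[OF D_meas]])
  qed (use B in \<open>auto simp: norm_mult\<close>)
  have "(\<integral>\<omega>. ?T \<omega> \<partial>P) = (1 - of_real (l\<^sup>2 * (A u - A s) / 2)) * (\<integral>\<omega>. Z \<omega> \<partial>P)"
  proof -
    have lin: "(\<integral>\<omega>. Z \<omega> + p * a \<omega> - q * b \<omega> \<partial>P) = (\<integral>\<omega>. Z \<omega> \<partial>P) + p * (\<integral>\<omega>. a \<omega> \<partial>P) - q * (\<integral>\<omega>. b \<omega> \<partial>P)"
      if "integrable P Z" "integrable P a" "integrable P b" for p q :: complex and a b
      using that by simp
    have "(\<integral>\<omega>. ?T \<omega> \<partial>P) = (\<integral>\<omega>. Z \<omega> \<partial>P) + (\<i> * of_real l) * (\<integral>\<omega>. Z \<omega> * of_real (D \<omega>) \<partial>P)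
        - of_real (l\<^sup>2 / 2) * (\<integral>\<omega>. Z \<omega> * of_real ((D \<omega>)\<^sup>2) \<partial>P)"
      by (rule lin) (use i(1)[of 0] i(1)[of 1] i(1)[of 2] in simp_all)
    also have "\<dots> = (1 - of_real (l\<^sup>2 * (A u - A s) / 2)) * (\<integral>\<omega>. Z \<omega> \<partial>P)"
      unfolding i(2,3) by (simp add: field_simps)
    finally show ?thesis .
  qed
  then have diff: "(\<integral>\<omega>. Z \<omega> * iexp (l * D \<omega>) \<partial>P) - (1 - of_real (l\<^sup>2 * (A u - A s) / 2)) * (\<integral>\<omega>. Z \<omega> \<partial>P)
      = (\<integral>\<omega>. Z \<omega> * iexp (l * D \<omega>) - ?T \<omega> \<partial>P)"
    using Bochner_Integration.integral_diff[OF Wi Ti] by simp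
  have "norm (\<integral>\<omega>. Z \<omega> * iexp (l * D \<omega>) - ?T \<omega> \<partial>P) \<le> (\<integral>\<omega>. \<bar>l\<bar> ^ 3 / 6 * \<bar>D \<omega>\<bar> ^ 3 \<partial>P)"
  proof (rule order_trans[OF integral_norm_bound integral_mono[OF integrable_norm[OF Bochner_Integration.integrable_diff[OF Wi Ti]]]])
    show "integrable P (\<lambda>\<omega>. \<bar>l\<bar> ^ 3 / 6 * \<bar>D \<omega>\<bar> ^ 3)"
      using integrable_abs[OF D_pow[of 3]] by (simp add: power_abs)
    show "norm (Z \<omega> * iexp (l * D \<omega>) - ?T \<omega>) \<le> \<bar>l\<bar> ^ 3 / 6 * \<bar>D \<omega>\<bar> ^ 3" for \<omega>
    proof -
      have "(\<Sum>k\<le>2. (\<i> * complex_of_real x) ^ k / fact k) = 1 + \<i> * of_real x - of_real (x\<^sup>2 / 2)" for x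
        by (simp add: numeral_2_eq_2 power_mult_distrib)
      then have e: "norm (iexp x - (1 + \<i> * of_real x - of_real (x\<^sup>2 / 2))) \<le> \<bar>x\<bar> ^ 3 / 6" for x
        using iexp_approx1[of x 2] by (simp add: numeral_3_eq_3 fact_numeral)
      have "z * w - (z + \<i> * of_real l * (z * of_real x) - of_real (l\<^sup>2 / 2) * (z * of_real (x\<^sup>2))) =
          z * (w - (1 + \<i> * of_real (l * x) - of_real ((l * x)\<^sup>2 / 2)))" for z w :: complex and x
        by (simp add: algebra_simps power_mult_distrib)
      from this[of "Z \<omega>" "iexp (l * D \<omega>)" "D \<omega>"]
      have eq: "Z \<omega> * iexp (l * D \<omega>) - ?T \<omega> =
          Z \<omega> * (iexp (l * D \<omega>) - (1 + \<i> * of_real (l * D \<omega>) - of_real ((l * D \<omega>)\<^sup>2 / 2)))" .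
      have "norm (Z \<omega> * iexp (l * D \<omega>) - ?T \<omega>) \<le> 1 * (\<bar>l * D \<omega>\<bar> ^ 3 / 6)"
        unfolding eq norm_mult by (rule mult_mono[OF B e]) simp_all
      then show ?thesis by (simp add: abs_mult power_mult_distrib)
    qed
  qed
  also have "\<dots> = \<bar>l\<bar> ^ 3 / 6 * (\<integral>\<omega>. \<bar>D \<omega>\<bar> ^ 3 \<partial>P)" by simp
  also have "\<dots> \<le> \<bar>l\<bar> ^ 3 / 6 * (2 * ((A u - A s) * sqrt (A u - A s)))"
    by (rule mult_left_mono[OF centered_normal_third_moment[OF prob_space_axioms D_normal]]) simp
  also have "\<dots> \<le> \<bar>l\<bar> ^ 3 * ((A u - A s) * sqrt (A u - A s))"
    using D_normal by (simp add: centered_normal_def)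
  finally show ?thesis unfolding diff .
qed

end

lemma A_mono: "0 \<le> s \<Longrightarrow> s \<le> u \<Longrightarrow> u \<le> T \<Longrightarrow> 0 \<le> A u - A s"
  using D_normal by (simp add: centered_normal_def)

text \<open>The compensated characteristic function \<open>h\<close> of the increment is Hoelder continuous of order \<open>3/2\<close>,
  hence constant.\<close>

lemma increment_char:
  fixes Z :: "'w \<Rightarrow> complex"
  assumes su: "0 \<le> s" "s \<le> u" "u \<le> T"
    and Z: "Z \<in> borel_measurable (\<F> s)" and B: "\<And>\<omega>. norm (Z \<omega>) \<le> 1"
  shows "(\<integral>\<omega>. Z \<omega> * iexp (l * (M u \<omega> - M s \<omega>)) \<partial>P) = of_real (exp (- (l\<^sup>2 * (A u - A s) / 2))) * (\<integral>\<omega>. Z \<omega> \<partial>P)"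
proof -
  define W where "W x \<omega> = Z \<omega> * iexp (l * (M x \<omega> - M s \<omega>))" for x \<omega>
  define h where "h x = of_real (exp (l\<^sup>2 * (A x - A s) / 2)) * (\<integral>\<omega>. W x \<omega> \<partial>P)" for x
  \<comment> \<open>At each later time the product is again a bounded variable measurable with
    respect to the past, so the expansion may be restarted there.\<close>
  have Wm: "W x \<in> borel_measurable (\<F> x)" if "s \<le> x" "x \<le> T" for x
    unfolding W_def using mono[OF that(1) Z] mono[OF that(1) M_ad] M_ad[of x] su that by simp
  have W1: "norm (W x \<omega>) \<le> 1" for x \<omega> unfolding W_def using B[of \<omega>] by (simp add: norm_mult)
  have "h u = h s"
  proof (rule three_halves_constant[OF _ su(2)])
    fix x y assume xy: "s \<le> x" "x \<le> y" "y \<le> u"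
    have x: "0 \<le> x" "x \<le> y" "y \<le> T" using xy su by auto
    let ?a = "A y - A x" and ?q = "1 - of_real (l\<^sup>2 * (A y - A x) / 2) :: complex"
    let ?w = "\<integral>\<omega>. W x \<omega> \<partial>P" and ?e = "of_real (exp (- (l\<^sup>2 * (A y - A x) / 2))) :: complex"
    have e1: "norm ((\<integral>\<omega>. W y \<omega> \<partial>P) - ?q * ?w) \<le> \<bar>l\<bar> ^ 3 * (?a * sqrt ?a)"
    proof -
      have "W y \<omega> = W x \<omega> * iexp (l * (M y \<omega> - M x \<omega>))" for \<omega>
        by (simp add: W_def exp_add[symmetric] algebra_simps)
      then show ?thesis using taylor_error[OF x Wm W1] xy x by simp
    qed
    \<comment> \<open>The expansion itself with weight 1 compares the exponential of the variance
      with its linear part, since the increment is normal; no separate estimate of the real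
      exponential is needed.\<close>
    have e2: "norm (?e - ?q) \<le> \<bar>l\<bar> ^ 3 * (?a * sqrt ?a)"
      using taylor_error[OF x, of "\<lambda>_. 1" l] D_normal[OF x] prob_space by (simp add: centered_normal_char_iff[OF prob_space_axioms])
    have w: "norm ?w \<le> 1"
    proof -
      have "norm ?w \<le> (\<integral>\<omega>. norm (W x \<omega>) \<partial>P)" by (rule integral_norm_bound)
      also have "\<dots> \<le> (\<integral>\<omega>. 1 \<partial>P)" by (rule integral_mono_AE') (use W1 in auto)
      finally show ?thesis using prob_space by simp
    qed
    have a: "0 \<le> ?a" "?a \<le> L * (y - x)" using A_mono[OF x] lipschitz[OF x] by auto
    have a3: "?a * sqrt ?a \<le> \<bar>L\<bar> * sqrt \<bar>L\<bar> * ((y - x) * sqrt (y - x))"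
    proof -
      have "?a \<le> \<bar>L\<bar> * (y - x)" by (rule order_trans[OF a(2) mult_right_mono]) (use xy in auto)
      then have "?a * sqrt ?a \<le> (\<bar>L\<bar> * (y - x)) * sqrt (\<bar>L\<bar> * (y - x))"
        using a(1) by (intro mult_mono) auto
      then show ?thesis by (simp add: real_sqrt_mult mult_ac)
    qed
    let ?E = "exp (l\<^sup>2 * (A u - A s) / 2)"
    have "h y - h x = of_real (exp (l\<^sup>2 * (A y - A s) / 2)) * ((\<integral>\<omega>. W y \<omega> \<partial>P) - ?e * ?w)"
    proof -
      have "exp (l\<^sup>2 * (A y - A s) / 2) * exp (- (l\<^sup>2 * (A y - A x) / 2)) = exp (l\<^sup>2 * (A x - A s) / 2)"
        unfolding exp_add[symmetric] by (simp add: field_simps)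
      then have "of_real (exp (l\<^sup>2 * (A y - A s) / 2)) * ?e = (of_real (exp (l\<^sup>2 * (A x - A s) / 2)) :: complex)"
        unfolding of_real_mult[symmetric] by simp
      then show ?thesis by (simp only: h_def right_diff_distrib mult.assoc[symmetric])
    qed
    then have "norm (h y - h x) = exp (l\<^sup>2 * (A y - A s) / 2) * norm ((\<integral>\<omega>. W y \<omega> \<partial>P) - ?e * ?w)"
      by (simp only: norm_mult norm_of_real abs_exp_cancel)
    also have "\<dots> \<le> ?E * (2 * (\<bar>l\<bar> ^ 3 * (?a * sqrt ?a)))"
    proof (rule mult_mono)
      show "exp (l\<^sup>2 * (A y - A s) / 2) \<le> ?E"
        using A_mono[of y u] x xy su by (simp add: divide_right_mono mult_left_mono)
      \<comment> \<open>Both the true expectation and the Gaussian factor are compared with the same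
        linear polynomial in the variance, whence the factor 2.\<close>
      have "(\<integral>\<omega>. W y \<omega> \<partial>P) - ?e * ?w = ((\<integral>\<omega>. W y \<omega> \<partial>P) - ?q * ?w) - (?e - ?q) * ?w" by (simp add: algebra_simps)
      also have "norm \<dots> \<le> norm ((\<integral>\<omega>. W y \<omega> \<partial>P) - ?q * ?w) + norm ((?e - ?q) * ?w)" by (rule norm_triangle_ineq4)
      also have "norm ((?e - ?q) * ?w) \<le> \<bar>l\<bar> ^ 3 * (?a * sqrt ?a) * 1"
        unfolding norm_mult using a by (intro mult_mono e2 w) auto
      finally show "norm ((\<integral>\<omega>. W y \<omega> \<partial>P) - ?e * ?w) \<le> 2 * (\<bar>l\<bar> ^ 3 * (?a * sqrt ?a))" using e1 by simp
    qed simp_all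
    also have "\<dots> \<le> ?E * (2 * (\<bar>l\<bar> ^ 3 * (\<bar>L\<bar> * sqrt \<bar>L\<bar> * ((y - x) * sqrt (y - x)))))"
      by (intro mult_left_mono a3) auto
    finally show "norm (h y - h x) \<le> ?E * (2 * (\<bar>l\<bar> ^ 3 * (\<bar>L\<bar> * sqrt \<bar>L\<bar>))) * ((y - x) * sqrt (y - x))" by (simp only: mult.assoc)
  qed
  moreover have "h s = (\<integral>\<omega>. Z \<omega> \<partial>P)" by (simp add: h_def W_def)
  ultimately have "of_real (exp (- (l\<^sup>2 * (A u - A s) / 2))) * h u = of_real (exp (- (l\<^sup>2 * (A u - A s) / 2))) * (\<integral>\<omega>. Z \<omega> \<partial>P)" by simp
  moreover have "of_real (exp (- (l\<^sup>2 * (A u - A s) / 2))) * h u = (\<integral>\<omega>. W u \<omega> \<partial>P)"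
    unfolding h_def mult.assoc[symmetric] of_real_mult[symmetric] exp_add[symmetric] by simp
  ultimately show ?thesis by (simp add: W_def)
qed

end

section \<open>The noise\<close>

lemma l1_le_sqrt_sn:
  fixes c :: "int^'d::finite \<Rightarrow> complex"
  assumes \<alpha>: "\<alpha> > real CARD('d) / 2" and c: "sn \<alpha> c < \<infinity>"
  shows "(\<integral>k. norm (c k) \<partial>cs) \<le> sqrt (enn2real (Zc \<alpha> TYPE('d)) * enn2real (sn \<alpha> c))"
proof (rule real_le_rsqrt)
  let ?I = "\<integral>\<^sup>+k. ennreal (norm (c k)) \<partial>cs"
  have I: "(\<integral>k. norm (c k) \<partial>cs) = enn2real ?I"
    by (rule integral_eq_nn_integral) (use sn_integrable[OF \<alpha> c] in auto)
  have "enn2real (?I\<^sup>2) \<le> enn2real (Zc \<alpha> TYPE('d) * sn \<alpha> c)"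
    by (rule enn2real_mono[OF sn_l1]) (use Zc_finite[OF \<alpha>] c in \<open>simp add: ennreal_mult_less_top\<close>)
  then show "(\<integral>k. norm (c k) \<partial>cs)\<^sup>2 \<le> enn2real (Zc \<alpha> TYPE('d)) * enn2real (sn \<alpha> c)"
    by (simp add: I enn2real_mult power2_eq_square)
qed

lemma norm_grad_square: "(norm (grad f x))\<^sup>2 = (\<Sum>i\<in>UNIV. (partial_d i f x)\<^sup>2)"
  unfolding power2_norm_eq_inner inner_vec_def grad_def by (simp add: power2_eq_square)

lemma grad_square_bound:
  fixes f :: "real^'d::finite \<Rightarrow> real"
  assumes "\<And>i. \<bar>partial_d i f x\<bar> \<le> D"
  shows "\<bar>(norm (grad f x))\<^sup>2\<bar> \<le> real CARD('d) * D\<^sup>2"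
proof -
  have "(\<Sum>i\<in>UNIV. (partial_d i f x)\<^sup>2) \<le> (\<Sum>i\<in>(UNIV :: 'd set). D\<^sup>2)"
    by (rule sum_mono) (use assms in \<open>simp add: abs_le_square_iff[symmetric] order_trans[OF _ abs_ge_self]\<close>)
  then show ?thesis by (simp add: norm_grad_square sum_nonneg)
qed

lemma grad_square_test_function:
  fixes f :: "real^'d::finite \<Rightarrow> real"
  assumes "test_function f"
  shows "(\<lambda>x. (norm (grad f x))\<^sup>2) \<in> borel_measurable borel" "\<exists>B\<ge>0. \<forall>x. \<bar>(norm (grad f x))\<^sup>2\<bar> \<le> B"
proof -
  have c: "continuous_on UNIV (partial_d i f)" for i
  proof -
    have "C_diff (Suc 0) f" using assms unfolding test_function_def smooth_def by blast
    then show ?thesis by simp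
  qed
  have cg: "continuous_on UNIV (\<lambda>x. (norm (grad f x))\<^sup>2)"
    unfolding norm_grad_square by (intro continuous_intros c)
  then show "(\<lambda>x. (norm (grad f x))\<^sup>2) \<in> borel_measurable borel" by (rule borel_measurable_continuous_onI)
  have "periodic (partial_d i f)" for i
    using assms by (intro periodic_partial_d) (simp add: test_function_def)
  then have "periodic (\<lambda>x. (norm (grad f x))\<^sup>2)" unfolding norm_grad_square periodic_def by simp
  from periodic_bounded[OF this cg] show "\<exists>B\<ge>0. \<forall>x. \<bar>(norm (grad f x))\<^sup>2\<bar> \<le> B"
    by (metis real_norm_def)
qed

section \<open>Integrals against the density\<close>

context density_path
begin

lemma rho_integral: "r \<in> {0..T} \<Longrightarrow> (\<integral>x. \<rho> r x \<partial>tm) = 1" "r \<in> {0..T} \<Longrightarrow> 0 \<le> \<rho> r x"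
  using rho_prob by (auto simp: probability_density_def integral_tm)

lemma pairing_rho_integrable:
  assumes r: "r \<in> {0..T}" and g: "g \<in> borel_measurable borel" "\<And>x. \<bar>g x\<bar> \<le> B"
  shows "integrable tm (\<lambda>x. g x * \<rho> r x)"
proof (rule Bochner_Integration.integrable_bound)
  show "integrable tm (\<lambda>x. B * \<rho> r x)" using rho_regular(3)[OF r] by simp
  show "(\<lambda>x. g x * \<rho> r x) \<in> borel_measurable tm"
    using borel_tm[OF g(1)] rho_regular(3)[OF r] by measurable
  show "AE x in tm. norm (g x * \<rho> r x) \<le> norm (B * \<rho> r x)"
  proof (intro always_eventually allI)
    fix x
    have "\<bar>g x\<bar> * \<bar>\<rho> r x\<bar> \<le> \<bar>B\<bar> * \<bar>\<rho> r x\<bar>" by (rule mult_right_mono) (use g(2)[of x] in auto)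
    then show "norm (g x * \<rho> r x) \<le> norm (B * \<rho> r x)" by (simp add: abs_mult)
  qed
qed

lemma pairing_rho_bound:
  assumes r: "r \<in> {0..T}" and g: "g \<in> borel_measurable borel" "\<And>x. \<bar>g x\<bar> \<le> B"
  shows "\<bar>pairing g (\<rho> r)\<bar> \<le> B"
proof -
  have "\<bar>pairing g (\<rho> r)\<bar> \<le> (\<integral>x. \<bar>g x * \<rho> r x\<bar> \<partial>tm)" unfolding pairing_tm by (rule integral_abs_bound)
  also have "\<dots> \<le> (\<integral>x. B * \<rho> r x \<partial>tm)"
  proof (rule integral_mono)
    show "integrable tm (\<lambda>x. \<bar>g x * \<rho> r x\<bar>)" by (rule integrable_abs[OF pairing_rho_integrable[OF r g]])
    show "integrable tm (\<lambda>x. B * \<rho> r x)" using rho_regular(3)[OF r] by simp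
    show "\<bar>g x * \<rho> r x\<bar> \<le> B * \<rho> r x" for x
      using g(2)[of x] rho_integral(2)[OF r, of x] by (simp add: abs_mult mult_right_mono)
  qed
  also have "\<dots> = B" using rho_integral(1)[OF r] by simp
  finally show ?thesis .
qed

lemma pairing_rho_tendsto:
  assumes r: "r \<in> {0..T}" and g: "\<And>n. g n \<in> borel_measurable borel" "\<And>n x. \<bar>g n x\<bar> \<le> B"
    and lim: "\<And>x. (\<lambda>n. g n x) \<longlonglongrightarrow> h x"
  shows "(\<lambda>n. pairing (g n) (\<rho> r)) \<longlonglongrightarrow> pairing h (\<rho> r)"
  unfolding pairing_tm
proof (rule integral_dominated_convergence[where w = "\<lambda>x. B * \<rho> r x"])
  have h: "h \<in> borel_measurable borel" by (rule borel_measurable_LIMSEQ_real[OF lim g(1)])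
  show "(\<lambda>x. h x * \<rho> r x) \<in> borel_measurable tm"
    using borel_tm[OF h] rho_regular(3)[OF r] by measurable
  show "(\<lambda>x. g n x * \<rho> r x) \<in> borel_measurable tm" for n
    using borel_tm[OF g(1)] rho_regular(3)[OF r] by measurable
  show "integrable tm (\<lambda>x. B * \<rho> r x)" using rho_regular(3)[OF r] by simp
  show "AE x in tm. (\<lambda>n. g n x * \<rho> r x) \<longlonglongrightarrow> h x * \<rho> r x"
    by (intro always_eventually allI tendsto_mult_right lim)
  show "AE x in tm. norm (g n x * \<rho> r x) \<le> B * \<rho> r x" for n
    using g(2)[of n] rho_integral(2)[OF r] by (intro always_eventually allI) (simp add: abs_mult mult_right_mono)
qed

text \<open>The density converges uniformly in space, because the sum of the moduli of its
  coefficients is controlled by the norm of order \<beta>. Continuity in time makes the variance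
  integrands measurable.\<close>

lemma pairing_rho_continuous:
  assumes g: "g \<in> borel_measurable borel" "\<And>x. \<bar>g x\<bar> \<le> B"
  shows "continuous_on {0..T} (\<lambda>r. pairing g (\<rho> r))"
  unfolding continuous_on_def
proof
  fix r assume r: "r \<in> {0..T}"
  define e where "e s = sqrt (enn2real (Zc \<beta> TYPE('d)) * enn2real (sn \<beta> (\<lambda>k. cf (\<rho> s) k - cf (\<rho> r) k)))" for s
  have "((\<lambda>s. enn2real (sn \<beta> (\<lambda>k. cf (\<rho> s) k - cf (\<rho> r) k))) \<longlongrightarrow> enn2real 0) (at r within {0..T})"
    by (rule tendsto_enn2real) (use rho_Cs r in \<open>auto simp: Cs_def\<close>)
  then have "(e \<longlongrightarrow> sqrt (enn2real (Zc \<beta> TYPE('d)) * 0)) (at r within {0..T})"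
    unfolding e_def by (intro tendsto_real_sqrt tendsto_mult_left) simp
  then have e: "((\<lambda>s. \<bar>B\<bar> * measure (tm :: (real^'d) measure) torus * e s) \<longlongrightarrow> 0) (at r within {0..T})"
    using tendsto_mult_right_zero by fastforce
  have "\<forall>\<^sub>F s in at r within {0..T}. s \<in> {0..T}" by (simp add: eventually_at_filter)
  moreover have "\<forall>\<^sub>F s in at r within {0..T}. sn \<beta> (\<lambda>k. cf (\<rho> s) k - cf (\<rho> r) k) < \<infinity>"
    by (rule order_tendstoD(2)[of _ 0]) (use rho_Cs r in \<open>auto simp: Cs_def\<close>)
  ultimately have "\<forall>\<^sub>F s in at r within {0..T}. norm (pairing g (\<rho> s) - pairing g (\<rho> r)) \<le> \<bar>B\<bar> * measure (tm :: (real^'d) measure) torus * e s"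
  proof eventually_elim
    case (elim s)
    have pt: "\<bar>\<rho> s x - \<rho> r x\<bar> \<le> e s" for x
    proof -
      have "fser (\<lambda>k. cf (\<rho> s) k - cf (\<rho> r) k) (\<lambda>x. of_real (\<rho> s x) - of_real (\<rho> r x))"
        by (rule fser_diff[OF rho_fser[OF elim(1)] rho_fser[OF r]])
      from fser_bound[OF this, of x] have "\<bar>\<rho> s x - \<rho> r x\<bar> \<le> (\<integral>k. norm (cf (\<rho> s) k - cf (\<rho> r) k) \<partial>cs)"
        by (simp flip: of_real_diff)
      also have "\<dots> \<le> e s" unfolding e_def by (rule l1_le_sqrt_sn[OF beta elim(2)])
      finally show ?thesis .
    qed
    have "pairing g (\<rho> s) - pairing g (\<rho> r) = (\<integral>x. g x * (\<rho> s x - \<rho> r x) \<partial>tm)"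
      unfolding pairing_tm
      by (subst Bochner_Integration.integral_diff[OF pairing_rho_integrable[OF elim(1) g] pairing_rho_integrable[OF r g], symmetric])
        (simp add: right_diff_distrib)
    also have "norm \<dots> \<le> (\<integral>x. \<bar>B\<bar> * e s \<partial>(tm :: (real^'d) measure))"
    proof (rule order_trans[OF integral_norm_bound integral_mono])
      have "integrable tm (\<lambda>x. g x * (\<rho> s x - \<rho> r x))"
        using Bochner_Integration.integrable_diff[OF pairing_rho_integrable[OF elim(1) g] pairing_rho_integrable[OF r g]]
        by (simp add: right_diff_distrib)
      then show "integrable tm (\<lambda>x. norm (g x * (\<rho> s x - \<rho> r x)))" by (rule integrable_norm)
      show "norm (g x * (\<rho> s x - \<rho> r x)) \<le> \<bar>B\<bar> * e s" for x
        unfolding real_norm_def abs_mult by (rule mult_mono[OF order_trans[OF g(2) abs_ge_self] pt]) auto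
    qed simp
    finally show ?case by (simp add: mult_ac)
  qed
  then have "((\<lambda>s. pairing g (\<rho> s) - pairing g (\<rho> r)) \<longlongrightarrow> 0) (at r within {0..T})"
    by (rule Lim_null_comparison[OF _ e])
  then show "((\<lambda>s. pairing g (\<rho> s)) \<longlongrightarrow> pairing g (\<rho> r)) (at r within {0..T})" by (rule LIM_zero_cancel)
qed

abbreviation q :: "(real^'d \<Rightarrow> real) \<Rightarrow> real \<Rightarrow> real" where
  "q \<psi> r \<equiv> pairing (\<lambda>x. (norm (grad \<psi> x))\<^sup>2) (\<rho> r)"

lemma q_integrable:
  assumes "test_function \<psi>" "t \<in> {0..T}"
  shows "integrable (lebesgue_on {0..t}) (q \<psi>)"
proof -
  obtain B where B: "B \<ge> 0" "\<And>x. \<bar>(norm (grad \<psi> x))\<^sup>2\<bar> \<le> B" using grad_square_test_function(2)[OF assms(1)] by blast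
  interpret fm: finite_measure "lebesgue_on {0..t}" by (rule finite_lebesgue_on)
  show ?thesis
  proof (rule fm.integrable_const_bound[where B = B])
    show "q \<psi> \<in> borel_measurable (lebesgue_on {0..t})"
      by (rule continuous_measurable_lebesgue_on[OF pairing_rho_continuous[OF grad_square_test_function(1)[OF assms(1)] B(2)]]) (use assms in auto)
    show "AE r in lebesgue_on {0..t}. norm (q \<psi> r) \<le> B"
      using assms(2) by (intro AE_I2) (auto intro!: pairing_rho_bound grad_square_test_function(1)[OF assms(1)] B(2))
  qed
qed

end

section \<open>Gaussian sums of noise increments\<close>

locale noise = density_path K T \<beta> \<rho> F \<zeta> \<theta>
  for K :: "real^'d::finite \<Rightarrow> real^'d" and T \<beta> :: real and \<rho> :: "real \<Rightarrow> real^'d \<Rightarrow> real"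
    and F :: "real^'d \<Rightarrow> real^'d" and \<zeta> \<theta> :: "real^'d \<Rightarrow> real" +
  fixes P :: "'w measure" and \<F> :: "real \<Rightarrow> 'w measure" and \<sigma> :: real
    and M :: "real \<Rightarrow> 'w \<Rightarrow> 'd functional"
  assumes basis: "stochastic_basis P \<F>" and M: "noise_process P \<F> T \<sigma> \<rho> M" and sigma: "\<sigma> > 0"
begin

sublocale prob_space P using basis by (simp add: stochastic_basis_def)

definition A :: "(real^'d \<Rightarrow> real) \<Rightarrow> real \<Rightarrow> real" where
  "A \<psi> u = 2 * \<sigma> * (LINT r:{0..u}|lebesgue. q \<psi> r)"

lemma A_diff:
  assumes "test_function \<psi>" "t \<in> {0..T}" "0 \<le> s" "s \<le> u" "u \<le> t"
  shows "A \<psi> u - A \<psi> s = 2 * \<sigma> * (\<integral>r. indicator {s<..u} r *\<^sub>R q \<psi> r \<partial>lebesgue_on {0..t})"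
  unfolding A_def right_diff_distrib[symmetric]
  by (subst integral_increment(1)[OF q_integrable[OF assms(1,2)] assms(3-5)]) simp

text \<open>Normality of values and of increments are linear combinations with one and with two
  terms. The Lipschitz constant is 2 \<sigma> times the supremum of the squared gradient, as the
  density has mass one.\<close>

lemma gaussian_martingale:
  assumes \<psi>: "test_function \<psi>"
  shows "\<exists>L. gaussian_martingale P \<F> T (\<lambda>t \<omega>. M t \<omega> \<psi>) (A \<psi>) L"
proof -
  obtain B where B: "B \<ge> 0" "\<And>x. \<bar>(norm (grad \<psi> x))\<^sup>2\<bar> \<le> B" using grad_square_test_function(2)[OF \<psi>] by blast
  note n = M[unfolded noise_process_def]
  have mart: "martingale P \<F> T (\<lambda>t \<omega>. M t \<omega> \<psi>)" and mart2: "martingale P \<F> T (\<lambda>t \<omega>. (M t \<omega> \<psi>)\<^sup>2 - A \<psi> t)"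
    unfolding A_def using n \<psi> by blast+
  have joint: "\<forall>(n::nat) c t \<phi>. (\<forall>i<n. t i \<in> {0..T} \<and> test_function (\<phi> i)) \<longrightarrow>
        (\<exists>v. centered_normal P (\<lambda>\<omega>. \<Sum>i<n. c i * M (t i) \<omega> (\<phi> i)) v)"
    using n by (elim conjE)
  have "gaussian_martingale P \<F> T (\<lambda>t \<omega>. M t \<omega> \<psi>) (A \<psi>) (2 * \<sigma> * B)"
  proof
    show "\<exists>v. centered_normal P (\<lambda>\<omega>. M t \<omega> \<psi>) v" if "t \<in> {0..T}" for t
      using joint[rule_format, of 1 "\<lambda>_. t" "\<lambda>_. \<psi>" "\<lambda>_. 1"] that \<psi> by simp
    show "\<exists>v. centered_normal P (\<lambda>\<omega>. M t \<omega> \<psi> - M s \<omega> \<psi>) v" if "s \<in> {0..T}" "t \<in> {0..T}" for s t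
      using joint[rule_format, of 2 "\<lambda>i. if i = 0 then t else s" "\<lambda>_. \<psi>" "\<lambda>i. if i = 0 then 1 else - 1"] that \<psi>
      by (simp add: numeral_2_eq_2)
    show "A \<psi> u - A \<psi> s \<le> 2 * \<sigma> * B * (u - s)" if su: "0 \<le> s" "s \<le> u" "u \<le> T" for s u
    proof -
      have u: "u \<in> {0..T}" using su by simp
      interpret fm: finite_measure "lebesgue_on {0..u}" by (rule finite_lebesgue_on)
      have "(\<integral>r. indicator {s<..u} r *\<^sub>R q \<psi> r \<partial>lebesgue_on {0..u}) \<le> (\<integral>r. indicator {s<..u} r *\<^sub>R B \<partial>lebesgue_on {0..u})"
      proof (rule integral_mono)
        show "integrable (lebesgue_on {0..u}) (\<lambda>r. indicator {s<..u} r *\<^sub>R q \<psi> r)"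
          by (rule integrable_indicator_on(1)[OF q_integrable[OF \<psi> u]])
        show "integrable (lebesgue_on {0..u}) (\<lambda>r. indicator {s<..u} r *\<^sub>R B)"
          by (rule integrable_indicator_on(1)[OF fm.integrable_const])
        show "indicator {s<..u} r *\<^sub>R q \<psi> r \<le> indicator {s<..u} r *\<^sub>R B" if "r \<in> space (lebesgue_on {0..u})" for r
        proof -
          have "r \<in> {0..T}" using that su by simp
          then have "q \<psi> r \<le> B" by (rule abs_le_D1[OF pairing_rho_bound[OF _ grad_square_test_function(1)[OF \<psi>] B(2)]])
          then show ?thesis by (simp add: indicator_def)
        qed
      qed
      also have "\<dots> = (LINT r:{0..u}|lebesgue. B) - (LINT r:{0..s}|lebesgue. B)"
        by (rule integral_increment(1)[symmetric]) (use su in auto)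
      also have "\<dots> = B * (u - s)" using su by (simp add: LINT_on algebra_simps measure_restrict_space)
      finally show ?thesis using sigma su A_diff[OF \<psi> u su(1,2) order_refl] by (simp add: mult.assoc)
    qed
  qed (fact basis mart mart2)+
  then show ?thesis by blast
qed

text \<open>By induction the exponential of the partial sum is a bounded variable known at the left
  end point of the next interval, so the characteristic function factorises and variances add. The
  test function may change from interval to interval. Independence of the initial value from the
  noise is part of the same argument, since \<open>Y\<close> is known at time 0.\<close>

lemma partition_normal:
  assumes Y: "Y \<in> borel_measurable (\<F> 0)" "centered_normal P Y v"
    and s: "s 0 = 0" "\<And>j. j < m \<Longrightarrow> 0 \<le> s j \<and> s j \<le> s (Suc j) \<and> s (Suc j) \<le> T"
    and \<psi>: "\<And>j. test_function (\<psi> j)"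
  shows "centered_normal P (\<lambda>\<omega>. Y \<omega> + (\<Sum>j<m. M (s (Suc j)) \<omega> (\<psi> j) - M (s j) \<omega> (\<psi> j)))
      (v + (\<Sum>j<m. A (\<psi> j) (s (Suc j)) - A (\<psi> j) (s j)))"
proof -
  define S where "S n \<omega> = Y \<omega> + (\<Sum>j<n. M (s (Suc j)) \<omega> (\<psi> j) - M (s j) \<omega> (\<psi> j))" for n \<omega>
  have "S n \<in> borel_measurable (\<F> (s n)) \<and> centered_normal P (S n) (v + (\<Sum>j<n. A (\<psi> j) (s (Suc j)) - A (\<psi> j) (s j)))"
    if "n \<le> m" for n using that
  proof (induction n)
    case 0
    have "S 0 = Y" by (simp add: S_def fun_eq_iff)
    then show ?case using Y s(1) by simp
  next
    case (Suc n)
    let ?D = "\<lambda>\<omega>. M (s (Suc n)) \<omega> (\<psi> n) - M (s n) \<omega> (\<psi> n)" and ?w = "v + (\<Sum>j<n. A (\<psi> j) (s (Suc j)) - A (\<psi> j) (s j))"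
    obtain L where "gaussian_martingale P \<F> T (\<lambda>t \<omega>. M t \<omega> (\<psi> n)) (A (\<psi> n)) L"
      using gaussian_martingale[OF \<psi>] by blast
    then interpret G: gaussian_martingale P \<F> T "\<lambda>t \<omega>. M t \<omega> (\<psi> n)" "A (\<psi> n)" L .
    have sn: "0 \<le> s n" "s n \<le> s (Suc n)" "s (Suc n) \<le> T" using s(2)[of n] Suc.prems by auto
    have IH: "S n \<in> borel_measurable (\<F> (s n))" "centered_normal P (S n) ?w" using Suc by auto
    have eq: "S (Suc n) = (\<lambda>\<omega>. S n \<omega> + ?D \<omega>)" by (simp add: S_def fun_eq_iff add.assoc)
    have Dm: "?D \<in> borel_measurable (\<F> (s (Suc n)))"
      by (intro borel_measurable_diff G.M_ad G.mono[OF sn(2) G.M_ad]) (use sn in auto)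
    have m: "S (Suc n) \<in> borel_measurable (\<F> (s (Suc n)))"
      unfolding eq by (rule borel_measurable_add[OF G.mono[OF sn(2) IH(1)] Dm])
    have ch: "(\<integral>\<omega>. iexp (l * S (Suc n) \<omega>) \<partial>P) =
        of_real (exp (- (l\<^sup>2 * (?w + (A (\<psi> n) (s (Suc n)) - A (\<psi> n) (s n))) / 2)))" for l
    proof -
      have "(\<integral>\<omega>. iexp (l * S (Suc n) \<omega>) \<partial>P) = (\<integral>\<omega>. iexp (l * S n \<omega>) * iexp (l * ?D \<omega>) \<partial>P)"
        unfolding eq by (rule Bochner_Integration.integral_cong) (simp_all add: exp_add[symmetric] algebra_simps)
      also have "\<dots> = of_real (exp (- (l\<^sup>2 * (A (\<psi> n) (s (Suc n)) - A (\<psi> n) (s n)) / 2))) * (\<integral>\<omega>. iexp (l * S n \<omega>) \<partial>P)"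
        \<comment> \<open>The weight is the exponential of everything accumulated up to the left end
          point.\<close>
        by (rule G.increment_char[OF sn borel_measurable_iexp[OF IH(1)]]) simp
      also have "(\<integral>\<omega>. iexp (l * S n \<omega>) \<partial>P) = of_real (exp (- (l\<^sup>2 * ?w / 2)))"
        using IH(2) by (simp only: centered_normal_char_iff[OF prob_space_axioms])
      also have "of_real (exp (- (l\<^sup>2 * (A (\<psi> n) (s (Suc n)) - A (\<psi> n) (s n)) / 2))) * of_real (exp (- (l\<^sup>2 * ?w / 2))) =
          (of_real (exp (- (l\<^sup>2 * (?w + (A (\<psi> n) (s (Suc n)) - A (\<psi> n) (s n))) / 2))) :: complex)"
        unfolding of_real_mult[symmetric] exp_add[symmetric] by (simp add: field_simps)
      finally show ?thesis .
    qed
    have "centered_normal P (S (Suc n)) (?w + (A (\<psi> n) (s (Suc n)) - A (\<psi> n) (s n)))"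
      unfolding centered_normal_char_iff[OF prob_space_axioms]
      using ch measurable_from_subalg[OF G.sub m] IH(2) G.A_mono[OF sn] by (simp add: centered_normal_def)
    then show ?case using m by (simp add: add.assoc)
  qed
  from this[of m] show ?thesis by (simp add: S_def[abs_def])
qed

end

section \<open>Convergence of the variances\<close>

lemma tpf_bound:
  assumes "integrable cs c"
  shows "\<bar>tpf (kbox n) c x\<bar> \<le> (\<integral>k. norm (c k) \<partial>cs)"
proof -
  have "\<bar>tpf (kbox n) c x\<bar> \<le> (\<Sum>k\<in>kbox n. norm (c k))"
    unfolding tpf_def
    by (rule order_trans[OF sum_abs sum_mono]) (rule order_trans[OF abs_Re_le_cmod], simp add: norm_mult)
  also have "\<dots> = (\<integral>k. (if k \<in> kbox n then norm (c k) else 0) \<partial>cs)"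
    by (subst integrable_cs_finite(2)[where A = "kbox n"]) auto
  also have "\<dots> \<le> (\<integral>k. norm (c k) \<partial>cs)"
    by (rule integral_mono) (use integrable_norm[OF assms] in \<open>auto intro: integrable_cs_finite(1)[OF finite_kbox]\<close>)
  finally show ?thesis .
qed

lemma tpf_tendsto:
  assumes "fser c (\<lambda>x. of_real (g x))"
  shows "(\<lambda>n. tpf (kbox n) c x) \<longlonglongrightarrow> g x"
proof -
  have "(\<lambda>n. Re (\<Sum>k\<in>kbox n. c k * ch k x)) \<longlonglongrightarrow> Re (\<integral>k. c k * ch k x \<partial>cs)"
    by (intro tendsto_Re sum_kbox_tendsto integrable_ch fser_integrable[OF assms])
  moreover have "(\<integral>k. c k * ch k x \<partial>cs) = of_real (g x)" using assms unfolding fser_def by simp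
  ultimately show ?thesis by (simp add: tpf_def)
qed

lemma tpf_borel: "tpf A c \<in> borel_measurable borel"
  by (rule borel_measurable_continuous_onI[OF C_diff_continuous[OF C_diff_tpf[where m = 0]]])

context backward
begin

text \<open>One constant bounds, for all times and all cut-offs, the suprema of the truncated
  solutions and of their first derivatives, since a sum of moduli over a cube is at most the full
  sum.\<close>

lemma l1_bounds:
  "\<exists>D\<ge>0. \<forall>s\<in>{0..t}. (\<integral>k. norm (cf (f s) k) \<partial>cs) \<le> D \<and> (\<forall>i. (\<integral>k. norm (dcf i (cf (f s)) k) \<partial>cs) \<le> D)"
proof -
  obtain B where B: "B \<ge> 0" "\<And>s. s \<in> {0..t} \<Longrightarrow> sn (\<beta> + 1) (cf (f s)) \<le> ennreal B"
    using Cs_bounded[OF f_Cs] by metis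
  define D1 where "D1 = sqrt (enn2real (Zc (\<beta> + 1) TYPE('d)) * B)"
  define D2 where "D2 = sqrt (enn2real (Zc \<beta> TYPE('d)) * B)"
  have "(\<integral>k. norm (cf (f s) k) \<partial>cs) \<le> max D1 D2 \<and> (\<forall>i. (\<integral>k. norm (dcf i (cf (f s)) k) \<partial>cs) \<le> max D1 D2)"
    if s: "s \<in> {0..t}" for s
  proof (intro conjI allI)
    have "(\<integral>k. norm (cf (f s) k) \<partial>cs) \<le> sqrt (enn2real (Zc (\<beta> + 1) TYPE('d)) * enn2real (sn (\<beta> + 1) (cf (f s))))"
      by (rule l1_le_sqrt_sn[OF beta1 f_sn[OF s]])
    also have "\<dots> \<le> D1" unfolding D1_def using B(1) B(2)[OF s]
      by (intro real_sqrt_le_mono mult_left_mono enn2real_leI) auto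
    finally show "(\<integral>k. norm (cf (f s) k) \<partial>cs) \<le> max D1 D2" by simp
    fix i
    have d: "sn \<beta> (dcf i (cf (f s))) \<le> sn (\<beta> + 1) (cf (f s))"
      unfolding dcf_def[abs_def] by (rule sn_deriv)
    have "(\<integral>k. norm (dcf i (cf (f s)) k) \<partial>cs) \<le> sqrt (enn2real (Zc \<beta> TYPE('d)) * enn2real (sn \<beta> (dcf i (cf (f s)))))"
      by (rule l1_le_sqrt_sn[OF beta le_less_trans[OF d f_sn[OF s]]])
    also have "\<dots> \<le> D2" unfolding D2_def using B(1) order_trans[OF d B(2)[OF s]]
      by (intro real_sqrt_le_mono mult_left_mono enn2real_leI) auto
    finally show "(\<integral>k. norm (dcf i (cf (f s)) k) \<partial>cs) \<le> max D1 D2" by simp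
  qed
  moreover have "max D1 D2 \<ge> 0" using B(1) by (simp add: D1_def le_max_iff_disj)
  ultimately show ?thesis by blast
qed

lemma dcf_fser: "s \<in> {0..t} \<Longrightarrow> fser (dcf i (cf (f s))) (\<lambda>x. of_real (partial_d i (f s) x))"
  unfolding dcf_def[abs_def] by (rule fser_partial(2)[OF f_fser sn_deriv_integrable[OF beta f_sn]])

lemma grad_square_tpf: "(norm (grad (\<psi> n s) x))\<^sup>2 = (\<Sum>i\<in>UNIV. (tpf (kbox n) (dcf i (cf (f s))) x)\<^sup>2)"
  by (simp add: norm_grad_square partial_d_tpf)

lemma grad_square_tpf_borel: "(\<lambda>x. (norm (grad (\<psi> n s) x))\<^sup>2) \<in> borel_measurable borel"
  by (rule grad_square_test_function(1)[OF test_function_tpf])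

lemma grad_square_tpf_bound: "\<exists>B\<ge>0. \<forall>n. \<forall>s\<in>{0..t}. \<forall>x. \<bar>(norm (grad (\<psi> n s) x))\<^sup>2\<bar> \<le> B"
proof -
  obtain D where D: "D \<ge> 0" "\<And>s i. s \<in> {0..t} \<Longrightarrow> (\<integral>k. norm (dcf i (cf (f s)) k) \<partial>cs) \<le> D" using l1_bounds by blast
  have "\<bar>(norm (grad (\<psi> n s) x))\<^sup>2\<bar> \<le> real CARD('d) * D\<^sup>2" if s: "s \<in> {0..t}" for n s x
    by (rule grad_square_bound, unfold partial_d_tpf, rule order_trans[OF tpf_bound[OF fser_integrable[OF dcf_fser[OF s]]] D(2)[OF s]])
  then show ?thesis by (intro exI[of _ "real CARD('d) * D\<^sup>2"]) simp
qed

lemma q_time_limit: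
  assumes X: "X \<longlonglongrightarrow> s" "\<And>m. X m \<in> {0..t}" and s: "s \<in> {0..t}" and r: "r \<in> {0..T}"
  shows "(\<lambda>m. q (\<psi> n (X m)) r) \<longlonglongrightarrow> q (\<psi> n s) r"
proof -
  obtain B where B: "B \<ge> 0" "\<And>n s x. s \<in> {0..t} \<Longrightarrow> \<bar>(norm (grad (\<psi> n s) x))\<^sup>2\<bar> \<le> B" using grad_square_tpf_bound by blast
  show ?thesis
  proof (rule pairing_rho_tendsto[OF r grad_square_tpf_borel B(2)[OF X(2)]])
    have cl: "(\<lambda>m. cf (f (X m)) k) \<longlonglongrightarrow> cf (f s) k" for k
      by (rule continuous_on_sequence[OF Cs_continuous[OF f_Cs] s X])
    show "(\<lambda>m. (norm (grad (\<psi> n (X m)) x))\<^sup>2) \<longlonglongrightarrow> (norm (grad (\<psi> n s) x))\<^sup>2" for x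
      unfolding grad_square_tpf tpf_def dcf_def by (intro tendsto_intros cl)
  qed
qed

lemma q_fourier_limit:
  assumes s: "s \<in> {0..t}" and r: "r \<in> {0..T}"
  shows "(\<lambda>n. q (\<psi> n s) r) \<longlonglongrightarrow> q (f s) r"
proof -
  obtain B where B: "B \<ge> 0" "\<And>n s x. s \<in> {0..t} \<Longrightarrow> \<bar>(norm (grad (\<psi> n s) x))\<^sup>2\<bar> \<le> B" using grad_square_tpf_bound by blast
  show ?thesis
  proof (rule pairing_rho_tendsto[OF r grad_square_tpf_borel B(2)[OF s]])
    show "(\<lambda>n. (norm (grad (\<psi> n s) x))\<^sup>2) \<longlonglongrightarrow> (norm (grad (f s) x))\<^sup>2" for x
      unfolding grad_square_tpf unfolding norm_grad_square by (intro tendsto_intros tpf_tendsto dcf_fser s)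
  qed
qed

lemma initial_variance_limit:
  "(\<lambda>n. pairing (\<lambda>x. (\<psi> n 0 x)\<^sup>2) (\<rho> 0) - (pairing (\<psi> n 0) (\<rho> 0))\<^sup>2)
    \<longlonglongrightarrow> pairing (\<lambda>x. (f 0 x)\<^sup>2) (\<rho> 0) - (pairing (f 0) (\<rho> 0))\<^sup>2"
proof -
  have 0: "0 \<in> {0..t}" "0 \<in> {0..T}" using t by auto
  obtain D where D: "D \<ge> 0" "(\<integral>k. norm (cf (f 0) k) \<partial>cs) \<le> D" using l1_bounds 0 by blast
  have b: "\<bar>\<psi> n 0 x\<bar> \<le> D" for n x
    by (rule order_trans[OF tpf_bound[OF fser_integrable[OF f_fser[OF 0(1)]]] D(2)])
  have l: "(\<lambda>n. \<psi> n 0 x) \<longlonglongrightarrow> f 0 x" for x by (rule tpf_tendsto[OF f_fser[OF 0(1)]])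
  have m: "(\<lambda>x. (\<psi> n 0 x)\<^sup>2) \<in> borel_measurable borel" for n by (rule borel_measurable_power[OF tpf_borel])
  have b2: "\<bar>(\<psi> n 0 x)\<^sup>2\<bar> \<le> D\<^sup>2" for n x using power_mono[OF b abs_ge_zero, of n x 2] by simp
  show ?thesis
    by (intro tendsto_diff tendsto_power pairing_rho_tendsto[OF 0(2) m b2] pairing_rho_tendsto[OF 0(2) tpf_borel b] l)
qed

text \<open>The same iterated limit as for the drift: step functions of time built from frozen
  gradients converge boundedly first in the partition and then in the cut-off. Measurability of the
  limits follows along the way.\<close>

lemma noise_variance_limit:
  "\<exists>w. (\<forall>n. (\<lambda>m. \<Sum>j<Suc m. \<integral>r. indicator {sp (Suc m) j<..sp (Suc m) (Suc j)} r *\<^sub>R q (\<psi> n (sp (Suc m) j)) r \<partial>lebesgue_on {0..t})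
      \<longlonglongrightarrow> w n) \<and> w \<longlonglongrightarrow> (LINT s:{0..t}|lebesgue. q (f s) s)"
proof -
  let ?M = "lebesgue_on {0..t}"
  interpret fm: finite_measure ?M by (rule finite_lebesgue_on)
  obtain B where B: "B \<ge> 0" "\<And>n s x. s \<in> {0..t} \<Longrightarrow> \<bar>(norm (grad (\<psi> n s) x))\<^sup>2\<bar> \<le> B" using grad_square_tpf_bound by blast
  have qb: "\<bar>q (\<psi> n s) r\<bar> \<le> B" if "s \<in> {0..t}" "r \<in> {0..t}" for n s r
    using that t by (intro pairing_rho_bound[OF _ grad_square_tpf_borel B(2)]) auto
  define V where "V n m r = (\<Sum>j<m. indicator {sp m j<..sp m (Suc j)} r *\<^sub>R q (\<psi> n (sp m j)) r)" for n m r
  \<comment> \<open>The value at 0 is set to 0 because the left-open intervals omit this point;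
    convergence then holds at every time in [0,t].\<close>
  define V' where "V' n r = (if r = 0 then 0 else q (\<psi> n r) r)" for n r
  have i: "integrable ?M (\<lambda>r. indicator {sp m j<..sp m (Suc j)} r *\<^sub>R q (\<psi> n (sp m j)) r)" for n m j
    by (rule integrable_indicator_on(1)[OF q_integrable[OF test_function_tpf t]])
  have Vi: "integrable ?M (V n m)" for n m
    unfolding V_def[abs_def] by (rule Bochner_Integration.integrable_sum) (rule i)
  have V0: "V n m 0 = 0" for n m
    unfolding V_def using sp_mono[of 0] by (intro sum.neutral) (simp add: indicator_def not_less)
  have ex: "\<exists>j. j < Suc m \<and> sp (Suc m) j < r \<and> r \<le> sp (Suc m) (Suc j) \<and> (\<forall>n. V n (Suc m) r = q (\<psi> n (sp (Suc m) j)) r)"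
    if r: "0 < r" "r \<le> t" for r m
  proof -
    obtain j where j: "j < Suc m" "sp (Suc m) j < r" "r \<le> sp (Suc m) (Suc j)"
      "\<And>a :: nat \<Rightarrow> real. (\<Sum>i<Suc m. indicator {sp (Suc m) i<..sp (Suc m) (Suc i)} r *\<^sub>R a i) = a j"
      by (rule sp_index[OF r, of "Suc m"]) (simp, rule that)
    show ?thesis by (intro exI[of _ j] conjI allI j(1-3)) (simp only: V_def j(4))
  qed
  have lim: "(\<lambda>m. V n (Suc m) r) \<longlonglongrightarrow> V' n r" if "r \<in> {0..t}" for n r
  proof (cases "r = 0")
    case True then show ?thesis by (simp add: V0 V'_def)
  next
    case False
    then have r: "0 < r" "r \<le> t" using that by auto
    obtain j where j: "\<And>m. j m < Suc m" "\<And>m. sp (Suc m) (j m) < r" "\<And>m. r \<le> sp (Suc m) (Suc (j m))"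
      "\<And>m n. V n (Suc m) r = q (\<psi> n (sp (Suc m) (j m))) r" using ex[OF r] by metis
    have "(\<lambda>m. q (\<psi> n (sp (Suc m) (j m))) r) \<longlonglongrightarrow> q (\<psi> n r) r"
      by (rule q_time_limit[OF sp_limits(1)[OF j(1-3)] _ that])
        (use sp_in j(1) that t in \<open>auto simp: less_imp_le\<close>)
    then show ?thesis using False by (simp add: j(4) V'_def)
  qed
  have bound: "\<bar>V n (Suc m) r\<bar> \<le> B" if "r \<in> {0..t}" for n m r
  proof (cases "r = 0")
    case True then show ?thesis using B(1) by (simp add: V0)
  next
    case False
    then have r: "0 < r" "r \<le> t" using that by auto
    obtain j where "j < Suc m" "V n (Suc m) r = q (\<psi> n (sp (Suc m) j)) r" using ex[OF r] by blast
    then show ?thesis using qb[OF sp_in that] by simp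
  qed
  have V'm: "V' n \<in> borel_measurable ?M" for n
    by (rule borel_measurable_LIMSEQ_real[OF lim borel_measurable_integrable[OF Vi]]) simp
  have b': "\<bar>V' n r\<bar> \<le> B" if "r \<in> {0..t}" for n r
    using qb[OF that that] B(1) by (simp add: V'_def)
  have 1: "(\<lambda>m. \<integral>r. V n (Suc m) r \<partial>?M) \<longlonglongrightarrow> (\<integral>r. V' n r \<partial>?M)" for n
  proof (rule integral_dominated_convergence[where w = "\<lambda>_. B"])
    show "V' n \<in> borel_measurable ?M" by (rule V'm)
    show "V n (Suc m) \<in> borel_measurable ?M" for m by (rule borel_measurable_integrable[OF Vi])
    show "AE r in ?M. (\<lambda>m. V n (Suc m) r) \<longlonglongrightarrow> V' n r" by (rule AE_I2) (simp add: lim)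
    show "AE r in ?M. norm (V n (Suc m) r) \<le> B" for m by (rule AE_I2) (simp add: bound)
  qed simp
  define W where "W r = (if r = 0 then 0 else q (f r) r)" for r
  have Wl: "(\<lambda>n. V' n r) \<longlonglongrightarrow> W r" if "r \<in> {0..t}" for r
    using q_fourier_limit[OF that, of r] that t by (simp add: V'_def W_def)
  have 2: "(\<lambda>n. \<integral>r. V' n r \<partial>?M) \<longlonglongrightarrow> (\<integral>r. W r \<partial>?M)"
  proof (rule integral_dominated_convergence[where w = "\<lambda>_. B"])
    show Wm: "W \<in> borel_measurable ?M" by (rule borel_measurable_LIMSEQ_real[OF Wl V'm]) simp
    show "AE r in ?M. (\<lambda>n. V' n r) \<longlonglongrightarrow> W r" by (rule AE_I2) (simp add: Wl)
    show "AE r in ?M. norm (V' n r) \<le> B" for n by (rule AE_I2) (simp add: b')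
  qed (use V'm in auto)
  have "(\<integral>r. W r \<partial>?M) = (\<integral>r. q (f r) r \<partial>?M)"
  proof (rule integral_cong_AE)
    show Wm: "W \<in> borel_measurable ?M" by (rule borel_measurable_LIMSEQ_real[OF Wl V'm]) simp
    \<comment> \<open>The actual integrand differs from the measurable limit only at the single
      point 0.\<close>
    show "(\<lambda>r. q (f r) r) \<in> borel_measurable ?M"
    proof -
      have "(\<lambda>r. q (f r) r) = (\<lambda>r. W r + indicator {0} r * q (f 0) 0)"
        by (auto simp: W_def indicator_def fun_eq_iff)
      moreover have "(indicator {0} :: real \<Rightarrow> real) \<in> borel_measurable ?M"
        by (rule measurable_restrict_space1[OF borel_measurable_indicator]) simp
      ultimately show ?thesis using Wm by simp
    qed
    show "AE r in ?M. W r = q (f r) r"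
      using AE_neq_lebesgue_on[where t = t and s = 0] by eventually_elim (simp add: W_def)
  qed
  then have 3: "(\<integral>r. W r \<partial>?M) = (LINT s:{0..t}|lebesgue. q (f s) s)" by (simp add: LINT_on)
  have 4: "(\<Sum>j<m. \<integral>r. indicator {sp m j<..sp m (Suc j)} r *\<^sub>R q (\<psi> n (sp m j)) r \<partial>?M) = (\<integral>r. V n m r \<partial>?M)" for n m
    unfolding V_def by (rule Bochner_Integration.integral_sum[symmetric]) (rule i)
  show ?thesis unfolding 4
    by (intro exI[of _ "\<lambda>n. \<integral>r. V' n r \<partial>?M"] conjI allI 1 2[unfolded 3])
qed

end

section \<open>The law of the solution\<close>

locale solution = noise K T \<beta> \<rho> F \<zeta> \<theta> P \<F> \<sigma> M + backward K T \<beta> \<rho> F \<zeta> \<theta> \<sigma> t \<phi> f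
  for K :: "real^'d::finite \<Rightarrow> real^'d" and T \<beta> :: real and \<rho> :: "real \<Rightarrow> real^'d \<Rightarrow> real"
    and F :: "real^'d \<Rightarrow> real^'d" and \<zeta> \<theta> :: "real^'d \<Rightarrow> real"
    and P :: "'w measure" and \<F> :: "real \<Rightarrow> 'w measure" and \<sigma> :: real
    and M :: "real \<Rightarrow> 'w \<Rightarrow> 'd functional" and t :: real and \<phi> :: "real^'d \<Rightarrow> real"
    and f :: "real \<Rightarrow> real^'d \<Rightarrow> real" +
  fixes \<eta>\<^sub>0 :: "'w \<Rightarrow> 'd functional" and \<eta> :: "real \<Rightarrow> 'w \<Rightarrow> 'd functional"
  assumes phi: "test_function \<phi>"
    and eta_0: "AE \<omega> in P. \<forall>\<psi>. test_function \<psi> \<longrightarrow> \<eta> 0 \<omega> \<psi> = \<eta>\<^sub>0 \<omega> \<psi>"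
    and eta_adapted: "\<And>s \<psi>. s \<in> {0..T} \<Longrightarrow> test_function \<psi> \<Longrightarrow> (\<lambda>\<omega>. \<eta> s \<omega> \<psi>) \<in> borel_measurable (\<F> s)"
    and eta_path: "AE \<omega> in P. C_sobolev T (- \<beta> - 2) (\<lambda>s. \<eta> s \<omega>) \<and> L2_sobolev T (- \<beta>) (\<lambda>s. \<eta> s \<omega>)"
    and spde: "\<And>s \<psi>. s \<in> {0..T} \<Longrightarrow> test_function \<psi> \<Longrightarrow> AE \<omega> in P.
      \<eta> s \<omega> \<psi> - \<eta>\<^sub>0 \<omega> \<psi> = (LINT r:{0..s}|lebesgue. \<sigma> * \<eta> r \<omega> (laplacian \<psi>))
        + (LINT r:{0..s}|lebesgue. sobolev_pairing (\<eta> r \<omega>) (dual_transport K F (\<rho> r) \<psi>)) + M s \<omega> \<psi>"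
    and eta_0_normal: "\<And>\<psi>. test_function \<psi> \<Longrightarrow> centered_normal P (\<lambda>\<omega>. \<eta>\<^sub>0 \<omega> \<psi>)
      (pairing (\<lambda>x. (\<psi> x)\<^sup>2) (\<rho> 0) - (pairing \<psi> (\<rho> 0))\<^sup>2)"
begin

lemma eta_measurable: "s \<in> {0..T} \<Longrightarrow> test_function g \<Longrightarrow> (\<lambda>\<omega>. \<eta> s \<omega> g) \<in> borel_measurable P"
  using basis by (intro measurable_from_subalg[OF _ eta_adapted]) (auto simp: stochastic_basis_def)

text \<open>The value of the solution at time 0 replaces the given initial datum: it has the same
  law and is measurable at time 0 of the filtration, as \<open>partition_normal\<close> requires.
  The law is transferred as the limit of a constant sequence.\<close>

lemma initial_normal:
  assumes g: "test_function g"
  shows "centered_normal P (\<lambda>\<omega>. \<eta> 0 \<omega> g) (pairing (\<lambda>x. (g x)\<^sup>2) (\<rho> 0) - (pairing g (\<rho> 0))\<^sup>2)"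
proof (rule centered_normal_limit[OF prob_space_axioms eta_0_normal[OF g] tendsto_const])
  show "AE \<omega> in P. (\<lambda>n. \<eta>\<^sub>0 \<omega> g) \<longlonglongrightarrow> \<eta> 0 \<omega> g"
    using eta_0 by eventually_elim (use g in simp)
  show "(\<lambda>\<omega>. \<eta> 0 \<omega> g) \<in> borel_measurable P" by (rule eta_measurable[OF _ g]) (use T in simp)
qed

lemma solution_normal:
  "centered_normal P (\<lambda>\<omega>. \<eta> t \<omega> \<phi>)
    (pairing (\<lambda>x. (f 0 x)\<^sup>2) (\<rho> 0) - (pairing (f 0) (\<rho> 0))\<^sup>2 + 2 * \<sigma> * (LINT s:{0..t}|lebesgue. q (f s) s))"
proof -
  let ?V = "\<lambda>\<psi>. pairing (\<lambda>x. (\<psi> x)\<^sup>2) (\<rho> 0) - (pairing \<psi> (\<rho> 0))\<^sup>2"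
  define Y where "Y n m \<omega> = \<eta> 0 \<omega> (\<psi> n 0) + ns (\<lambda>s. M s \<omega>) n (Suc m)" for n m \<omega>
  \<comment> \<open>The inner limit defined for every \<omega>, so that it is a measurable function;
    on good paths it is the one of \<open>path_limit\<close>.\<close>
  define X where "X n \<omega> = lim (\<lambda>m. Y n m \<omega>)" for n \<omega>
  define v where "v n m = (\<Sum>j<Suc m. \<integral>r. indicator {sp (Suc m) j<..sp (Suc m) (Suc j)} r *\<^sub>R q (\<psi> n (sp (Suc m) j)) r \<partial>lebesgue_on {0..t})" for n m
  obtain w where w: "\<And>n. v n \<longlonglongrightarrow> w n" "w \<longlonglongrightarrow> (LINT s:{0..t}|lebesgue. q (f s) s)"
    using noise_variance_limit unfolding v_def by blast
  have spT: "sp m j \<in> {0..T}" if "j \<le> m" for m j using sp_in[OF that] t by auto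
  have Yn: "centered_normal P (Y n m) (?V (\<psi> n 0) + 2 * \<sigma> * v n m)" for n m
  proof -
    have s: "sp (Suc m) 0 = 0" "j < Suc m \<Longrightarrow> 0 \<le> sp (Suc m) j \<and> sp (Suc m) j \<le> sp (Suc m) (Suc j) \<and> sp (Suc m) (Suc j) \<le> T" for j
      using spT[of j "Suc m"] spT[of "Suc j" "Suc m"] sp_mono[of j "Suc j" "Suc m"] by auto
    have "centered_normal P (\<lambda>\<omega>. \<eta> 0 \<omega> (\<psi> n 0) + (\<Sum>j<Suc m. M (sp (Suc m) (Suc j)) \<omega> (\<psi> n (sp (Suc m) j)) - M (sp (Suc m) j) \<omega> (\<psi> n (sp (Suc m) j))))
      (?V (\<psi> n 0) + (\<Sum>j<Suc m. A (\<psi> n (sp (Suc m) j)) (sp (Suc m) (Suc j)) - A (\<psi> n (sp (Suc m) j)) (sp (Suc m) j)))"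
      by (rule partition_normal[OF eta_adapted initial_normal s test_function_tpf])
        (use T test_function_tpf in auto)
    also have "(\<Sum>j<Suc m. A (\<psi> n (sp (Suc m) j)) (sp (Suc m) (Suc j)) - A (\<psi> n (sp (Suc m) j)) (sp (Suc m) j)) = 2 * \<sigma> * v n m"
      unfolding v_def sum_distrib_left
    proof (rule sum.cong[OF refl], rule A_diff[OF test_function_tpf t])
      fix j assume "j \<in> {..<Suc m}"
      then show "0 \<le> sp (Suc m) j" "sp (Suc m) j \<le> sp (Suc m) (Suc j)" "sp (Suc m) (Suc j) \<le> t"
        using sp_in[of j "Suc m"] sp_in[of "Suc j" "Suc m"] sp_mono[of j "Suc j" "Suc m"] by auto
    qed
    finally show ?thesis by (simp add: Y_def[abs_def] ns_def)
  qed
  have "AE \<omega> in P. \<forall>n m i j. 1 \<le> m \<and> i \<le> m \<and> j \<le> m \<longrightarrow>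
    \<eta> (sp m j) \<omega> (\<psi> n (sp m i)) - \<eta>\<^sub>0 \<omega> (\<psi> n (sp m i)) =
      (LINT r:{0..sp m j}|lebesgue. \<sigma> * \<eta> r \<omega> (laplacian (\<psi> n (sp m i))))
      + (LINT r:{0..sp m j}|lebesgue. sobolev_pairing (\<eta> r \<omega>) (dual_transport K F (\<rho> r) (\<psi> n (sp m i))))
      + M (sp m j) \<omega> (\<psi> n (sp m i))"
  proof (unfold AE_all_countable, intro allI)
    fix n m i j
    show "AE \<omega> in P. 1 \<le> m \<and> i \<le> m \<and> j \<le> m \<longrightarrow>
      \<eta> (sp m j) \<omega> (\<psi> n (sp m i)) - \<eta>\<^sub>0 \<omega> (\<psi> n (sp m i)) =
      (LINT r:{0..sp m j}|lebesgue. \<sigma> * \<eta> r \<omega> (laplacian (\<psi> n (sp m i))))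
      + (LINT r:{0..sp m j}|lebesgue. sobolev_pairing (\<eta> r \<omega>) (dual_transport K F (\<rho> r) (\<psi> n (sp m i))))
      + M (sp m j) \<omega> (\<psi> n (sp m i))"
    proof (cases "j \<le> m")
      case True
      show ?thesis using spde[OF spT[OF True] test_function_tpf[of "kbox n" "cf (f (sp m i))"]]
        by eventually_elim (rule impI)
    qed simp
  qed
  then have "AE \<omega> in P. (\<forall>n. (\<lambda>m. Y n m \<omega>) \<longlonglongrightarrow> X n \<omega>) \<and> (\<lambda>n. X n \<omega>) \<longlonglongrightarrow> \<eta> t \<omega> \<phi>"
    using eta_path
  proof eventually_elim
    case (elim \<omega>)
    interpret p: spde_path K T \<beta> \<rho> F \<zeta> \<theta> \<sigma> t \<phi> f "\<lambda>s. \<eta> s \<omega>"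
      by unfold_locales (use elim(2) in auto)
    have "\<exists>X. (\<forall>n. (\<lambda>m. Y n m \<omega>) \<longlonglongrightarrow> X n) \<and> X \<longlonglongrightarrow> \<eta> t \<omega> \<phi>"
      unfolding Y_def
      by (rule p.path_limit[of "\<eta>\<^sub>0 \<omega>" "\<lambda>s. M s \<omega>", OF _ phi]) (use elim(1) in blast)
    then obtain X' where X': "\<And>n. (\<lambda>m. Y n m \<omega>) \<longlonglongrightarrow> X' n" "X' \<longlonglongrightarrow> \<eta> t \<omega> \<phi>" by blast
    have "X n \<omega> = X' n" for n unfolding X_def by (rule limI[OF X'(1)])
    then show ?case using X' by simp
  qed
  then have lim1: "AE \<omega> in P. (\<lambda>m. Y n m \<omega>) \<longlonglongrightarrow> X n \<omega>" and lim2: "AE \<omega> in P. (\<lambda>n. X n \<omega>) \<longlonglongrightarrow> \<eta> t \<omega> \<phi>" for n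
    by (eventually_elim, blast)+
  have Xn: "centered_normal P (X n) (?V (\<psi> n 0) + 2 * \<sigma> * w n)" for n
  proof (rule centered_normal_limit[OF prob_space_axioms Yn _ lim1])
    show "(\<lambda>m. ?V (\<psi> n 0) + 2 * \<sigma> * v n m) \<longlonglongrightarrow> ?V (\<psi> n 0) + 2 * \<sigma> * w n"
      by (intro tendsto_add tendsto_mult_left tendsto_const w(1))
    show "X n \<in> borel_measurable P"
      unfolding X_def[abs_def] by (rule borel_measurable_lim_metric) (use Yn in \<open>simp add: centered_normal_def\<close>)
  qed
  show ?thesis
  proof (rule centered_normal_limit[OF prob_space_axioms Xn _ lim2 eta_measurable[OF t phi]])
    show "(\<lambda>n. ?V (\<psi> n 0) + 2 * \<sigma> * w n) \<longlonglongrightarrow> ?V (f 0) + 2 * \<sigma> * (LINT s:{0..t}|lebesgue. q (f s) s)"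
      by (intro tendsto_add tendsto_mult_left initial_variance_limit w(2))
  qed
qed

end

theorem proposition1p5:
  fixes T \<sigma> \<beta> :: real
    and \<sigma>N :: "nat \<Rightarrow> real"
    and K F :: "real^'d \<Rightarrow> real^'d"
    and \<rho> :: "real \<Rightarrow> real^'d \<Rightarrow> real"
    and \<zeta> \<theta> :: "real^'d \<Rightarrow> real"
    and PN :: "nat \<Rightarrow> 'v measure"
    and \<F>N :: "nat \<Rightarrow> real \<Rightarrow> 'v measure"
    and B X :: "nat \<Rightarrow> nat \<Rightarrow> real \<Rightarrow> 'v \<Rightarrow> real^'d"
    and P :: "'w measure"
    and \<F> :: "real \<Rightarrow> 'w measure"
    and \<eta>\<^sub>0 :: "'w \<Rightarrow> 'd::finite functional"
    and \<eta> :: "real \<Rightarrow> 'w \<Rightarrow> 'd::finite functional"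
    and Q :: "real \<Rightarrow> real \<Rightarrow> (real^'d \<Rightarrow> real) \<Rightarrow> real^'d \<Rightarrow> real"
  assumes dim: "CARD('d) \<ge> 2"
    and T: "T > 0"
    and K_meas: "K \<in> borel_measurable borel" "periodic K"
    and sigmaN_nonneg: "\<And>N. \<sigma>N N \<ge> 0"
    and particles: "\<And>N. N \<ge> 1 \<Longrightarrow> particle_system (PN N) (\<F>N N) T N (\<sigma>N N) K F (B N) (X N)"
    and initial_conv:
      "converges_in_law distribution_topology
         PN (\<lambda>N \<omega>. fluctuation N (\<lambda>i. X N i 0 \<omega>) (\<rho> 0)) P \<eta>\<^sub>0"
    and kernel:
      "bounded (range K) \<or>
       ((\<forall>x. K x = - K (- x)) \<and>
        (\<exists>C. AE x in lborel. x \<in> torus \<longrightarrow> norm x * norm (K x) \<le> C))"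
    and entropy:
      "(SUP t\<in>{0..T}. SUP N\<in>{1..}.
          relative_entropy (joint_law (PN N) N (\<lambda>i. X N i t)) (tensor_law N (\<rho> t))) < \<infinity>"
    and sigma_pos: "\<sigma> > 0"
    and sigma_rate: "(\<lambda>N. \<bar>\<sigma>N N - \<sigma>\<bar>) \<in> O(\<lambda>N. 1 / real N)"
    and mean_field: "mean_field_weak_solution T \<sigma> K F \<rho>"
    and beta: "\<beta> > real CARD('d) / 2"
    and partition: "dyadic_partition \<zeta> \<theta>"
    and rho_regular: "C_path \<zeta> \<theta> T (\<beta> + 1) \<rho>"
    and F_regular: "\<And>i. C_space \<zeta> \<theta> (\<beta> + 1) (\<lambda>x. F x $ i)"
    and initial_gaussian:
      "\<And>\<phi>. test_function \<phi> \<Longrightarrow>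
         centered_normal P (\<lambda>\<omega>. \<eta>\<^sub>0 \<omega> \<phi>)
           (pairing (\<lambda>x. (\<phi> x)\<^sup>2) (\<rho> 0) - (pairing \<phi> (\<rho> 0))\<^sup>2)"
    and solution: "martingale_solution P \<F> T \<sigma> K F \<rho> \<eta>\<^sub>0 \<eta>"
    and limit:
      "\<And>\<alpha>. \<alpha> > real CARD('d) / 2 \<Longrightarrow>
         converges_in_law (path_topology T \<alpha>)
           PN (\<lambda>N \<omega> t. fluctuation N (\<lambda>i. X N i t \<omega>) (\<rho> t)) P (\<lambda>\<omega> t. \<eta> t \<omega>)"
    and Q: "evolution_operators \<beta> T \<sigma> K F \<rho> Q"
  shows "\<forall>\<phi> t. test_function \<phi> \<longrightarrow> t \<in> {0..T} \<longrightarrow>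
     centered_normal P (\<lambda>\<omega>. \<eta> t \<omega> \<phi>)
       (pairing (\<lambda>x. (Q 0 t \<phi> x)\<^sup>2) (\<rho> 0) - (pairing (Q 0 t \<phi>) (\<rho> 0))\<^sup>2
        + 2 * \<sigma> * (LINT s:{0..t}|lebesgue. pairing (\<lambda>x. (norm (grad (Q s t \<phi>) x))\<^sup>2) (\<rho> s)))"
proof (intro allI impI)
  fix \<phi> :: "real^'d \<Rightarrow> real" and t assume \<phi>: "test_function \<phi>" and t: "t \<in> {0..T}"
  \<comment> \<open>In both alternatives for the kernel, integrability comes from
    \<open>kernel_integrable\<close>.\<close>
  interpret kernel K
    by unfold_locales (use K_meas kernel_integrable[OF dim K_meas(1)] kernel in blast)+
  interpret density_path K T \<beta> \<rho> F \<zeta> \<theta>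
    by unfold_locales (use T beta partition rho_regular F_regular mean_field in \<open>auto simp: mean_field_weak_solution_def\<close>)
  note s = solution[unfolded martingale_solution_def]
  obtain M where M: "noise_process P \<F> T \<sigma> \<rho> M"
    "\<And>\<phi> t. test_function \<phi> \<Longrightarrow> t \<in> {0..T} \<Longrightarrow> AE \<omega> in P.
       \<eta> t \<omega> \<phi> - \<eta>\<^sub>0 \<omega> \<phi> =
         (LINT s:{0..t}|lebesgue. \<sigma> * \<eta> s \<omega> (laplacian \<phi>))
         + (LINT s:{0..t}|lebesgue. sobolev_pairing (\<eta> s \<omega>) (dual_transport K F (\<rho> s) \<phi>))
         + M t \<omega> \<phi>"
    using s by blast
  have "solution K T \<beta> \<rho> F \<zeta> \<theta> P \<F> \<sigma> M t \<phi> (\<lambda>s. Q s t \<phi>) \<eta>\<^sub>0 \<eta>"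
  proof unfold_locales
    show "stochastic_basis P \<F>" using s by blast
    show "AE \<omega> in P. \<forall>\<psi>. test_function \<psi> \<longrightarrow> \<eta> 0 \<omega> \<psi> = \<eta>\<^sub>0 \<omega> \<psi>" using s by blast
    show "backward_solution \<beta> \<sigma> K F \<rho> t \<phi> (\<lambda>s. Q s t \<phi>)"
      using Q \<phi> t unfolding evolution_operators_def by blast
    show "(\<lambda>\<omega>. \<eta> s \<omega> \<psi>) \<in> borel_measurable (\<F> s)" if "s \<in> {0..T}" "test_function \<psi>" for s \<psi>
      using s that by blast
    have "AE \<omega> in P. \<forall>\<alpha>>real CARD('d) / 2.
        C_sobolev T (- \<alpha> - 2) (\<lambda>t. \<eta> t \<omega>) \<and> L2_sobolev T (- \<alpha>) (\<lambda>t. \<eta> t \<omega>)" using s by blast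
    \<comment> \<open>The order \<alpha> = \<beta> is the one dual to the regularity of the
      transported backward solution.\<close>
    then show "AE \<omega> in P. C_sobolev T (- \<beta> - 2) (\<lambda>s. \<eta> s \<omega>) \<and> L2_sobolev T (- \<beta>) (\<lambda>s. \<eta> s \<omega>)"
      by eventually_elim (use beta in blast)
  qed ((fact M(1) sigma_pos t \<phi>)+, (rule M(2), assumption+), rule initial_gaussian, assumption)
  then show "centered_normal P (\<lambda>\<omega>. \<eta> t \<omega> \<phi>)
       (pairing (\<lambda>x. (Q 0 t \<phi> x)\<^sup>2) (\<rho> 0) - (pairing (Q 0 t \<phi>) (\<rho> 0))\<^sup>2
        + 2 * \<sigma> * (LINT s:{0..t}|lebesgue. pairing (\<lambda>x. (norm (grad (Q s t \<phi>) x))\<^sup>2) (\<rho> s)))"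
    by (rule solution.solution_normal)
qed

end
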